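(* Let $d\in\mathbb N$, $1<p_1,p_2,\ldots,p_d<\infty$ and $\bar p=(p_1,p_2,\ldots,p_d)$. Then the $d$-parameter tensor product Haar system $(h_{\bar I})_{\bar I\in\mathcal R_d}$, with an appropriate linear order (enumerating it as a sequence indexed by $\mathbb N$), is strategically reproducible in $L^{\bar p}_0$.
   Context: All Banach spaces are real. $\mathcal D$ is the set of dyadic intervals $[\frac{i-1}{2^j},\frac{i}{2^j})$, $j\ge0$, $1\le i\le2^j$; for $I\in\mathcal D$ with left half $I^+$ and right half $I^-$, $h_I=\chi_{I^+}-\chi_{I^-}$. $\mathcal R_d=\{I_1\times\cdots\times I_d: I_1,\dots,I_d\in\mathcal D\}$ and $h_{\bar I}(t_1,\dots,t_d)=h_{I_1}(t_1)\cdots h_{I_d}(t_d)$ for $\bar I=I_1\times\cdots\times I_d$. $L^{\bar p}=L^{p_1}(L^{p_2}(\cdots(L^{p_d})\cdots))$ is the mixed norm Lebesgue space on $[0,1]^d$ and $L^{\bar p}_0=\{f\in L^{\bar p}:\int_0^1f(t_1,\dots,t_d)\,dt_j=0\text{ for all }1\le j\le d\}$ (as functions of the remaining variables, a.e.). For $1<p_1,\dots,p_d<\infty$ the space $L^{\bar p}_0$ is reflexive and $(h_{\bar I})_{\bar I\in\mathcal R_d}$ is an unconditional (and shrinking) basis of it. Impartial equivalence: sequences $(x_i)$, $(y_i)$ in Banach spaces are impartially $C$-equivalent if $\frac1{\sqrt C}\|\sum a_iy_i\|\le\|\sum a_ix_i\|\le\sqrt C\|\sum a_iy_i\|$ for all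 finitely supported real sequences $(a_i)$. Strategical reproducibility (for unconditional shrinking bases): let $X$ be a Banach space with an unconditional and shrinking basis $(e_n)_{n\in\mathbb N}$ and coordinate functionals $(e_n^* )\subset X^*$. For $C\ge1$ consider the infinite game in which in turn $k=1,2,\dots$ player (I) chooses $n_k\in\mathbb N$ and then player (II) chooses $b_k\in\mathrm{span}(e_n:n\ge n_k)$ and $b_k^*\in\mathrm{span}(e_n^*:n\ge n_k)$. Player (II) wins if $(b_k)$ is impartially $C$-equivalent to $(e_k)$, $(b_k^* )$ is impartially $C$-equivalent to $(e_k^* )$, and $b_k^*(b_l)=\delta_{k,l}$ for all $k,l\in\mathbb N$. The basis $(e_n)$ is strategically reproducible if for some $C\ge1$ player (II) has a winning strategy in this game. *)

theory Defs
  imports "HOL-Analysis.Analysis" "HOL-Library.Function_Algebras"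
begin

section \<open>Functions as vectors\<close>

instantiation "fun" :: (type, real_vector) real_vector
begin

definition scaleR_fun :: "real \<Rightarrow> ('a \<Rightarrow> 'b) \<Rightarrow> 'a \<Rightarrow> 'b" where
  "scaleR_fun c f = (\<lambda>x. c *\<^sub>R f x)"

instance
  by standard (simp_all add: scaleR_fun_def fun_eq_iff scaleR_add_right scaleR_add_left)

end


section \<open>Bases of Banach spaces\<close>

text \<open>
  A Banach space is presented by a subspace \<open>X\<close> of a real vector space together with a
  complete seminorm \<open>N\<close> on \<open>X\<close>; the Banach space meant is \<open>X\<close> modulo \<open>{x \<in> X. N x = 0}\<close>.
  In this way Lebesgue spaces can be handled through functions rather than through classes of
  functions that agree almost everywhere. Convergence, bounded functionals, bases, coordinate
  functionals and norms of linear combinations are the same in \<open>X\<close> and in the quotient.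
\<close>

definition banach_on :: "'v::real_vector set \<Rightarrow> ('v \<Rightarrow> real) \<Rightarrow> bool" where
  "banach_on X N \<longleftrightarrow>
     subspace X \<and>
     (\<forall>x\<in>X. 0 \<le> N x) \<and>
     (\<forall>x\<in>X. \<forall>y\<in>X. N (x + y) \<le> N x + N y) \<and>
     (\<forall>c. \<forall>x\<in>X. N (c *\<^sub>R x) = \<bar>c\<bar> * N x) \<and>
     (\<forall>u::nat \<Rightarrow> 'v. (\<forall>n. u n \<in> X) \<and>
        (\<forall>\<epsilon>>0. \<exists>M. \<forall>m\<ge>M. \<forall>n\<ge>M. N (u m - u n) < \<epsilon>) \<longrightarrow>
        (\<exists>x\<in>X. (\<lambda>n. N (u n - x)) \<longlonglongrightarrow> 0))"

definition sums_in :: "('v::real_vector \<Rightarrow> real) \<Rightarrow> (nat \<Rightarrow> 'v) \<Rightarrow> 'v \<Rightarrow> bool" where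
  "sums_in N u x \<longleftrightarrow> (\<lambda>m. N ((\<Sum>n<m. u n) - x)) \<longlonglongrightarrow> 0"

definition schauder_basis :: "'v::real_vector set \<Rightarrow> ('v \<Rightarrow> real) \<Rightarrow> (nat \<Rightarrow> 'v) \<Rightarrow> bool" where
  "schauder_basis X N e \<longleftrightarrow>
     range e \<subseteq> X \<and> (\<forall>x\<in>X. \<exists>!a::nat \<Rightarrow> real. sums_in N (\<lambda>n. a n *\<^sub>R e n) x)"

text \<open>
  Functionals on \<open>X\<close> are extended by \<open>0\<close> outside of \<open>X\<close>, so that two functionals are equal as
  HOL functions iff they agree on \<open>X\<close>. The function \<open>coord X N e n\<close> is the coordinate
  functional \<open>e\<^sub>n\<^sup>*\<close>; it is meaningful if \<open>e\<close> is a basis.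
\<close>

definition coord :: "'v::real_vector set \<Rightarrow> ('v \<Rightarrow> real) \<Rightarrow> (nat \<Rightarrow> 'v) \<Rightarrow> nat \<Rightarrow> 'v \<Rightarrow> real" where
  "coord X N e n x =
     (if x \<in> X then (THE a. sums_in N (\<lambda>k. a k *\<^sub>R e k) x) n else 0)"

definition dual_space :: "'v::real_vector set \<Rightarrow> ('v \<Rightarrow> real) \<Rightarrow> ('v \<Rightarrow> real) set" where
  "dual_space X N = {\<phi>.
     (\<forall>x\<in>X. \<forall>y\<in>X. \<phi> (x + y) = \<phi> x + \<phi> y) \<and>
     (\<forall>c. \<forall>x\<in>X. \<phi> (c *\<^sub>R x) = c * \<phi> x) \<and>
     (\<forall>x. x \<notin> X \<longrightarrow> \<phi> x = 0) \<and>
     (\<exists>B. \<forall>x\<in>X. \<bar>\<phi> x\<bar> \<le> B * N x)}"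

definition dual_norm :: "'v::real_vector set \<Rightarrow> ('v \<Rightarrow> real) \<Rightarrow> ('v \<Rightarrow> real) \<Rightarrow> real" where
  "dual_norm X N \<phi> = (SUP x\<in>{x\<in>X. N x \<le> 1}. \<bar>\<phi> x\<bar>)"

definition unconditional_basis :: "'v::real_vector set \<Rightarrow> ('v \<Rightarrow> real) \<Rightarrow> (nat \<Rightarrow> 'v) \<Rightarrow> bool" where
  "unconditional_basis X N e \<longleftrightarrow>
     schauder_basis X N e \<and>
     (\<forall>x\<in>X. \<forall>\<pi>::nat \<Rightarrow> nat. bij \<pi> \<longrightarrow>
        sums_in N (\<lambda>n. coord X N e (\<pi> n) x *\<^sub>R e (\<pi> n)) x)"

definition shrinking_basis :: "'v::real_vector set \<Rightarrow> ('v \<Rightarrow> real) \<Rightarrow> (nat \<Rightarrow> 'v) \<Rightarrow> bool" where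
  "shrinking_basis X N e \<longleftrightarrow>
     schauder_basis X N e \<and>
     schauder_basis (dual_space X N) (dual_norm X N) (coord X N e)"


section \<open>Strategical reproducibility\<close>

definition impartially_equivalent ::
  "real \<Rightarrow> ('v::real_vector \<Rightarrow> real) \<Rightarrow> (nat \<Rightarrow> 'v) \<Rightarrow> ('w::real_vector \<Rightarrow> real) \<Rightarrow> (nat \<Rightarrow> 'w) \<Rightarrow> bool" where
  "impartially_equivalent C N x M y \<longleftrightarrow>
     (\<forall>a::nat \<Rightarrow> real. finite {i. a i \<noteq> 0} \<longrightarrow>
        1 / sqrt C * M (\<Sum>i | a i \<noteq> 0. a i *\<^sub>R y i) \<le> N (\<Sum>i | a i \<noteq> 0. a i *\<^sub>R x i) \<and>
        N (\<Sum>i | a i \<noteq> 0. a i *\<^sub>R x i) \<le> sqrt C * M (\<Sum>i | a i \<noteq> 0. a i *\<^sub>R y i))"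

text \<open>
  A strategy of player (II) maps the finite list of moves \<open>[n\<^sub>0, \<dots>, n\<^sub>k]\<close> made so far by
  player (I) to the answer \<open>(b\<^sub>k, b\<^sub>k\<^sup>*)\<close>; player (II)'s own earlier moves are determined by the
  strategy and by this list. The strategy is winning if all its answers are legal moves and the
  resulting sequences fulfil the winning condition, whatever player (I) plays.
\<close>

definition winning_strategy ::
  "'v::real_vector set \<Rightarrow> ('v \<Rightarrow> real) \<Rightarrow> (nat \<Rightarrow> 'v) \<Rightarrow> real \<Rightarrow> (nat list \<Rightarrow> 'v \<times> ('v \<Rightarrow> real)) \<Rightarrow> bool" where
  "winning_strategy X N e C \<tau> \<longleftrightarrow>
     (\<forall>n::nat \<Rightarrow> nat.
        let b = (\<lambda>k. fst (\<tau> (map n [0..<Suc k])));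
            b' = (\<lambda>k. snd (\<tau> (map n [0..<Suc k])))
        in (\<forall>k. b k \<in> span (e ` {n k..}) \<and> b' k \<in> span (coord X N e ` {n k..})) \<and>
           impartially_equivalent C N b N e \<and>
           impartially_equivalent C (dual_norm X N) b' (dual_norm X N) (coord X N e) \<and>
           (\<forall>k l. b' k (b l) = (if k = l then 1 else 0)))"

definition strategically_reproducible ::
  "'v::real_vector set \<Rightarrow> ('v \<Rightarrow> real) \<Rightarrow> (nat \<Rightarrow> 'v) \<Rightarrow> bool" where
  "strategically_reproducible X N e \<longleftrightarrow>
     banach_on X N \<and> unconditional_basis X N e \<and> shrinking_basis X N e \<and>
     (\<exists>C\<ge>1. \<exists>\<tau>. winning_strategy X N e C \<tau>)"


section \<open>Mixed norm Lebesgue spaces\<close>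

text \<open>
  Points of the cube \<open>[0,1]\<^sup>d\<close> are the extensional functions \<open>t\<close> on \<open>{1..d}\<close> with values in
  \<open>{0..1}\<close>. The exponents are given by a sequence \<open>p\<close>, of which \<open>p 1, \<dots>, p d\<close> are used.
\<close>

abbreviation unit_interval :: "real measure" where
  "unit_interval \<equiv> restrict_space lborel {0..1}"

abbreviation cube :: "nat set \<Rightarrow> (nat \<Rightarrow> real) measure" where
  "cube J \<equiv> Pi\<^sub>M J (\<lambda>_. unit_interval)"

definition ennreal_powr :: "ennreal \<Rightarrow> real \<Rightarrow> ennreal" where
  "ennreal_powr x a = (if x = top then top else ennreal (enn2real x powr a))"

text \<open>
  The norm in the last \<open>length js\<close> variables, the others being fixed to their values in \<open>t\<close>; the
  head of the list is the outermost integration variable.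
\<close>

primrec iterated_norm ::
  "(nat \<Rightarrow> real) \<Rightarrow> nat list \<Rightarrow> ((nat \<Rightarrow> real) \<Rightarrow> real) \<Rightarrow> (nat \<Rightarrow> real) \<Rightarrow> ennreal" where
  "iterated_norm p [] f t = ennreal \<bar>f t\<bar>"
| "iterated_norm p (j # js) f t =
     ennreal_powr (\<integral>\<^sup>+ s. ennreal_powr (iterated_norm p js f (t(j := s))) (p j) \<partial>unit_interval) (1 / p j)"

definition mixed_ennorm :: "nat \<Rightarrow> (nat \<Rightarrow> real) \<Rightarrow> ((nat \<Rightarrow> real) \<Rightarrow> real) \<Rightarrow> ennreal" where
  "mixed_ennorm d p f = iterated_norm p [1..<Suc d] f (\<lambda>_. undefined)"

definition mixed_norm :: "nat \<Rightarrow> (nat \<Rightarrow> real) \<Rightarrow> ((nat \<Rightarrow> real) \<Rightarrow> real) \<Rightarrow> real" where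
  "mixed_norm d p f = enn2real (mixed_ennorm d p f)"

definition mixed_Lp :: "nat \<Rightarrow> (nat \<Rightarrow> real) \<Rightarrow> ((nat \<Rightarrow> real) \<Rightarrow> real) set" where
  "mixed_Lp d p = {f \<in> borel_measurable (cube {1..d}). mixed_ennorm d p f < top}"

text \<open>
  For \<open>f \<in> mixed_Lp d p\<close> with exponents \<open>\<ge> 1\<close> the function \<open>f\<close> is integrable on the cube, so the
  Bochner integrals below exist for almost all values of the remaining variables.
\<close>

definition mixed_Lp0 :: "nat \<Rightarrow> (nat \<Rightarrow> real) \<Rightarrow> ((nat \<Rightarrow> real) \<Rightarrow> real) set" where
  "mixed_Lp0 d p = {f \<in> mixed_Lp d p.
     \<forall>j\<in>{1..d}. AE t in cube ({1..d} - {j}). (\<integral>s. f (t(j := s)) \<partial>unit_interval) = 0}"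


section \<open>The tensor product Haar system\<close>

definition dyadic_intervals :: "real set set" where
  "dyadic_intervals = {{(real i - 1) / 2 ^ j ..< real i / 2 ^ j} | i j :: nat. 1 \<le> i \<and> i \<le> 2 ^ j}"

definition left_half :: "real set \<Rightarrow> real set" where
  "left_half I = {Inf I ..< (Inf I + Sup I) / 2}"

definition right_half :: "real set \<Rightarrow> real set" where
  "right_half I = {(Inf I + Sup I) / 2 ..< Sup I}"

definition haar :: "real set \<Rightarrow> real \<Rightarrow> real" where
  "haar I s = indicator (left_half I) s - indicator (right_half I) s"

text \<open>
  A rectangle \<open>I\<^sub>1 \<times> \<dots> \<times> I\<^sub>d\<close> is represented by the family of its sides, which it determines
  since dyadic intervals are nonempty.
\<close>

definition dyadic_rectangles :: "nat \<Rightarrow> (nat \<Rightarrow> real set) set" where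
  "dyadic_rectangles d = {1..d} \<rightarrow>\<^sub>E dyadic_intervals"

definition tensor_haar :: "nat \<Rightarrow> (nat \<Rightarrow> real set) \<Rightarrow> (nat \<Rightarrow> real) \<Rightarrow> real" where
  "tensor_haar d I t = (\<Prod>i\<in>{1..d}. haar (I i) (t i))"

end

theory Submission
  imports Defs
begin

text \<open>
  The proof rests on the square function estimate for the tensor product Haar system in mixed norm
  spaces,
  \<open>\<parallel>\<Sum> a\<^sub>J h\<^sub>J\<parallel> ~ \<parallel>(\<Sum> a\<^sub>J\<^sup>2 h\<^sub>J\<^sup>2)\<^sup>1\<^sup>/\<^sup>2\<parallel>\<close>, with constants that depend on the exponents
  only. It shows that, up to constants, the norm of a Haar sum depends only on the absolute values of
  the coefficients and on the functions \<open>h\<^sub>J\<^sup>2\<close>, the indicators of the rectangles, and this is what lets one sequence of blocks of Haar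
  functions imitate the whole basis.

  \<^emph>\<open>The strategy.\<close> Let \<open>I = I\<^sub>1 \<times> \<dots> \<times> I\<^sub>d\<close> be the \<open>k\<close>-th rectangle. Player (II) plays for \<open>b\<^sub>k\<close> the sum of the
  Haar functions of all rectangles \<open>I\<^sub>1 \<times> \<dots> \<times> I\<^sub>d\<^sub>-\<^sub>1 \<times> J\<close>, where \<open>J\<close> runs through the dyadic subintervals of \<open>I\<^sub>d\<close> of
  one very fine level, and for \<open>b\<^sub>k\<^sup>*\<close> the average of the corresponding coordinate functionals. A fine
  level makes the move legal and the blocks disjoint. The supports of these Haar functions partition
  \<open>I\<close>, so \<open>\<Sum> a\<^sub>k b\<^sub>k\<close> and \<open>\<Sum> a\<^sub>k h\<^sub>k\<close> have the same square function and \<open>(b\<^sub>k)\<close> is equivalent to the basis.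
  By duality the equivalence of \<open>(b\<^sub>k\<^sup>*)\<close> with the coordinate functionals needs in addition that
  \<open>x \<mapsto> \<Sum> b\<^sub>k\<^sup>*(x) h\<^sub>k\<close> is bounded (\<open>block_strategy_wins\<close>). In terms of square functions this map takes
  conditional expectations in the last variable, a different one for every \<open>k\<close>, and it is bounded by
  Stein's inequality. These estimates are collected in \<open>strategy_bounds\<close>.

  \<^emph>\<open>The analytic core.\<close> Both the square function estimate and Stein's inequality come from one
  extrapolation principle, \<open>haar_extrapolation\<close>: if a Haar polynomial with coefficients in a seminormed
  space dominates another one in \<open>L\<^sup>q\<close> for one \<open>q > 1\<close>, and keeps doing so when coefficients are deleted,
  then it dominates it in \<open>L\<^sup>p\<close> for all \<open>p > 1\<close>. It is proved by a good-lambda inequality on the dyadic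
  tree, where the two jumps of a walk at a node have equal norm and stopping rules are therefore
  predictable. In \<open>L\<^sup>2\<close> the two basic estimates are trivial by orthogonality. For the mixed norms one
  extrapolates in one variable at a time: if the exponents of the first two variables coincide, Fubini
  lets them change places, and afterwards extrapolation adjusts the first exponent
  (\<open>square_function_one_variable\<close>). Working with \<open>\<ell>\<^sup>2\<close>-valued functions, one then replaces sums by square
  functions in one variable after the other (\<open>square_function\<close>).

  \<^emph>\<open>The basis.\<close> The square function estimate also shows that coordinate projections are uniformly
  bounded, and that disjoint blocks satisfy an upper \<open>r\<close>-estimate with some \<open>r > 1\<close>, which forces the
  basis to be shrinking. Totality reduces to the density of dyadic step functions: for a function with
  vanishing marginals, the marginals of its approximants are small, because averaging in one
  variable is a contraction of the mixed norm, and can be subtracted.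

  All estimates for finite Haar sums take place on a finite grid whose atoms are words of bits. The
  iterated integrals of the mixed norm are there iterated averages (\<open>N_haar_sum\<close>).
\<close>

section \<open>Walks on the dyadic tree and Doob's inequality\<close>

definition seminorm :: "('v::real_vector \<Rightarrow> real) \<Rightarrow> bool" where
  "seminorm N \<longleftrightarrow> (\<forall>x y. N (x + y) \<le> N x + N y) \<and> (\<forall>c x. N (c *\<^sub>R x) = \<bar>c\<bar> * N x)"

lemma seminorm_add: "seminorm N \<Longrightarrow> N (x + y) \<le> N x + N y"
  and seminorm_scale: "seminorm N \<Longrightarrow> N (c *\<^sub>R x) = \<bar>c\<bar> * N x"
  by (auto simp: seminorm_def)

lemma seminorm_zero: "seminorm N \<Longrightarrow> N 0 = 0"
  using seminorm_scale[of N 0 0] by simp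

lemma seminorm_minus: "seminorm N \<Longrightarrow> N (- x) = N x"
  using seminorm_scale[of N "-1" x] by simp

lemma seminorm_nonneg: "seminorm N \<Longrightarrow> 0 \<le> N x"
  using seminorm_add[of N x "- x"] seminorm_zero[of N] seminorm_minus[of N x] by simp

lemma seminorm_diff: "seminorm N \<Longrightarrow> N (x - y) \<le> N x + N y"
  using seminorm_add[of N x "- y"] seminorm_minus[of N y] by simp

text \<open>
  A dyadic interval is a word of bits: the empty word is \<open>[0, 1)\<close>, and a longer word tells in
  which half (\<open>True\<close> for left) one has to go at each level. Words of length \<open>n\<close> are the atoms of
  the grid of mesh \<open>2\<^sup>-\<^sup>n\<close>, shorter words are the intervals whose Haar function is constant on
  these atoms.
\<close>

definition pts :: "nat \<Rightarrow> bool list set" where "pts n = {s. length s = n}"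

definition nodes :: "nat \<Rightarrow> bool list set" where "nodes n = {I. length I < n}"

definition avg :: "nat \<Rightarrow> (bool list \<Rightarrow> real) \<Rightarrow> real" where
  "avg n g = (\<Sum>s\<in>pts n. g s) / 2 ^ n"

lemma finite_pts [simp]: "finite (pts n)"
  using finite_lists_length_eq[of "UNIV :: bool set" n] by (simp add: pts_def)

lemma finite_nodes [simp]: "finite (nodes n)"
  using finite_lists_length_le[of "UNIV :: bool set" n] unfolding nodes_def
  by (rule finite_subset[rotated]) auto

lemma pts_0 [simp]: "pts 0 = {[]}"
  by (auto simp: pts_def)

lemma pts_Suc: "pts (Suc n) = Cons True ` pts n \<union> Cons False ` pts n"
  by (auto simp: pts_def image_iff length_Suc_conv)

lemma nodes_0 [simp]: "nodes 0 = {}"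
  by (auto simp: nodes_def)

lemma nodes_Suc: "nodes (Suc n) = insert [] (Cons True ` nodes n \<union> Cons False ` nodes n)"
proof -
  have "I \<in> nodes (Suc n) \<longleftrightarrow> I \<in> insert [] (Cons True ` nodes n \<union> Cons False ` nodes n)" for I
    by (cases I) (auto simp: nodes_def image_iff)
  then show ?thesis by blast
qed

lemma sum_pts_Suc: "(\<Sum>s\<in>pts (Suc n). g s) = (\<Sum>s\<in>pts n. g (True # s)) + (\<Sum>s\<in>pts n. g (False # s))"
  unfolding pts_Suc by (subst sum.union_disjoint) (auto simp: sum.reindex)

lemma sum_nodes_Suc:
  fixes g :: "bool list \<Rightarrow> 'a::comm_monoid_add"
  shows "(\<Sum>s\<in>nodes (Suc n). g s) = g [] + (\<Sum>s\<in>nodes n. g (True # s)) + (\<Sum>s\<in>nodes n. g (False # s))"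
  unfolding nodes_Suc
  by (subst sum.insert, (auto)[2], subst sum.union_disjoint) (auto simp: sum.reindex add.assoc)

lemma avg_0 [simp]: "avg 0 g = g []"
  by (simp add: avg_def)

lemma avg_Suc: "avg (Suc n) g = (avg n (\<lambda>s. g (True # s)) + avg n (\<lambda>s. g (False # s))) / 2"
  by (simp add: avg_def sum_pts_Suc field_simps)

lemma avg_mono: "(\<And>s. s \<in> pts n \<Longrightarrow> f s \<le> g s) \<Longrightarrow> avg n f \<le> avg n g"
  unfolding avg_def by (intro divide_right_mono sum_mono) auto

lemma avg_cong: "(\<And>s. s \<in> pts n \<Longrightarrow> f s = g s) \<Longrightarrow> avg n f = avg n g"
  unfolding avg_def by (metis (mono_tags, lifting) sum.cong)

lemma avg_nonneg: "(\<And>s. s \<in> pts n \<Longrightarrow> 0 \<le> f s) \<Longrightarrow> 0 \<le> avg n f"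
  unfolding avg_def by (intro divide_nonneg_nonneg sum_nonneg) auto

lemma card_pts: "card (pts n) = 2 ^ n"
  using card_lists_length_eq[of "UNIV::bool set" n] by (simp add: pts_def card_UNIV_bool)

lemma avg_const [simp]: "avg n (\<lambda>s. c) = c"
  by (simp add: avg_def card_pts)

lemma avg_add: "avg n (\<lambda>s. f s + g s) = avg n f + avg n g"
  by (simp add: avg_def sum.distrib add_divide_distrib)

lemma avg_cmult: "avg n (\<lambda>s. c * f s) = c * avg n f"
  by (simp add: avg_def sum_distrib_left)

lemma avg_sum: "avg n (\<lambda>s. \<Sum>i\<in>A. f i s) = (\<Sum>i\<in>A. avg n (f i))"
  by (simp add: avg_def sum_divide_distrib sum.swap[of _ A])

lemma avg_swap: "avg n (\<lambda>s. avg m (\<lambda>t. f s t)) = avg m (\<lambda>t. avg n (\<lambda>s. f s t))"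
  by (simp add: avg_def sum_divide_distrib sum.swap[of _ "pts m" "pts n"] mult.commute)

definition sg :: "bool \<Rightarrow> real" where "sg b = (if b then 1 else - 1)"

lemma sg_simps [simp]: "sg True = 1" "sg False = - 1" "\<bar>sg b\<bar> = 1"
  by (auto simp: sg_def)

text \<open>
  The value of the Haar function of \<open>I\<close> on the atom \<open>s\<close>.
\<close>

fun hr :: "bool list \<Rightarrow> bool list \<Rightarrow> real" where
  "hr I [] = 0"
| "hr [] (b # s) = sg b"
| "hr (c # I) (b # s) = (if b = c then hr I s else 0)"

text \<open>
  The Haar polynomial with vector coefficients \<open>x\<close>, evaluated at the atom \<open>s\<close> by walking down the
  path of \<open>s\<close>. The recursion on the path is what makes all martingale arguments inductions on words.
\<close>

primrec mart :: "(bool list \<Rightarrow> 'v::real_vector) \<Rightarrow> bool list \<Rightarrow> 'v" where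
  "mart x [] = 0"
| "mart x (b # s) = sg b *\<^sub>R x [] + mart (\<lambda>I. x (b # I)) s"

lemma mart_eq_sum: "s \<in> pts n \<Longrightarrow> mart x s = (\<Sum>I\<in>nodes n. hr I s *\<^sub>R x I)"
proof (induction n arbitrary: x s)
  case 0
  then show ?case by simp
next
  case (Suc n)
  then obtain b t where s: "s = b # t" "t \<in> pts n" by (auto simp: pts_Suc)
  then show ?case
    using Suc.IH[of t "\<lambda>I. x (b # I)"] by (cases b) (simp_all add: sum_nodes_Suc)
qed

lemma mart_zero [simp]: "mart (\<lambda>I. 0) s = 0"
  by (induction s) auto

text \<open>
  The maximal function of the walk that starts at the vector \<open>v\<close>.
\<close>

primrec pathmax :: "('v::real_vector \<Rightarrow> real) \<Rightarrow> (bool list \<Rightarrow> 'v) \<Rightarrow> 'v \<Rightarrow> bool list \<Rightarrow> real" where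
  "pathmax N x v [] = N v"
| "pathmax N x v (b # s) = max (N v) (pathmax N (\<lambda>I. x (b # I)) (v + sg b *\<^sub>R x []) s)"

lemma pathmax_ge_start: "N v \<le> pathmax N x v s"
  by (cases s) auto

lemma pathmax_ge_end: "N (v + mart x s) \<le> pathmax N x v s"
proof (induction s arbitrary: x v)
  case (Cons b s)
  show ?case using Cons.IH[of "v + sg b *\<^sub>R x []" "\<lambda>I. x (b # I)"] by (simp add: add.assoc)
qed simp

lemma pathmax_nonneg: "seminorm N \<Longrightarrow> 0 \<le> pathmax N x v s"
  using seminorm_nonneg pathmax_ge_start order_trans by metis

lemma pathmax_shift: "seminorm N \<Longrightarrow> pathmax N x (u + v) s \<le> N u + pathmax N x v s"
proof (induction s arbitrary: x v)
  case Nil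
  then show ?case by (simp add: seminorm_add)
next
  case (Cons b s)
  then have "pathmax N (\<lambda>I. x (b # I)) (u + (v + sg b *\<^sub>R x [])) s
      \<le> N u + pathmax N (\<lambda>I. x (b # I)) (v + sg b *\<^sub>R x []) s" by blast
  then show ?case using seminorm_add[OF Cons.prems, of u v] by (simp add: add.assoc max_def)
qed

lemma young_powr:
  fixes a b p :: real
  assumes "1 \<le> p" "0 \<le> a" "0 \<le> b"
  shows "p * a powr (p - 1) * b \<le> (p - 1) * a powr p + b powr p"
proof (cases "p = 1")
  case True
  then show ?thesis using assms by (cases "a = 0") auto
next
  case False
  then have p: "1 < p" using assms by simp
  define q where "q = p / (p - 1)"
  have q: "1 < q" "1 / p + 1 / q = 1" "(p - 1) * q = p"
    using p by (auto simp: q_def field_simps)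
  have "b * a powr (p - 1) \<le> b powr p / p + (a powr (p - 1)) powr q / q"
    by (rule Youngs_inequality[OF p q(1,2)]) (use assms in auto)
  also have "(a powr (p - 1)) powr q = a powr p" by (simp add: powr_powr q(3))
  finally have "b * a powr (p - 1) \<le> b powr p / p + a powr p / q" .
  then have "p * (b * a powr (p - 1)) \<le> p * (b powr p / p + a powr p / q)"
    using p by (intro mult_left_mono) auto
  also have "\<dots> = (p - 1) * a powr p + b powr p" using p by (simp add: q_def field_simps)
  finally show ?thesis by (simp add: mult_ac)
qed

lemma powr_mult_self: "0 \<le> (y::real) \<Longrightarrow> y powr (p - 1) * y = y powr p"
  by (cases "y = 0") (auto simp: powr_diff)

text \<open>
  Burkholder's method. With \<open>p' = p / (p - 1)\<close>, the function
  \<open>U(y, z) = p y\<^sup>p\<^sup>-\<^sup>1 (y - p' z)\<close> majorises \<open>y\<^sup>p - p'\<^sup>p z\<^sup>p\<close>, is decreasing and affine in \<open>z\<close>, and does not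
  grow when a new maximum is reached, \<open>U(max y z, z) \<le> U(y, z)\<close>. As \<open>N v\<close> is at most the average
  of \<open>N\<close> over the two next positions, \<open>U\<close> can only decrease on average along the walk. Here \<open>y\<close>
  is the running maximum and \<open>z\<close> the norm of the current position.
\<close>

lemma doob_aux:
  assumes N: "seminorm N" and p: "1 < p" and "N v \<le> y"
  shows "avg n (\<lambda>s. max y (pathmax N x v s) powr p) - (p / (p - 1)) powr p * avg n (\<lambda>s. N (v + mart x s) powr p)
     \<le> p * y powr (p - 1) * (y - p / (p - 1) * N v)"
  using assms(3)
proof (induction n arbitrary: x v y)
  case 0
  define q where "q = p / (p - 1)"
  have q: "0 < q" "p = (p - 1) * q" using p by (auto simp: q_def)
  have y: "0 \<le> y" using 0 seminorm_nonneg[OF N, of v] by linarith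
  \<comment> \<open>The majorisation of \<open>y\<^sup>p - p'\<^sup>p z\<^sup>p\<close> is Young's inequality.\<close>
  have "p * y powr (p - 1) * (q * N v) \<le> (p - 1) * y powr p + (q * N v) powr p"
    using p y q seminorm_nonneg[OF N, of v] by (intro young_powr) auto
  moreover have "(q * N v) powr p = q powr p * N v powr p"
    using q seminorm_nonneg[OF N, of v] by (simp add: powr_mult)
  moreover have "p * y powr (p - 1) * (y - q * N v) = p * (y powr (p - 1) * y) - p * y powr (p - 1) * (q * N v)"
    by (simp only: right_diff_distrib mult.assoc)
  moreover have "p * (y powr (p - 1) * y) = p * y powr p"
    using powr_mult_self[OF y, of p] by simp
  ultimately have "y powr p - q powr p * N v powr p \<le> p * y powr (p - 1) * (y - q * N v)"
    by (simp add: left_diff_distrib)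
  then show ?case using 0 unfolding q_def[symmetric] by (simp add: max_absorb1)
next
  case (Suc n)
  define q where "q = p / (p - 1)"
  have q: "1 < q" "p = (p - 1) * q" "p * (q - 1) = q" using p by (auto simp: q_def field_simps)
  have pq: "q * (p - 1) = p" using q(2) by (simp add: mult.commute)
  have y: "0 \<le> y" using Suc seminorm_nonneg[OF N, of v] by linarith
  define vb where "vb b = v + sg b *\<^sub>R x []" for b
  define T where "T b = avg n (\<lambda>s. max y (pathmax N x v (b # s)) powr p)
     - q powr p * avg n (\<lambda>s. N (v + mart x (b # s)) powr p)" for b
  have T: "T b \<le> p * y powr (p - 1) * (y - q * N (vb b))" for b
  proof -
    have "max y (pathmax N x v (b # s)) = max (max y (N (vb b))) (pathmax N (\<lambda>I. x (b # I)) (vb b) s)" for s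
      using Suc.prems pathmax_ge_start[of N "vb b" "\<lambda>I. x (b # I)" s] by (auto simp: vb_def)
    then have "T b \<le> p * max y (N (vb b)) powr (p - 1) * (max y (N (vb b)) - q * N (vb b))"
      using Suc.IH[of "vb b" "max y (N (vb b))" "\<lambda>I. x (b # I)"]
      unfolding T_def q_def[symmetric] by (simp add: vb_def add.assoc)
    \<comment> \<open>A new maximum does not increase \<open>U\<close>; this is Young's inequality again.\<close>
    also have "\<dots> \<le> p * y powr (p - 1) * (y - q * N (vb b))"
    proof (cases "N (vb b) \<le> y")
      case False
      define z where "z = N (vb b)"
      have z: "0 \<le> z" "y \<le> z" using False y by (auto simp: z_def)
      have *: "p * y powr (p - 1) * z \<le> (p - 1) * y powr p + z powr p"
        using p y z by (intro young_powr) auto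
      have 1: "y powr (p - 1) * y = y powr p" "z powr (p - 1) * z = z powr p"
        using powr_mult_self y z by auto
      have "p * y powr (p - 1) * (y - q * z) - p * z powr (p - 1) * (z - q * z)
         = p * (y powr (p - 1) * y) - q * (p * y powr (p - 1) * z) + p * (q - 1) * (z powr (p - 1) * z)"
        by (simp add: algebra_simps)
      also have "\<dots> = p * y powr p - q * (p * y powr (p - 1) * z) + q * z powr p"
        unfolding 1 q(3) ..
      also have "\<dots> = q * ((p - 1) * y powr p + z powr p - p * y powr (p - 1) * z)"
        unfolding right_diff_distrib distrib_left mult.assoc[symmetric] using pq by (simp add: algebra_simps)
      also have "0 \<le> \<dots>" using * q by simp
      finally have "0 \<le> p * y powr (p - 1) * (y - q * z) - p * z powr (p - 1) * (z - q * z)" .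
      then show ?thesis using z unfolding z_def[symmetric] by (simp add: max_absorb2)
    qed (simp add: max_absorb1)
    finally show ?thesis .
  qed
  \<comment> \<open>The current position is the midpoint of the next two.\<close>
  have "2 *\<^sub>R v = vb True + vb False" by (simp add: vb_def scaleR_2)
  then have "2 * N v \<le> N (vb True) + N (vb False)"
    using seminorm_scale[OF N, of 2 v] seminorm_add[OF N, of "vb True" "vb False"] by simp
  define K where "K = p * y powr (p - 1)"
  have K: "0 \<le> K * q" using p q by (simp add: K_def)
  have "K * q * (2 * N v) \<le> K * q * (N (vb True) + N (vb False))"
    using \<open>2 * N v \<le> _\<close> K by (intro mult_left_mono) auto
  moreover have "T b \<le> K * y - K * q * N (vb b)" for b
    using T[of b] unfolding K_def[symmetric] by (simp add: right_diff_distrib)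
  from this[of True] this[of False] have "T True + T False \<le> 2 * (K * y) - K * q * N (vb True) - K * q * N (vb False)"
    by simp
  ultimately have "(T True + T False) / 2 \<le> K * y - K * q * N v"
    by (simp only: distrib_left) simp
  also have "\<dots> = p * y powr (p - 1) * (y - q * N v)"
    by (simp add: K_def right_diff_distrib)
  finally have "(T True + T False) / 2 \<le> p * y powr (p - 1) * (y - q * N v)" .
  then show ?case unfolding q_def[symmetric] T_def by (simp add: avg_Suc field_simps)
qed

text \<open>
  The walk starts at \<open>0\<close> with maximum \<open>0\<close>, where the function of Burkholder's method vanishes.
\<close>

lemma doob:
  assumes N: "seminorm N" and p: "1 < p"
  shows "avg n (\<lambda>s. pathmax N x 0 s powr p) \<le> (p / (p - 1)) powr p * avg n (\<lambda>s. N (mart x s) powr p)"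
proof -
  have "max 0 (pathmax N x 0 s) = pathmax N x 0 s" for s
    using pathmax_nonneg[OF N] by (simp add: max_absorb2)
  then show ?thesis
    using doob_aux[OF N p, of 0 0 n x] seminorm_zero[OF N] by simp
qed

section \<open>Extrapolation of Haar multipliers\<close>

text \<open>
  The estimate is required for every set \<open>F\<close> of retained coefficients, because the good-lambda
  argument applies it to stopped walks and to subtrees.
\<close>

definition dominates ::
  "real \<Rightarrow> real \<Rightarrow> nat \<Rightarrow> ('v::real_vector \<Rightarrow> real) \<Rightarrow> (bool list \<Rightarrow> 'v) \<Rightarrow> ('w::real_vector \<Rightarrow> real) \<Rightarrow> (bool list \<Rightarrow> 'w) \<Rightarrow> bool" where
  "dominates A q n NX x NY y \<longleftrightarrow>
    (\<forall>F. avg n (\<lambda>s. NY (mart (\<lambda>I. if I \<in> F then y I else 0) s) powr q)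
       \<le> A powr q * avg n (\<lambda>s. NX (mart (\<lambda>I. if I \<in> F then x I else 0) s) powr q))"

lemma dominatesD:
  assumes "dominates A q n NX x NY y"
  shows "avg n (\<lambda>s. NY (mart (\<lambda>I. if P I then y I else 0) s) powr q)
       \<le> A powr q * avg n (\<lambda>s. NX (mart (\<lambda>I. if P I then x I else 0) s) powr q)"
  using assms[unfolded dominates_def, rule_format, of "{I. P I}"] by simp

lemma mart_child:
  "mart (\<lambda>I. if I \<in> Cons b ` F then y I else 0) (c # s) =
     (if c = b then mart (\<lambda>I. if I \<in> F then y (b # I) else 0) s else 0)"
proof -
  have "(\<lambda>I. if c # I \<in> Cons b ` F then y (c # I) else 0) = (if c = b then (\<lambda>I. if I \<in> F then y (b # I) else 0) else (\<lambda>I. 0))"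
    by (auto simp: fun_eq_iff)
  moreover have "[] \<notin> Cons b ` F" by auto
  ultimately show ?thesis by simp
qed

text \<open>
  Only the coefficients below the child \<open>b\<close> are retained; the two sides then vanish on the other
  half, so that the common factor \<open>1/2\<close> cancels.
\<close>

lemma dominates_child:
  assumes "dominates A q (Suc n) NX x NY y" "seminorm NX" "seminorm NY"
  shows "dominates A q n NX (\<lambda>I. x (b # I)) NY (\<lambda>I. y (b # I))"
  unfolding dominates_def
proof
  fix F
  have key: "avg (Suc n) (\<lambda>s. N (mart (\<lambda>I. if I \<in> Cons b ` F then z I else 0) s) powr q)
     = avg n (\<lambda>s. N (mart (\<lambda>I. if I \<in> F then z (b # I) else 0) s) powr q) / 2"
    if "seminorm N" for N :: "'c::real_vector \<Rightarrow> real" and z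
    unfolding avg_Suc mart_child using seminorm_zero[OF that] by (cases b) auto
  show "avg n (\<lambda>s. NY (mart (\<lambda>I. if I \<in> F then y (b # I) else 0) s) powr q)
       \<le> A powr q * avg n (\<lambda>s. NX (mart (\<lambda>I. if I \<in> F then x (b # I) else 0) s) powr q)"
    using assms(1)[unfolded dominates_def, rule_format, of "Cons b ` F"]
    unfolding key[OF assms(2)] key[OF assms(3)] by simp
qed

text \<open>
  Retaining only the root coefficient compares single jumps: jumps of \<open>y\<close> are controlled by jumps
  of \<open>x\<close> with the same constant.
\<close>

lemma dominates_root:
  assumes "dominates A q (Suc n) NX x NY y" "seminorm NX" "seminorm NY" "0 < q" "0 \<le> A"
  shows "NY (y []) \<le> A * NX (x [])"
proof -
  have "avg (Suc n) (\<lambda>s. N (mart (\<lambda>I. if I \<in> {[]} then z I else 0) s) powr q) = N (z []) powr q"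
    if "seminorm N" for N :: "'c::real_vector \<Rightarrow> real" and z
  proof -
    have "avg (Suc n) (\<lambda>s. N (mart (\<lambda>I. if I \<in> {[]} then z I else 0) s) powr q) = avg (Suc n) (\<lambda>s. N (z []) powr q)"
    proof (rule avg_cong)
      fix s assume "s \<in> pts (Suc n)"
      then obtain b t where "s = b # t" by (auto simp: pts_Suc)
      then show "N (mart (\<lambda>I. if I \<in> {[]} then z I else 0) s) powr q = N (z []) powr q"
        using seminorm_scale[OF that, of "sg b" "z []"] by simp
    qed
    then show ?thesis by simp
  qed
  from this[OF assms(2)] this[OF assms(3)]
  have "NY (y []) powr q \<le> A powr q * NX (x []) powr q"
    using assms(1)[unfolded dominates_def, rule_format, of "{[]}"] by simp
  also have "\<dots> = (A * NX (x [])) powr q"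
    using assms seminorm_nonneg[of NX] by (simp add: powr_mult)
  finally have le: "NY (y []) powr q \<le> (A * NX (x [])) powr q" .
  show ?thesis
  proof (rule ccontr)
    assume "\<not> ?thesis"
    then have "(A * NX (x [])) powr q < NY (y []) powr q"
      using assms seminorm_nonneg[OF assms(2)] by (intro powr_less_mono2) auto
    with le show False by simp
  qed
qed

text \<open>
  The walk is stopped once its norm exceeds \<open>r\<close>, or before it makes a jump larger than \<open>2 * r\<close>. Both events can be read off the prefix \<open>I\<close>, since the two possible jumps at a node have
  the same norm. Hence the last position with norm at most \<open>r\<close> is followed by at most one jump.
\<close>

lemma stopped_bounded:
  assumes N: "seminorm N" and r: "0 \<le> r" and "N v \<le> 3 * r"
  shows "N (v + mart (\<lambda>I. if pathmax N x v I \<le> r \<and> N (x I) \<le> 2 * r then x I else 0) s) \<le> 3 * r"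
  using assms(3)
proof (induction s arbitrary: x v)
  case Nil
  then show ?case by simp
next
  case (Cons b s)
  define vb where "vb = v + sg b *\<^sub>R x []"
  show ?case
  proof (cases "N v \<le> r \<and> N (x []) \<le> 2 * r")
    case True
    have "N vb \<le> 3 * r"
      using seminorm_add[OF N, of v "sg b *\<^sub>R x []"] seminorm_scale[OF N, of "sg b" "x []"] True
      by (simp add: vb_def)
    from Cons.IH[OF this, of "\<lambda>I. x (b # I)"] True show ?thesis
      by (simp add: vb_def add.assoc)
  next
    case False
    have big: "r < N v \<or> r < N vb"
    proof (rule ccontr)
      assume "\<not> ?thesis"
      moreover have "sg b *\<^sub>R x [] = vb - v" by (simp add: vb_def)
      then have "N (x []) \<le> N vb + N v"
        using seminorm_diff[OF N, of vb v] seminorm_scale[OF N, of "sg b" "x []"] by simp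
      ultimately show False using False by auto
    qed
    define Z where "Z = (\<lambda>I. if pathmax N x v I \<le> r \<and> N (x I) \<le> 2 * r then x I else 0)"
    have "\<not> pathmax N x v (b # I) \<le> r" for I
      using big pathmax_ge_start[of N vb "\<lambda>I. x (b # I)" I] by (auto simp: vb_def)
    then have "Z (b # I) = 0" for I unfolding Z_def by (simp only: if_False simp_thms)
    moreover have "Z [] = 0" using False by (auto simp: Z_def)
    ultimately have "mart Z (b # s) = 0" by simp
    then show ?thesis using Cons.prems unfolding Z_def[symmetric] by simp
  qed
qed

text \<open>
  As long as the walk stays in the ball of radius \<open>r\<close>, its jumps are at most \<open>2 * r\<close>, so that
  nothing has been stopped. The same stopping rule may drive another walk, with coefficients \<open>y\<close>.
\<close>

lemma stopped_agrees:
  assumes N: "seminorm N" and "pathmax N x v s \<le> r"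
  shows "pathmax M (\<lambda>I. if pathmax N x v I \<le> r \<and> N (x I) \<le> 2 * r then y I else 0) w s = pathmax M y w s"
  using assms(2)
proof (induction s arbitrary: x v y w)
  case Nil
  then show ?case by simp
next
  case (Cons b s)
  define vb where "vb = v + sg b *\<^sub>R x []"
  have 1: "N v \<le> r" "pathmax N (\<lambda>I. x (b # I)) vb s \<le> r" using Cons.prems by (auto simp: vb_def)
  have "sg b *\<^sub>R x [] = vb - v" by (simp add: vb_def)
  then have "N (x []) \<le> N vb + N v"
    using seminorm_diff[OF N, of vb v] seminorm_scale[OF N, of "sg b" "x []"] by simp
  then have 2: "N (x []) \<le> 2 * r"
    using 1 pathmax_ge_start[of N vb "\<lambda>I. x (b # I)" s] by simp
  show ?case using Cons.IH[OF 1(2), of "\<lambda>I. y (b # I)" "w + sg b *\<^sub>R y []"] 1(1) 2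
    by (simp add: vb_def)
qed

text \<open>
  A real-valued indicator of a proposition, so that \<open>avg\<close> of it is a probability.
\<close>

definition ind :: "bool \<Rightarrow> real" where "ind P = (if P then 1 else 0)"

text \<open>
  The estimate after the walk of \<open>y\<close> has just passed the level \<open>lam\<close>. On the event in question the
  stopping rule for \<open>x\<close> with radius \<open>d * lam\<close> does not change the walk of \<open>y\<close>, which has to travel a
  distance at least \<open>lam\<close>. Chebyshev, Doob and the domination in \<open>L\<^sup>q\<close> bound the probability by the
  \<open>q\<close>-th moment of the stopped walk of \<open>x\<close>, and this walk is bounded.
\<close>

lemma good_lambda_subtree:
  assumes NX: "seminorm NX" and NY: "seminorm NY" and q: "1 < q" and A: "0 \<le> A"
    and dom: "dominates A q n NX x NY y" and lam: "0 < lam" and d: "0 < d"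
    and w: "NY w \<le> 2 * lam"
  shows "avg n (\<lambda>s. ind (3 * lam < pathmax NY y w s \<and> pathmax NX x v s \<le> d * lam))
     \<le> (q / (q - 1)) powr q * A powr q * (4 * d) powr q"
proof (cases "NX v \<le> d * lam")
  case False
  then have "\<not> pathmax NX x v s \<le> d * lam" for s
    using pathmax_ge_start[of NX v x s] by auto
  then show ?thesis by (simp add: ind_def)
next
  case True
  define r where "r = d * lam"
  have r: "0 < r" using d lam by (simp add: r_def)
  define P where "P I \<longleftrightarrow> pathmax NX x v I \<le> r \<and> NX (x I) \<le> 2 * r" for I
  define x' where "x' = (\<lambda>I. if P I then x I else 0)"
  define y' where "y' = (\<lambda>I. if P I then y I else 0)"
  have bd: "NX (mart x' s) \<le> 4 * r" for s
  proof -
    have "NX (v + mart x' s) \<le> 3 * r"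
      unfolding x'_def P_def by (rule stopped_bounded[OF NX]) (use r True in \<open>auto simp: r_def\<close>)
    moreover have "NX (mart x' s) \<le> NX (v + mart x' s) + NX v"
      using seminorm_diff[OF NX, of "v + mart x' s" v] by simp
    ultimately show ?thesis using True by (simp add: r_def)
  qed
  have "avg n (\<lambda>s. ind (3 * lam < pathmax NY y w s \<and> pathmax NX x v s \<le> d * lam))
      \<le> avg n (\<lambda>s. (1 / lam powr q) * pathmax NY y' 0 s powr q)"
  proof (rule avg_mono)
    fix s
    show "ind (3 * lam < pathmax NY y w s \<and> pathmax NX x v s \<le> d * lam) \<le> (1 / lam powr q) * pathmax NY y' 0 s powr q"
    proof (cases "3 * lam < pathmax NY y w s \<and> pathmax NX x v s \<le> d * lam")
      case True
      then have "pathmax NY y' w s = pathmax NY y w s"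
        unfolding y'_def P_def r_def by (intro stopped_agrees[OF NX]) auto
      then have "lam \<le> pathmax NY y' 0 s"
        using pathmax_shift[OF NY, of y' w 0 s] w True by simp
      then have "lam powr q \<le> pathmax NY y' 0 s powr q"
        using lam q by (intro powr_mono2) auto
      then show ?thesis using lam True by (simp add: ind_def)
    next
      case False
      then have "ind (3 * lam < pathmax NY y w s \<and> pathmax NX x v s \<le> d * lam) = 0"
        by (simp only: ind_def if_False)
      then show ?thesis by simp
    qed
  qed
  also have "\<dots> = (1 / lam powr q) * avg n (\<lambda>s. pathmax NY y' 0 s powr q)"
    by (rule avg_cmult)
  also have "\<dots> \<le> (1 / lam powr q) * ((q / (q - 1)) powr q * avg n (\<lambda>s. NY (mart y' s) powr q))"
    by (intro mult_left_mono doob[OF NY q]) auto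
  also have "\<dots> \<le> (1 / lam powr q) * ((q / (q - 1)) powr q * (A powr q * avg n (\<lambda>s. NX (mart x' s) powr q)))"
    unfolding y'_def x'_def by (intro mult_left_mono dominatesD[OF dom]) auto
  also have "\<dots> \<le> (1 / lam powr q) * ((q / (q - 1)) powr q * (A powr q * avg n (\<lambda>s. (4 * r) powr q)))"
    using bd q seminorm_nonneg[OF NX] by (intro mult_left_mono avg_mono powr_mono2) auto
  also have "(4 * r) powr q = (4 * d) powr q * lam powr q"
    using d lam by (simp add: r_def powr_mult)
  finally show ?thesis using lam by simp
qed

text \<open>
  The tree is followed until \<open>NY\<close> first exceeds \<open>lam\<close>, and the previous estimate is applied below
  each node where this happens. The jump across the level is at most \<open>lam\<close> since jumps of \<open>y\<close> are
  at most \<open>A\<close> times jumps of \<open>x\<close>, which are at most \<open>2 * d * lam\<close> on the event considered.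
\<close>

lemma good_lambda_tree:
  assumes NX: "seminorm NX" and NY: "seminorm NY" and q: "1 < q" and A: "0 \<le> A"
    and dom: "dominates A q n NX x NY y" and lam: "0 < lam" and d: "0 < d" and Ad: "2 * A * d \<le> 1"
    and w: "NY w \<le> lam"
  shows "avg n (\<lambda>s. ind (3 * lam < pathmax NY y w s \<and> pathmax NX x v s \<le> d * lam))
     \<le> (q / (q - 1)) powr q * A powr q * (4 * d) powr q * avg n (\<lambda>s. ind (lam < pathmax NY y w s))"
  using dom w
proof (induction n arbitrary: x y v w)
  case 0
  then show ?case using lam by (simp add: ind_def)
next
  case (Suc n)
  define kap where "kap = (q / (q - 1)) powr q * A powr q * (4 * d) powr q"
  have kap: "0 \<le> kap" by (simp add: kap_def)
  define wb where "wb b = w + sg b *\<^sub>R y []" for b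
  define vb where "vb b = v + sg b *\<^sub>R x []" for b
  have child: "avg n (\<lambda>s. ind (3 * lam < pathmax NY y w (b # s) \<and> pathmax NX x v (b # s) \<le> d * lam))
      \<le> kap * avg n (\<lambda>s. ind (lam < pathmax NY y w (b # s)))" for b
  proof -
    have dom': "dominates A q n NX (\<lambda>I. x (b # I)) NY (\<lambda>I. y (b # I))"
      by (rule dominates_child[OF Suc.prems(1) NX NY])
    let ?E = "\<lambda>s. ind (3 * lam < pathmax NY (\<lambda>I. y (b # I)) (wb b) s \<and> pathmax NX (\<lambda>I. x (b # I)) (vb b) s \<le> d * lam)"
    have le: "avg n (\<lambda>s. ind (3 * lam < pathmax NY y w (b # s) \<and> pathmax NX x v (b # s) \<le> d * lam)) \<le> avg n ?E"
      using Suc.prems(2) lam by (intro avg_mono) (auto simp: ind_def wb_def vb_def)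
    have D: "ind (lam < pathmax NY y w (b # s)) = ind (lam < pathmax NY (\<lambda>I. y (b # I)) (wb b) s)" for s
      using Suc.prems(2) by (auto simp: ind_def wb_def)
    consider "NY (wb b) \<le> lam" | "lam < NY (wb b)" "NX v \<le> d * lam \<and> NX (vb b) \<le> d * lam"
      | "lam < NY (wb b)" "\<not> (NX v \<le> d * lam \<and> NX (vb b) \<le> d * lam)" by linarith
    then show ?thesis
    proof cases
      \<comment> \<open>The level has not been passed yet: induction.\<close>
      case 1
      show ?thesis unfolding D using le Suc.IH[OF dom' 1, of "vb b"] by (simp add: kap_def)
    next
      \<comment> \<open>The level is passed in this very step.\<close>
      case 2
      have "ind (lam < pathmax NY y w (b # s)) = 1" for s
        unfolding D using 2(1) pathmax_ge_start[of NY "wb b" "\<lambda>I. y (b # I)" s] by (simp add: ind_def)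
      then have one: "avg n (\<lambda>s. ind (lam < pathmax NY y w (b # s))) = 1" by simp
      have "sg b *\<^sub>R x [] = vb b - v" by (simp add: vb_def)
      then have "NX (x []) \<le> 2 * (d * lam)"
        using seminorm_diff[OF NX, of "vb b" v] seminorm_scale[OF NX, of "sg b" "x []"] 2(2) by simp
      moreover have "NY (y []) \<le> A * NX (x [])"
        using dominates_root[OF Suc.prems(1) NX NY] q A by simp
      ultimately have "NY (y []) \<le> A * (2 * (d * lam))"
        using A by (meson mult_left_mono order_trans)
      also have "\<dots> = (2 * A * d) * lam" by simp
      also have "\<dots> \<le> 1 * lam" using Ad lam by (intro mult_right_mono) auto
      finally have "NY (wb b) \<le> 2 * lam"
        using seminorm_add[OF NY, of w "sg b *\<^sub>R y []"] seminorm_scale[OF NY, of "sg b" "y []"] Suc.prems(2)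
        by (simp add: wb_def)
      then show ?thesis
        using good_lambda_subtree[OF NX NY q A dom' lam d, of "wb b" "vb b"] le one by (simp add: kap_def)
    next
      \<comment> \<open>The walk of \<open>x\<close> has already left the small ball, so the event is empty.\<close>
      case 3
      have "\<not> pathmax NX x v (b # s) \<le> d * lam" for s
        using 3(2) pathmax_ge_start[of NX "vb b" "\<lambda>I. x (b # I)" s] by (auto simp: vb_def)
      then have "avg n (\<lambda>s. ind (3 * lam < pathmax NY y w (b # s) \<and> pathmax NX x v (b # s) \<le> d * lam)) = 0"
        by (simp only: ind_def simp_thms if_False avg_const)
      then show ?thesis using kap by (auto intro!: mult_nonneg_nonneg avg_nonneg simp: ind_def)
    qed
  qed
  from child[of True] child[of False] show ?case
    unfolding kap_def[symmetric] avg_Suc by (simp add: distrib_left add_divide_distrib)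
qed

text \<open>
  The integration variable is restricted to a fixed interval \<open>{0..R}\<close> so that finitely many such
  formulas can be added.
\<close>

lemma layer_cake_has_integral:
  fixes a R p :: real
  assumes p: "1 < p" and a: "0 \<le> a" "a \<le> R"
  shows "((\<lambda>l. if 0 < l \<and> l < a then p * l powr (p - 1) else 0) has_integral a powr p) {0..R}"
proof -
  have "((\<lambda>l. p * l powr (p - 1)) has_integral (a powr p - 0 powr p)) {0..a}"
  proof (rule fundamental_theorem_of_calculus_interior)
    show "continuous_on {0..a} (\<lambda>l. l powr p)"
      using p by (intro continuous_on_powr') (auto intro!: continuous_intros)
    show "((\<lambda>l. l powr p) has_vector_derivative p * l powr (p - 1)) (at l)" if "l \<in> {0<..<a}" for l
      using that by (auto intro!: derivative_eq_intros simp: has_real_derivative_iff_has_vector_derivative[symmetric])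
  qed (use a in auto)
  then have "((\<lambda>l. p * l powr (p - 1)) has_integral a powr p) {0..a}" using p by simp
  then have "((\<lambda>l. if l \<in> {0..a} then p * l powr (p - 1) else 0) has_integral a powr p) {0..R}"
    using has_integral_restrict[of "{0..a}" "{0..R}" "\<lambda>l. p * l powr (p - 1)" "a powr p"] a by auto
  then show ?thesis
    by (rule has_integral_spike_finite[rotated 2, where S = "{0, a}"]) (use a in auto)
qed

text \<open>
  Distributional inequalities become inequalities of \<open>p\<close>-th moments after integration against
  \<open>p l\<^sup>p\<^sup>-\<^sup>1 dl\<close>.
\<close>

lemma layer_cake:
  fixes a b c :: "'a \<Rightarrow> real"
  assumes fin: "finite S" and p: "1 < p"
    and nn: "\<And>s. s \<in> S \<Longrightarrow> 0 \<le> a s \<and> 0 \<le> b s \<and> 0 \<le> c s"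
    and le: "\<And>l. 0 < l \<Longrightarrow> (\<Sum>s\<in>S. ind (l < a s)) \<le> k * (\<Sum>s\<in>S. ind (l < b s)) + (\<Sum>s\<in>S. ind (l < c s))"
  shows "(\<Sum>s\<in>S. a s powr p) \<le> k * (\<Sum>s\<in>S. b s powr p) + (\<Sum>s\<in>S. c s powr p)"
proof -
  define R where "R = (\<Sum>s\<in>S. a s + b s + c s)"
  have R: "a s \<le> R \<and> b s \<le> R \<and> c s \<le> R" if "s \<in> S" for s
    using member_le_sum[of s S "\<lambda>s. a s + b s + c s"] nn fin that unfolding R_def by fastforce
  define \<phi> where "\<phi> u l = (if 0 < l \<and> l < u then p * l powr (p - 1) else 0)" for u l
  have \<phi>: "(\<phi> u has_integral u powr p) {0..R}" if "0 \<le> u" "u \<le> R" for u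
    unfolding \<phi>_def using layer_cake_has_integral[OF p] that by blast
  have \<phi>_ind: "\<phi> u l = (if 0 < l then p * l powr (p - 1) else 0) * ind (l < u)" for u l
    by (auto simp: \<phi>_def ind_def)
  have 1: "((\<lambda>l. \<Sum>s\<in>S. \<phi> (a s) l) has_integral (\<Sum>s\<in>S. a s powr p)) {0..R}"
    using nn R \<phi> fin by (intro has_integral_sum) auto
  have 2: "((\<lambda>l. k * (\<Sum>s\<in>S. \<phi> (b s) l) + (\<Sum>s\<in>S. \<phi> (c s) l)) has_integral
      (k * (\<Sum>s\<in>S. b s powr p) + (\<Sum>s\<in>S. c s powr p))) {0..R}"
    using nn R \<phi> fin by (intro has_integral_add has_integral_mult_right has_integral_sum) auto
  show ?thesis
  proof (rule has_integral_le[OF 1 2])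
    fix l
    define g where "g = (if 0 < l then p * l powr (p - 1) else 0)"
    show "(\<Sum>s\<in>S. \<phi> (a s) l) \<le> k * (\<Sum>s\<in>S. \<phi> (b s) l) + (\<Sum>s\<in>S. \<phi> (c s) l)"
    proof (cases "0 < l")
      case True
      then have "g * (\<Sum>s\<in>S. ind (l < a s)) \<le> g * (k * (\<Sum>s\<in>S. ind (l < b s)) + (\<Sum>s\<in>S. ind (l < c s)))"
        using p le by (intro mult_left_mono) (auto simp: g_def)
      then show ?thesis unfolding \<phi>_ind g_def[symmetric] sum_distrib_left[symmetric]
        by (simp add: algebra_simps)
    qed (simp add: \<phi>_def)
  qed
qed

lemma ex_small_powr:
  fixes K q e :: real assumes "0 < q" "0 \<le> K" "0 < e" "0 < M"
  shows "\<exists>d>0. d \<le> M \<and> K * d powr q \<le> e"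
proof -
  define d where "d = min M ((e / (K + 1)) powr (1 / q))"
  have "d powr q \<le> ((e / (K + 1)) powr (1 / q)) powr q"
    using assms by (intro powr_mono2) (auto simp: d_def)
  also have "\<dots> = e / (K + 1)" using assms by (simp add: powr_powr)
  finally have "K * d powr q \<le> K * (e / (K + 1))" using assms by (intro mult_left_mono) auto
  also have "\<dots> \<le> e" using assms by (simp add: field_simps)
  finally show ?thesis using assms by (intro exI[of _ d]) (auto simp: d_def)
qed

text \<open>
  A domination between two Haar polynomials at one exponent \<open>q\<close>, stable under deleting
  coefficients, holds at every exponent \<open>p\<close> in \<open>(1, \<infinity>)\<close>, for arbitrary seminorms. No geometry of
  the target spaces enters, because everything needed about them is in the assumption for \<open>q\<close>.
  The constant depends on \<open>p\<close>, \<open>q\<close> and \<open>A\<close> only, which is indispensable for the later inductions.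
\<close>

theorem haar_extrapolation:
  fixes p q A :: real
  assumes p: "1 < p" and q: "1 < q" and A: "0 < A"
  obtains C where "0 < C"
    "\<And>n (NX :: 'v::real_vector \<Rightarrow> real) (NY :: 'w::real_vector \<Rightarrow> real) x y.
       seminorm NX \<Longrightarrow> seminorm NY \<Longrightarrow> dominates A q n NX x NY y \<Longrightarrow>
       avg n (\<lambda>s. NY (mart y s) powr p) \<le> C powr p * avg n (\<lambda>s. NX (mart x s) powr p)"
proof -
  define K where "K = (q / (q - 1)) powr q * A powr q * 4 powr q"
  \<comment> \<open>The good-lambda factor has to be absorbed on the left, where passing from the level \<open>3 * l\<close> to
    \<open>l\<close> costs \<open>(1/3)\<^sup>p\<close>; the second bound on \<open>d\<close> controls the jumps.\<close>
  obtain d where d: "0 < d" "d \<le> 1 / (2 * A)" "K * d powr q \<le> (1/3) powr p / 2"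
    using ex_small_powr[of q K "(1/3) powr p / 2" "1 / (2 * A)"] q A by (auto simp: K_def)
  define kap where "kap = (q / (q - 1)) powr q * A powr q * (4 * d) powr q"
  have kap: "kap \<le> (1/3) powr p / 2" "0 \<le> kap"
    using d by (auto simp: kap_def K_def powr_mult mult_ac)
  have Ad: "2 * A * d \<le> 1" using d A by (simp add: field_simps)
  define C where "C = 6 / d * (p / (p - 1))"
  have C: "0 < C" using d p by (simp add: C_def)
  have main: "avg n (\<lambda>s. NY (mart y s) powr p) \<le> C powr p * avg n (\<lambda>s. NX (mart x s) powr p)"
    if NX: "seminorm NX" and NY: "seminorm NY" and dom: "dominates A q n NX x NY y"
    for n and NX :: "'v \<Rightarrow> real" and NY :: "'w \<Rightarrow> real" and x y
  proof -
    define G where "G s = pathmax NY y 0 s" for s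
    define F where "F s = pathmax NX x 0 s" for s
    have nn: "0 \<le> G s" "0 \<le> F s" for s
      using pathmax_nonneg NX NY by (auto simp: G_def F_def)
    have lvl: "(\<Sum>s\<in>pts n. ind (l < G s / 3)) \<le> kap * (\<Sum>s\<in>pts n. ind (l < G s)) + (\<Sum>s\<in>pts n. ind (l < F s / d))"
      if l: "0 < l" for l
    proof -
      have "(\<Sum>s\<in>pts n. ind (l < G s / 3)) \<le>
          (\<Sum>s\<in>pts n. ind (3 * l < G s \<and> F s \<le> d * l) + ind (l < F s / d))"
        using d l by (intro sum_mono) (auto simp: ind_def field_simps)
      also have "\<dots> = (\<Sum>s\<in>pts n. ind (3 * l < G s \<and> F s \<le> d * l)) + (\<Sum>s\<in>pts n. ind (l < F s / d))"
        by (rule sum.distrib)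
      also have "(\<Sum>s\<in>pts n. ind (3 * l < G s \<and> F s \<le> d * l)) \<le> kap * (\<Sum>s\<in>pts n. ind (l < G s))"
        using good_lambda_tree[OF NX NY q _ dom l d(1) Ad, of 0 0] A seminorm_zero[OF NY] l
        unfolding kap_def[symmetric] G_def[symmetric] F_def[symmetric] avg_def
        by (simp add: field_simps)
      finally show ?thesis by simp
    qed
    have "(\<Sum>s\<in>pts n. (G s / 3) powr p) \<le> kap * (\<Sum>s\<in>pts n. G s powr p) + (\<Sum>s\<in>pts n. (F s / d) powr p)"
      using nn d p lvl by (intro layer_cake) auto
    then have "(1/3) powr p * (\<Sum>s\<in>pts n. G s powr p) \<le> kap * (\<Sum>s\<in>pts n. G s powr p) + (1/d) powr p * (\<Sum>s\<in>pts n. F s powr p)"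
      using nn d by (simp add: powr_divide sum_divide_distrib)
    also have "kap * (\<Sum>s\<in>pts n. G s powr p) \<le> (1/3) powr p / 2 * (\<Sum>s\<in>pts n. G s powr p)"
      using kap by (intro mult_right_mono sum_nonneg) auto
    finally have "(1/3) powr p * (\<Sum>s\<in>pts n. G s powr p) \<le> 2 * ((1/d) powr p * (\<Sum>s\<in>pts n. F s powr p))"
      by simp
    then have "(3 powr p) * ((1/3) powr p * (\<Sum>s\<in>pts n. G s powr p)) \<le> 3 powr p * (2 * ((1/d) powr p * (\<Sum>s\<in>pts n. F s powr p)))"
      by (intro mult_left_mono) auto
    moreover have "(3 powr p) * (1/3) powr p = (1::real)"
      by (simp add: powr_mult[symmetric])
    then have "(3 powr p) * ((1/3) powr p * z) = z" for z :: real
      by (metis mult.assoc mult_1)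
    ultimately have "(\<Sum>s\<in>pts n. G s powr p) \<le> 3 powr p * (2 * ((1/d) powr p * (\<Sum>s\<in>pts n. F s powr p)))"
      by simp
    also have "\<dots> \<le> 3 powr p * (2 powr p * ((1/d) powr p * (\<Sum>s\<in>pts n. F s powr p)))"
      using p powr_mono[of 1 p "2::real"] by (intro mult_left_mono mult_right_mono mult_nonneg_nonneg sum_nonneg) auto
    also have "\<dots> = (6 / d) powr p * (\<Sum>s\<in>pts n. F s powr p)"
    proof -
      have "(6 / d) powr p = (3 * (2 * (1 / d))) powr p" by simp
      also have "\<dots> = 3 powr p * (2 powr p * (1 / d) powr p)" using d by (simp only: powr_mult)
      finally show ?thesis by (simp add: mult.assoc)
    qed
    finally have GF: "avg n (\<lambda>s. G s powr p) \<le> (6 / d) powr p * avg n (\<lambda>s. F s powr p)"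
      unfolding avg_def by (simp add: divide_right_mono)
    have "avg n (\<lambda>s. NY (mart y s) powr p) \<le> avg n (\<lambda>s. G s powr p)"
      using pathmax_ge_end[of NY 0 y] seminorm_nonneg[OF NY] p
      by (intro avg_mono powr_mono2) (auto simp: G_def)
    also note GF
    also have "(6 / d) powr p * avg n (\<lambda>s. F s powr p) \<le> (6 / d) powr p * ((p / (p - 1)) powr p * avg n (\<lambda>s. NX (mart x s) powr p))"
      unfolding F_def by (intro mult_left_mono doob[OF NX p]) auto
    also have "\<dots> = C powr p * avg n (\<lambda>s. NX (mart x s) powr p)"
      using d p by (simp add: C_def powr_mult[symmetric] mult.assoc[symmetric])
    finally show ?thesis .
  qed
  show thesis by (rule that[OF C main])
qed

section \<open>Mixed norms on the finite grid\<close>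

text \<open>
  The mixed \<open>L\<^sup>p\<close> norm of a function on the grid of atoms, one exponent for each variable and the
  first variable outermost. A point of the grid is the list of its coordinates, each of them an atom.
\<close>

primrec sn :: "nat \<Rightarrow> real list \<Rightarrow> (bool list list \<Rightarrow> real) \<Rightarrow> real" where
  "sn n [] g = \<bar>g []\<bar>"
| "sn n (p # ps) g = avg n (\<lambda>s. sn n ps (\<lambda>u. g (s # u)) powr p) powr (1 / p)"

definition grid :: "nat \<Rightarrow> nat \<Rightarrow> bool list list set" where
  "grid n d = {u. length u = d \<and> set u \<subseteq> pts n}"

lemma Cons_grid: "s # u \<in> grid n (Suc d) \<longleftrightarrow> s \<in> pts n \<and> u \<in> grid n d"
  by (auto simp: grid_def)

lemma Nil_grid [simp]: "u \<in> grid n 0 \<longleftrightarrow> u = []"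
  by (auto simp: grid_def)

lemma sn_nonneg: "0 \<le> sn n ps g"
  by (cases ps) auto

lemma sn_cong: "(\<And>u. u \<in> grid n (length ps) \<Longrightarrow> f u = g u) \<Longrightarrow> sn n ps f = sn n ps g"
proof (induction ps arbitrary: f g)
  case (Cons p ps)
  have "avg n (\<lambda>s. sn n ps (\<lambda>u. f (s # u)) powr p) = avg n (\<lambda>s. sn n ps (\<lambda>u. g (s # u)) powr p)"
  proof (rule avg_cong)
    fix s assume "s \<in> pts n"
    then have "sn n ps (\<lambda>u. f (s # u)) = sn n ps (\<lambda>u. g (s # u))"
      using Cons.prems by (intro Cons.IH) (auto simp: Cons_grid)
    then show "sn n ps (\<lambda>u. f (s # u)) powr p = sn n ps (\<lambda>u. g (s # u)) powr p" by simp
  qed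
  then show ?case by simp
qed simp

lemma sn_Cons_powr: "0 < p \<Longrightarrow> sn n (p # ps) g powr p = avg n (\<lambda>s. sn n ps (\<lambda>u. g (s # u)) powr p)"
  by (simp add: powr_powr avg_nonneg)

lemma avg_powr_le:
  fixes p :: real
  assumes "0 < p" "0 \<le> C" "\<And>s. s \<in> pts n \<Longrightarrow> 0 \<le> f s" "\<And>s. s \<in> pts n \<Longrightarrow> 0 \<le> g s"
    "\<And>s. s \<in> pts n \<Longrightarrow> f s \<le> C * g s"
  shows "avg n (\<lambda>s. f s powr p) powr (1 / p) \<le> C * avg n (\<lambda>s. g s powr p) powr (1 / p)"
proof -
  have "avg n (\<lambda>s. f s powr p) \<le> avg n (\<lambda>s. C powr p * g s powr p)"
  proof (rule avg_mono)
    fix s assume s: "s \<in> pts n"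
    have "f s powr p \<le> (C * g s) powr p" using assms s by (intro powr_mono2) auto
    then show "f s powr p \<le> C powr p * g s powr p" using assms s by (simp add: powr_mult)
  qed
  also have "\<dots> = C powr p * avg n (\<lambda>s. g s powr p)" by (rule avg_cmult)
  finally have "avg n (\<lambda>s. f s powr p) powr (1 / p) \<le> (C powr p * avg n (\<lambda>s. g s powr p)) powr (1 / p)"
    using assms by (intro powr_mono2) (auto intro!: avg_nonneg)
  also have "\<dots> = (C powr p) powr (1 / p) * avg n (\<lambda>s. g s powr p) powr (1 / p)"
    by (simp add: powr_mult)
  also have "(C powr p) powr (1 / p) = C" using assms by (simp add: powr_powr)
  finally show ?thesis .
qed

lemma sn_Cons_le:
  assumes "0 < p" "0 \<le> C"
    "\<And>s. s \<in> pts n \<Longrightarrow> sn n ps (\<lambda>u. f (s # u)) \<le> C * sn n ps' (\<lambda>u. g (s # u))"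
  shows "sn n (p # ps) f \<le> C * sn n (p # ps') g"
  using assms by (simp add: avg_powr_le sn_nonneg)

lemma sn_mono:
  assumes "\<And>p. p \<in> set ps \<Longrightarrow> 0 < p" "\<And>u. u \<in> grid n (length ps) \<Longrightarrow> \<bar>f u\<bar> \<le> \<bar>g u\<bar>"
  shows "sn n ps f \<le> sn n ps g"
  using assms
proof (induction ps arbitrary: f g)
  case (Cons p ps)
  have "sn n ps (\<lambda>u. f (s # u)) \<le> 1 * sn n ps (\<lambda>u. g (s # u))" if "s \<in> pts n" for s
    using Cons.prems that Cons.IH[of "\<lambda>u. f (s # u)" "\<lambda>u. g (s # u)"] by (auto simp: Cons_grid)
  then have "sn n (p # ps) f \<le> 1 * sn n (p # ps) g"
    using Cons.prems(1) by (intro sn_Cons_le) auto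
  then show ?case by simp
qed simp

lemma sn_cmult:
  assumes "\<And>p. p \<in> set ps \<Longrightarrow> 0 < p"
  shows "sn n ps (\<lambda>u. c * f u) = \<bar>c\<bar> * sn n ps f"
  using assms
proof (induction ps arbitrary: f)
  case (Cons p ps)
  then have "sn n ps (\<lambda>u. c * f (s # u)) = \<bar>c\<bar> * sn n ps (\<lambda>u. f (s # u))" for s by simp
  then have "sn n (p # ps) (\<lambda>u. c * f u) = (\<bar>c\<bar> powr p * avg n (\<lambda>s. sn n ps (\<lambda>u. f (s # u)) powr p)) powr (1 / p)"
    by (simp add: powr_mult sn_nonneg avg_cmult)
  also have "\<dots> = (\<bar>c\<bar> powr p) powr (1 / p) * sn n (p # ps) f"
    by (simp add: powr_mult avg_nonneg)
  also have "(\<bar>c\<bar> powr p) powr (1 / p) = \<bar>c\<bar>" using Cons.prems[of p] by (simp add: powr_powr)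
  finally show ?case .
qed (simp add: abs_mult)

lemma powr_convex_comb:
  fixes x y t p :: real
  assumes "1 \<le> p" "0 \<le> x" "0 \<le> y" "0 \<le> t" "t \<le> 1"
  shows "(t * x + (1 - t) * y) powr p \<le> t * x powr p + (1 - t) * y powr p"
proof -
  define z where "z = t * x + (1 - t) * y"
  have z: "0 \<le> z" using assms by (simp add: z_def)
  have "t * (p * z powr (p - 1) * x) \<le> t * ((p - 1) * z powr p + x powr p)"
    using assms z by (intro mult_left_mono young_powr) auto
  moreover have "(1 - t) * (p * z powr (p - 1) * y) \<le> (1 - t) * ((p - 1) * z powr p + y powr p)"
    using assms z by (intro mult_left_mono young_powr) auto
  moreover have "t * (p * z powr (p - 1) * x) + (1 - t) * (p * z powr (p - 1) * y) = p * (z powr (p - 1) * z)"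
    by (simp add: z_def algebra_simps)
  moreover have "z powr (p - 1) * z = z powr p" using powr_mult_self[OF z] .
  ultimately have "p * z powr p \<le> t * ((p - 1) * z powr p + x powr p) + (1 - t) * ((p - 1) * z powr p + y powr p)"
    by simp
  then show ?thesis unfolding z_def[symmetric] by (simp add: algebra_simps)
qed

text \<open>
  The normalised functions are combined by convexity of the \<open>p\<close>-th power, with weights
  proportional to their norms.
\<close>

lemma minkowski_avg:
  fixes p :: real
  assumes p: "1 \<le> p" and a: "\<And>s. 0 \<le> a s" and b: "\<And>s. 0 \<le> b s"
  shows "avg n (\<lambda>s. (a s + b s) powr p) powr (1 / p)
     \<le> avg n (\<lambda>s. a s powr p) powr (1 / p) + avg n (\<lambda>s. b s powr p) powr (1 / p)"
proof -
  define A where "A = avg n (\<lambda>s. a s powr p) powr (1 / p)"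
  define B where "B = avg n (\<lambda>s. b s powr p) powr (1 / p)"
  have Ap: "A powr p = avg n (\<lambda>s. a s powr p)" and Bp: "B powr p = avg n (\<lambda>s. b s powr p)"
    using p by (simp_all add: A_def B_def powr_powr avg_nonneg)
  have zero: "c s = 0" if "avg n (\<lambda>s. c s powr p) = 0" "s \<in> pts n" for c :: "bool list \<Rightarrow> real" and s
    using that by (simp add: avg_def sum_nonneg_eq_0_iff)
  have AB: "0 \<le> A" "0 \<le> B" by (simp_all add: A_def B_def)
  consider "A = 0" | "B = 0" | "0 < A" "0 < B" using AB by linarith
  then show ?thesis
  proof cases
    case 1
    then have "avg n (\<lambda>s. a s powr p) = 0" using Ap p by simp
    then have "avg n (\<lambda>s. (a s + b s) powr p) = avg n (\<lambda>s. b s powr p)"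
      using zero[of a] by (intro avg_cong) simp
    then show ?thesis by simp
  next
    case 2
    then have "avg n (\<lambda>s. b s powr p) = 0" using Bp p by simp
    then have "avg n (\<lambda>s. (a s + b s) powr p) = avg n (\<lambda>s. a s powr p)"
      using zero[of b] by (intro avg_cong) simp
    then show ?thesis by simp
  next
    case 3
    define t where "t = A / (A + B)"
    have t: "0 \<le> t" "t \<le> 1" "1 - t = B / (A + B)" using 3 by (auto simp: t_def field_simps)
    have "avg n (\<lambda>s. ((a s + b s) / (A + B)) powr p)
       \<le> avg n (\<lambda>s. t / A powr p * a s powr p + (1 - t) / B powr p * b s powr p)"
    proof (rule avg_mono)
      fix s
      have "(a s + b s) / (A + B) = t * (a s / A) + (1 - t) * (b s / B)"
        using 3 unfolding t(3) by (simp add: t_def add_divide_distrib)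
      then have "((a s + b s) / (A + B)) powr p \<le> t * (a s / A) powr p + (1 - t) * (b s / B) powr p"
        using powr_convex_comb[of p "a s / A" "b s / B" t] p a b 3 t by simp
      then show "((a s + b s) / (A + B)) powr p \<le> t / A powr p * a s powr p + (1 - t) / B powr p * b s powr p"
        using a b 3 by (simp add: powr_divide)
    qed
    also have "\<dots> = t / A powr p * A powr p + (1 - t) / B powr p * B powr p"
      unfolding avg_add avg_cmult Ap Bp ..
    also have "\<dots> = 1" using 3 by simp
    finally have "avg n (\<lambda>s. (1 / (A + B)) powr p * (a s + b s) powr p) \<le> 1"
      using a b 3 by (simp add: powr_divide)
    then have "avg n (\<lambda>s. (a s + b s) powr p) \<le> (A + B) powr p"
      unfolding avg_cmult using 3 by (simp add: powr_divide field_simps)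
    then have "avg n (\<lambda>s. (a s + b s) powr p) powr (1 / p) \<le> ((A + B) powr p) powr (1 / p)"
      using p by (intro powr_mono2) (auto intro!: avg_nonneg)
    then show ?thesis using p 3 unfolding A_def[symmetric] B_def[symmetric] by (simp add: powr_powr)
  qed
qed

lemma minkowski_avg_sum:
  fixes p :: real
  assumes p: "1 \<le> p" and a: "\<And>k s. 0 \<le> a k s"
  shows "avg n (\<lambda>s. (\<Sum>k\<in>K. a k s) powr p) powr (1 / p) \<le> (\<Sum>k\<in>K. avg n (\<lambda>s. a k s powr p) powr (1 / p))"
proof (induction K rule: infinite_finite_induct)
  case (insert k K)
  have "avg n (\<lambda>s. (a k s + (\<Sum>k\<in>K. a k s)) powr p) powr (1 / p)
    \<le> avg n (\<lambda>s. a k s powr p) powr (1 / p) + avg n (\<lambda>s. (\<Sum>k\<in>K. a k s) powr p) powr (1 / p)"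
    using a by (intro minkowski_avg[OF p] sum_nonneg) auto
  then show ?case using insert by simp
qed auto

lemma sn_triangle:
  assumes "\<And>p. p \<in> set ps \<Longrightarrow> 1 \<le> p"
  shows "sn n ps (\<lambda>u. f u + g u) \<le> sn n ps f + sn n ps g"
  using assms
proof (induction ps arbitrary: f g)
  case (Cons p ps)
  have p: "1 \<le> p" "0 < p" using Cons.prems[of p] by simp_all
  have "sn n (p # ps) (\<lambda>u. f u + g u)
      \<le> avg n (\<lambda>s. (sn n ps (\<lambda>u. f (s # u)) + sn n ps (\<lambda>u. g (s # u))) powr p) powr (1 / p)"
    using p Cons.IH Cons.prems avg_powr_le[of p 1 n "\<lambda>s. sn n ps (\<lambda>u. f (s # u) + g (s # u))"
       "\<lambda>s. sn n ps (\<lambda>u. f (s # u)) + sn n ps (\<lambda>u. g (s # u))"] by (simp add: sn_nonneg)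
  also have "\<dots> \<le> sn n (p # ps) f + sn n (p # ps) g"
    using minkowski_avg[OF p(1), of "\<lambda>s. sn n ps (\<lambda>u. f (s # u))" "\<lambda>s. sn n ps (\<lambda>u. g (s # u))" n]
    by (simp add: sn_nonneg)
  finally show ?case .
qed simp

text \<open>
  The norm of the space of \<open>\<ell>\<^sup>2(M)\<close>-valued functions. The square function estimates are proved for
  such functions, since an \<open>\<ell>\<^sup>2\<close>-index absorbs the Haar indices of the variables already treated.
\<close>

definition vn :: "nat \<Rightarrow> real list \<Rightarrow> 'm set \<Rightarrow> (bool list list \<Rightarrow> 'm \<Rightarrow> real) \<Rightarrow> real" where
  "vn n ps M z = sn n ps (\<lambda>u. L2_set (z u) M)"

lemma L2_set_cmult: "L2_set (\<lambda>m. c * f m) M = \<bar>c\<bar> * L2_set f M"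
proof -
  have "L2_set (\<lambda>m. c * f m) M = L2_set (\<lambda>m. \<bar>c\<bar> * f m) M"
    by (simp add: L2_set_def power_mult_distrib)
  then show ?thesis using L2_set_right_distrib[of "\<bar>c\<bar>" f M] by simp
qed

lemma seminorm_vn:
  assumes "\<And>p. p \<in> set ps \<Longrightarrow> 1 \<le> p"
  shows "seminorm (vn n ps M)"
  unfolding seminorm_def
proof (intro conjI allI)
  fix x y :: "bool list list \<Rightarrow> 'a \<Rightarrow> real" and c :: real
  have pos: "\<And>p. p \<in> set ps \<Longrightarrow> 0 < p" using assms by fastforce
  have "vn n ps M (x + y) \<le> sn n ps (\<lambda>u. L2_set (x u) M + L2_set (y u) M)"
    unfolding vn_def using L2_set_triangle_ineq[of "x _" "y _" M] pos
    by (intro sn_mono) (auto simp: plus_fun_def)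
  also have "\<dots> \<le> vn n ps M x + vn n ps M y"
    unfolding vn_def by (rule sn_triangle[OF assms])
  finally show "vn n ps M (x + y) \<le> vn n ps M x + vn n ps M y" .
  show "vn n ps M (c *\<^sub>R x) = \<bar>c\<bar> * vn n ps M x"
    unfolding vn_def scaleR_fun_def using pos
    by (simp add: sn_cmult L2_set_cmult)
qed

lemma mart_apply: "s \<in> pts n \<Longrightarrow> mart x s u m = (\<Sum>I\<in>nodes n. hr I s * x I u m)"
  for x :: "bool list \<Rightarrow> 'a \<Rightarrow> 'm \<Rightarrow> real"
proof (induction n arbitrary: x s)
  case (Suc n)
  then obtain b t where s: "s = b # t" "t \<in> pts n" by (auto simp: pts_Suc)
  then show ?case
    using Suc.IH[of t "\<lambda>I. x (b # I)"] by (cases b) (simp_all add: sum_nodes_Suc scaleR_fun_def)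
qed simp

lemma mart_apply1: "s \<in> pts n \<Longrightarrow> mart x s m = (\<Sum>I\<in>nodes n. hr I s * x I m)"
  for x :: "bool list \<Rightarrow> 'm \<Rightarrow> real"
proof (induction n arbitrary: x s)
  case (Suc n)
  then obtain b t where s: "s = b # t" "t \<in> pts n" by (auto simp: pts_Suc)
  then show ?case
    using Suc.IH[of t "\<lambda>I. x (b # I)"] by (cases b) (simp_all add: sum_nodes_Suc scaleR_fun_def)
qed simp

text \<open>
  The cross terms at the root cancel between the two halves; the rest is induction on the tree.
\<close>

lemma haar_orthogonal:
  fixes x :: "bool list \<Rightarrow> real"
  shows "avg n (\<lambda>s. (v + (\<Sum>I\<in>nodes n. hr I s * x I))\<^sup>2) = v\<^sup>2 + avg n (\<lambda>s. \<Sum>I\<in>nodes n. (hr I s * x I)\<^sup>2)"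
proof (induction n arbitrary: x v)
  case (Suc n)
  have e: "avg n (\<lambda>s. (v + (\<Sum>I\<in>nodes (Suc n). hr I (b # s) * x I))\<^sup>2)
      = (v + sg b * x [])\<^sup>2 + avg n (\<lambda>s. \<Sum>I\<in>nodes n. (hr I s * x (b # I))\<^sup>2)" for b
  proof -
    have e0: "v + (\<Sum>I\<in>nodes (Suc n). hr I (b # s) * x I) = (v + sg b * x []) + (\<Sum>I\<in>nodes n. hr I s * x (b # I))" for s
      by (cases b) (simp_all add: sum_nodes_Suc)
    show ?thesis unfolding e0 by (rule Suc.IH)
  qed
  have f: "avg n (\<lambda>s. \<Sum>I\<in>nodes (Suc n). (hr I (b # s) * x I)\<^sup>2)
      = (x [])\<^sup>2 + avg n (\<lambda>s. \<Sum>I\<in>nodes n. (hr I s * x (b # I))\<^sup>2)" for b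
    using avg_add[of n "\<lambda>s. (x [])\<^sup>2"]
    by (cases b) (simp_all add: sum_nodes_Suc)
  show ?case unfolding avg_Suc e f by (simp add: power2_sum power2_diff field_simps)
qed simp

section \<open>The square function of Haar polynomials\<close>

text \<open>
  The two functions to be compared: the \<open>\<ell>\<^sup>2(M)\<close>-norm of a Haar polynomial in the first variable, whose
  coefficients depend on the remaining variables, and its square function.
\<close>

definition sumfn :: "nat \<Rightarrow> 'm set \<Rightarrow> (bool list \<Rightarrow> bool list list \<Rightarrow> 'm \<Rightarrow> real) \<Rightarrow> bool list list \<Rightarrow> real" where
  "sumfn n M x v = L2_set (\<lambda>m. \<Sum>I\<in>nodes n. hr I (hd v) * x I (tl v) m) M"

definition sqfn :: "nat \<Rightarrow> 'm set \<Rightarrow> (bool list \<Rightarrow> bool list list \<Rightarrow> 'm \<Rightarrow> real) \<Rightarrow> bool list list \<Rightarrow> real" where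
  "sqfn n M x v = L2_set (\<lambda>(I, m). hr I (hd v) * x I (tl v) m) (nodes n \<times> M)"

text \<open>
  The argument of type \<open>itself\<close> fixes the type of the \<open>\<ell>\<^sup>2\<close>-indices, over which the definition
  quantifies.
\<close>

definition sq_equiv :: "'m itself \<Rightarrow> real \<Rightarrow> real list \<Rightarrow> bool" where
  "sq_equiv _ p ps \<longleftrightarrow> (\<exists>C>0. \<forall>n (M::'m set) x. finite M \<longrightarrow>
     sn n (p # ps) (sumfn n M x) \<le> C * sn n (p # ps) (sqfn n M x) \<and>
     sn n (p # ps) (sqfn n M x) \<le> C * sn n (p # ps) (sumfn n M x))"

text \<open>
  Putting the coefficient of \<open>I\<close> into the \<open>I\<close>-th coordinate of a larger \<open>\<ell>\<^sup>2\<close>-sum turns the square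
  function into the norm of another Haar polynomial. This makes the square function estimate an
  instance of domination.
\<close>

definition diag :: "(bool list \<Rightarrow> bool list list \<Rightarrow> 'm \<Rightarrow> real) \<Rightarrow> bool list \<Rightarrow> bool list list \<Rightarrow> bool list \<times> 'm \<Rightarrow> real" where
  "diag x I u Jm = (if fst Jm = I then x I u (snd Jm) else 0)"

lemma sumfn_powr:
  assumes "0 < p"
  shows "sn n (p # ps) (sumfn n M x) powr p = avg n (\<lambda>s. vn n ps M (mart x s) powr p)"
  unfolding sn_Cons_powr[OF assms]
proof (rule avg_cong)
  fix s assume "s \<in> pts n"
  then have "mart x s = (\<lambda>u m. \<Sum>I\<in>nodes n. hr I s * x I u m)"
    by (simp add: fun_eq_iff mart_apply)
  then show "sn n ps (\<lambda>u. sumfn n M x (s # u)) powr p = vn n ps M (mart x s) powr p"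
    by (simp add: vn_def sumfn_def)
qed

lemma sqfn_powr:
  assumes "0 < p" "finite M"
  shows "sn n (p # ps) (sqfn n M x) powr p = avg n (\<lambda>s. vn n ps (nodes n \<times> M) (mart (diag x) s) powr p)"
proof -
  have "vn n ps (nodes n \<times> M) (mart (diag x) s) = sn n ps (\<lambda>u. sqfn n M x (s # u))" if s: "s \<in> pts n" for s
    unfolding vn_def
  proof (rule sn_cong)
    fix u
    have "mart (diag x) s u (J, m) = hr J s * x J u m" if "J \<in> nodes n" for J m
      using that s by (simp add: mart_apply diag_def if_distrib[of "\<lambda>z. _ * z"] cong: if_cong)
    then show "L2_set (mart (diag x) s u) (nodes n \<times> M) = sqfn n M x (s # u)"
      unfolding sqfn_def by (intro L2_set_cong) auto
  qed
  then show ?thesis unfolding sn_Cons_powr[OF assms(1)] by (intro avg_cong) simp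
qed

lemma powr_le_iff_le: "0 < p \<Longrightarrow> 0 \<le> a \<Longrightarrow> 0 \<le> b \<Longrightarrow> a powr p \<le> b powr p \<longleftrightarrow> a \<le> (b::real)"
  using powr_mono2[of p a b] powr_less_mono2[of p b a] by linarith

lemma powr_le_mult_iff: "0 < p \<Longrightarrow> 0 \<le> a \<Longrightarrow> 0 \<le> b \<Longrightarrow> 0 \<le> C \<Longrightarrow> a powr p \<le> C powr p * b powr p \<longleftrightarrow> a \<le> C * (b::real)"
  using powr_le_iff_le[of p a "C * b"] by (simp add: powr_mult)

text \<open>
  Both inequalities are dominations, one between \<open>x\<close> and \<open>diag x\<close> and one in the other direction,
  and \<open>diag\<close> commutes with deleting coefficients. So the extrapolation applies to both.
\<close>

lemma sq_equiv_extrapolate: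
  assumes sq: "sq_equiv (T :: 'm itself) q ps" and p: "1 < p" and q: "1 < q" and ps: "\<And>r. r \<in> set ps \<Longrightarrow> 1 \<le> r"
  shows "sq_equiv T p ps"
proof -
  obtain A where A: "0 < A" and
    A1: "\<And>n (M::'m set) x. finite M \<Longrightarrow> sn n (q # ps) (sumfn n M x) \<le> A * sn n (q # ps) (sqfn n M x)" and
    A2: "\<And>n (M::'m set) x. finite M \<Longrightarrow> sn n (q # ps) (sqfn n M x) \<le> A * sn n (q # ps) (sumfn n M x)"
    using sq unfolding sq_equiv_def by blast
  obtain C1 where C1: "0 < C1"
    "\<And>n (NX :: (bool list list \<Rightarrow> 'm \<Rightarrow> real) \<Rightarrow> real) (NY :: (bool list list \<Rightarrow> bool list \<times> 'm \<Rightarrow> real) \<Rightarrow> real) x y.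
       seminorm NX \<Longrightarrow> seminorm NY \<Longrightarrow> dominates A q n NX x NY y \<Longrightarrow>
       avg n (\<lambda>s. NY (mart y s) powr p) \<le> C1 powr p * avg n (\<lambda>s. NX (mart x s) powr p)"
    using haar_extrapolation[OF p q A] by blast
  obtain C2 where C2: "0 < C2"
    "\<And>n (NX :: (bool list list \<Rightarrow> bool list \<times> 'm \<Rightarrow> real) \<Rightarrow> real) (NY :: (bool list list \<Rightarrow> 'm \<Rightarrow> real) \<Rightarrow> real) x y.
       seminorm NX \<Longrightarrow> seminorm NY \<Longrightarrow> dominates A q n NX x NY y \<Longrightarrow>
       avg n (\<lambda>s. NY (mart y s) powr p) \<le> C2 powr p * avg n (\<lambda>s. NX (mart x s) powr p)"
    using haar_extrapolation[OF p q A] by blast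
  define C where "C = max C1 C2"
  have C: "0 < C" "C1 \<le> C" "C2 \<le> C" using C1 by (auto simp: C_def)
  show ?thesis unfolding sq_equiv_def
  proof (intro exI[of _ C] conjI allI impI)
    fix n and M :: "'m set" and x :: "bool list \<Rightarrow> bool list list \<Rightarrow> 'm \<Rightarrow> real"
    assume M: "finite M"
    let ?NX = "vn n ps M" and ?NY = "vn n ps (nodes n \<times> M)"
    have sem: "seminorm ?NX" "seminorm ?NY" using ps by (auto intro: seminorm_vn)
    have pq: "0 < p" "0 < q" using p q by auto
    note toq = sqfn_powr[OF pq(2) M, symmetric] sumfn_powr[OF pq(2), where M = M, symmetric]
      powr_le_mult_iff[OF pq(2) sn_nonneg sn_nonneg less_imp_le[OF A]]
    have restr: "(\<lambda>I. if I \<in> F then diag x I else 0) = diag (\<lambda>I. if I \<in> F then x I else 0)" for F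
      by (auto simp: diag_def fun_eq_iff)
    have d1: "dominates A q n ?NX x ?NY (diag x)"
      unfolding dominates_def restr
    proof
      fix F
      show "avg n (\<lambda>s. ?NY (mart (diag (\<lambda>I. if I \<in> F then x I else 0)) s) powr q)
         \<le> A powr q * avg n (\<lambda>s. ?NX (mart (\<lambda>I. if I \<in> F then x I else 0) s) powr q)"
        unfolding toq by (rule A2[OF M])
    qed
    have d2: "dominates A q n ?NY (diag x) ?NX x"
      unfolding dominates_def restr
    proof
      fix F
      show "avg n (\<lambda>s. ?NX (mart (\<lambda>I. if I \<in> F then x I else 0) s) powr q)
         \<le> A powr q * avg n (\<lambda>s. ?NY (mart (diag (\<lambda>I. if I \<in> F then x I else 0)) s) powr q)"
        unfolding toq by (rule A1[OF M])
    qed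
    have "sn n (p # ps) (sumfn n M x) \<le> C2 * sn n (p # ps) (sqfn n M x)"
      using C2(2)[OF sem(2,1) d2]
      unfolding sqfn_powr[OF pq(1) M, symmetric] sumfn_powr[OF pq(1), where M = M, symmetric]
        powr_le_mult_iff[OF pq(1) sn_nonneg sn_nonneg less_imp_le[OF C2(1)]] .
    also have "\<dots> \<le> C * sn n (p # ps) (sqfn n M x)" using C by (intro mult_right_mono sn_nonneg)
    finally show "sn n (p # ps) (sumfn n M x) \<le> C * sn n (p # ps) (sqfn n M x)" .
    have "sn n (p # ps) (sqfn n M x) \<le> C1 * sn n (p # ps) (sumfn n M x)"
      using C1(2)[OF sem(1,2) d1]
      unfolding sqfn_powr[OF pq(1) M, symmetric] sumfn_powr[OF pq(1), where M = M, symmetric]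
        powr_le_mult_iff[OF pq(1) sn_nonneg sn_nonneg less_imp_le[OF C1(1)]] .
    also have "\<dots> \<le> C * sn n (p # ps) (sumfn n M x)" using C by (intro mult_right_mono sn_nonneg)
    finally show "sn n (p # ps) (sqfn n M x) \<le> C * sn n (p # ps) (sumfn n M x)" .
  qed (use C in auto)
qed

lemma L2_set_square: "(L2_set f A)\<^sup>2 = (\<Sum>i\<in>A. (f i)\<^sup>2)"
  by (simp add: L2_set_def sum_nonneg)

text \<open>
  In \<open>L\<^sup>2\<close> of one variable orthogonality gives equality.
\<close>

lemma sq_equiv_base: "sq_equiv (T :: 'm itself) 2 []"
proof -
  have eq: "sn n [2] (sumfn n M x) = sn n [2] (sqfn n M x)" if M: "finite M"
    for n and M :: "'m set" and x
  proof -
    have "avg n (\<lambda>s. (sumfn n M x [s])\<^sup>2) = (\<Sum>m\<in>M. avg n (\<lambda>s. (\<Sum>I\<in>nodes n. hr I s * x I [] m)\<^sup>2))"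
      by (simp add: sumfn_def L2_set_square avg_sum)
    also have "\<dots> = (\<Sum>m\<in>M. avg n (\<lambda>s. \<Sum>I\<in>nodes n. (hr I s * x I [] m)\<^sup>2))"
      using haar_orthogonal[of n 0] by simp
    also have "\<dots> = avg n (\<lambda>s. (sqfn n M x [s])\<^sup>2)"
    proof -
      have "(sqfn n M x [s])\<^sup>2 = (\<Sum>m\<in>M. \<Sum>I\<in>nodes n. (hr I s * x I [] m)\<^sup>2)" for s
      proof -
        have "(sqfn n M x [s])\<^sup>2 = (\<Sum>I\<in>nodes n. \<Sum>m\<in>M. (hr I s * x I [] m)\<^sup>2)"
          by (simp add: sqfn_def L2_set_square sum.cartesian_product split_def)
        then show ?thesis by (subst sum.swap) simp
      qed
      then show ?thesis by (simp only: avg_sum)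
    qed
    finally show ?thesis by (simp add: sumfn_def sqfn_def)
  qed
  then show ?thesis unfolding sq_equiv_def by (intro exI[of _ 1]) simp
qed

text \<open>
  Two neighbouring variables with the same exponent may be interchanged by Fubini. The second one
  then becomes an outer parameter, over which the estimate is integrated.
\<close>

lemma sq_equiv_swap:
  assumes sq: "sq_equiv (T :: 'm itself) q ps" and q: "1 < q"
  shows "sq_equiv T q (q # ps)"
proof -
  obtain A where A: "0 < A" and
    A1: "\<And>n (M::'m set) x. finite M \<Longrightarrow> sn n (q # ps) (sumfn n M x) \<le> A * sn n (q # ps) (sqfn n M x)" and
    A2: "\<And>n (M::'m set) x. finite M \<Longrightarrow> sn n (q # ps) (sqfn n M x) \<le> A * sn n (q # ps) (sumfn n M x)"
    using sq unfolding sq_equiv_def by blast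
  have swap: "sn n (q # q # ps) f powr q = avg n (\<lambda>t. sn n (q # ps) (\<lambda>v. f (hd v # t # tl v)) powr q)" for n f
  proof -
    have pos: "0 < q" using q by simp
    show ?thesis unfolding sn_Cons_powr[OF pos] by (subst avg_swap) simp
  qed
  have 1: "sn n (q # q # ps) (sumfn n M x) powr q = avg n (\<lambda>t. sn n (q # ps) (sumfn n M (\<lambda>I u. x I (t # u))) powr q)"
    for n and M :: "'m set" and x
    unfolding swap by (simp add: sumfn_def)
  have 2: "sn n (q # q # ps) (sqfn n M x) powr q = avg n (\<lambda>t. sn n (q # ps) (sqfn n M (\<lambda>I u. x I (t # u))) powr q)"
    for n and M :: "'m set" and x
    unfolding swap by (simp add: sqfn_def)
  have step: "sn n (q # q # ps) f \<le> A * sn n (q # q # ps) g"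
    if "sn n (q # q # ps) f powr q = avg n (\<lambda>t. F t powr q)" "sn n (q # q # ps) g powr q = avg n (\<lambda>t. G t powr q)"
      "\<And>t. 0 \<le> F t" "\<And>t. 0 \<le> G t" "\<And>t. F t \<le> A * G t" for n f g F G
  proof -
    have "avg n (\<lambda>t. F t powr q) \<le> avg n (\<lambda>t. A powr q * G t powr q)"
    proof (rule avg_mono)
      fix t
      have "F t powr q \<le> (A * G t) powr q" using that q by (intro powr_mono2) auto
      then show "F t powr q \<le> A powr q * G t powr q" using that A by (simp add: powr_mult)
    qed
    then have "sn n (q # q # ps) f powr q \<le> A powr q * sn n (q # q # ps) g powr q"
      unfolding that(1,2) avg_cmult .
    then show ?thesis using q A by (simp add: powr_le_mult_iff sn_nonneg del: sn.simps)
  qed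
  show ?thesis unfolding sq_equiv_def
  proof (intro exI[of _ A] conjI allI impI)
    fix n and M :: "'m set" and x :: "bool list \<Rightarrow> bool list list \<Rightarrow> 'm \<Rightarrow> real"
    assume M: "finite M"
    show "sn n (q # q # ps) (sumfn n M x) \<le> A * sn n (q # q # ps) (sqfn n M x)"
      by (rule step[OF 1 2 sn_nonneg sn_nonneg A1[OF M]])
    show "sn n (q # q # ps) (sqfn n M x) \<le> A * sn n (q # q # ps) (sumfn n M x)"
      by (rule step[OF 2 1 sn_nonneg sn_nonneg A2[OF M]])
  qed (rule A)
qed

text \<open>
  Every new variable enters with the exponent \<open>q\<close> of the swap, after which the outer exponent is
  moved from \<open>q\<close> to the desired \<open>p\<close> by extrapolation.
\<close>

lemma square_function_one_variable:
  assumes "1 < p" "\<And>r. r \<in> set ps \<Longrightarrow> 1 < r"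
  shows "sq_equiv (T :: 'm itself) p ps"
  using assms
proof (induction ps arbitrary: p)
  case Nil
  show ?case by (rule sq_equiv_extrapolate[OF sq_equiv_base Nil(1)]) auto
next
  case (Cons q ps)
  have q: "1 < q" using Cons.prems by simp
  have "sq_equiv T q (q # ps)" using Cons by (intro sq_equiv_swap q) auto
  then show ?case
  proof (rule sq_equiv_extrapolate)
    show "1 \<le> r" if "r \<in> set (q # ps)" for r using Cons.prems(2)[OF that] by simp
  qed (use Cons.prems q in auto)
qed

section \<open>The square function in several variables\<close>

text \<open>
  The tensor product Haar function of the list \<open>J\<close> of intervals at the grid point \<open>u\<close>.
\<close>

primrec th :: "bool list list \<Rightarrow> bool list list \<Rightarrow> real" where
  "th [] u = 1"
| "th (I # J) u = hr I (hd u) * th J (tl u)"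

definition rects :: "nat \<Rightarrow> nat \<Rightarrow> bool list list set" where
  "rects n d = {J. length J = d \<and> set J \<subseteq> nodes n}"

lemma rects_0 [simp]: "rects n 0 = {[]}"
  by (auto simp: rects_def)

lemma rects_Suc: "rects n (Suc d) = (\<lambda>(I, J). I # J) ` (nodes n \<times> rects n d)"
proof -
  have "K \<in> rects n (Suc d) \<longleftrightarrow> K \<in> (\<lambda>(I, J). I # J) ` (nodes n \<times> rects n d)" for K
    by (cases K) (auto simp: rects_def image_iff)
  then show ?thesis by blast
qed

lemma finite_rects [simp]: "finite (rects n d)"
  by (induction d) (auto simp: rects_Suc)

lemma inj_Cons_pair: "inj_on (\<lambda>(I, J). I # J) A"
  by (auto simp: inj_on_def)

lemma sum_rects_Suc: "(\<Sum>J\<in>rects n (Suc d). f J) = (\<Sum>I\<in>nodes n. \<Sum>J\<in>rects n d. f (I # J))"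
  unfolding rects_Suc sum.reindex[OF inj_Cons_pair] by (simp add: sum.cartesian_product split_def)

lemma L2_set_sum_eq: "(\<Sum>i\<in>A. (f i)\<^sup>2) = (\<Sum>i\<in>B. (g i)\<^sup>2) \<Longrightarrow> L2_set f A = L2_set g B"
  by (simp add: L2_set_def)

text \<open>
  The \<open>\<ell>\<^sup>2\<close>-indices are lists of words, a type that is closed under prepending a Haar index; otherwise
  the induction on the number of variables would change the type of the indices.
\<close>

definition vector_bound :: "real list \<Rightarrow> real \<Rightarrow> bool" where
  "vector_bound ps C \<longleftrightarrow> (\<forall>n (M::bool list list set) a. finite M \<longrightarrow>
     sn n ps (\<lambda>u. L2_set (\<lambda>m. \<Sum>J\<in>rects n (length ps). th J u * a J m) M)
       \<le> C * sn n ps (\<lambda>u. L2_set (\<lambda>(J, m). th J u * a J m) (rects n (length ps) \<times> M)) \<and>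
     sn n ps (\<lambda>u. L2_set (\<lambda>(J, m). th J u * a J m) (rects n (length ps) \<times> M))
       \<le> C * sn n ps (\<lambda>u. L2_set (\<lambda>m. \<Sum>J\<in>rects n (length ps). th J u * a J m) M))"

text \<open>
  The one-variable estimate replaces the sum over the first interval \<open>I\<close> by a square function, at the
  price of the larger index set of all pairs \<open>(I, m)\<close>. For a fixed atom in the first variable what
  remains is a vector-valued sum in the other variables, to which the induction hypothesis applies.
\<close>

lemma square_function_vector:
  assumes "\<And>r. r \<in> set ps \<Longrightarrow> 1 < r"
  shows "\<exists>C>0. vector_bound ps C"
  using assms
proof (induction ps)
  case Nil
  have "L2_set (\<lambda>(J, m). th J [] * a J m) ({[]} \<times> M) = L2_set (\<lambda>m. a [] m) M"
    for a :: "bool list list \<Rightarrow> bool list list \<Rightarrow> real" and M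
    by (rule L2_set_sum_eq) (simp add: sum.cartesian_product')
  then show ?case by (intro exI[of _ 1]) (simp add: vector_bound_def)
next
  case (Cons p ps)
  let ?d = "length ps"
  have p: "1 < p" "0 < p" using Cons.prems[of p] by auto
  obtain C2 where C2: "0 < C2" "vector_bound ps C2"
    using Cons.IH Cons.prems by (metis list.set_intros(2))
  note IH1 = C2(2)[unfolded vector_bound_def, rule_format, THEN conjunct1]
    and IH2 = C2(2)[unfolded vector_bound_def, rule_format, THEN conjunct2]
  obtain C1 where C1: "0 < C1" and
    S1: "\<And>n (M::bool list list set) x. finite M \<Longrightarrow> sn n (p # ps) (sumfn n M x) \<le> C1 * sn n (p # ps) (sqfn n M x)" and
    S2: "\<And>n (M::bool list list set) x. finite M \<Longrightarrow> sn n (p # ps) (sqfn n M x) \<le> C1 * sn n (p # ps) (sumfn n M x)"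
    using square_function_one_variable[OF p(1), of ps "TYPE(bool list list)"] Cons.prems
    unfolding sq_equiv_def by (metis list.set_intros(2))
  show ?case unfolding vector_bound_def
  proof (intro exI[of _ "C1 * C2"] conjI allI impI)
    fix n and M :: "bool list list set" and a :: "bool list list \<Rightarrow> bool list list \<Rightarrow> real"
    assume M: "finite M"
    define x where "x I u m = (\<Sum>J\<in>rects n ?d. th J u * a (I # J) m)" for I u m
    let ?L = "\<lambda>u. L2_set (\<lambda>m. \<Sum>J\<in>rects n (length (p # ps)). th J u * a J m) M"
    let ?R = "\<lambda>u. L2_set (\<lambda>(J, m). th J u * a J m) (rects n (length (p # ps)) \<times> M)"
    \<comment> \<open>The pair \<open>(I, m)\<close> is encoded as the list \<open>I # m\<close>.\<close>
    define M2 where "M2 = (\<lambda>(I, m). I # m) ` (nodes n \<times> M)"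
    have M2: "finite M2" using M by (simp add: M2_def)
    define a2 where "a2 s J m = hr (hd m) s * a (hd m # J) (tl m)" for s J and m :: "bool list list"
    have L: "?L = sumfn n M x"
    proof
      fix u
      have "(\<Sum>J\<in>rects n (length (p # ps)). th J u * a J m) = (\<Sum>I\<in>nodes n. hr I (hd u) * x I (tl u) m)" for m
        by (simp add: sum_rects_Suc x_def sum_distrib_left mult.assoc)
      then show "?L u = sumfn n M x u" by (simp add: sumfn_def)
    qed
    have Q: "sqfn n M x (s # u) = L2_set (\<lambda>m. \<Sum>J\<in>rects n ?d. th J u * a2 s J m) M2" for s u
      unfolding sqfn_def M2_def
      by (rule L2_set_sum_eq, unfold sum.reindex[OF inj_Cons_pair])
        (simp add: x_def a2_def split_def sum_distrib_left mult_ac)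
    have R: "?R (s # u) = L2_set (\<lambda>(J, m). th J u * a2 s J m) (rects n ?d \<times> M2)" for s u
    proof (rule L2_set_sum_eq)
      have "(\<Sum>i\<in>rects n ?d \<times> M2. (case i of (J, m) \<Rightarrow> th J u * a2 s J m)\<^sup>2)
        = (\<Sum>J\<in>rects n ?d. \<Sum>I\<in>nodes n. \<Sum>m\<in>M. (th J u * (hr I s * a (I # J) m))\<^sup>2)"
        by (simp add: sum.cartesian_product' M2_def sum.reindex[OF inj_Cons_pair] a2_def)
      also have "\<dots> = (\<Sum>I\<in>nodes n. \<Sum>J\<in>rects n ?d. \<Sum>m\<in>M. (th J u * (hr I s * a (I # J) m))\<^sup>2)"
        by (rule sum.swap)
      also have "\<dots> = (\<Sum>i\<in>rects n (length (p # ps)) \<times> M. (case i of (J, m) \<Rightarrow> th J (s # u) * a J m)\<^sup>2)"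
        by (simp add: sum.cartesian_product' sum_rects_Suc mult_ac)
      finally show "(\<Sum>i\<in>rects n (length (p # ps)) \<times> M. (case i of (J, m) \<Rightarrow> th J (s # u) * a J m)\<^sup>2)
         = (\<Sum>i\<in>rects n ?d \<times> M2. (case i of (J, m) \<Rightarrow> th J u * a2 s J m)\<^sup>2)" by simp
    qed
    have QR: "sn n (p # ps) (sqfn n M x) \<le> C2 * sn n (p # ps) ?R"
    proof (rule sn_Cons_le[OF p(2) less_imp_le[OF C2(1)]])
      show "sn n ps (\<lambda>u. sqfn n M x (s # u)) \<le> C2 * sn n ps (\<lambda>u. ?R (s # u))" for s
        unfolding Q R by (rule IH1[OF M2])
    qed
    have RQ: "sn n (p # ps) ?R \<le> C2 * sn n (p # ps) (sqfn n M x)"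
    proof (rule sn_Cons_le[OF p(2) less_imp_le[OF C2(1)]])
      show "sn n ps (\<lambda>u. ?R (s # u)) \<le> C2 * sn n ps (\<lambda>u. sqfn n M x (s # u))" for s
        unfolding Q R by (rule IH2[OF M2])
    qed
    show "sn n (p # ps) ?L \<le> C1 * C2 * sn n (p # ps) ?R"
      unfolding L mult.assoc
      by (rule order_trans[OF S1[OF M] mult_left_mono[OF QR less_imp_le[OF C1]]])
    show "sn n (p # ps) ?R \<le> C1 * C2 * sn n (p # ps) ?L"
      unfolding L mult.commute[of C1 C2] mult.assoc
      by (rule order_trans[OF RQ mult_left_mono[OF S2[OF M] less_imp_le[OF C2(1)]]])
  qed (use C1 C2 in simp)
qed

theorem square_function:
  assumes "\<And>r. r \<in> set ps \<Longrightarrow> 1 < r"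
  obtains C where "0 < C"
    "\<And>n a. sn n ps (\<lambda>u. \<Sum>J\<in>rects n (length ps). th J u * a J)
       \<le> C * sn n ps (\<lambda>u. L2_set (\<lambda>J. th J u * a J) (rects n (length ps)))"
    "\<And>n a. sn n ps (\<lambda>u. L2_set (\<lambda>J. th J u * a J) (rects n (length ps)))
       \<le> C * sn n ps (\<lambda>u. \<Sum>J\<in>rects n (length ps). th J u * a J)"
proof -
  let ?d = "length ps"
  obtain C where C: "0 < C" and H: "vector_bound ps C"
    using square_function_vector assms by metis
  note 1 = H[unfolded vector_bound_def, rule_format, THEN conjunct1] and 2 = H[unfolded vector_bound_def, rule_format, THEN conjunct2]
  have pos: "\<And>r. r \<in> set ps \<Longrightarrow> 0 < r" using assms by fastforce
  \<comment> \<open>The scalar case is that of a single \<open>\<ell>\<^sup>2\<close>-index, for which the \<open>\<ell>\<^sup>2\<close>-norm is the absolute value.\<close>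
  have L: "sn n ps (\<lambda>u. L2_set (\<lambda>m. \<Sum>J\<in>rects n ?d. th J u * a J) {[]}) = sn n ps (\<lambda>u. \<Sum>J\<in>rects n ?d. th J u * a J)"
    for n a by (rule antisym; rule sn_mono) (use pos in auto)
  have R: "L2_set (\<lambda>(J, m). th J u * a J) (rects n ?d \<times> {[]}) = L2_set (\<lambda>J. th J u * a J) (rects n ?d)"
    for n u a by (rule L2_set_sum_eq) (simp add: sum.cartesian_product')
  show thesis
  proof (rule that[OF C])
    fix n a
    show "sn n ps (\<lambda>u. \<Sum>J\<in>rects n ?d. th J u * a J)
       \<le> C * sn n ps (\<lambda>u. L2_set (\<lambda>J. th J u * a J) (rects n ?d))"
      using 1[of "{[]}" n "\<lambda>J m. a J"] unfolding L R by simp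
    show "sn n ps (\<lambda>u. L2_set (\<lambda>J. th J u * a J) (rects n ?d))
       \<le> C * sn n ps (\<lambda>u. \<Sum>J\<in>rects n ?d. th J u * a J)"
      using 2[of "{[]}" n "\<lambda>J m. a J"] unfolding L R by simp
  qed
qed

section \<open>Upper estimates for disjoint blocks\<close>

text \<open>
  Mixed norms with exponents at least \<open>r\<close> are \<open>r\<close>-convex: in each variable this is Minkowski's
  inequality in \<open>L\<^sup>p\<^sup>/\<^sup>r\<close>.
\<close>

lemma sn_r_convex:
  fixes r :: real
  assumes r: "0 < r" "\<And>p. p \<in> set ps \<Longrightarrow> r \<le> p" and K: "finite K"
  shows "sn n ps (\<lambda>u. (\<Sum>k\<in>K. \<bar>g k u\<bar> powr r) powr (1 / r)) \<le> (\<Sum>k\<in>K. sn n ps (g k) powr r) powr (1 / r)"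
  using r(2)
proof (induction ps arbitrary: g)
  case Nil
  then show ?case by simp
next
  case (Cons p ps)
  have p: "r \<le> p" "0 < p" using Cons.prems[of p] r by auto
  define a where "a k s = sn n ps (\<lambda>u. g k (s # u)) powr r" for k s
  have a: "0 \<le> a k s" for k s by (simp add: a_def)
  have "sn n (p # ps) (\<lambda>u. (\<Sum>k\<in>K. \<bar>g k u\<bar> powr r) powr (1 / r))
     \<le> avg n (\<lambda>s. ((\<Sum>k\<in>K. a k s) powr (1 / r)) powr p) powr (1 / p)"
    using avg_powr_le[of p 1 n "\<lambda>s. sn n ps (\<lambda>u. (\<Sum>k\<in>K. \<bar>g k (s # u)\<bar> powr r) powr (1 / r))"
        "\<lambda>s. (\<Sum>k\<in>K. a k s) powr (1 / r)"] p Cons.IH[of "\<lambda>k u. g k (_ # u)"] Cons.prems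
    by (simp add: sn_nonneg a_def)
  also have "\<dots> = (avg n (\<lambda>s. (\<Sum>k\<in>K. a k s) powr (p / r)) powr (1 / (p / r))) powr (1 / r)"
    using p r(1) by (simp add: powr_powr)
  also have "\<dots> \<le> (\<Sum>k\<in>K. avg n (\<lambda>s. a k s powr (p / r)) powr (1 / (p / r))) powr (1 / r)"
    using p r(1) a by (intro powr_mono2 minkowski_avg_sum) auto
  also have "(\<lambda>k. avg n (\<lambda>s. a k s powr (p / r)) powr (1 / (p / r))) = (\<lambda>k. sn n (p # ps) (g k) powr r)"
    using p r(1) by (simp add: a_def powr_powr fun_eq_iff)
  finally show ?case .
qed

lemma L2_set_le_powr_sum:
  fixes r :: real
  assumes r: "0 < r" "r \<le> 2" and K: "finite K"
  shows "L2_set S K \<le> (\<Sum>k\<in>K. \<bar>S k\<bar> powr r) powr (1 / r)"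
proof -
  define T where "T = (\<Sum>k\<in>K. \<bar>S k\<bar> powr r) powr (1 / r)"
  have Tr: "T powr r = (\<Sum>k\<in>K. \<bar>S k\<bar> powr r)" using r by (simp add: T_def powr_powr sum_nonneg)
  have le: "\<bar>S k\<bar> \<le> T" if "k \<in> K" for k
  proof -
    have "\<bar>S k\<bar> powr r \<le> T powr r" unfolding Tr using K that by (intro member_le_sum) auto
    then show ?thesis using r by (subst (asm) powr_le_iff_le) (auto simp: T_def)
  qed
  show ?thesis
  proof (cases "T = 0")
    case True
    then show ?thesis using le by (simp add: T_def[symmetric] L2_set_0')
  next
    case False
    then have T: "0 < T" by (simp add: T_def less_le)
    have "(\<Sum>k\<in>K. (S k)\<^sup>2) = (\<Sum>k\<in>K. T\<^sup>2 * (\<bar>S k\<bar> / T) powr 2)"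
      using T by (intro sum.cong) (auto simp: power_divide powr_numeral)
    also have "\<dots> \<le> (\<Sum>k\<in>K. T\<^sup>2 * (\<bar>S k\<bar> / T) powr r)"
      using T le r by (intro sum_mono mult_left_mono powr_mono') auto
    also have "\<dots> = T\<^sup>2 / T powr r * (\<Sum>k\<in>K. \<bar>S k\<bar> powr r)"
      using T by (simp add: sum_distrib_left powr_divide)
    also have "\<dots> = T\<^sup>2" unfolding Tr[symmetric] using T by simp
    finally show ?thesis unfolding L2_set_def T_def[symmetric] using T by (simp add: real_le_lsqrt sum_nonneg)
  qed
qed

text \<open>
  By the square function estimates, blocks \<open>f\<^sub>k\<close> with disjoint Haar supports and square functions \<open>S\<^sub>k\<close>
  satisfy \<open>\<parallel>\<Sum> f\<^sub>k\<parallel> \<le> C \<parallel>(\<Sum> S\<^sub>k\<^sup>2)\<^sup>1\<^sup>/\<^sup>2\<parallel>\<close>. The \<open>\<ell>\<^sup>2\<close>-norm is at most the \<open>\<ell>\<^sup>r\<close>-norm for \<open>r \<le> 2\<close>, and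
  \<open>r\<close>-convexity takes the \<open>\<ell>\<^sup>r\<close>-norm out of the mixed norm. This needs \<open>r\<close> to be at most \<open>2\<close> and at most
  all the exponents; since these exceed \<open>1\<close>, so does \<open>r\<close>.
\<close>

theorem upper_estimate:
  assumes ps: "\<And>p. p \<in> set ps \<Longrightarrow> 1 < p"
  obtains C r where "0 < C" "1 < r"
    "\<And>n m F a B. disjoint_family_on F {..<m} \<Longrightarrow> (\<And>k. k < m \<Longrightarrow> F k \<subseteq> rects n (length ps)) \<Longrightarrow>
       (\<And>k. k < m \<Longrightarrow> sn n ps (\<lambda>u. \<Sum>J\<in>F k. th J u * a J) \<le> B) \<Longrightarrow>
       sn n ps (\<lambda>u. \<Sum>k<m. \<Sum>J\<in>F k. th J u * a J) \<le> C * B * real m powr (1 / r)"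
proof -
  let ?d = "length ps"
  obtain C where C: "0 < C" and
    1: "\<And>n a. sn n ps (\<lambda>u. \<Sum>J\<in>rects n ?d. th J u * a J)
       \<le> C * sn n ps (\<lambda>u. L2_set (\<lambda>J. th J u * a J) (rects n ?d))" and
    2: "\<And>n a. sn n ps (\<lambda>u. L2_set (\<lambda>J. th J u * a J) (rects n ?d))
       \<le> C * sn n ps (\<lambda>u. \<Sum>J\<in>rects n ?d. th J u * a J)"
    by (rule square_function[of ps, OF ps]) (assumption | rule that)+
  define r where "r = Min (insert 2 (set ps))"
  have r: "1 < r" "r \<le> 2" "\<And>p. p \<in> set ps \<Longrightarrow> r \<le> p" using ps by (auto simp: r_def)
  have pos: "\<And>p. p \<in> set ps \<Longrightarrow> 0 < p" using ps by fastforce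
  have "sn n ps (\<lambda>u. \<Sum>k<m. \<Sum>J\<in>F k. th J u * a J) \<le> C\<^sup>2 * B * real m powr (1 / r)"
    if F: "disjoint_family_on F {..<m}" "\<And>k. k < m \<Longrightarrow> F k \<subseteq> rects n ?d"
      and B: "\<And>k. k < m \<Longrightarrow> sn n ps (\<lambda>u. \<Sum>J\<in>F k. th J u * a J) \<le> B" for n m F a B
  proof (cases "m = 0")
    case True
    have "sn n ps (\<lambda>u. 0) = 0" using sn_cmult[of ps n 0 "\<lambda>u. 0"] pos by simp
    then show ?thesis using True by simp
  next
    case False
    have B0: "0 \<le> B" using B[of 0] False sn_nonneg[of n ps "\<lambda>u. \<Sum>J\<in>F 0. th J u * a J"] by simp
    have finF: "finite (F k)" if "k < m" for k using F(2)[OF that] finite_subset finite_rects by blast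
    define G where "G = (\<Union>k<m. F k)"
    have G: "G \<subseteq> rects n ?d" "finite G" using F(2) finF by (auto simp: G_def)
    have sumG: "(\<Sum>k<m. \<Sum>J\<in>F k. h J) = (\<Sum>J\<in>rects n ?d. if J \<in> G then h J else 0)" for h :: "bool list list \<Rightarrow> real"
    proof -
      have "(\<Sum>k<m. \<Sum>J\<in>F k. h J) = (\<Sum>J\<in>G. h J)"
        unfolding G_def using F(1) finF by (intro sum.UNION_disjoint[symmetric]) (auto simp: disjoint_family_on_def)
      also have "\<dots> = (\<Sum>J\<in>rects n ?d. if J \<in> G then h J else 0)"
        using G by (simp add: sum.If_cases Int_absorb1)
      finally show ?thesis .
    qed
    define b where "b J = (if J \<in> G then a J else 0)" for J
    define S where "S k u = L2_set (\<lambda>J. th J u * a J) (F k)" for k u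
    have S: "sn n ps (S k) \<le> C * B" if "k < m" for k
    proof -
      define c where "c J = (if J \<in> F k then a J else 0)" for J
      have e: "(\<Sum>J\<in>rects n ?d. if J \<in> F k then h J else 0) = (\<Sum>J\<in>F k. h J)" for h :: "bool list list \<Rightarrow> real"
        using F(2)[OF that] by (simp add: sum.If_cases Int_absorb1)
      have "S k u = L2_set (\<lambda>J. th J u * c J) (rects n ?d)" for u
        unfolding S_def by (rule L2_set_sum_eq) (simp add: c_def e[symmetric] if_distrib[of "\<lambda>z. (_ * z)\<^sup>2"] cong: if_cong)
      then have "sn n ps (S k) = sn n ps (\<lambda>u. L2_set (\<lambda>J. th J u * c J) (rects n ?d))" by presburger
      also have "\<dots> \<le> C * sn n ps (\<lambda>u. \<Sum>J\<in>rects n ?d. th J u * c J)" by (rule 2)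
      also have "(\<lambda>u. \<Sum>J\<in>rects n ?d. th J u * c J) = (\<lambda>u. \<Sum>J\<in>F k. th J u * a J)"
        by (simp add: c_def e[symmetric] if_distrib[of "\<lambda>z. _ * z"] cong: if_cong)
      also have "C * sn n ps \<dots> \<le> C * B" using C B[OF that] by simp
      finally show ?thesis .
    qed
    have "sn n ps (\<lambda>u. \<Sum>k<m. \<Sum>J\<in>F k. th J u * a J) = sn n ps (\<lambda>u. \<Sum>J\<in>rects n ?d. th J u * b J)"
      unfolding sumG b_def by (simp add: if_distrib[of "\<lambda>z. _ * z"] cong: if_cong)
    also have "\<dots> \<le> C * sn n ps (\<lambda>u. L2_set (\<lambda>J. th J u * b J) (rects n ?d))" by (rule 1)
    also have "(\<lambda>u. L2_set (\<lambda>J. th J u * b J) (rects n ?d)) = (\<lambda>u. L2_set (\<lambda>k. S k u) {..<m})"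
    proof
      fix u
      have "(\<Sum>J\<in>rects n ?d. (th J u * b J)\<^sup>2) = (\<Sum>k<m. \<Sum>J\<in>F k. (th J u * a J)\<^sup>2)"
        unfolding sumG by (intro sum.cong) (auto simp: b_def)
      also have "\<dots> = (\<Sum>k<m. (S k u)\<^sup>2)" by (simp add: S_def L2_set_square)
      finally show "L2_set (\<lambda>J. th J u * b J) (rects n ?d) = L2_set (\<lambda>k. S k u) {..<m}" by (rule L2_set_sum_eq)
    qed
    also have "sn n ps \<dots> \<le> sn n ps (\<lambda>u. (\<Sum>k<m. \<bar>S k u\<bar> powr r) powr (1 / r))"
      using L2_set_le_powr_sum[of r "{..<m}"] r pos by (intro sn_mono) auto
    also have "\<dots> \<le> (\<Sum>k<m. sn n ps (S k) powr r) powr (1 / r)"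
      using r by (intro sn_r_convex) auto
    also have "\<dots> \<le> (\<Sum>k<m. (C * B) powr r) powr (1 / r)"
      using S r by (intro powr_mono2 sum_mono) (auto simp: sn_nonneg sum_nonneg)
    also have "\<dots> = C * B * real m powr (1 / r)"
      using C B0 r by (simp add: powr_mult powr_powr mult_ac)
    finally show ?thesis using C by (simp add: power2_eq_square)
  qed
  then show thesis using C r(1) by (intro that[of "C\<^sup>2" r]) auto
qed

section \<open>Stein's inequality\<close>

text \<open>
  The conditional expectation given the first \<open>l\<close> bits.
\<close>

definition cexp :: "nat \<Rightarrow> nat \<Rightarrow> (bool list \<Rightarrow> real) \<Rightarrow> bool list \<Rightarrow> real" where
  "cexp n l g s = avg (n - l) (\<lambda>r. g (take l s @ r))"

text \<open>
  The Haar coefficient of \<open>g\<close> at \<open>I\<close>, for the normalisation in which Haar functions take the values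
  \<open>1\<close> and \<open>-1\<close>.
\<close>

definition hcoef :: "nat \<Rightarrow> (bool list \<Rightarrow> real) \<Rightarrow> bool list \<Rightarrow> real" where
  "hcoef n g I = (avg (n - Suc (length I)) (\<lambda>r. g (I @ True # r)) - avg (n - Suc (length I)) (\<lambda>r. g (I @ False # r))) / 2"

lemma hcoef_Cons: "hcoef (Suc n) g (b # I) = hcoef n (\<lambda>s. g (b # s)) I"
  by (simp add: hcoef_def)

text \<open>
  Conditional expectations truncate the Haar expansion at a level.
\<close>

lemma cexp_eq_mart:
  "s \<in> pts n \<Longrightarrow> l \<le> n \<Longrightarrow> cexp n l g s = avg n g + mart (\<lambda>I. if length I < l then hcoef n g I else 0) s"
proof (induction n arbitrary: g s l)
  case 0
  then show ?case by (simp add: cexp_def)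
next
  case (Suc n)
  from Suc.prems obtain b t where s: "s = b # t" "t \<in> pts n" by (auto simp: pts_Suc)
  show ?case
  proof (cases l)
    case 0
    then show ?thesis by (simp add: cexp_def)
  next
    case (Suc k)
    have b: "avg n (\<lambda>s. g (b # s)) = avg (Suc n) g + sg b * hcoef (Suc n) g []"
      by (cases b) (simp_all add: avg_Suc hcoef_def field_simps)
    have "cexp (Suc n) l g s = cexp n k (\<lambda>s. g (b # s)) t"
      by (simp add: cexp_def s Suc)
    also have "\<dots> = avg n (\<lambda>s. g (b # s)) + mart (\<lambda>I. if length I < k then hcoef n (\<lambda>s. g (b # s)) I else 0) t"
      using Suc.IH[OF s(2)] Suc.prems Suc by simp
    also have "\<dots> = avg (Suc n) g + mart (\<lambda>I. if length I < l then hcoef (Suc n) g I else 0) s"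
      by (simp add: b s Suc hcoef_Cons cong: if_cong)
    finally show ?thesis .
  qed
qed

lemma L2_set_avg_le: "L2_set (\<lambda>k. avg n (g k)) K \<le> avg n (\<lambda>s. L2_set (\<lambda>k. g k s) K)"
proof (induction n arbitrary: g)
  case (Suc n)
  have "L2_set (\<lambda>k. avg (Suc n) (g k)) K
      = L2_set (\<lambda>k. 1/2 * (avg n (\<lambda>s. g k (True # s)) + avg n (\<lambda>s. g k (False # s)))) K"
    by (simp add: avg_Suc)
  also have "\<dots> = 1/2 * L2_set (\<lambda>k. avg n (\<lambda>s. g k (True # s)) + avg n (\<lambda>s. g k (False # s))) K"
    by (subst L2_set_cmult) simp
  also have "\<dots> \<le> 1/2 * (L2_set (\<lambda>k. avg n (\<lambda>s. g k (True # s))) K + L2_set (\<lambda>k. avg n (\<lambda>s. g k (False # s))) K)"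
    by (intro mult_left_mono L2_set_triangle_ineq) simp
  also have "\<dots> \<le> 1/2 * (avg n (\<lambda>s. L2_set (\<lambda>k. g k (True # s)) K) + avg n (\<lambda>s. L2_set (\<lambda>k. g k (False # s)) K))"
    by (intro mult_left_mono add_mono Suc.IH) simp
  finally show ?case by (simp add: avg_Suc)
qed simp

lemma avg_jensen:
  fixes p :: real
  assumes p: "1 \<le> p" and f: "\<And>s. 0 \<le> f s"
  shows "avg n f powr p \<le> avg n (\<lambda>s. f s powr p)"
  using f
proof (induction n arbitrary: f)
  case (Suc n)
  let ?T = "avg n (\<lambda>s. f (True # s))" and ?F = "avg n (\<lambda>s. f (False # s))"
  have "avg (Suc n) f powr p = (1/2 * ?T + (1 - 1/2) * ?F) powr p" by (simp add: avg_Suc add_divide_distrib)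
  also have "\<dots> \<le> 1/2 * ?T powr p + (1 - 1/2) * ?F powr p"
    using Suc.prems by (intro powr_convex_comb p avg_nonneg) auto
  also have "\<dots> \<le> 1/2 * avg n (\<lambda>s. f (True # s) powr p) + (1 - 1/2) * avg n (\<lambda>s. f (False # s) powr p)"
    using Suc.prems by (intro add_mono mult_left_mono Suc.IH) auto
  finally show ?case by (simp add: avg_Suc add_divide_distrib)
qed simp

lemma seminorm_L2_set: "seminorm (\<lambda>z :: 'k \<Rightarrow> real. L2_set z K)"
  unfolding seminorm_def
proof (intro conjI allI)
  fix x y :: "'k \<Rightarrow> real" and c :: real
  show "L2_set (x + y) K \<le> L2_set x K + L2_set y K"
    using L2_set_triangle_ineq[of x y K] by (simp add: plus_fun_def)
  show "L2_set (c *\<^sub>R x) K = \<bar>c\<bar> * L2_set x K"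
    unfolding scaleR_fun_def using L2_set_cmult[of c x K] by simp
qed

text \<open>
  Applying conditional expectations of different levels to the coordinates of an \<open>\<ell>\<^sup>2\<close>-valued function
  deletes Haar coefficients, coordinate by coordinate. In \<open>L\<^sup>2\<close> this is a contraction, even after further
  coefficients have been deleted, so extrapolation carries it over to \<open>L\<^sup>p\<close>. The means, which the Haar
  functions do not see, are estimated by Jensen's inequality.
\<close>

theorem stein_inequality:
  fixes p :: real
  assumes p: "1 < p"
  obtains C where "0 < C"
    "\<And>n (K::'k set) l g. (\<And>k. k \<in> K \<Longrightarrow> l k \<le> n) \<Longrightarrow>
       sn n [p] (\<lambda>u. L2_set (\<lambda>k. cexp n (l k) (g k) (hd u)) K) \<le> C * sn n [p] (\<lambda>u. L2_set (\<lambda>k. g k (hd u)) K)"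
proof -
  obtain A where A: "0 < A" "\<And>n (NX :: ('k \<Rightarrow> real) \<Rightarrow> real) (NY :: ('k \<Rightarrow> real) \<Rightarrow> real) x y.
       seminorm NX \<Longrightarrow> seminorm NY \<Longrightarrow> dominates 1 2 n NX x NY y \<Longrightarrow>
       avg n (\<lambda>s. NY (mart y s) powr p) \<le> A powr p * avg n (\<lambda>s. NX (mart x s) powr p)"
    using haar_extrapolation[OF p, of 2 1] by auto
  have p1: "1 \<le> p" "0 < p" using p by auto
  have main: "sn n [p] (\<lambda>u. L2_set (\<lambda>k. cexp n (l k) (g k) (hd u)) K) \<le> (1 + 2 * A) * sn n [p] (\<lambda>u. L2_set (\<lambda>k. g k (hd u)) K)"
    if l: "\<And>k. k \<in> K \<Longrightarrow> l k \<le> n" for n and K :: "'k set" and l g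
  proof -
    define N where "N z = L2_set z K" for z :: "'k \<Rightarrow> real"
    have N: "seminorm N" using seminorm_L2_set[of K] by (simp add: N_def[abs_def])
    define x where "x I k = hcoef n (g k) I" for I k
    define y where "y I k = (if length I < l k then x I k else 0)" for I k
    define mean where "mean k = avg n (g k)" for k
    define lp where "lp f = sn n [p] (\<lambda>u. f (hd u))" for f :: "bool list \<Rightarrow> real"
    define G where "G = lp (\<lambda>s. N (\<lambda>k. g k s))"
    have lp: "lp f powr p = avg n (\<lambda>s. \<bar>f s\<bar> powr p)" for f
      unfolding lp_def using p1 by (simp add: powr_powr avg_nonneg)
    have lp_tri: "lp (\<lambda>s. f s + h s) \<le> lp f + lp h" for f h
      unfolding lp_def using p1 by (intro sn_triangle) auto
    have lp_mono: "(\<And>s. s \<in> pts n \<Longrightarrow> \<bar>f s\<bar> \<le> \<bar>h s\<bar>) \<Longrightarrow> lp f \<le> lp h" for f h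
      unfolding lp_def using p1 by (intro sn_mono) (auto simp: grid_def length_Suc_conv)
    have nn: "0 \<le> N z" for z by (simp add: N_def)
    have dom: "dominates 1 2 n N x N y"
      unfolding dominates_def
    proof
      fix F
      define c where "c I k = (if I \<in> F then x I k else 0)" for I k
      define e where "e I k = (if I \<in> F then y I k else 0)" for I k
      have sq: "avg n (\<lambda>s. N (mart w s) powr 2) = (\<Sum>k\<in>K. avg n (\<lambda>s. \<Sum>I\<in>nodes n. (hr I s * w I k)\<^sup>2))" for w
      proof -
        have "avg n (\<lambda>s. N (mart w s) powr 2) = avg n (\<lambda>s. \<Sum>k\<in>K. (0 + (\<Sum>I\<in>nodes n. hr I s * w I k))\<^sup>2)"
          by (rule avg_cong) (simp add: N_def powr_numeral L2_set_square mart_apply1)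
        then show ?thesis by (simp only: avg_sum haar_orthogonal) simp
      qed
      have "avg n (\<lambda>s. N (mart e s) powr 2) \<le> avg n (\<lambda>s. N (mart c s) powr 2)"
        unfolding sq by (intro sum_mono avg_mono) (simp add: c_def e_def y_def)
      moreover have "(\<lambda>I. if I \<in> F then x I else 0) = c" "(\<lambda>I. if I \<in> F then y I else 0) = e"
        by (auto simp: c_def e_def fun_eq_iff)
      ultimately show "avg n (\<lambda>s. N (mart (\<lambda>I. if I \<in> F then y I else 0) s) powr 2)
         \<le> 1 powr 2 * avg n (\<lambda>s. N (mart (\<lambda>I. if I \<in> F then x I else 0) s) powr 2)" by simp
    qed
    have "lp (\<lambda>s. N (mart y s)) powr p \<le> A powr p * lp (\<lambda>s. N (mart x s)) powr p"
      using A(2)[OF N N dom] nn by (simp add: lp)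
    then have yx: "lp (\<lambda>s. N (mart y s)) \<le> A * lp (\<lambda>s. N (mart x s))"
      using p1 A(1) by (subst (asm) powr_le_mult_iff) (auto simp: lp_def sn_nonneg simp del: sn.simps)
    have mean: "lp (\<lambda>s. N mean) \<le> G"
    proof -
      have "lp (\<lambda>s. N mean) powr p = N mean powr p" using nn by (simp add: lp)
      also have "\<dots> \<le> avg n (\<lambda>s. N (\<lambda>k. g k s)) powr p"
        using p1 unfolding N_def mean_def by (intro powr_mono2 L2_set_avg_le) auto
      also have "\<dots> \<le> avg n (\<lambda>s. N (\<lambda>k. g k s) powr p)" using p1 nn by (intro avg_jensen) auto
      also have "\<dots> = G powr p" using nn by (simp add: G_def lp)
      finally show ?thesis using p1 by (subst (asm) powr_le_iff_le) (auto simp: lp_def G_def sn_nonneg simp del: sn.simps)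
    qed
    have E: "cexp n (l k) (g k) s = mean k + mart y s k" if "s \<in> pts n" "k \<in> K" for s k
    proof -
      have "mart (\<lambda>I. if length I < l k then hcoef n (g k) I else 0) s = mart y s k"
        by (subst mart_apply1[OF that(1)], subst mart_eq_sum[OF that(1)]) (simp add: y_def x_def cong: if_cong)
      then show ?thesis using cexp_eq_mart[OF that(1) l[OF that(2)], of "g k"] by (simp add: mean_def)
    qed
    have g: "g k s = mean k + mart x s k" if "s \<in> pts n" for s k
    proof -
      have "mart (\<lambda>I. if length I < n then hcoef n (g k) I else 0) s = mart x s k"
        by (subst mart_apply1[OF that], subst mart_eq_sum[OF that])
          (auto simp: x_def nodes_def intro!: sum.cong)
      moreover have "cexp n n (g k) s = g k s" using that by (simp add: cexp_def pts_def)
      ultimately show ?thesis using cexp_eq_mart[OF that order_refl, of "g k"] by (simp add: mean_def)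
    qed
    have "lp (\<lambda>s. N (mart x s)) \<le> lp (\<lambda>s. N (\<lambda>k. g k s) + N mean)"
    proof (rule lp_mono)
      fix s assume s: "s \<in> pts n"
      have "mart x s = (\<lambda>k. g k s) - mean" using g[OF s] by (simp add: fun_eq_iff)
      then show "\<bar>N (mart x s)\<bar> \<le> \<bar>N (\<lambda>k. g k s) + N mean\<bar>"
        using seminorm_diff[OF N, of "\<lambda>k. g k s" mean] nn by simp
    qed
    also have "\<dots> \<le> G + lp (\<lambda>s. N mean)" unfolding G_def by (rule lp_tri)
    finally have x2: "lp (\<lambda>s. N (mart x s)) \<le> 2 * G" using mean by simp
    have "lp (\<lambda>s. L2_set (\<lambda>k. cexp n (l k) (g k) s) K) \<le> lp (\<lambda>s. N mean + N (mart y s))"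
    proof (rule lp_mono)
      fix s assume s: "s \<in> pts n"
      have "L2_set (\<lambda>k. cexp n (l k) (g k) s) K = N (mean + mart y s)"
        unfolding N_def using E[OF s] by (intro L2_set_cong) auto
      then show "\<bar>L2_set (\<lambda>k. cexp n (l k) (g k) s) K\<bar> \<le> \<bar>N mean + N (mart y s)\<bar>"
        using seminorm_add[OF N, of mean "mart y s"] nn by simp
    qed
    also have "\<dots> \<le> lp (\<lambda>s. N mean) + lp (\<lambda>s. N (mart y s))" by (rule lp_tri)
    also have "\<dots> \<le> G + A * (2 * G)"
      using mean yx mult_left_mono[OF x2 less_imp_le[OF A(1)]] by linarith
    finally show ?thesis by (simp add: lp_def G_def N_def algebra_simps del: sn.simps)
  qed
  show thesis by (rule that[OF _ main]) (use A(1) in auto)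
qed

text \<open>
  An estimate in the inner variables, uniform in the outer ones, passes to the full mixed norm.
\<close>

lemma sn_append_le:
  assumes "\<And>q. q \<in> set qs \<Longrightarrow> 0 < q" "0 \<le> C"
    "\<And>u. u \<in> grid n (length qs) \<Longrightarrow> sn n ps (\<lambda>v. f (u @ v)) \<le> C * sn n ps (\<lambda>v. g (u @ v))"
  shows "sn n (qs @ ps) f \<le> C * sn n (qs @ ps) g"
  using assms
proof (induction qs arbitrary: f g)
  case Nil
  then show ?case by simp
next
  case (Cons q qs)
  have "sn n (q # (qs @ ps)) f \<le> C * sn n (q # (qs @ ps)) g"
  proof (rule sn_Cons_le)
    fix s assume s: "s \<in> pts n"
    show "sn n (qs @ ps) (\<lambda>u. f (s # u)) \<le> C * sn n (qs @ ps) (\<lambda>u. g (s # u))"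
    proof (rule Cons.IH)
      show "sn n ps (\<lambda>v. f (s # u @ v)) \<le> C * sn n ps (\<lambda>v. g (s # u @ v))" if "u \<in> grid n (length qs)" for u
        using Cons.prems(3)[of "s # u"] that s by (simp add: Cons_grid)
    qed (use Cons.prems in auto)
  qed (use Cons.prems in auto)
  then show ?case by simp
qed

section \<open>Suppression unconditional systems\<close>

text \<open>
  Membership and norm are explicit, since the functions of an \<open>L\<^sup>p\<close> space are not identified almost
  everywhere and \<open>N\<close> is only a seminorm.
\<close>

locale seminormed_subspace =
  fixes X :: "'v::real_vector set" and N :: "'v \<Rightarrow> real"
  assumes subspace_X: "subspace X"
    and N_nonneg: "x \<in> X \<Longrightarrow> 0 \<le> N x"
    and N_add: "x \<in> X \<Longrightarrow> y \<in> X \<Longrightarrow> N (x + y) \<le> N x + N y"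
    and N_scale: "x \<in> X \<Longrightarrow> N (c *\<^sub>R x) = \<bar>c\<bar> * N x"
begin

lemma N_zero: "N 0 = 0"
  using N_scale[of 0 0] subspace_0[OF subspace_X] by simp

lemma N_minus_commute: "x \<in> X \<Longrightarrow> y \<in> X \<Longrightarrow> N (x - y) = N (y - x)"
  using N_scale[of "x - y" "-1"] subspace_diff[OF subspace_X] by simp

lemma N_triangle: "x \<in> X \<Longrightarrow> y \<in> X \<Longrightarrow> z \<in> X \<Longrightarrow> N (x - z) \<le> N (x - y) + N (y - z)"
  using N_add[of "x - y" "y - z"] subspace_diff[OF subspace_X] by simp

lemma N_le_diff: "x \<in> X \<Longrightarrow> y \<in> X \<Longrightarrow> N x \<le> N y + N (x - y)"
  using N_add[of y "x - y"] subspace_diff[OF subspace_X] by simp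

lemma dual_norm_facts:
  assumes "\<phi> \<in> dual_space X N"
  shows dual_norm_bdd: "bdd_above ((\<lambda>x. \<bar>\<phi> x\<bar>) ` {x \<in> X. N x \<le> 1})"
    and dual_norm_le: "x \<in> X \<Longrightarrow> \<bar>\<phi> x\<bar> \<le> dual_norm X N \<phi> * N x"
    and dual_norm_nonneg: "0 \<le> dual_norm X N \<phi>"
proof -
  obtain B where B: "\<And>x. x \<in> X \<Longrightarrow> \<bar>\<phi> x\<bar> \<le> B * N x"
    using assms unfolding dual_space_def by blast
  show bdd: "bdd_above ((\<lambda>x. \<bar>\<phi> x\<bar>) ` {x \<in> X. N x \<le> 1})"
  proof (rule bdd_aboveI2)
    fix x assume x: "x \<in> {x \<in> X. N x \<le> 1}"
    have "\<bar>\<phi> x\<bar> \<le> B * N x" using B x by simp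
    also have "\<dots> \<le> \<bar>B\<bar> * 1" using x N_nonneg[of x] by (intro mult_mono) auto
    finally show "\<bar>\<phi> x\<bar> \<le> \<bar>B\<bar>" by simp
  qed
  have le1: "\<bar>\<phi> x\<bar> \<le> dual_norm X N \<phi>" if "x \<in> X" "N x \<le> 1" for x
    unfolding dual_norm_def by (rule cSUP_upper2[OF bdd]) (use that in auto)
  show "0 \<le> dual_norm X N \<phi>"
    using le1[of 0] subspace_0[OF subspace_X] N_zero by simp
  show "\<bar>\<phi> x\<bar> \<le> dual_norm X N \<phi> * N x" if x: "x \<in> X"
  proof (cases "N x = 0")
    case True
    then show ?thesis using B[OF x] by simp
  next
    case False
    then have pos: "0 < N x" using N_nonneg[OF x] by simp
    have "\<bar>\<phi> ((1 / N x) *\<^sub>R x)\<bar> \<le> dual_norm X N \<phi>"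
      using le1[of "(1 / N x) *\<^sub>R x"] x pos subspace_scale[OF subspace_X] N_scale by simp
    moreover have "\<phi> ((1 / N x) *\<^sub>R x) = (1 / N x) * \<phi> x"
      using assms x by (simp add: dual_space_def)
    ultimately show ?thesis using pos by (simp add: abs_mult field_simps)
  qed
qed

lemma dual_norm_least:
  assumes "\<And>x. x \<in> X \<Longrightarrow> N x \<le> 1 \<Longrightarrow> \<bar>\<phi> x\<bar> \<le> B"
  shows "dual_norm X N \<phi> \<le> B"
  unfolding dual_norm_def
proof (rule cSUP_least)
  show "{x \<in> X. N x \<le> 1} \<noteq> {}" using subspace_0[OF subspace_X] N_zero by force
qed (use assms in auto)

end

text \<open>
  A total sequence on which the coordinate projections onto sets of indices are uniformly bounded on
  finite sums. These are the properties that can be verified for the Haar system by estimates of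
  finite sums; being an unconditional basis follows.
\<close>

locale unconditional_system = seminormed_subspace X N
  for X :: "'v::real_vector set" and N :: "'v \<Rightarrow> real" +
  fixes e :: "nat \<Rightarrow> 'v" and C :: real
  assumes e_in: "e n \<in> X"
    and e_pos: "0 < N (e n)"
    and suppress: "finite G \<Longrightarrow> F \<subseteq> G \<Longrightarrow> N (\<Sum>n\<in>F. a n *\<^sub>R e n) \<le> C * N (\<Sum>n\<in>G. a n *\<^sub>R e n)"
    and total: "x \<in> X \<Longrightarrow> 0 < \<epsilon> \<Longrightarrow> \<exists>F a. finite F \<and> N (x - (\<Sum>n\<in>F. a n *\<^sub>R e n)) < \<epsilon>"
begin

lemma sum_in: "(\<Sum>n\<in>F. a n *\<^sub>R e n) \<in> X"
  using e_in by (intro subspace_sum[OF subspace_X] subspace_scale[OF subspace_X])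

lemma C_ge_1: "1 \<le> C"
  using suppress[of "{0}" "{0}" "\<lambda>_. 1"] e_pos[of 0] by simp

lemma coef_bound: "finite G \<Longrightarrow> n \<in> G \<Longrightarrow> \<bar>a n\<bar> * N (e n) \<le> C * N (\<Sum>n\<in>G. a n *\<^sub>R e n)"
  using suppress[of G "{n}" a] N_scale[OF e_in, of "a n"] by simp

lemma sum_diff_coef: "(\<Sum>n\<in>F. a n *\<^sub>R e n) - (\<Sum>n\<in>F. b n *\<^sub>R e n) = (\<Sum>n\<in>F. (a n - b n) *\<^sub>R e n)"
  by (simp add: sum_subtractf scaleR_diff_left)

text \<open>
  Finite sums approximating \<open>x\<close> have converging coefficients, since coordinate functionals are bounded
  on finite sums. The suppression estimate for the difference of two approximants is uniform in the
  index set, which makes the limiting series converge to \<open>x\<close> along the net of finite sets.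
\<close>

lemma expansion_exists:
  assumes x: "x \<in> X"
  obtains a where "\<And>\<epsilon>. 0 < \<epsilon> \<Longrightarrow> \<exists>F. finite F \<and> (\<forall>G. finite G \<and> F \<subseteq> G \<longrightarrow> N ((\<Sum>n\<in>G. a n *\<^sub>R e n) - x) \<le> \<epsilon>)"
proof -
  have "\<forall>j. \<exists>F a. finite F \<and> N (x - (\<Sum>n\<in>F. a n *\<^sub>R e n)) < (1/2) ^ j"
    using total[OF x] by simp
  then obtain F0 b0 where F0: "\<And>j. finite (F0 j)" "\<And>j. N (x - (\<Sum>n\<in>F0 j. b0 j n *\<^sub>R e n)) < (1/2) ^ j"
    by metis
  define b where "b j n = (if n \<in> F0 j then b0 j n else 0)" for j n
  have sumb: "(\<Sum>n\<in>G. b j n *\<^sub>R e n) = (\<Sum>n\<in>F0 j. b0 j n *\<^sub>R e n)" if "finite G" "F0 j \<subseteq> G" for G j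
  proof -
    have "(\<Sum>n\<in>F0 j. b0 j n *\<^sub>R e n) = (\<Sum>n\<in>F0 j. b j n *\<^sub>R e n)" by (simp add: b_def)
    also have "\<dots> = (\<Sum>n\<in>G. b j n *\<^sub>R e n)" using that by (intro sum.mono_neutral_left) (auto simp: b_def)
    finally show ?thesis by simp
  qed
  define y where "y j = (\<Sum>n\<in>F0 j. b0 j n *\<^sub>R e n)" for j
  have yX: "y j \<in> X" for j by (simp add: y_def sum_in)
  have xy: "N (x - y j) < (1/2) ^ j" for j using F0(2) by (simp add: y_def)
  have yy: "N (y i - y j) \<le> (1/2) ^ i + (1/2) ^ j" for i j
    using N_triangle[OF yX x yX, of i j] xy[of i] xy[of j] N_minus_commute[OF x yX, of i] by simp
  have part: "N (\<Sum>n\<in>G. (b i n - b j n) *\<^sub>R e n) \<le> C * ((1/2) ^ i + (1/2) ^ j)" if "finite G" for G i j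
  proof -
    let ?H = "G \<union> F0 i \<union> F0 j"
    have H: "finite ?H" using that F0 by simp
    have "N (\<Sum>n\<in>G. (b i n - b j n) *\<^sub>R e n) \<le> C * N (\<Sum>n\<in>?H. (b i n - b j n) *\<^sub>R e n)"
      using H by (intro suppress) auto
    also have "(\<Sum>n\<in>?H. (b i n - b j n) *\<^sub>R e n) = y i - y j"
      unfolding sum_diff_coef[symmetric] y_def using sumb[OF H] by auto
    also have "C * N (y i - y j) \<le> C * ((1/2) ^ i + (1/2) ^ j)"
      using yy C_ge_1 by (intro mult_left_mono) auto
    finally show ?thesis .
  qed
  have "\<exists>l. (\<lambda>i. b i n) \<longlonglongrightarrow> l" for n
  proof -
    have bd: "\<bar>b i n - b j n\<bar> \<le> C / N (e n) * ((1/2) ^ i + (1/2) ^ j)" for i j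
      using part[of "{n}" i j] N_scale[OF e_in, of "b i n - b j n" n] e_pos[of n] by (simp add: field_simps)
    have "Cauchy (\<lambda>i. b i n)"
    proof (rule metric_CauchyI)
      fix \<epsilon> :: real assume "0 < \<epsilon>"
      have "(\<lambda>i. C / N (e n) * ((1/2) ^ i + (1/2) ^ i)) \<longlonglongrightarrow> C / N (e n) * (0 + 0)"
        by (intro tendsto_intros LIMSEQ_power_zero) auto
      then have "eventually (\<lambda>i. C / N (e n) * ((1/2) ^ i + (1/2) ^ i) < \<epsilon>) sequentially"
        using \<open>0 < \<epsilon>\<close> by (auto dest: order_tendstoD(2))
      then obtain M where M: "C / N (e n) * ((1/2) ^ M + (1/2) ^ M) < \<epsilon>"
        by (auto simp: eventually_sequentially)
      show "\<exists>M. \<forall>i\<ge>M. \<forall>j\<ge>M. dist (b i n) (b j n) < \<epsilon>"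
      proof (intro exI allI impI)
        fix i j assume ij: "i \<ge> M" "j \<ge> M"
        have "dist (b i n) (b j n) \<le> C / N (e n) * ((1/2) ^ i + (1/2) ^ j)"
          using bd by (simp add: dist_real_def)
        also have "\<dots> \<le> C / N (e n) * ((1/2) ^ M + (1/2) ^ M)"
          using ij C_ge_1 e_pos[of n] by (intro mult_left_mono add_mono power_decreasing) auto
        finally show "dist (b i n) (b j n) < \<epsilon>" using M by simp
      qed
    qed
    then show ?thesis by (simp add: Cauchy_convergent_iff convergent_def)
  qed
  then obtain a where a: "\<And>n. (\<lambda>i. b i n) \<longlonglongrightarrow> a n" by metis
  have lim: "N (\<Sum>n\<in>G. (a n - b j n) *\<^sub>R e n) \<le> C * (1/2) ^ j" if G: "finite G" for G j
  proof -
    have "(\<lambda>i. C * ((1/2) ^ i + (1/2) ^ j) + (\<Sum>n\<in>G. \<bar>a n - b i n\<bar> * N (e n))) \<longlonglongrightarrow> C * (0 + (1/2) ^ j) + (\<Sum>n\<in>G. \<bar>a n - a n\<bar> * N (e n))"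
      by (intro tendsto_intros LIMSEQ_power_zero a) auto
    moreover have "N (\<Sum>n\<in>G. (a n - b j n) *\<^sub>R e n) \<le> C * ((1/2) ^ i + (1/2) ^ j) + (\<Sum>n\<in>G. \<bar>a n - b i n\<bar> * N (e n))" for i
    proof -
      have tri: "N (\<Sum>n\<in>H. c n *\<^sub>R e n) \<le> (\<Sum>n\<in>H. \<bar>c n\<bar> * N (e n))" if "finite H" for H c
        using that
      proof induction
        case (insert n H)
        then show ?case
          using N_add[OF subspace_scale[OF subspace_X e_in, of "c n" n] sum_in[of c H]] N_scale[OF e_in, of "c n" n] by simp
      qed (simp add: N_zero)
      have "(\<Sum>n\<in>G. (a n - b j n) *\<^sub>R e n) = (\<Sum>n\<in>G. (b i n - b j n) *\<^sub>R e n) + (\<Sum>n\<in>G. (a n - b i n) *\<^sub>R e n)"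
        by (simp add: sum.distrib[symmetric] scaleR_add_left[symmetric])
      then have "N (\<Sum>n\<in>G. (a n - b j n) *\<^sub>R e n) \<le> N (\<Sum>n\<in>G. (b i n - b j n) *\<^sub>R e n) + N (\<Sum>n\<in>G. (a n - b i n) *\<^sub>R e n)"
        using N_add[OF sum_in sum_in] by metis
      then show ?thesis using part[OF G, of i j] tri[OF G, of "\<lambda>n. a n - b i n"] by linarith
    qed
    ultimately show ?thesis by (intro LIMSEQ_le_const) auto
  qed
  show thesis
  proof (rule that)
    fix \<epsilon> :: real assume "0 < \<epsilon>"
    have "(\<lambda>j. C * (1/2) ^ j + (1/2) ^ j) \<longlonglongrightarrow> C * 0 + 0"
      by (intro tendsto_intros LIMSEQ_power_zero) auto
    then have "eventually (\<lambda>j. C * (1/2) ^ j + (1/2) ^ j < \<epsilon>) sequentially"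
      using \<open>0 < \<epsilon>\<close> by (auto dest: order_tendstoD(2))
    then obtain j where j: "C * (1/2) ^ j + (1/2) ^ j < \<epsilon>" by (auto simp: eventually_sequentially)
    show "\<exists>F. finite F \<and> (\<forall>G. finite G \<and> F \<subseteq> G \<longrightarrow> N ((\<Sum>n\<in>G. a n *\<^sub>R e n) - x) \<le> \<epsilon>)"
    proof (intro exI[of _ "F0 j"] conjI allI impI)
      fix G assume G: "finite G \<and> F0 j \<subseteq> G"
      have "N ((\<Sum>n\<in>G. a n *\<^sub>R e n) - x) \<le> N ((\<Sum>n\<in>G. a n *\<^sub>R e n) - y j) + N (y j - x)"
        by (rule N_triangle[OF sum_in yX x])
      moreover have "(\<Sum>n\<in>G. a n *\<^sub>R e n) - y j = (\<Sum>n\<in>G. (a n - b j n) *\<^sub>R e n)"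
        unfolding sum_diff_coef[symmetric] y_def using sumb G by simp
      ultimately show "N ((\<Sum>n\<in>G. a n *\<^sub>R e n) - x) \<le> \<epsilon>"
        using lim[of G j] G xy[of j] N_minus_commute[OF x yX, of j] j by simp
    qed (rule F0)
  qed
qed

lemma sums_unique:
  assumes x: "x \<in> X" and a: "sums_in N (\<lambda>n. a n *\<^sub>R e n) x" and b: "sums_in N (\<lambda>n. b n *\<^sub>R e n) x"
  shows "a = b"
proof
  fix n
  have "(\<lambda>m. C * (N ((\<Sum>n<m. a n *\<^sub>R e n) - x) + N ((\<Sum>n<m. b n *\<^sub>R e n) - x))) \<longlonglongrightarrow> C * (0 + 0)"
    using a b unfolding sums_in_def by (intro tendsto_intros)
  moreover have "eventually (\<lambda>m. \<bar>a n - b n\<bar> * N (e n) \<le> C * (N ((\<Sum>n<m. a n *\<^sub>R e n) - x) + N ((\<Sum>n<m. b n *\<^sub>R e n) - x))) sequentially"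
    using eventually_gt_at_top[of n]
  proof eventually_elim
    case (elim m)
    have "\<bar>a n - b n\<bar> * N (e n) \<le> C * N (\<Sum>n<m. (a n - b n) *\<^sub>R e n)"
      using elim by (intro coef_bound) auto
    also have "N (\<Sum>n<m. (a n - b n) *\<^sub>R e n) \<le> N ((\<Sum>n<m. a n *\<^sub>R e n) - x) + N ((\<Sum>n<m. b n *\<^sub>R e n) - x)"
      unfolding sum_diff_coef[symmetric]
      using N_triangle[OF sum_in x sum_in] N_minus_commute[OF x sum_in] by metis
    finally show ?case using C_ge_1 by simp
  qed
  ultimately have "\<bar>a n - b n\<bar> * N (e n) \<le> C * (0 + 0)"
    by (intro tendsto_lowerbound[of _ _ sequentially]) auto
  then show "a n = b n" using e_pos[of n] by (simp add: mult_le_0_iff)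
qed

text \<open>
  Convergence along all finite sets covers every rearrangement at once.
\<close>

lemma unordered_imp_sums:
  assumes "\<And>\<epsilon>. 0 < \<epsilon> \<Longrightarrow> \<exists>F. finite F \<and> (\<forall>G. finite G \<and> F \<subseteq> G \<longrightarrow> N ((\<Sum>n\<in>G. a n *\<^sub>R e n) - x) \<le> \<epsilon>)"
    and x: "x \<in> X" and \<pi>: "bij \<pi>"
  shows "sums_in N (\<lambda>n. a (\<pi> n) *\<^sub>R e (\<pi> n)) x"
  unfolding sums_in_def
proof (rule LIMSEQ_I)
  fix \<epsilon> :: real assume "0 < \<epsilon>"
  then obtain F where F: "finite F" "\<And>G. finite G \<Longrightarrow> F \<subseteq> G \<Longrightarrow> N ((\<Sum>n\<in>G. a n *\<^sub>R e n) - x) \<le> \<epsilon> / 2"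
    using assms(1)[of "\<epsilon> / 2"] by auto
  have fin: "finite (inv \<pi> ` F)" using F by simp
  show "\<exists>m0. \<forall>m\<ge>m0. norm (N ((\<Sum>n<m. a (\<pi> n) *\<^sub>R e (\<pi> n)) - x) - 0) < \<epsilon>"
  proof (intro exI[of _ "Suc (Max (insert 0 (inv \<pi> ` F)))"] allI impI)
    fix m assume m: "Suc (Max (insert 0 (inv \<pi> ` F))) \<le> m"
    have "F \<subseteq> \<pi> ` {..<m}"
    proof
      fix k assume "k \<in> F"
      then have "inv \<pi> k \<le> Max (insert 0 (inv \<pi> ` F))" using fin by (intro Max_ge) auto
      then have "inv \<pi> k < m" using m by simp
      moreover have "\<pi> (inv \<pi> k) = k" using \<pi> by (simp add: bij_is_surj surj_f_inv_f)
      ultimately show "k \<in> \<pi> ` {..<m}" by (metis imageI lessThan_iff)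
    qed
    then have "N ((\<Sum>n\<in>\<pi> ` {..<m}. a n *\<^sub>R e n) - x) \<le> \<epsilon> / 2" by (intro F(2)) auto
    moreover have "(\<Sum>n\<in>\<pi> ` {..<m}. a n *\<^sub>R e n) = (\<Sum>n<m. a (\<pi> n) *\<^sub>R e (\<pi> n))"
      using inj_on_subset[OF bij_is_inj[OF \<pi>]] by (subst sum.reindex) auto
    ultimately show "norm (N ((\<Sum>n<m. a (\<pi> n) *\<^sub>R e (\<pi> n)) - x) - 0) < \<epsilon>"
      using \<open>0 < \<epsilon>\<close> N_nonneg[OF subspace_diff[OF subspace_X sum_in[of a "\<pi> ` {..<m}"] x]] by simp
  qed
qed

lemma schauder: "schauder_basis X N e"
  unfolding schauder_basis_def
proof (intro conjI ballI)
  fix x assume x: "x \<in> X"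
  obtain a where "\<And>\<epsilon>. 0 < \<epsilon> \<Longrightarrow> \<exists>F. finite F \<and> (\<forall>G. finite G \<and> F \<subseteq> G \<longrightarrow> N ((\<Sum>n\<in>G. a n *\<^sub>R e n) - x) \<le> \<epsilon>)"
    using expansion_exists[OF x] by blast
  from unordered_imp_sums[OF this x bij_id] have "sums_in N (\<lambda>n. a n *\<^sub>R e n) x" by simp
  then show "\<exists>!a. sums_in N (\<lambda>n. a n *\<^sub>R e n) x" using sums_unique[OF x] by blast
qed (use e_in in auto)

abbreviation "cf \<equiv> coord X N e"

lemma coord_eqI: "x \<in> X \<Longrightarrow> sums_in N (\<lambda>n. a n *\<^sub>R e n) x \<Longrightarrow> cf n x = a n"
  unfolding coord_def using sums_unique[of x] by (simp add: the_equality)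

lemma coord_unordered:
  assumes x: "x \<in> X" and "0 < \<epsilon>"
  shows "\<exists>F. finite F \<and> (\<forall>G. finite G \<and> F \<subseteq> G \<longrightarrow> N ((\<Sum>n\<in>G. cf n x *\<^sub>R e n) - x) \<le> \<epsilon>)"
proof -
  obtain a where a: "\<And>\<epsilon>. 0 < \<epsilon> \<Longrightarrow> \<exists>F. finite F \<and> (\<forall>G. finite G \<and> F \<subseteq> G \<longrightarrow> N ((\<Sum>n\<in>G. a n *\<^sub>R e n) - x) \<le> \<epsilon>)"
    using expansion_exists[OF x] by blast
  from unordered_imp_sums[OF this x bij_id] have "sums_in N (\<lambda>n. a n *\<^sub>R e n) x" by simp
  then have "cf n x = a n" for n using x by (intro coord_eqI)
  then show ?thesis using a[OF assms(2)] by simp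
qed

lemma unconditional: "unconditional_basis X N e"
  unfolding unconditional_basis_def
  using schauder unordered_imp_sums[OF coord_unordered] by blast

lemma coord_sums: "x \<in> X \<Longrightarrow> sums_in N (\<lambda>n. cf n x *\<^sub>R e n) x"
  using unordered_imp_sums[OF coord_unordered _ bij_id] by simp

lemma sums_finite: "finite F \<Longrightarrow> sums_in N (\<lambda>n. (if n \<in> F then a n else 0) *\<^sub>R e n) (\<Sum>n\<in>F. a n *\<^sub>R e n)"
  unfolding sums_in_def
proof (rule LIMSEQ_I)
  fix \<epsilon> :: real assume F: "finite F" and \<epsilon>: "0 < \<epsilon>"
  show "\<exists>m0. \<forall>m\<ge>m0. norm (N ((\<Sum>n<m. (if n \<in> F then a n else 0) *\<^sub>R e n) - (\<Sum>n\<in>F. a n *\<^sub>R e n)) - 0) < \<epsilon>"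
  proof (intro exI[of _ "Suc (Max (insert 0 F))"] allI impI)
    fix m assume m: "Suc (Max (insert 0 F)) \<le> m"
    have "n < m" if "n \<in> F" for n
    proof -
      have "n \<le> Max (insert 0 F)" using F that by (intro Max_ge) auto
      then show ?thesis using m by linarith
    qed
    then have "(\<Sum>n<m. (if n \<in> F then a n else 0) *\<^sub>R e n) = (\<Sum>n\<in>F. a n *\<^sub>R e n)"
      by (intro sum.mono_neutral_cong_right) auto
    then show "norm (N ((\<Sum>n<m. (if n \<in> F then a n else 0) *\<^sub>R e n) - (\<Sum>n\<in>F. a n *\<^sub>R e n)) - 0) < \<epsilon>"
      using \<epsilon> N_zero by simp
  qed
qed

lemma coord_sum: "finite F \<Longrightarrow> cf n (\<Sum>n\<in>F. a n *\<^sub>R e n) = (if n \<in> F then a n else 0)"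
  using coord_eqI[OF sum_in sums_finite] by blast

lemma coord_basis: "cf n (e m) = (if n = m then 1 else 0)"
  using coord_sum[of "{m}" n "\<lambda>_. 1"] by simp

lemma coord_add: "x \<in> X \<Longrightarrow> y \<in> X \<Longrightarrow> cf n (x + y) = cf n x + cf n y"
proof (rule coord_eqI)
  assume x: "x \<in> X" and y: "y \<in> X"
  show "x + y \<in> X" using x y subspace_add[OF subspace_X] by simp
  have lim: "(\<lambda>m. N ((\<Sum>n<m. cf n x *\<^sub>R e n) - x) + N ((\<Sum>n<m. cf n y *\<^sub>R e n) - y)) \<longlonglongrightarrow> 0 + 0"
    using coord_sums[OF x] coord_sums[OF y] unfolding sums_in_def by (intro tendsto_intros)
  show "sums_in N (\<lambda>n. (cf n x + cf n y) *\<^sub>R e n) (x + y)"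
    unfolding sums_in_def
  proof (rule tendsto_sandwich[where f = "\<lambda>_. 0" and h = "\<lambda>m. N ((\<Sum>n<m. cf n x *\<^sub>R e n) - x) + N ((\<Sum>n<m. cf n y *\<^sub>R e n) - y)"])
    have D: "(\<Sum>n<m. (cf n x + cf n y) *\<^sub>R e n) - (x + y) = ((\<Sum>n<m. cf n x *\<^sub>R e n) - x) + ((\<Sum>n<m. cf n y *\<^sub>R e n) - y)" for m
      by (simp add: scaleR_add_left sum.distrib)
    have in_X: "(\<Sum>n<m. cf n x *\<^sub>R e n) - x \<in> X" "(\<Sum>n<m. cf n y *\<^sub>R e n) - y \<in> X" for m
      using sum_in x y subspace_diff[OF subspace_X] by auto
    show "\<forall>\<^sub>F m in sequentially. N ((\<Sum>n<m. (cf n x + cf n y) *\<^sub>R e n) - (x + y)) \<le> N ((\<Sum>n<m. cf n x *\<^sub>R e n) - x) + N ((\<Sum>n<m. cf n y *\<^sub>R e n) - y)"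
      unfolding D using N_add[OF in_X] by simp
    show "\<forall>\<^sub>F m in sequentially. 0 \<le> N ((\<Sum>n<m. (cf n x + cf n y) *\<^sub>R e n) - (x + y))"
      unfolding D using N_nonneg[OF subspace_add[OF subspace_X in_X]] by simp
  qed (use lim in auto)
qed

lemma coord_scale: "x \<in> X \<Longrightarrow> cf n (c *\<^sub>R x) = c * cf n x"
proof (rule coord_eqI)
  assume x: "x \<in> X"
  show "c *\<^sub>R x \<in> X" using x subspace_scale[OF subspace_X] by simp
  have D: "(\<Sum>n<m. (c * cf n x) *\<^sub>R e n) - c *\<^sub>R x = c *\<^sub>R ((\<Sum>n<m. cf n x *\<^sub>R e n) - x)" for m
    by (simp add: scaleR_diff_right scaleR_sum_right)
  have in_X: "(\<Sum>n<m. cf n x *\<^sub>R e n) - x \<in> X" for m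
    using sum_in x subspace_diff[OF subspace_X] by auto
  have "(\<lambda>m. \<bar>c\<bar> * N ((\<Sum>n<m. cf n x *\<^sub>R e n) - x)) \<longlonglongrightarrow> \<bar>c\<bar> * 0"
    using coord_sums[OF x] unfolding sums_in_def by (intro tendsto_intros)
  then show "sums_in N (\<lambda>n. (c * cf n x) *\<^sub>R e n) (c *\<^sub>R x)"
    unfolding sums_in_def D N_scale[OF in_X] by simp
qed

text \<open>
  The suppression estimate for finite sums extends to limits.
\<close>

lemma projection_bound:
  assumes x: "x \<in> X" and F: "finite F"
  shows "N (\<Sum>n\<in>F. cf n x *\<^sub>R e n) \<le> C * N x"
proof (rule LIMSEQ_le_const)
  show "(\<lambda>m. C * (N x + N ((\<Sum>n<m. cf n x *\<^sub>R e n) - x))) \<longlonglongrightarrow> C * N x"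
    using tendsto_mult[OF tendsto_const[of C] tendsto_add[OF tendsto_const[of "N x"] coord_sums[OF x, unfolded sums_in_def]]]
    by simp
  show "\<exists>M. \<forall>m\<ge>M. N (\<Sum>n\<in>F. cf n x *\<^sub>R e n) \<le> C * (N x + N ((\<Sum>n<m. cf n x *\<^sub>R e n) - x))"
  proof (intro exI[of _ "Suc (Max (insert 0 F))"] allI impI)
    fix m assume m: "Suc (Max (insert 0 F)) \<le> m"
    have "n < m" if "n \<in> F" for n
    proof -
      have "n \<le> Max (insert 0 F)" using F that by (intro Max_ge) auto
      then show ?thesis using m by linarith
    qed
    then have "N (\<Sum>n\<in>F. cf n x *\<^sub>R e n) \<le> C * N (\<Sum>n<m. cf n x *\<^sub>R e n)" by (intro suppress) auto
    also have "N (\<Sum>n<m. cf n x *\<^sub>R e n) \<le> N x + N ((\<Sum>n<m. cf n x *\<^sub>R e n) - x)"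
      by (rule N_le_diff[OF sum_in x])
    finally show "N (\<Sum>n\<in>F. cf n x *\<^sub>R e n) \<le> C * (N x + N ((\<Sum>n<m. cf n x *\<^sub>R e n) - x))"
      using C_ge_1 by simp
  qed
qed

lemma coord_dual: "cf n \<in> dual_space X N"
proof -
  have "\<bar>cf n x\<bar> \<le> (C / N (e n)) * N x" if x: "x \<in> X" for x
  proof -
    have "\<bar>cf n x\<bar> * N (e n) \<le> C * N x"
      using projection_bound[OF x, of "{n}"] N_scale[OF e_in] by simp
    then show ?thesis using e_pos[of n] by (simp add: field_simps)
  qed
  moreover have "cf n x = 0" if "x \<notin> X" for x using that by (simp add: coord_def)
  ultimately show ?thesis unfolding dual_space_def using coord_add coord_scale by blast
qed

lemma dual_zero: "\<phi> \<in> dual_space X N \<Longrightarrow> \<phi> 0 = 0"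
proof -
  assume "\<phi> \<in> dual_space X N"
  then have "\<phi> (0 *\<^sub>R 0) = 0 * \<phi> 0" using subspace_0[OF subspace_X] unfolding dual_space_def by blast
  then show ?thesis by simp
qed

lemma dual_sum: "\<phi> \<in> dual_space X N \<Longrightarrow> \<phi> (\<Sum>n\<in>F. a n *\<^sub>R e n) = (\<Sum>n\<in>F. a n * \<phi> (e n))"
proof (induction F rule: infinite_finite_induct)
  case (insert n F)
  then show ?case using subspace_scale[OF subspace_X e_in] sum_in e_in by (simp add: dual_space_def)
qed (auto simp: dual_zero)

end

lemma sum_fun_apply: "(\<Sum>n\<in>F. f n) x = (\<Sum>n\<in>F. f n x)" for f :: "'i \<Rightarrow> 'a \<Rightarrow> 'b::comm_monoid_add"
  by (induction F rule: infinite_finite_induct) auto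

context unconditional_system
begin

lemma dual_add: "\<phi> \<in> dual_space X N \<Longrightarrow> x \<in> X \<Longrightarrow> y \<in> X \<Longrightarrow> \<phi> (x + y) = \<phi> x + \<phi> y"
  and dual_scale: "\<phi> \<in> dual_space X N \<Longrightarrow> x \<in> X \<Longrightarrow> \<phi> (c *\<^sub>R x) = c * \<phi> x"
  and dual_bound: "\<phi> \<in> dual_space X N \<Longrightarrow> \<exists>B. \<forall>x\<in>X. \<bar>\<phi> x\<bar> \<le> B * N x"
  by (auto simp: dual_space_def)

lemma subspace_dual: "subspace (dual_space X N)"
proof (rule subspaceI)
  have "\<exists>B. \<forall>x\<in>X. \<bar>(0::'v \<Rightarrow> real) x\<bar> \<le> B * N x" by (intro exI[of _ 0]) simp
  then show "0 \<in> dual_space X N" by (simp add: dual_space_def)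
next
  fix \<phi> \<psi> assume "\<phi> \<in> dual_space X N" "\<psi> \<in> dual_space X N"
  then obtain A B where A: "\<And>x. x \<in> X \<Longrightarrow> \<bar>\<phi> x\<bar> \<le> A * N x" and B: "\<And>x. x \<in> X \<Longrightarrow> \<bar>\<psi> x\<bar> \<le> B * N x"
    using dual_bound by meson
  have "\<bar>(\<phi> + \<psi>) x\<bar> \<le> (A + B) * N x" if "x \<in> X" for x
    using A[OF that] B[OF that] by (simp add: distrib_right)
  then have "\<exists>B. \<forall>x\<in>X. \<bar>(\<phi> + \<psi>) x\<bar> \<le> B * N x" by blast
  with \<open>\<phi> \<in> _\<close> \<open>\<psi> \<in> _\<close> show "\<phi> + \<psi> \<in> dual_space X N"
    by (simp add: dual_space_def algebra_simps)
next
  fix c \<phi> assume \<phi>: "\<phi> \<in> dual_space X N"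
  then obtain A where A: "\<And>x. x \<in> X \<Longrightarrow> \<bar>\<phi> x\<bar> \<le> A * N x"
    using dual_bound by meson
  have "\<bar>(c *\<^sub>R \<phi>) x\<bar> \<le> (\<bar>c\<bar> * A) * N x" if "x \<in> X" for x
    using mult_left_mono[OF A[OF that], of "\<bar>c\<bar>"] by (simp add: scaleR_fun_def abs_mult mult.assoc)
  then have "\<exists>B. \<forall>x\<in>X. \<bar>(c *\<^sub>R \<phi>) x\<bar> \<le> B * N x" by blast
  with \<phi> show "c *\<^sub>R \<phi> \<in> dual_space X N"
    by (simp add: dual_space_def scaleR_fun_def algebra_simps)
qed

lemma coord_sum_dual: "(\<Sum>n\<in>F. a n *\<^sub>R cf n) \<in> dual_space X N"
  using coord_dual by (intro subspace_sum[OF subspace_dual] subspace_scale[OF subspace_dual])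

lemma coord_sum_apply: "(\<Sum>n\<in>F. a n *\<^sub>R cf n) x = (\<Sum>n\<in>F. a n * cf n x)"
  by (simp add: sum_fun_apply scaleR_fun_def)

text \<open>
  Evaluation at the basis vectors recovers the coefficients of a norm convergent series of coordinate
  functionals.
\<close>

lemma sums_in_dual_unique:
  assumes \<phi>: "\<phi> \<in> dual_space X N" and c: "sums_in (dual_norm X N) (\<lambda>n. c n *\<^sub>R cf n) \<phi>"
  shows "c k = \<phi> (e k)"
proof -
  have "(\<lambda>m. dual_norm X N ((\<Sum>n<m. c n *\<^sub>R cf n) - \<phi>) * N (e k)) \<longlonglongrightarrow> 0 * N (e k)"
    using c unfolding sums_in_def by (intro tendsto_intros)
  moreover have "eventually (\<lambda>m. \<bar>c k - \<phi> (e k)\<bar> \<le> dual_norm X N ((\<Sum>n<m. c n *\<^sub>R cf n) - \<phi>) * N (e k)) sequentially"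
    using eventually_gt_at_top[of k]
  proof eventually_elim
    case (elim m)
    have "((\<Sum>n<m. c n *\<^sub>R cf n) - \<phi>) (e k) = c k - \<phi> (e k)"
      using elim by (simp add: coord_sum_apply coord_basis mult_delta_right)
    then show ?case
      using dual_norm_le[OF subspace_diff[OF subspace_dual coord_sum_dual \<phi>] e_in, of c "{..<m}" k] by simp
  qed
  ultimately have "\<bar>c k - \<phi> (e k)\<bar> \<le> 0 * N (e k)"
    by (intro tendsto_lowerbound[of _ _ sequentially]) auto
  then show ?thesis by simp
qed

lemma sum_ivl_diff: "m \<le> M \<Longrightarrow> (\<Sum>n<M. a n *\<^sub>R e n) - (\<Sum>n<m. a n *\<^sub>R e n) = (\<Sum>n\<in>{m..<M}. a n *\<^sub>R e n)"
  using sum_diff_nat_ivl[of 0 m M "\<lambda>n. a n *\<^sub>R e n"] by (simp add: lessThan_atLeast0)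

section \<open>Shrinking bases and the reproduction game\<close>

text \<open>
  If finite blocks satisfy an upper \<open>r\<close>-estimate with \<open>r > 1\<close>, no continuous functional is bounded
  from below by a positive number on infinitely many disjoint bounded blocks: its value at the sum of
  \<open>m\<close> of them would grow like \<open>m\<close>, the norm of the sum only like \<open>m\<^sup>1\<^sup>/\<^sup>r\<close>.
\<close>

lemma dual_tail:
  assumes r: "1 < r" and K: "0 \<le> K"
    and block: "\<And>m F a B. disjoint_family_on F {..<m} \<Longrightarrow> (\<And>k. k < m \<Longrightarrow> finite (F k)) \<Longrightarrow>
       (\<And>k. k < m \<Longrightarrow> N (\<Sum>n\<in>F k. a n *\<^sub>R e n) \<le> B) \<Longrightarrow>
       N (\<Sum>k<m. \<Sum>n\<in>F k. a n *\<^sub>R e n) \<le> K * B * real m powr (1 / r)"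
    and \<phi>: "\<phi> \<in> dual_space X N" and \<epsilon>: "0 < \<epsilon>"
  shows "\<exists>m0. \<forall>m\<ge>m0. \<forall>x\<in>X. N x \<le> 1 \<longrightarrow> \<bar>\<phi> (x - (\<Sum>n<m. cf n x *\<^sub>R e n))\<bar> \<le> \<epsilon>"
proof (rule ccontr)
  assume neg: "\<not> ?thesis"
  define D where "D = dual_norm X N \<phi>"
  have D: "0 \<le> D" "\<And>x. x \<in> X \<Longrightarrow> \<bar>\<phi> x\<bar> \<le> D * N x"
    using dual_norm_nonneg[OF \<phi>] dual_norm_le[OF \<phi>] by (auto simp: D_def)
  have \<phi>diff: "\<phi> (x - y) = \<phi> x - \<phi> y" if "x \<in> X" "y \<in> X" for x y
  proof -
    have "\<phi> ((x - y) + y) = \<phi> (x - y) + \<phi> y"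
      by (rule dual_add[OF \<phi> subspace_diff[OF subspace_X that] that(2)])
    then show ?thesis by simp
  qed
  \<comment> \<open>If tails of \<open>\<phi>\<close> do not become small, then beyond every index there is a finite block of norm at
    most \<open>C\<close> on which \<open>\<phi>\<close> exceeds \<open>\<epsilon>\<close>. The pair \<open>z\<close> consists of the end of the block and its
    coefficients.\<close>
  have "\<exists>z. m0 < fst z \<and> N (\<Sum>n\<in>{m0..<fst z}. snd z n *\<^sub>R e n) \<le> C \<and> \<epsilon> < \<phi> (\<Sum>n\<in>{m0..<fst z}. snd z n *\<^sub>R e n)" for m0
  proof -
    obtain m x where m: "m0 \<le> m" and x: "x \<in> X" "N x \<le> 1" "\<epsilon> < \<bar>\<phi> (x - (\<Sum>n<m. cf n x *\<^sub>R e n))\<bar>"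
      using neg by (meson not_le)
    define \<eta> where "\<eta> = \<bar>\<phi> (x - (\<Sum>n<m. cf n x *\<^sub>R e n))\<bar> - \<epsilon>"
    have \<eta>: "0 < \<eta>" using x by (simp add: \<eta>_def)
    have "(\<lambda>M. D * N ((\<Sum>n<M. cf n x *\<^sub>R e n) - x)) \<longlonglongrightarrow> D * 0"
      using coord_sums[OF x(1)] unfolding sums_in_def by (intro tendsto_intros)
    then have "eventually (\<lambda>M. D * N ((\<Sum>n<M. cf n x *\<^sub>R e n) - x) < \<eta>) sequentially"
      using \<eta> by (auto dest: order_tendstoD(2))
    then have "eventually (\<lambda>M. D * N ((\<Sum>n<M. cf n x *\<^sub>R e n) - x) < \<eta> \<and> m < M) sequentially"
      using eventually_gt_at_top[of m] by eventually_elim auto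
    then obtain M where M: "D * N ((\<Sum>n<M. cf n x *\<^sub>R e n) - x) < \<eta>" "m < M"
      by (auto simp: eventually_sequentially)
    define z where "z = (\<Sum>n\<in>{m..<M}. cf n x *\<^sub>R e n)"
    have z: "z = (\<Sum>n<M. cf n x *\<^sub>R e n) - (\<Sum>n<m. cf n x *\<^sub>R e n)"
      using sum_ivl_diff[of m M] M by (simp add: z_def)
    have "\<phi> z = \<phi> ((\<Sum>n<M. cf n x *\<^sub>R e n) - x) + \<phi> (x - (\<Sum>n<m. cf n x *\<^sub>R e n))"
      unfolding z by (simp add: \<phi>diff sum_in x)
    moreover have "\<bar>\<phi> ((\<Sum>n<M. cf n x *\<^sub>R e n) - x)\<bar> < \<eta>"
      by (rule order.strict_trans1[OF D(2)[OF subspace_diff[OF subspace_X sum_in x(1)]] M(1)])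
    ultimately have \<phi>z: "\<epsilon> < \<bar>\<phi> z\<bar>" unfolding \<eta>_def by linarith
    define \<sigma> where "\<sigma> = sgn (\<phi> z)"
    have \<sigma>: "\<bar>\<sigma>\<bar> = 1" using \<phi>z \<epsilon> by (auto simp: \<sigma>_def sgn_if)
    define a where "a n = (if m \<le> n then \<sigma> * cf n x else 0)" for n
    have az: "(\<Sum>n\<in>{m0..<M}. a n *\<^sub>R e n) = \<sigma> *\<^sub>R z"
    proof -
      have "(\<Sum>n\<in>{m0..<M}. a n *\<^sub>R e n) = (\<Sum>n\<in>{m..<M}. (\<sigma> * cf n x) *\<^sub>R e n)"
        using m by (intro sum.mono_neutral_cong_right) (auto simp: a_def)
      then show ?thesis by (simp add: z_def scaleR_sum_right)
    qed
    have zX: "z \<in> X" unfolding z_def by (rule sum_in)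
    have "N z \<le> C * N x" unfolding z_def by (rule projection_bound) (use x in auto)
    also have "\<dots> \<le> C" using x(2) C_ge_1 mult_left_mono[of "N x" 1 C] by simp
    finally have "N (\<sigma> *\<^sub>R z) \<le> C" using N_scale[OF zX] \<sigma> by simp
    moreover have "\<phi> (\<sigma> *\<^sub>R z) = \<bar>\<phi> z\<bar>"
      using \<phi> zX by (simp add: dual_space_def \<sigma>_def abs_sgn mult.commute)
    ultimately show ?thesis
      using \<phi>z m M(2) az by (intro exI[of _ "(M, a)"]) simp
  qed
  then have "\<exists>f. \<forall>m0. m0 < fst (f m0) \<and> N (\<Sum>n\<in>{m0..<fst (f m0)}. snd (f m0) n *\<^sub>R e n) \<le> C \<and>
      \<epsilon> < \<phi> (\<Sum>n\<in>{m0..<fst (f m0)}. snd (f m0) n *\<^sub>R e n)"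
    by (rule choice[OF allI])
  then obtain f where f: "\<And>m0. m0 < fst (f m0)" "\<And>m0. N (\<Sum>n\<in>{m0..<fst (f m0)}. snd (f m0) n *\<^sub>R e n) \<le> C"
      "\<And>m0. \<epsilon> < \<phi> (\<Sum>n\<in>{m0..<fst (f m0)}. snd (f m0) n *\<^sub>R e n)"
    by blast
  define hi A where "hi = (\<lambda>m. fst (f m))" and "A = (\<lambda>m. snd (f m))"
  have hi: "\<And>m. m < hi m" "\<And>m. N (\<Sum>n\<in>{m..<hi m}. A m n *\<^sub>R e n) \<le> C"
      "\<And>m. \<epsilon> < \<phi> (\<Sum>n\<in>{m..<hi m}. A m n *\<^sub>R e n)"
    unfolding hi_def A_def by (rule f)+
  \<comment> \<open>Consecutive blocks are placed one after the other, each beginning where the last one ends.\<close>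
  define m where "m k = (hi ^^ k) 0" for k
  have m_Suc: "m (Suc k) = hi (m k)" for k by (simp add: m_def)
  have m_mono: "strict_mono m" unfolding strict_mono_Suc_iff m_Suc using hi(1) by blast
  define F where "F k = {m k..<m (Suc k)}" for k
  have F_disj: "k = l" if "n \<in> F k" "n \<in> F l" for n k l
  proof (rule ccontr)
    assume "k \<noteq> l"
    then consider "Suc k \<le> l" | "Suc l \<le> k" by linarith
    then show False
    proof cases
      case 1
      then have "m (Suc k) \<le> m l" using m_mono by (simp add: strict_mono_less_eq)
      then show False using that by (auto simp: F_def)
    next
      case 2
      then have "m (Suc l) \<le> m k" using m_mono by (simp add: strict_mono_less_eq)
      then show False using that by (auto simp: F_def)
    qed
  qed
  define a where "a n = A (m (SOME k. n \<in> F k)) n" for n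
  have a: "a n = A (m k) n" if "n \<in> F k" for n k
    using some_equality[of "\<lambda>k. n \<in> F k" k] that F_disj unfolding a_def by metis
  have sumF: "(\<Sum>n\<in>F k. a n *\<^sub>R e n) = (\<Sum>n\<in>{m k..<hi (m k)}. A (m k) n *\<^sub>R e n)" for k
    using a by (intro sum.cong) (auto simp: F_def m_Suc)
  have bound: "real k * \<epsilon> \<le> D * K * C * real k powr (1 / r)" for k
  proof -
    define y where "y = (\<Sum>j<k. \<Sum>n\<in>F j. a n *\<^sub>R e n)"
    have yX: "y \<in> X" unfolding y_def by (intro subspace_sum[OF subspace_X] sum_in)
    have "N y \<le> K * C * real k powr (1 / r)"
      unfolding y_def
    proof (rule block)
      show "disjoint_family_on F {..<k}" unfolding disjoint_family_on_def using F_disj by blast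
      show "N (\<Sum>n\<in>F j. a n *\<^sub>R e n) \<le> C" for j unfolding sumF by (rule hi(2))
    qed (simp add: F_def)
    have "\<phi> y = (\<Sum>j<k. \<phi> (\<Sum>n\<in>F j. a n *\<^sub>R e n))"
      unfolding y_def
    proof (induction k)
      case (Suc k)
      have "(\<Sum>j<k. \<Sum>n\<in>F j. a n *\<^sub>R e n) \<in> X" by (intro subspace_sum[OF subspace_X] sum_in)
      then show ?case using Suc \<phi> sum_in by (simp add: dual_space_def)
    qed (simp add: dual_zero[OF \<phi>])
    moreover have "(\<Sum>j<k. \<epsilon>) \<le> (\<Sum>j<k. \<phi> (\<Sum>n\<in>F j. a n *\<^sub>R e n))"
      using hi(3) by (intro sum_mono less_imp_le) (simp add: sumF)
    ultimately have "real k * \<epsilon> \<le> \<phi> y" by simp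
    also have "\<dots> \<le> D * N y" using D(2)[OF yX] by simp
    also have "\<dots> \<le> D * (K * C * real k powr (1 / r))"
      using D(1) \<open>N y \<le> _\<close> by (rule mult_left_mono[rotated])
    finally show ?thesis by (simp add: mult.assoc)
  qed
  \<comment> \<open>For large \<open>k\<close> the bound \<open>k \<epsilon> \<le> D K C k\<^sup>1\<^sup>/\<^sup>r\<close> fails.\<close>
  define Q where "Q = D * K * C / \<epsilon>"
  have Q: "0 \<le> Q" using D K C_ge_1 \<epsilon> by (simp add: Q_def)
  define s where "s = 1 - 1 / r"
  have s: "0 < s" using r by (simp add: s_def)
  obtain k where k: "(Q + 1) powr (1 / s) < real k" using reals_Archimedean2 by blast
  then have k0: "0 < real k" using powr_ge_zero[of "Q + 1" "1 / s"] by linarith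
  have "Q + 1 = ((Q + 1) powr (1 / s)) powr s" using s Q by (simp add: powr_powr)
  also have "\<dots> \<le> real k powr s" using k s by (intro powr_mono2) auto
  finally have 1: "Q + 1 \<le> real k powr s" .
  have "real k powr s * real k powr (1 / r) = real k"
    using k0 by (simp add: powr_add[symmetric] s_def)
  then have "real k powr (1 / r) * (real k powr s * \<epsilon>) \<le> real k powr (1 / r) * (D * K * C)"
    using bound[of k] by (simp add: mult_ac)
  then have "real k powr s * \<epsilon> \<le> D * K * C" using k0 by (subst (asm) mult_le_cancel_left_pos) auto
  then have "real k powr s \<le> Q" using \<epsilon> by (simp add: Q_def field_simps)
  with 1 show False by simp
qed

text \<open>
  Uniformly small tails on the unit ball say precisely that the partial sums of the expansion of
  \<open>\<phi>\<close> in coordinate functionals converge to \<open>\<phi>\<close> in the dual norm.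
\<close>

lemma shrinking_of_upper_estimate:
  assumes r: "1 < r" and K: "0 \<le> K"
    and block: "\<And>m F a B. disjoint_family_on F {..<m} \<Longrightarrow> (\<And>k. k < m \<Longrightarrow> finite (F k)) \<Longrightarrow>
       (\<And>k. k < m \<Longrightarrow> N (\<Sum>n\<in>F k. a n *\<^sub>R e n) \<le> B) \<Longrightarrow>
       N (\<Sum>k<m. \<Sum>n\<in>F k. a n *\<^sub>R e n) \<le> K * B * real m powr (1 / r)"
  shows "shrinking_basis X N e"
  unfolding shrinking_basis_def
proof (intro conjI schauder)
  show "schauder_basis (dual_space X N) (dual_norm X N) cf"
    unfolding schauder_basis_def
  proof (intro conjI ballI)
    show "range cf \<subseteq> dual_space X N" using coord_dual by auto
    fix \<phi> assume \<phi>: "\<phi> \<in> dual_space X N"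
    have sums: "sums_in (dual_norm X N) (\<lambda>n. \<phi> (e n) *\<^sub>R cf n) \<phi>"
      unfolding sums_in_def
    proof (rule LIMSEQ_I)
      fix \<epsilon> :: real assume \<epsilon>: "0 < \<epsilon>"
      have "\<exists>m0. \<forall>m\<ge>m0. \<forall>x\<in>X. N x \<le> 1 \<longrightarrow> \<bar>\<phi> (x - (\<Sum>n<m. cf n x *\<^sub>R e n))\<bar> \<le> \<epsilon> / 2"
        by (rule dual_tail[OF r K _ \<phi>], rule block) (use \<epsilon> in simp_all)
      then obtain m0 where m0: "\<And>m x. m0 \<le> m \<Longrightarrow> x \<in> X \<Longrightarrow> N x \<le> 1 \<Longrightarrow> \<bar>\<phi> (x - (\<Sum>n<m. cf n x *\<^sub>R e n))\<bar> \<le> \<epsilon> / 2"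
        by blast
      have "norm (dual_norm X N ((\<Sum>n<m. \<phi> (e n) *\<^sub>R cf n) - \<phi>) - 0) < \<epsilon>" if m: "m0 \<le> m" for m
      proof -
        have "dual_norm X N ((\<Sum>n<m. \<phi> (e n) *\<^sub>R cf n) - \<phi>) \<le> \<epsilon> / 2"
        proof (rule dual_norm_least)
          fix x assume x: "x \<in> X" "N x \<le> 1"
          have "\<phi> ((x - (\<Sum>n<m. cf n x *\<^sub>R e n)) + (\<Sum>n<m. cf n x *\<^sub>R e n)) = \<phi> (x - (\<Sum>n<m. cf n x *\<^sub>R e n)) + \<phi> (\<Sum>n<m. cf n x *\<^sub>R e n)"
            by (rule dual_add[OF \<phi> subspace_diff[OF subspace_X x(1) sum_in] sum_in])
          then have "((\<Sum>n<m. \<phi> (e n) *\<^sub>R cf n) - \<phi>) x = - \<phi> (x - (\<Sum>n<m. cf n x *\<^sub>R e n))"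
            using dual_sum[OF \<phi>, of "\<lambda>n. cf n x" "{..<m}"] by (simp add: coord_sum_apply mult.commute)
          then show "\<bar>((\<Sum>n<m. \<phi> (e n) *\<^sub>R cf n) - \<phi>) x\<bar> \<le> \<epsilon> / 2" using m0[OF m x] by simp
        qed
        then show ?thesis
          using dual_norm_nonneg[OF subspace_diff[OF subspace_dual coord_sum_dual \<phi>], of "\<lambda>n. \<phi> (e n)" "{..<m}"] \<epsilon> by simp
      qed
      then show "\<exists>m0. \<forall>m\<ge>m0. norm (dual_norm X N ((\<Sum>n<m. \<phi> (e n) *\<^sub>R cf n) - \<phi>) - 0) < \<epsilon>" by blast
    qed
    show "\<exists>!c. sums_in (dual_norm X N) (\<lambda>n. c n *\<^sub>R cf n) \<phi>"
      by (rule ex1I[where a = "\<lambda>n. \<phi> (e n)"], rule sums, rule ext, rule sums_in_dual_unique[OF \<phi>])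
  qed
qed

text \<open>
  A strategy that answers the history \<open>ns\<close> with the sum over a finite block \<open>B ns\<close> of basis vectors and
  a weighted sum of the corresponding functionals. The list \<open>H n k\<close> is the history after move \<open>k\<close> of
  the opponent who plays \<open>n\<close>. The hypotheses \<open>up\<close> and \<open>lo\<close> are the equivalence of the blocks with
  the basis. The equivalence of the dual sequences follows by duality from \<open>up\<close> and from \<open>proj\<close>, the
  boundedness of the map sending \<open>x\<close> to \<open>\<Sum> b\<^sub>k\<^sup>*(x) e\<^sub>k\<close>.
\<close>

lemma block_strategy_wins:
  fixes B :: "nat list \<Rightarrow> nat set" and w :: "nat list \<Rightarrow> nat \<Rightarrow> real" and D :: real
  defines "H n k \<equiv> map n [0..<Suc k]"
  assumes D: "1 \<le> D"
    and fin: "\<And>n k. finite (B (H n k))" and late: "\<And>n k. B (H n k) \<subseteq> {n k..}"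
    and disj: "\<And>n k l. k \<noteq> l \<Longrightarrow> B (H n k) \<inter> B (H n l) = {}"
    and w1: "\<And>n k. (\<Sum>j\<in>B (H n k). w (H n k) j) = 1"
    and up: "\<And>n F a. finite F \<Longrightarrow> N (\<Sum>k\<in>F. a k *\<^sub>R (\<Sum>j\<in>B (H n k). e j)) \<le> D * N (\<Sum>k\<in>F. a k *\<^sub>R e k)"
    and lo: "\<And>n F a. finite F \<Longrightarrow> N (\<Sum>k\<in>F. a k *\<^sub>R e k) \<le> D * N (\<Sum>k\<in>F. a k *\<^sub>R (\<Sum>j\<in>B (H n k). e j))"
    and proj: "\<And>n F x. finite F \<Longrightarrow> N (\<Sum>k\<in>F. (\<Sum>j\<in>B (H n k). w (H n k) j * x j) *\<^sub>R e k)
         \<le> D * N (\<Sum>j\<in>(\<Union>k\<in>F. B (H n k)). x j *\<^sub>R e j)"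
  shows "winning_strategy X N e ((C * D)\<^sup>2) (\<lambda>ns. (\<Sum>j\<in>B ns. e j, \<Sum>j\<in>B ns. w ns j *\<^sub>R cf j))"
  unfolding winning_strategy_def Let_def fst_conv snd_conv
proof (intro allI)
  fix n :: "nat \<Rightarrow> nat"
  define b where "b k = (\<Sum>j\<in>B (H n k). e j)" for k
  define b' where "b' k = (\<Sum>j\<in>B (H n k). w (H n k) j *\<^sub>R cf j)" for k
  have CD: "1 \<le> C * D" using C_ge_1 D mult_mono[of 1 C 1 D] by simp
  have DC: "D \<le> C * D" using C_ge_1 D mult_right_mono[of 1 C D] by simp
  have sq: "sqrt ((C * D)\<^sup>2) = C * D" using CD by simp
  have b_in: "b k \<in> X" for k
    unfolding b_def using sum_in[of "\<lambda>_. 1"] by simp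
  have sb_in: "(\<Sum>k\<in>F. a k *\<^sub>R b k) \<in> X" for F a
    using b_in by (intro subspace_sum[OF subspace_X] subspace_scale[OF subspace_X])
  have b'_dual: "b' k \<in> dual_space X N" for k
    unfolding b'_def by (rule coord_sum_dual)
  have sb'_dual: "(\<Sum>k\<in>F. a k *\<^sub>R b' k) \<in> dual_space X N" for F a
    using b'_dual by (intro subspace_sum[OF subspace_dual] subspace_scale[OF subspace_dual])
  have biorth: "b' k (b l) = (if k = l then 1 else 0)" for k l
  proof -
    have "b' k (b l) = (\<Sum>j\<in>B (H n k). w (H n k) j * cf j (b l))"
      unfolding b'_def by (rule coord_sum_apply)
    also have "\<dots> = (\<Sum>j\<in>B (H n k). if j \<in> B (H n l) then w (H n k) j else 0)"
      unfolding b_def using coord_sum[OF fin, of _ "\<lambda>_. 1"] by (intro sum.cong) auto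
    also have "\<dots> = (if k = l then 1 else 0)"
      using disj[of k l n] w1[of n k] by (auto intro!: sum.neutral)
    finally show ?thesis .
  qed
  have scale: "1 / (C * D) * y \<le> z \<longleftrightarrow> y \<le> C * D * z" for y z :: real
    using CD by (simp add: field_simps)
  have weaken: "y \<le> C * D * N z" if "y \<le> D * N z" "z \<in> X" for y z
    using that mult_right_mono[OF DC N_nonneg[OF that(2)]] by linarith
  have equiv: "impartially_equivalent ((C * D)\<^sup>2) N b N e"
    unfolding impartially_equivalent_def sq scale
  proof (intro allI impI conjI)
    fix a :: "nat \<Rightarrow> real" assume F: "finite {i. a i \<noteq> 0}"
    show "N (\<Sum>i | a i \<noteq> 0. a i *\<^sub>R e i) \<le> C * D * N (\<Sum>i | a i \<noteq> 0. a i *\<^sub>R b i)"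
      by (rule weaken[OF _ sb_in]) (use lo[OF F] in \<open>simp add: b_def\<close>)
    show "N (\<Sum>i | a i \<noteq> 0. a i *\<^sub>R b i) \<le> C * D * N (\<Sum>i | a i \<noteq> 0. a i *\<^sub>R e i)"
      by (rule weaken[OF _ sum_in]) (use up[OF F] in \<open>simp add: b_def\<close>)
  qed
  have equiv': "impartially_equivalent ((C * D)\<^sup>2) (dual_norm X N) b' (dual_norm X N) cf"
    unfolding impartially_equivalent_def sq scale
  proof (intro allI impI conjI)
    fix a :: "nat \<Rightarrow> real" assume F: "finite {i. a i \<noteq> 0}"
    define \<phi> where "\<phi> = (\<Sum>i | a i \<noteq> 0. a i *\<^sub>R cf i)"
    define \<psi> where "\<psi> = (\<Sum>i | a i \<noteq> 0. a i *\<^sub>R b' i)"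
    have \<phi>: "\<phi> \<in> dual_space X N" unfolding \<phi>_def by (rule coord_sum_dual)
    have \<psi>: "\<psi> \<in> dual_space X N" unfolding \<psi>_def by (rule sb'_dual)
    have \<phi>_apply: "\<phi> x = (\<Sum>i | a i \<noteq> 0. a i * cf i x)" for x unfolding \<phi>_def by (rule coord_sum_apply)
    have \<psi>_apply: "\<psi> x = (\<Sum>i | a i \<noteq> 0. a i * b' i x)" for x
      unfolding \<psi>_def by (simp add: sum_fun_apply scaleR_fun_def)
    show "dual_norm X N (\<Sum>i | a i \<noteq> 0. a i *\<^sub>R cf i) \<le> C * D * dual_norm X N (\<Sum>i | a i \<noteq> 0. a i *\<^sub>R b' i)"
      unfolding \<phi>_def[symmetric] \<psi>_def[symmetric]
    proof (rule dual_norm_least)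
      fix x assume x: "x \<in> X" "N x \<le> 1"
      \<comment> \<open>A unit vector \<open>x\<close> testing the norm of \<open>\<phi>\<close> is replaced by \<open>y\<close>, on which \<open>\<psi>\<close> takes the same
        value by biorthogonality.\<close>
      define y where "y = (\<Sum>i | a i \<noteq> 0. cf i x *\<^sub>R b i)"
      have y: "y \<in> X" unfolding y_def by (rule sb_in)
      have "b' k y = (\<Sum>i | a i \<noteq> 0. cf i x * b' k (b i))" for k
        unfolding y_def
      proof (use F in \<open>induction rule: finite_induct\<close>)
        case empty
        show ?case by (simp add: dual_zero[OF b'_dual])
      next
        case (insert i F)
        then show ?case
          using b'_dual[of k] b_in sb_in[of "\<lambda>i. cf i x" F] subspace_scale[OF subspace_X b_in]
          by (simp add: dual_space_def)
      qed
      then have "\<psi> y = \<phi> x"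
        unfolding \<phi>_apply \<psi>_apply biorth using F by (intro sum.cong) (auto simp: mult_delta_right)
      then have "\<bar>\<phi> x\<bar> \<le> dual_norm X N \<psi> * N y" using dual_norm_le[OF \<psi> y] by simp
      moreover have "N y \<le> D * (C * N x)"
        using up[OF F, of "\<lambda>i. cf i x" n] projection_bound[OF x(1) F] D
          mult_left_mono[of "N (\<Sum>i | a i \<noteq> 0. cf i x *\<^sub>R e i)" "C * N x" D]
        unfolding y_def b_def by linarith
      moreover have "D * (C * N x) \<le> C * D" using x(2) CD mult_left_mono[of "N x" 1 "C * D"] by (simp add: mult_ac)
      ultimately show "\<bar>\<phi> x\<bar> \<le> C * D * dual_norm X N \<psi>"
        using mult_left_mono[of "N y" "C * D" "dual_norm X N \<psi>"] dual_norm_nonneg[OF \<psi>]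
        by (simp add: mult.commute)
    qed
    show "dual_norm X N (\<Sum>i | a i \<noteq> 0. a i *\<^sub>R b' i) \<le> C * D * dual_norm X N (\<Sum>i | a i \<noteq> 0. a i *\<^sub>R cf i)"
      unfolding \<phi>_def[symmetric] \<psi>_def[symmetric]
    proof (rule dual_norm_least)
      fix x assume x: "x \<in> X" "N x \<le> 1"
      \<comment> \<open>Conversely, the value of \<open>\<psi>\<close> at \<open>x\<close> is the value of \<open>\<phi>\<close> at \<open>z\<close>.\<close>
      define z where "z = (\<Sum>i | a i \<noteq> 0. b' i x *\<^sub>R e i)"
      have z: "z \<in> X" unfolding z_def by (rule sum_in)
      have "\<phi> z = \<psi> x"
        unfolding \<phi>_apply \<psi>_apply z_def using F by (intro sum.cong) (auto simp: coord_sum)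
      then have "\<bar>\<psi> x\<bar> \<le> dual_norm X N \<phi> * N z" using dual_norm_le[OF \<phi> z] by simp
      moreover have "N z \<le> D * (C * N x)"
      proof -
        have "N z \<le> D * N (\<Sum>j\<in>(\<Union>k\<in>{i. a i \<noteq> 0}. B (H n k)). cf j x *\<^sub>R e j)"
          using proj[OF F, of n "\<lambda>j. cf j x"] unfolding z_def b'_def coord_sum_apply .
        also have "\<dots> \<le> D * (C * N x)"
          using D F fin by (intro mult_left_mono projection_bound x) auto
        finally show ?thesis .
      qed
      moreover have "D * (C * N x) \<le> C * D" using x(2) CD mult_left_mono[of "N x" 1 "C * D"] by (simp add: mult_ac)
      ultimately show "\<bar>\<psi> x\<bar> \<le> C * D * dual_norm X N \<phi>"
        using mult_left_mono[of "N z" "C * D" "dual_norm X N \<phi>"] dual_norm_nonneg[OF \<phi>]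
        by (simp add: mult.commute)
    qed
  qed
  have legal: "b k \<in> span (e ` {n k..}) \<and> b' k \<in> span (cf ` {n k..})" for k
    unfolding b_def b'_def using late[of n k]
    by (intro conjI span_sum span_scale span_base) auto
  show "(\<forall>k. (\<Sum>j\<in>B (map n [0..<Suc k]). e j) \<in> span (e ` {n k..}) \<and>
             (\<Sum>j\<in>B (map n [0..<Suc k]). w (map n [0..<Suc k]) j *\<^sub>R cf j) \<in> span (cf ` {n k..})) \<and>
        impartially_equivalent ((C * D)\<^sup>2) N (\<lambda>k. \<Sum>j\<in>B (map n [0..<Suc k]). e j) N e \<and>
        impartially_equivalent ((C * D)\<^sup>2) (dual_norm X N) (\<lambda>k. \<Sum>j\<in>B (map n [0..<Suc k]). w (map n [0..<Suc k]) j *\<^sub>R cf j) (dual_norm X N) cf \<and>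
        (\<forall>k l. (\<Sum>j\<in>B (map n [0..<Suc k]). w (map n [0..<Suc k]) j *\<^sub>R cf j) (\<Sum>j\<in>B (map n [0..<Suc l]). e j) = (if k = l then 1 else 0))"
    using legal equiv equiv' biorth unfolding b_def b'_def H_def by blast
qed

end

section \<open>Integral inequalities\<close>

lemma space_unit_interval [simp]: "space unit_interval = {0..1}"
  by (simp add: space_restrict_space)

lemma emeasure_unit_interval: "A \<in> sets borel \<Longrightarrow> A \<subseteq> {0..1} \<Longrightarrow> emeasure unit_interval A = emeasure lborel A"
  by (subst emeasure_restrict_space) auto

lemma emeasure_unit_interval_space: "emeasure unit_interval {0..1} = 1"
  by (simp add: emeasure_unit_interval)

interpretation unit_interval: finite_measure unit_interval
  by (rule finite_measureI) (simp add: emeasure_unit_interval)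

interpretation cubes: product_sigma_finite "\<lambda>_::nat. unit_interval"
  by (rule product_sigma_finite.intro) (rule unit_interval.sigma_finite_measure_axioms)

lemma ennreal_powr_simps [simp]: "ennreal_powr top a = top" "0 < a \<Longrightarrow> ennreal_powr 0 a = 0"
  by (simp_all add: ennreal_powr_def)

lemma ennreal_powr_ennreal: "0 \<le> x \<Longrightarrow> ennreal_powr (ennreal x) a = ennreal (x powr a)"
  by (simp add: ennreal_powr_def)

lemma ennreal_powr_mono: "0 < a \<Longrightarrow> x \<le> y \<Longrightarrow> ennreal_powr x a \<le> ennreal_powr y a"
  by (auto simp: ennreal_powr_def top_unique intro!: powr_mono2 enn2real_mono simp: less_top)

lemma ennreal_powr_measurable [measurable]: "(\<lambda>x. ennreal_powr x a) \<in> borel_measurable borel"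
  unfolding ennreal_powr_def by measurable

lemma ennreal_powr_eq_top: "ennreal_powr x a = top \<longleftrightarrow> x = top"
  by (simp add: ennreal_powr_def)

lemma ennreal_powr_lt_top: "ennreal_powr x a < top \<longleftrightarrow> x < top"
  using ennreal_powr_eq_top[of x a] by (simp add: less_top[symmetric])

lemma ennreal_powr_eq_0: "0 < a \<Longrightarrow> ennreal_powr x a = 0 \<longleftrightarrow> x = 0"
  by (cases x) (auto simp: ennreal_powr_ennreal)

lemma ennreal_powr_powr: "0 < a \<Longrightarrow> 0 < b \<Longrightarrow> ennreal_powr (ennreal_powr x a) b = ennreal_powr x (a * b)"
  by (cases x) (auto simp: ennreal_powr_ennreal powr_powr)

lemma ennreal_powr_1 [simp]: "ennreal_powr x 1 = x"
  by (cases x) (auto simp: ennreal_powr_ennreal)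

lemma ennreal_powr_mult: "0 < a \<Longrightarrow> ennreal_powr (x * y) a = ennreal_powr x a * ennreal_powr y a"
proof (cases x; cases y)
  fix r s assume "0 < a" "0 \<le> r" "x = ennreal r" "0 \<le> s" "y = ennreal s"
  then show ?thesis
    by (simp add: ennreal_powr_ennreal ennreal_mult[symmetric] powr_mult)
qed (auto simp: ennreal_powr_ennreal ennreal_mult_top ennreal_top_mult)

lemma ennreal_powr_tendsto_0:
  assumes "0 < a" "(f \<longlongrightarrow> 0) F"
  shows "((\<lambda>x. ennreal_powr (f x) a) \<longlongrightarrow> 0) F"
proof (rule order_tendstoI)
  fix e :: ennreal assume e: "0 < e"
  define b where "b = ennreal_powr (min e 1) (1 / a)"
  have "0 < b" using e assms by (simp add: b_def less_le ennreal_powr_eq_0 eq_commute[of 0] min_def)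
  then have "eventually (\<lambda>x. f x < b) F" using assms(2) by (rule order_tendstoD(2)[rotated])
  then show "eventually (\<lambda>x. ennreal_powr (f x) a < e) F"
  proof eventually_elim
    case (elim x)
    have m: "ennreal_powr b a = min e 1" unfolding b_def using assms by (simp add: ennreal_powr_powr)
    have "ennreal_powr (f x) a \<le> min e 1"
      using ennreal_powr_mono[OF assms(1) less_imp_le[OF elim]] m by simp
    moreover have "ennreal_powr (f x) a \<noteq> min e 1"
    proof
      assume "ennreal_powr (f x) a = min e 1"
      then have "ennreal_powr (ennreal_powr (f x) a) (1 / a) = b" by (simp add: b_def)
      then show False using elim assms by (simp add: ennreal_powr_powr)
    qed
    ultimately have "ennreal_powr (f x) a < min e 1" by (simp add: less_le)
    then show ?case by simp
  qed
qed simp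

lemma young_ennreal:
  assumes "1 \<le> p" "0 \<le> z"
  shows "ennreal (p * z powr (p - 1)) * x \<le> ennreal ((p - 1) * z powr p) + ennreal_powr x p"
proof (cases x)
  case (real r)
  have "ennreal (p * z powr (p - 1)) * x = ennreal (p * z powr (p - 1) * r)"
    using real assms by (simp add: ennreal_mult)
  also have "\<dots> \<le> ennreal ((p - 1) * z powr p + r powr p)"
    using assms real by (intro ennreal_leI young_powr) auto
  also have "\<dots> = ennreal ((p - 1) * z powr p) + ennreal_powr x p"
    using assms real by (simp add: ennreal_powr_ennreal)
  finally show ?thesis .
qed simp

text \<open>
  Integrating Young's inequality, the tangent line inequality of the \<open>p\<close>-th power, at the point
  \<open>z\<close> and choosing for \<open>z\<close> the weighted mean of \<open>x\<close>.
\<close>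

lemma weighted_jensen:
  assumes p: "1 < p" and [measurable]: "w \<in> borel_measurable M" "x \<in> borel_measurable M"
    and W: "(\<integral>\<^sup>+ a. w a \<partial>M) = ennreal W" "0 < W"
  shows "ennreal_powr (\<integral>\<^sup>+ a. w a * x a \<partial>M) p \<le> ennreal (W powr (p - 1)) * (\<integral>\<^sup>+ a. w a * ennreal_powr (x a) p \<partial>M)"
proof -
  define I where "I = (\<integral>\<^sup>+ a. w a * x a \<partial>M)"
  define P where "P = (\<integral>\<^sup>+ a. w a * ennreal_powr (x a) p \<partial>M)"
  have key: "ennreal (p * z powr (p - 1)) * I \<le> ennreal ((p - 1) * z powr p * W) + P" if z: "0 \<le> z" for z
  proof -
    have "ennreal (p * z powr (p - 1)) * I = (\<integral>\<^sup>+ a. w a * (ennreal (p * z powr (p - 1)) * x a) \<partial>M)"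
      unfolding I_def by (subst nn_integral_cmult[symmetric]) (auto simp: mult_ac)
    also have "\<dots> \<le> (\<integral>\<^sup>+ a. w a * (ennreal ((p - 1) * z powr p) + ennreal_powr (x a) p) \<partial>M)"
      using p z by (intro nn_integral_mono mult_left_mono young_ennreal) auto
    also have "\<dots> = (\<integral>\<^sup>+ a. ennreal ((p - 1) * z powr p) * w a + w a * ennreal_powr (x a) p \<partial>M)"
      by (simp add: distrib_left mult.commute)
    also have "\<dots> = ennreal ((p - 1) * z powr p) * ennreal W + P"
      unfolding P_def W(1)[symmetric] by (subst nn_integral_add) (auto simp: nn_integral_cmult)
    also have "ennreal ((p - 1) * z powr p) * ennreal W = ennreal ((p - 1) * z powr p * W)"
      using p W by (simp add: ennreal_mult)
    finally show ?thesis .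
  qed
  show ?thesis
  proof (cases P)
    case top
    then show ?thesis using W p unfolding P_def[symmetric] I_def[symmetric] by (simp add: ennreal_mult_top)
  next
    case (real b)
    have "I \<noteq> top"
    proof
      assume "I = top"
      then have "ennreal p * top \<le> ennreal ((p - 1) * W) + ennreal b" using key[of 1] real by simp
      then show False using p by (simp add: ennreal_mult_top top_unique)
    qed
    then obtain i where i: "0 \<le> i" "I = ennreal i" by (cases I) auto
    define z where "z = i / W"
    have z: "0 \<le> z" "i = z * W" using i W by (auto simp: z_def)
    have "ennreal (p * z powr (p - 1) * i) \<le> ennreal ((p - 1) * z powr p * W + b)"
      using key[OF z(1)] i real p W z by (simp add: ennreal_mult[symmetric] ennreal_plus[symmetric] del: ennreal_plus)
    then have "p * z powr (p - 1) * i \<le> (p - 1) * z powr p * W + b"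
      using p W z real by (subst (asm) ennreal_le_iff) auto
    moreover have "p * z powr (p - 1) * i = p * z powr p * W"
      using powr_mult_self[OF z(1), of p] by (simp add: z(2) mult_ac)
    ultimately have "p * z powr p * W \<le> (p - 1) * z powr p * W + b" by simp
    then have "z powr p * W \<le> b" by (simp add: algebra_simps)
    then have "W powr (p - 1) * (z powr p * W) \<le> W powr (p - 1) * b" by (intro mult_left_mono) auto
    moreover have "W powr (p - 1) * (z powr p * W) = i powr p"
      using powr_mult_self[of W p] W z by (simp add: powr_mult mult_ac)
    ultimately show ?thesis
      unfolding P_def[symmetric] I_def[symmetric] i(2) real(2)
      using i(1) real(1) by (simp add: ennreal_powr_ennreal ennreal_mult[symmetric] ennreal_leI)
  qed
qed

text \<open>
  Let \<open>w a\<close> be the norm of the slice \<open>u a\<close> and \<open>W\<close> the integral of \<open>w\<close>. Writing \<open>u = w * x\<close> with slices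
  of \<open>x\<close> of norm at most one, Jensen's inequality with the weight \<open>w\<close> bounds the \<open>p\<close>-th power of the inner
  integral by \<open>W\<^sup>p\<^sup>-\<^sup>1\<close> times the integral of \<open>w * x\<^sup>p\<close>, and Tonelli's theorem gives \<open>W\<^sup>p\<close> altogether.
\<close>

lemma minkowski_integral:
  assumes p: "1 < p" and sf: "sigma_finite_measure M" "sigma_finite_measure S"
    and u [measurable]: "case_prod u \<in> borel_measurable (M \<Otimes>\<^sub>M S)"
  shows "ennreal_powr (\<integral>\<^sup>+ s. ennreal_powr (\<integral>\<^sup>+ a. u a s \<partial>M) p \<partial>S) (1 / p)
     \<le> (\<integral>\<^sup>+ a. ennreal_powr (\<integral>\<^sup>+ s. ennreal_powr (u a s) p \<partial>S) (1 / p) \<partial>M)"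
proof -
  interpret M: sigma_finite_measure M by fact
  interpret S: sigma_finite_measure S by fact
  interpret pair_sigma_finite M S ..
  have p0: "0 < p" using p by simp
  define n where "n a = (\<integral>\<^sup>+ s. ennreal_powr (u a s) p \<partial>S)" for a
  define w where "w a = ennreal_powr (n a) (1 / p)" for a
  have wp: "ennreal_powr (w a) p = n a" for a using p0 by (simp add: w_def ennreal_powr_powr)
  have n [measurable]: "n \<in> borel_measurable M" unfolding n_def by measurable
  have w [measurable]: "w \<in> borel_measurable M" unfolding w_def by measurable
  have u' [measurable]: "(\<lambda>z. u (fst z) (snd z)) \<in> borel_measurable (M \<Otimes>\<^sub>M S)"
    using u by (simp add: split_beta')
  have u2 [measurable]: "(\<lambda>s. u a s) \<in> borel_measurable S" if "a \<in> space M" for a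
    using that by measurable
  show ?thesis
  proof (cases "\<integral>\<^sup>+ a. w a \<partial>M")
    case top
    then show ?thesis unfolding w_def n_def by simp
  next
    case (real W)
    show ?thesis
    proof (cases "W = 0")
      case True
      then have w0: "AE a in M. w a = 0" using real nn_integral_0_iff_AE[OF w] by simp
      have "AE a in M. AE s in S. u a s = 0"
      proof (rule AE_mp[OF w0], rule AE_I2, rule impI)
        fix a assume a: "a \<in> space M" "w a = 0"
        then have "n a = 0" using wp[of a] p0 by simp
        then show "AE s in S. u a s = 0" using p0 a unfolding n_def
          by (subst (asm) nn_integral_0_iff_AE) (auto simp: ennreal_powr_eq_0)
      qed
      then have "AE s in S. AE a in M. u a s = 0"
        by (rule iffD1[OF AE_commute, rotated]) measurable
      then have "AE s in S. (\<integral>\<^sup>+ a. u a s \<partial>M) = 0"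
        by (rule AE_mp) (auto intro!: AE_I2 simp: nn_integral_0_iff_AE)
      then have "(\<integral>\<^sup>+ s. ennreal_powr (\<integral>\<^sup>+ a. u a s \<partial>M) p \<partial>S) = 0"
        using p0 by (subst nn_integral_0_iff_AE) (auto simp: ennreal_powr_eq_0)
      then show ?thesis using p0 by simp
    next
      case False
      then have W: "0 < W" using real by simp
      define x where "x a s = u a s / w a" for a s
      have [measurable]: "case_prod x \<in> borel_measurable (M \<Otimes>\<^sub>M S)"
        unfolding x_def by measurable
      then have [measurable]: "(\<lambda>z. x (fst z) (snd z)) \<in> borel_measurable (M \<Otimes>\<^sub>M S)"
        by (simp add: split_beta')
      have wt: "AE a in M. w a \<noteq> top"
        using nn_integral_PInf_AE[OF w] real by simp
      \<comment> \<open>Where \<open>w\<close> vanishes the quotient is meaningless, but the slice vanishes almost everywhere.\<close>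
      have fin: "AE a in M. AE s in S. u a s = w a * x a s"
      proof (rule AE_mp[OF wt], rule AE_I2, rule impI)
        fix a assume a: "a \<in> space M" "w a \<noteq> top"
        show "AE s in S. u a s = w a * x a s"
        proof (cases "w a = 0")
          case True
          then have "n a = 0" using wp[of a] p0 by simp
          then have "AE s in S. u a s = 0" using p0 a unfolding n_def
            by (subst (asm) nn_integral_0_iff_AE) (auto simp: ennreal_powr_eq_0)
          then show ?thesis using True by simp
        next
          case False
          then show ?thesis using a unfolding x_def
            by (intro AE_I2) (simp add: ennreal_times_divide mult.commute[of "w a"] ennreal_mult_divide_eq)
        qed
      qed
      then have "AE s in S. AE a in M. u a s = w a * x a s"
        by (rule iffD1[OF AE_commute, rotated]) measurable
      then have G: "AE s in S. (\<integral>\<^sup>+ a. u a s \<partial>M) = (\<integral>\<^sup>+ a. w a * x a s \<partial>M)"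
        by (rule AE_mp) (auto intro!: AE_I2 nn_integral_cong_AE)
      have "(\<integral>\<^sup>+ s. ennreal_powr (\<integral>\<^sup>+ a. u a s \<partial>M) p \<partial>S) = (\<integral>\<^sup>+ s. ennreal_powr (\<integral>\<^sup>+ a. w a * x a s \<partial>M) p \<partial>S)"
        using G by (intro nn_integral_cong_AE) auto
      also have "\<dots> \<le> (\<integral>\<^sup>+ s. ennreal (W powr (p - 1)) * (\<integral>\<^sup>+ a. w a * ennreal_powr (x a s) p \<partial>M) \<partial>S)"
        by (intro nn_integral_mono weighted_jensen[OF p _ _ real(2) W]) measurable
      also have "\<dots> = ennreal (W powr (p - 1)) * (\<integral>\<^sup>+ s. (\<integral>\<^sup>+ a. w a * ennreal_powr (x a s) p \<partial>M) \<partial>S)"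
        by (rule nn_integral_cmult) measurable
      also have "(\<integral>\<^sup>+ s. (\<integral>\<^sup>+ a. w a * ennreal_powr (x a s) p \<partial>M) \<partial>S) = (\<integral>\<^sup>+ a. (\<integral>\<^sup>+ s. w a * ennreal_powr (x a s) p \<partial>S) \<partial>M)"
        by (rule Fubini') measurable
      also have "\<dots> \<le> (\<integral>\<^sup>+ a. w a \<partial>M)"
      proof (rule nn_integral_mono_AE)
        show "AE a in M. (\<integral>\<^sup>+ s. w a * ennreal_powr (x a s) p \<partial>S) \<le> w a"
        proof (rule AE_mp[OF AE_conjI[OF fin wt]], rule AE_I2, rule impI)
          fix a assume a: "a \<in> space M" and *: "(AE s in S. u a s = w a * x a s) \<and> w a \<noteq> top"
          show "(\<integral>\<^sup>+ s. w a * ennreal_powr (x a s) p \<partial>S) \<le> w a"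
          proof (cases "w a = 0")
            case False
            have "n a = (\<integral>\<^sup>+ s. ennreal_powr (w a) p * ennreal_powr (x a s) p \<partial>S)"
              unfolding n_def using * p0 by (intro nn_integral_cong_AE) (auto simp: ennreal_powr_mult)
            also have "\<dots> = n a * (\<integral>\<^sup>+ s. ennreal_powr (x a s) p \<partial>S)"
              unfolding wp using a by (intro nn_integral_cmult) measurable
            finally have "n a * (\<integral>\<^sup>+ s. ennreal_powr (x a s) p \<partial>S) = n a * 1" by simp
            moreover have "n a \<noteq> 0" "n a \<noteq> top"
              using False * wp[of a] p0 ennreal_powr_eq_0[of p "w a"] ennreal_powr_eq_top[of "w a" p] by auto
            ultimately have "(\<integral>\<^sup>+ s. ennreal_powr (x a s) p \<partial>S) = 1"
              by (metis ennreal_mult_cancel_left)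
            moreover have "(\<integral>\<^sup>+ s. w a * ennreal_powr (x a s) p \<partial>S) = w a * (\<integral>\<^sup>+ s. ennreal_powr (x a s) p \<partial>S)"
              using a by (intro nn_integral_cmult) measurable
            ultimately show ?thesis by simp
          qed simp
        qed
      qed
      also have "\<dots> = ennreal W" by (rule real(2))
      also have "ennreal (W powr (p - 1)) * ennreal W = ennreal (W powr p)"
        using W powr_mult_self[of W p] by (simp add: ennreal_mult[symmetric])
      finally have "(\<integral>\<^sup>+ s. ennreal_powr (\<integral>\<^sup>+ a. u a s \<partial>M) p \<partial>S) \<le> ennreal (W powr p)"
        by (simp add: mult_left_mono)
      then have "ennreal_powr (\<integral>\<^sup>+ s. ennreal_powr (\<integral>\<^sup>+ a. u a s \<partial>M) p \<partial>S) (1 / p) \<le> ennreal_powr (ennreal (W powr p)) (1 / p)"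
        using p0 by (intro ennreal_powr_mono) auto
      also have "\<dots> = ennreal W" using W p0 by (simp add: ennreal_powr_ennreal powr_powr)
      finally show ?thesis using real unfolding w_def n_def by simp
    qed
  qed
qed

section \<open>Iterated norms of nonnegative functions\<close>

text \<open>
  The iterated norm for functions with values in \<open>[0, \<infinity>]\<close>, in the variables listed in \<open>js\<close>, the
  remaining coordinates of \<open>t\<close> being parameters. In this form it can be applied to integrals, infinite
  sums and suprema of functions without any finiteness assumptions.
\<close>

primrec inorm :: "(nat \<Rightarrow> real) \<Rightarrow> nat list \<Rightarrow> ((nat \<Rightarrow> real) \<Rightarrow> ennreal) \<Rightarrow> (nat \<Rightarrow> real) \<Rightarrow> ennreal" where
  "inorm p [] g t = g t"
| "inorm p (j # js) g t =
     ennreal_powr (\<integral>\<^sup>+ s. ennreal_powr (inorm p js g (t(j := s))) (p j) \<partial>unit_interval) (1 / p j)"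

lemma inorm_Nil [simp]: "inorm p [] g = g"
  by (rule ext) simp

lemma iterated_norm_eq: "iterated_norm p js f t = inorm p js (\<lambda>t. ennreal \<bar>f t\<bar>) t"
  by (induction js arbitrary: t) auto

lemma space_cube: "space (cube J) = (J \<rightarrow>\<^sub>E {0..1})"
  by (simp add: space_PiM)

lemma upd_space_cube: "t \<in> space (cube J) \<Longrightarrow> s \<in> {0..1} \<Longrightarrow> t(j := s) \<in> space (cube (insert j J))"
  unfolding space_cube by (rule PiE_fun_upd)

lemma measurable_upd: "t \<in> space (cube J) \<Longrightarrow> (\<lambda>s. t(j := s)) \<in> measurable unit_interval (cube (insert j J))"
proof -
  assume "t \<in> space (cube J)"
  from measurable_compose[OF measurable_Pair1'[OF this] measurable_add_dim[of j J "\<lambda>_. unit_interval"]]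
  show ?thesis by simp
qed

lemma inorm_mono:
  assumes "\<And>j. j \<in> set js \<Longrightarrow> 0 < p j" "t \<in> space (cube J)"
    "\<And>t. t \<in> space (cube (J \<union> set js)) \<Longrightarrow> g t \<le> h t"
  shows "inorm p js g t \<le> inorm p js h t"
  using assms
proof (induction js arbitrary: t J)
  case (Cons j js)
  have "inorm p js g (t(j := s)) \<le> inorm p js h (t(j := s))" if "s \<in> {0..1}" for s
    using Cons.prems that
      by (intro Cons.IH[where J = "insert j J", OF _ upd_space_cube[OF Cons.prems(2) that]]) (simp_all del: fun_upd_apply)
  then show ?case
    using Cons.prems(1)[of j] by (auto intro!: ennreal_powr_mono nn_integral_mono)
qed simp

lemma measurable_upd_pair:
  "(\<lambda>((a, t), s). (a, t(j := s))) \<in> measurable ((M \<Otimes>\<^sub>M cube J) \<Otimes>\<^sub>M unit_interval) (M \<Otimes>\<^sub>M cube (insert j J))"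
proof -
  have [measurable]: "(\<lambda>(t, s). t(j := s)) \<in> measurable (cube J \<Otimes>\<^sub>M unit_interval) (cube (insert j J))"
    by (rule measurable_add_dim)
  have "(\<lambda>z. (snd (fst z), snd z)) \<in> measurable ((M \<Otimes>\<^sub>M cube J) \<Otimes>\<^sub>M unit_interval) (cube J \<Otimes>\<^sub>M unit_interval)"
    by measurable
  from measurable_compose[OF this measurable_add_dim]
  have [measurable]: "(\<lambda>z. (snd (fst z))(j := snd z)) \<in> measurable ((M \<Otimes>\<^sub>M cube J) \<Otimes>\<^sub>M unit_interval) (cube (insert j J))"
    by simp
  show ?thesis unfolding split_beta' by measurable
qed

lemma inorm_measurable:
  assumes "distinct js" "J \<inter> set js = {}" "(\<lambda>(a, t). g a t) \<in> borel_measurable (M \<Otimes>\<^sub>M cube (J \<union> set js))"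
  shows "(\<lambda>(a, t). inorm p js (g a) t) \<in> borel_measurable (M \<Otimes>\<^sub>M cube J)"
  using assms
proof (induction js arbitrary: J)
  case (Cons j js)
  have "(\<lambda>(a, t). inorm p js (g a) t) \<in> borel_measurable (M \<Otimes>\<^sub>M cube (insert j J))"
    using Cons.prems by (intro Cons.IH) auto
  from measurable_compose[OF measurable_upd_pair this]
  have [measurable]: "(\<lambda>z. inorm p js (g (fst (fst z))) ((snd (fst z))(j := snd z))) \<in> borel_measurable ((M \<Otimes>\<^sub>M cube J) \<Otimes>\<^sub>M unit_interval)"
    by (simp add: split_beta')
  have [measurable]: "(\<lambda>z. \<integral>\<^sup>+ s. ennreal_powr (inorm p js (g (fst z)) ((snd z)(j := s))) (p j) \<partial>unit_interval) \<in> borel_measurable (M \<Otimes>\<^sub>M cube J)"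
    by (rule unit_interval.borel_measurable_nn_integral) (simp add: split_beta')
  show ?case by (simp add: split_beta')
qed (simp add: split_beta')

lemma inorm_measurable1:
  assumes "distinct js" "J \<inter> set js = {}" "g \<in> borel_measurable (cube (J \<union> set js))"
  shows "inorm p js g \<in> borel_measurable (cube J)"
proof -
  have "(\<lambda>(a, t). g t) \<in> borel_measurable (count_space {()} \<Otimes>\<^sub>M cube (J \<union> set js))"
    using assms(3) by (simp add: split_beta')
  from inorm_measurable[OF assms(1,2) this, of p]
  have "(\<lambda>(a, t). inorm p js g t) \<in> borel_measurable (count_space {()} \<Otimes>\<^sub>M cube J)" .
  from measurable_compose[OF _ this, of "\<lambda>t. ((), t)" "cube J"] show ?thesis by simp
qed

lemma inorm_upd_measurable:
  assumes "distinct (j # js)" "J \<inter> set (j # js) = {}" "g \<in> borel_measurable (cube (J \<union> set (j # js)))"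
    "t \<in> space (cube J)"
  shows "(\<lambda>s. inorm p js g (t(j := s))) \<in> borel_measurable unit_interval"
proof -
  have [measurable]: "inorm p js g \<in> borel_measurable (cube (insert j J))"
    using assms by (intro inorm_measurable1) auto
  have "(\<lambda>s. t(j := s)) \<in> measurable unit_interval (cube (insert j J))"
    by (rule measurable_upd[OF assms(4)])
  then show ?thesis by (rule measurable_compose) measurable
qed

text \<open>
  Minkowski's integral inequality, applied in one variable after the other.
\<close>

lemma inorm_minkowski:
  assumes "distinct js" "J \<inter> set js = {}" "\<And>j. j \<in> set js \<Longrightarrow> 1 < p j"
    "(\<lambda>(a, t). u a t) \<in> borel_measurable (M \<Otimes>\<^sub>M cube (J \<union> set js))"
    "t \<in> space (cube J)" "sigma_finite_measure M"
  shows "inorm p js (\<lambda>t. \<integral>\<^sup>+ a. u a t \<partial>M) t \<le> (\<integral>\<^sup>+ a. inorm p js (u a) t \<partial>M)"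
  using assms(1-5)
proof (induction js arbitrary: J t)
  case (Cons j js)
  have pj: "1 < p j" "0 < p j" using Cons.prems(3)[of j] by auto
  have meas: "(\<lambda>(a, t). inorm p js (u a) t) \<in> borel_measurable (M \<Otimes>\<^sub>M cube (insert j J))"
    using Cons.prems by (intro inorm_measurable) auto
  have "(\<lambda>z. (fst z, t(j := snd z))) \<in> measurable (M \<Otimes>\<^sub>M unit_interval) (M \<Otimes>\<^sub>M cube (insert j J))"
  proof -
    have "(\<lambda>s. t(j := s)) \<in> measurable unit_interval (cube (insert j J))"
      by (rule measurable_upd[OF Cons.prems(5)])
    then show ?thesis by measurable
  qed
  from measurable_compose[OF this meas]
  have m: "(\<lambda>(a, s). inorm p js (u a) (t(j := s))) \<in> borel_measurable (M \<Otimes>\<^sub>M unit_interval)"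
    by (simp add: split_beta')
  have "inorm p js (\<lambda>t. \<integral>\<^sup>+ a. u a t \<partial>M) (t(j := s)) \<le> (\<integral>\<^sup>+ a. inorm p js (u a) (t(j := s)) \<partial>M)"
    if "s \<in> {0..1}" for s
    using Cons.prems that
      by (intro Cons.IH[where J = "insert j J", OF _ _ _ _ upd_space_cube[OF Cons.prems(5) that]]) (simp_all del: fun_upd_apply)
  then have "inorm p (j # js) (\<lambda>t. \<integral>\<^sup>+ a. u a t \<partial>M) t
     \<le> ennreal_powr (\<integral>\<^sup>+ s. ennreal_powr (\<integral>\<^sup>+ a. inorm p js (u a) (t(j := s)) \<partial>M) (p j) \<partial>unit_interval) (1 / p j)"
    using pj by (auto intro!: ennreal_powr_mono nn_integral_mono)
  also have "\<dots> \<le> (\<integral>\<^sup>+ a. inorm p (j # js) (u a) t \<partial>M)"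
    using minkowski_integral[OF pj(1) assms(6) unit_interval.sigma_finite_measure_axioms m] by simp
  finally show ?case .
qed simp

text \<open>
  Tonelli's theorem: the integral over the cube is the iterated norm with all exponents one. In this
  way all comparisons with the integral become comparisons of iterated norms.
\<close>

lemma nn_integral_cube_eq_inorm:
  assumes "distinct js" "J \<inter> set js = {}" "finite J" "g \<in> borel_measurable (cube (J \<union> set js))"
  shows "(\<integral>\<^sup>+ t. g t \<partial>cube (J \<union> set js)) = (\<integral>\<^sup>+ t. inorm (\<lambda>_. 1) js g t \<partial>cube J)"
  using assms
proof (induction js arbitrary: J)
  case (Cons j js)
  have "(\<integral>\<^sup>+ t. g t \<partial>cube (J \<union> set (j # js))) = (\<integral>\<^sup>+ t. inorm (\<lambda>_. 1) js g t \<partial>cube (insert j J))"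
    using Cons.IH[of "insert j J"] Cons.prems by simp
  also have "\<dots> = (\<integral>\<^sup>+ t. (\<integral>\<^sup>+ s. inorm (\<lambda>_. 1) js g (t(j := s)) \<partial>unit_interval) \<partial>cube J)"
    using Cons.prems by (intro cubes.product_nn_integral_insert inorm_measurable1) auto
  finally show ?case by simp
qed simp

lemma jensen_unit_interval:
  assumes p: "1 < p" and [measurable]: "x \<in> borel_measurable unit_interval"
  shows "(\<integral>\<^sup>+ s. x s \<partial>unit_interval) \<le> ennreal_powr (\<integral>\<^sup>+ s. ennreal_powr (x s) p \<partial>unit_interval) (1 / p)"
proof -
  have "ennreal_powr (\<integral>\<^sup>+ s. 1 * x s \<partial>unit_interval) p \<le> ennreal (1 powr (p - 1)) * (\<integral>\<^sup>+ s. 1 * ennreal_powr (x s) p \<partial>unit_interval)"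
    by (rule weighted_jensen[OF p]) (auto simp: emeasure_unit_interval_space)
  then have "ennreal_powr (ennreal_powr (\<integral>\<^sup>+ s. x s \<partial>unit_interval) p) (1 / p) \<le> ennreal_powr (\<integral>\<^sup>+ s. ennreal_powr (x s) p \<partial>unit_interval) (1 / p)"
    using p by (intro ennreal_powr_mono) auto
  then show ?thesis using p by (simp add: ennreal_powr_powr)
qed

lemma inorm_1_le:
  assumes "distinct js" "J \<inter> set js = {}" "\<And>j. j \<in> set js \<Longrightarrow> 1 < p j"
    "g \<in> borel_measurable (cube (J \<union> set js))" "t \<in> space (cube J)"
  shows "inorm (\<lambda>_. 1) js g t \<le> inorm p js g t"
  using assms
proof (induction js arbitrary: J t)
  case (Cons j js)
  have "inorm (\<lambda>_. 1) js g (t(j := s)) \<le> inorm p js g (t(j := s))" if "s \<in> {0..1}" for s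
    using Cons.prems that
      by (intro Cons.IH[where J = "insert j J", OF _ _ _ _ upd_space_cube[OF Cons.prems(5) that]]) (simp_all del: fun_upd_apply)
  then have "inorm (\<lambda>_. 1) (j # js) g t \<le> (\<integral>\<^sup>+ s. inorm p js g (t(j := s)) \<partial>unit_interval)"
    by (auto intro!: nn_integral_mono)
  also have "\<dots> \<le> inorm p (j # js) g t"
    using jensen_unit_interval[of "p j" "\<lambda>s. inorm p js g (t(j := s))"] Cons.prems inorm_upd_measurable[of j js J g t p]
    by simp
  finally show ?case .
qed simp

lemma inorm_1_zero:
  assumes "distinct js" "J \<inter> set js = {}" "\<And>j. j \<in> set js \<Longrightarrow> 0 < p j"
    "g \<in> borel_measurable (cube (J \<union> set js))" "t \<in> space (cube J)" "inorm (\<lambda>_. 1) js g t = 0"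
  shows "inorm p js g t = 0"
  using assms
proof (induction js arbitrary: J t)
  case (Cons j js)
  have [measurable]: "(\<lambda>s. inorm q js g (t(j := s))) \<in> borel_measurable unit_interval" for q
    using Cons.prems by (intro inorm_upd_measurable[of j js J]) auto
  have pj: "0 < p j" using Cons.prems(3) by simp
  have "AE s in unit_interval. inorm (\<lambda>_. 1) js g (t(j := s)) = 0"
    using Cons.prems(6) by (simp add: nn_integral_0_iff_AE)
  moreover have "AE s in unit_interval. s \<in> {0..1}" by (rule AE_I2) simp
  ultimately have "AE s in unit_interval. ennreal_powr (inorm p js g (t(j := s))) (p j) = 0"
  proof eventually_elim
    case (elim s)
    have "inorm p js g (t(j := s)) = 0"
      using Cons.prems elim
      by (intro Cons.IH[where J = "insert j J", OF _ _ _ _ upd_space_cube[OF Cons.prems(5) elim(2)]]) (simp_all del: fun_upd_apply)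
    then show ?case using pj by simp
  qed
  then have "(\<integral>\<^sup>+ s. ennreal_powr (inorm p js g (t(j := s))) (p j) \<partial>unit_interval) = 0"
    by (subst nn_integral_0_iff_AE) auto
  then show ?case using pj by simp
qed simp

text \<open>
  Dominated convergence, applied in one variable after the other.
\<close>

lemma inorm_tendsto_0:
  assumes "distinct js" "J \<inter> set js = {}" "\<And>j. j \<in> set js \<Longrightarrow> 0 < p j"
    "\<And>n. g n \<in> borel_measurable (cube (J \<union> set js))" "G \<in> borel_measurable (cube (J \<union> set js))"
    "\<And>n t. t \<in> space (cube (J \<union> set js)) \<Longrightarrow> g n t \<le> G t"
    "\<And>t. t \<in> space (cube (J \<union> set js)) \<Longrightarrow> G t < top \<Longrightarrow> (\<lambda>n. g n t) \<longlonglongrightarrow> 0"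
    "t \<in> space (cube J)" "inorm p js G t < top"
  shows "(\<lambda>n::nat. inorm p js (g n) t) \<longlonglongrightarrow> 0"
  using assms
proof (induction js arbitrary: J t)
  case (Cons j js)
  have [measurable]: "(\<lambda>s. inorm p js (g n) (t(j := s))) \<in> borel_measurable unit_interval"
    "(\<lambda>s. inorm p js G (t(j := s))) \<in> borel_measurable unit_interval" for n
    using Cons.prems by (auto intro!: inorm_upd_measurable[of j js J])
  have pj: "0 < p j" using Cons.prems(3) by simp
  have fin: "(\<integral>\<^sup>+ s. ennreal_powr (inorm p js G (t(j := s))) (p j) \<partial>unit_interval) < \<infinity>"
    using Cons.prems(9) by (simp add: ennreal_powr_lt_top)
  have sp: "AE s in unit_interval. s \<in> {0..1}" by (rule AE_I2) simp
  have "AE s in unit_interval. ennreal_powr (inorm p js G (t(j := s))) (p j) \<noteq> \<infinity>"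
    using fin by (intro nn_integral_PInf_AE) auto
  then have lim: "AE s in unit_interval. (\<lambda>n. ennreal_powr (inorm p js (g n) (t(j := s))) (p j)) \<longlonglongrightarrow> 0"
    using sp
  proof eventually_elim
    case (elim s)
    then have "inorm p js G (t(j := s)) < top" by (auto simp: ennreal_powr_eq_top less_top)
    then have "(\<lambda>n. inorm p js (g n) (t(j := s))) \<longlonglongrightarrow> 0"
      using Cons.prems elim(2)
      by (intro Cons.IH[where J = "insert j J", OF _ _ _ _ _ _ _ upd_space_cube[OF Cons.prems(8) elim(2)]]) (simp_all del: fun_upd_apply)
    then show ?case by (rule ennreal_powr_tendsto_0[OF pj])
  qed
  have le: "AE s in unit_interval. ennreal_powr (inorm p js (g n) (t(j := s))) (p j) \<le> ennreal_powr (inorm p js G (t(j := s))) (p j)" for n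
    using sp
  proof eventually_elim
    case (elim s)
    have "inorm p js (g n) (t(j := s)) \<le> inorm p js G (t(j := s))"
      using Cons.prems elim
      by (intro inorm_mono[where J = "insert j J", OF _ upd_space_cube[OF Cons.prems(8) elim]]) (simp_all del: fun_upd_apply)
    then show ?case using pj by (intro ennreal_powr_mono)
  qed
  have "(\<lambda>n. \<integral>\<^sup>+ s. ennreal_powr (inorm p js (g n) (t(j := s))) (p j) \<partial>unit_interval) \<longlonglongrightarrow> (\<integral>\<^sup>+ s. 0 \<partial>unit_interval)"
    by (rule nn_integral_dominated_convergence[OF _ _ _ le fin lim]) auto
  then show ?case using pj by (simp add: ennreal_powr_tendsto_0)
qed simp

lemma inorm_cmult:
  assumes "distinct js" "J \<inter> set js = {}" "\<And>j. j \<in> set js \<Longrightarrow> 0 < p j"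
    "g \<in> borel_measurable (cube (J \<union> set js))" "t \<in> space (cube J)"
  shows "inorm p js (\<lambda>t. c * g t) t = c * inorm p js g t"
  using assms
proof (induction js arbitrary: J t)
  case (Cons j js)
  have [measurable]: "(\<lambda>s. inorm p js g (t(j := s))) \<in> borel_measurable unit_interval"
    using Cons.prems by (intro inorm_upd_measurable[of j js J]) auto
  have pj: "0 < p j" using Cons.prems(3) by simp
  have "inorm p js (\<lambda>t. c * g t) (t(j := s)) = c * inorm p js g (t(j := s))" if "s \<in> {0..1}" for s
    using Cons.prems that
      by (intro Cons.IH[where J = "insert j J", OF _ _ _ _ upd_space_cube[OF Cons.prems(5) that]]) (simp_all del: fun_upd_apply)
  then have "(\<integral>\<^sup>+ s. ennreal_powr (inorm p js (\<lambda>t. c * g t) (t(j := s))) (p j) \<partial>unit_interval)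
     = (\<integral>\<^sup>+ s. ennreal_powr c (p j) * ennreal_powr (inorm p js g (t(j := s))) (p j) \<partial>unit_interval)"
    using pj by (intro nn_integral_cong) (simp add: ennreal_powr_mult)
  also have "\<dots> = ennreal_powr c (p j) * (\<integral>\<^sup>+ s. ennreal_powr (inorm p js g (t(j := s))) (p j) \<partial>unit_interval)"
    by (rule nn_integral_cmult) measurable
  finally show ?case using pj by (simp add: ennreal_powr_mult ennreal_powr_powr)
qed simp

lemma inorm_indep:
  assumes "j \<notin> set js" "\<And>t s. g (t(j := s)) = g t"
  shows "inorm p js g (t(j := s)) = inorm p js g t"
  using assms(1)
proof (induction js arbitrary: t)
  case (Cons i js)
  have "inorm p js g ((t(j := s))(i := r)) = inorm p js g (t(i := r))" for r
    using Cons.IH[of "t(i := r)"] Cons.prems by (simp add: fun_upd_twist del: fun_upd_apply)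
  then show ?case by (simp del: fun_upd_apply)
qed (use assms(2) in simp)

text \<open>
  Averaging over the variable \<open>j\<close> does not increase the iterated norm. The average moves out of the
  norms in the variables after \<open>j\<close> by Minkowski's inequality, is estimated by the norm in the variable
  \<open>j\<close> by Jensen's inequality, and the norms in the earlier variables are monotone.
\<close>

lemma inorm_average:
  assumes "distinct (js @ j # js')" "J \<inter> set (js @ j # js') = {}" "\<And>i. i \<in> set (js @ j # js') \<Longrightarrow> 1 < p i"
    "g \<in> borel_measurable (cube (J \<union> set (js @ j # js')))" "t \<in> space (cube J)"
  shows "inorm p (js @ j # js') (\<lambda>t. \<integral>\<^sup>+ s. g (t(j := s)) \<partial>unit_interval) t \<le> inorm p (js @ j # js') g t"
  using assms
proof (induction js arbitrary: J t)
  case Nil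
  have pj: "1 < p j" "0 < p j" using Nil.prems(3)[of j] by auto
  define A where "A t = (\<integral>\<^sup>+ s. g (t(j := s)) \<partial>unit_interval)" for t
  have A: "A (t(j := s)) = A t" for t s by (simp add: A_def)
  have "inorm p js' A (t(j := s)) = inorm p js' A t" for s
    using Nil.prems A by (intro inorm_indep) auto
  then have "inorm p (j # js') A t = inorm p js' A t"
    using pj emeasure_unit_interval_space by (simp add: ennreal_powr_powr)
  also have "\<dots> = inorm p js' A (t(j := 0))"
    using Nil.prems A by (intro inorm_indep[symmetric]) auto
  also have "\<dots> \<le> (\<integral>\<^sup>+ s. inorm p js' (\<lambda>t. g (t(j := s))) (t(j := 0)) \<partial>unit_interval)"
    unfolding A_def
  proof (rule inorm_minkowski[where J = "insert j J"])
    have g: "g \<in> borel_measurable (cube (insert j (J \<union> set (j # js'))))" using Nil.prems by (simp add: insert_absorb)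
    have "(\<lambda>z. (snd z, fst z)) \<in> measurable (unit_interval \<Otimes>\<^sub>M cube (J \<union> set (j # js'))) (cube (J \<union> set (j # js')) \<Otimes>\<^sub>M unit_interval)"
      by measurable
    from measurable_compose[OF this measurable_compose[OF measurable_add_dim g]]
    show "(\<lambda>(s, t). g (t(j := s))) \<in> borel_measurable (unit_interval \<Otimes>\<^sub>M cube (insert j J \<union> set js'))"
      by (simp add: split_beta')
    show "t(j := 0) \<in> space (cube (insert j J))" using Nil.prems by (intro upd_space_cube) auto
    show "sigma_finite_measure unit_interval" by (rule unit_interval.sigma_finite_measure_axioms)
  qed (use Nil.prems in auto)
  also have "\<dots> = (\<integral>\<^sup>+ s. inorm p js' g (t(j := s)) \<partial>unit_interval)"
  proof -
    have "inorm p js (\<lambda>t. g (t(j := s))) t = inorm p js g (t(j := s))" if "j \<notin> set js" for js s t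
      using that
    proof (induction js arbitrary: t)
      case (Cons i js)
      have "inorm p js (\<lambda>t. g (t(j := s))) (t(i := r)) = inorm p js g ((t(j := s))(i := r))" for r
        using Cons.IH[of "t(i := r)"] Cons.prems by (simp add: fun_upd_twist del: fun_upd_apply)
      then show ?case by (simp del: fun_upd_apply)
    qed simp
    from this[of js' _ "t(j := 0)"] show ?thesis using Nil.prems by simp
  qed
  also have "\<dots> \<le> inorm p (j # js') g t"
    using jensen_unit_interval[of "p j" "\<lambda>s. inorm p js' g (t(j := s))"] Nil.prems inorm_upd_measurable[of j js' J g t p]
    by simp
  finally show ?case by (simp add: A_def[abs_def] del: fun_upd_apply)
next
  case (Cons i js)
  let ?A = "\<lambda>t. \<integral>\<^sup>+ s. g (t(j := s)) \<partial>unit_interval"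
  have "inorm p (js @ j # js') ?A (t(i := s)) \<le> inorm p (js @ j # js') g (t(i := s))" if "s \<in> {0..1}" for s
    using Cons.prems that
      by (intro Cons.IH[where J = "insert i J", OF _ _ _ _ upd_space_cube[OF Cons.prems(5) that]])
        (simp_all add: insert_commute del: fun_upd_apply)
  moreover have "0 < p i" using Cons.prems(3)[of i] by simp
  ultimately show ?case by (auto intro!: ennreal_powr_mono nn_integral_mono simp del: fun_upd_apply)
qed

section \<open>The mixed norm space and its subspace of vanishing marginals\<close>

locale mixed =
  fixes d :: nat and p :: "nat \<Rightarrow> real"
  assumes d: "1 \<le> d" and p: "\<And>i. i \<in> {1..d} \<Longrightarrow> 1 < p i"
begin

definition Ix :: "nat set" where "Ix = {1..d}"

abbreviation "Q \<equiv> cube Ix"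
abbreviation "X \<equiv> mixed_Lp0 d p"
abbreviation "L \<equiv> mixed_Lp d p"
abbreviation "N \<equiv> mixed_norm d p"

definition js :: "nat list" where "js = [1..<Suc d]"

text \<open>
  No coordinate is left as a parameter, so the iterated norm is taken at the only point of the empty cube.
\<close>

definition En :: "((nat \<Rightarrow> real) \<Rightarrow> ennreal) \<Rightarrow> ennreal" where
  "En g = inorm p js g (\<lambda>_. undefined)"

lemma finite_Ix [simp]: "finite Ix" by (simp add: Ix_def)

lemma js_facts: "distinct js" "{} \<inter> set js = {}"
  "\<And>j. j \<in> set js \<Longrightarrow> 1 < p j" "\<And>j. j \<in> set js \<Longrightarrow> 0 < p j"
  "(\<lambda>_. undefined) \<in> space (cube {})" and set_js: "{} \<union> set js = Ix" "set js = Ix"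
proof -
  show s: "set js = Ix" by (auto simp: js_def Ix_def)
  show "1 < p j" "0 < p j" if "j \<in> set js" for j using p[of j] that unfolding s Ix_def by auto
qed (auto simp: js_def space_PiM Ix_def)

lemma En_mono: "(\<And>t. t \<in> space Q \<Longrightarrow> g t \<le> h t) \<Longrightarrow> En g \<le> En h"
  unfolding En_def by (rule inorm_mono[OF js_facts(4,5)]) (simp_all add: set_js)

lemma En_minkowski:
  assumes "(\<lambda>(a, t). u a t) \<in> borel_measurable (M \<Otimes>\<^sub>M Q)" "sigma_finite_measure M"
  shows "En (\<lambda>t. \<integral>\<^sup>+ a. u a t \<partial>M) \<le> (\<integral>\<^sup>+ a. En (u a) \<partial>M)"
  unfolding En_def using assms js_facts
  by (intro inorm_minkowski[where J = "{}"]) (simp_all add: set_js)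

lemma En_suminf:
  assumes "\<And>n::nat. g n \<in> borel_measurable Q"
  shows "En (\<lambda>t. \<Sum>n. g n t) \<le> (\<Sum>n. En (g n))"
proof -
  have "(\<lambda>(n, t). g n t) \<in> borel_measurable (count_space UNIV \<Otimes>\<^sub>M Q)"
    using assms by (intro measurable_pair_measure_countable1) auto
  from En_minkowski[OF this sigma_finite_measure_count_space]
  show ?thesis by (simp add: nn_integral_count_space_nat)
qed

lemma En_add:
  assumes "g \<in> borel_measurable Q" "h \<in> borel_measurable Q"
  shows "En (\<lambda>t. g t + h t) \<le> En g + En h"
proof -
  have "(\<lambda>(b, t). (if b then g else h) t) \<in> borel_measurable (count_space (UNIV::bool set) \<Otimes>\<^sub>M Q)"
    using assms by (intro measurable_pair_measure_countable1) auto
  from En_minkowski[OF this sigma_finite_measure_count_space]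
  show ?thesis by (simp add: nn_integral_count_space_finite UNIV_bool add.commute)
qed

lemma En_cmult: "g \<in> borel_measurable Q \<Longrightarrow> En (\<lambda>t. c * g t) = c * En g"
  unfolding En_def using js_facts
  by (intro inorm_cmult[where J = "{}"]) (simp_all add: set_js)

lemma nn_integral_le_En:
  assumes "g \<in> borel_measurable Q"
  shows "(\<integral>\<^sup>+ t. g t \<partial>Q) \<le> En g"
proof -
  have "(\<integral>\<^sup>+ t. g t \<partial>Q) = (\<integral>\<^sup>+ t. inorm (\<lambda>_. 1) js g t \<partial>cube {})"
    using nn_integral_cube_eq_inorm[OF js_facts(1,2), of g] assms unfolding set_js by simp
  also have "\<dots> = inorm (\<lambda>_. 1) js g (\<lambda>_. undefined)"
    by (rule cubes.nn_integral_empty) simp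
  also have "\<dots> \<le> En g"
    unfolding En_def using js_facts assms
    by (intro inorm_1_le[where J = "{}"]) (simp_all add: set_js)
  finally show ?thesis .
qed

lemma En_zero:
  assumes "g \<in> borel_measurable Q" "AE t in Q. g t = 0"
  shows "En g = 0"
proof -
  have "(\<integral>\<^sup>+ t. g t \<partial>Q) = (\<integral>\<^sup>+ t. inorm (\<lambda>_. 1) js g t \<partial>cube {})"
    using nn_integral_cube_eq_inorm[OF js_facts(1,2), of g] assms unfolding set_js by simp
  also have "\<dots> = inorm (\<lambda>_. 1) js g (\<lambda>_. undefined)"
    by (rule cubes.nn_integral_empty) simp
  finally have z: "inorm (\<lambda>_. 1) js g (\<lambda>_. undefined) = 0"
    using assms nn_integral_0_iff_AE[of g Q] by simp
  show ?thesis
    unfolding En_def by (rule inorm_1_zero[OF js_facts(1,2,4) _ js_facts(5) z]) (simp_all add: set_js assms(1))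
qed

lemma En_tendsto_0:
  assumes "\<And>n. g n \<in> borel_measurable Q" "G \<in> borel_measurable Q"
    "\<And>n t. t \<in> space Q \<Longrightarrow> g n t \<le> G t"
    "\<And>t. t \<in> space Q \<Longrightarrow> G t < top \<Longrightarrow> (\<lambda>n. g n t) \<longlonglongrightarrow> 0" "En G < top"
  shows "(\<lambda>n::nat. En (g n)) \<longlonglongrightarrow> 0"
  unfolding En_def using js_facts assms(5)
  by (intro inorm_tendsto_0[where J = "{}" and G = G]; (simp add: set_js En_def assms)?)

lemma En_average:
  assumes j: "j \<in> Ix" and g: "g \<in> borel_measurable Q"
  shows "En (\<lambda>t. \<integral>\<^sup>+ s. g (t(j := s)) \<partial>unit_interval) \<le> En g"
proof -
  have e: "js = [1..<j] @ j # [Suc j..<Suc d]"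
    using j upt_add_eq_append[of 1 j "Suc d - j"] by (simp add: js_def Ix_def upt_conv_Cons del: upt_Suc)
  show ?thesis
    using inorm_average[of "[1..<j]" j "[Suc j..<Suc d]" "{}" p g "\<lambda>_. undefined"] js_facts g
    unfolding En_def e[symmetric] set_js by simp
qed

lemma mixed_ennorm_eq: "mixed_ennorm d p f = En (\<lambda>t. ennreal \<bar>f t\<bar>)"
  unfolding mixed_ennorm_def En_def js_def by (rule iterated_norm_eq)

lemma Lp_iff: "f \<in> L \<longleftrightarrow> f \<in> borel_measurable Q \<and> En (\<lambda>t. ennreal \<bar>f t\<bar>) < top"
  by (simp add: mixed_Lp_def mixed_ennorm_eq Ix_def)

lemma Lp_measurable: "f \<in> L \<Longrightarrow> f \<in> borel_measurable Q"
  by (simp add: Lp_iff)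

lemma ennreal_N: "f \<in> L \<Longrightarrow> ennreal (N f) = En (\<lambda>t. ennreal \<bar>f t\<bar>)"
  by (simp add: mixed_norm_def Lp_iff mixed_ennorm_eq)

lemma N_leI: "f \<in> borel_measurable Q \<Longrightarrow> 0 \<le> c \<Longrightarrow> En (\<lambda>t. ennreal \<bar>f t\<bar>) \<le> ennreal c \<Longrightarrow> f \<in> L \<and> N f \<le> c"
  unfolding Lp_iff mixed_norm_def mixed_ennorm_eq
  using enn2real_leI le_less_trans ennreal_less_top by blast

lemma N_le: "0 \<le> c \<Longrightarrow> En (\<lambda>t. ennreal \<bar>f t\<bar>) \<le> ennreal c \<Longrightarrow> N f \<le> c"
  unfolding mixed_norm_def mixed_ennorm_eq by (rule enn2real_leI)

lemma N_nn: "0 \<le> N f"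
  by (simp add: mixed_norm_def)

lemma En_abs_add:
  assumes [measurable]: "f \<in> borel_measurable Q" "g \<in> borel_measurable Q"
  shows "En (\<lambda>t. ennreal \<bar>f t + g t\<bar>) \<le> En (\<lambda>t. ennreal \<bar>f t\<bar>) + En (\<lambda>t. ennreal \<bar>g t\<bar>)"
proof -
  have "En (\<lambda>t. ennreal \<bar>f t + g t\<bar>) \<le> En (\<lambda>t. ennreal \<bar>f t\<bar> + ennreal \<bar>g t\<bar>)"
    by (intro En_mono) (simp add: ennreal_plus[symmetric] abs_triangle_ineq ennreal_leI del: ennreal_plus)
  also have "\<dots> \<le> En (\<lambda>t. ennreal \<bar>f t\<bar>) + En (\<lambda>t. ennreal \<bar>g t\<bar>)"
    by (rule En_add) measurable
  finally show ?thesis .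
qed

lemma En_abs_scale:
  assumes [measurable]: "f \<in> borel_measurable Q"
  shows "En (\<lambda>t. ennreal \<bar>c * f t\<bar>) = ennreal \<bar>c\<bar> * En (\<lambda>t. ennreal \<bar>f t\<bar>)"
  by (subst En_cmult[symmetric]) (auto simp: ennreal_mult abs_mult)

lemma Lp_add: "f \<in> L \<Longrightarrow> g \<in> L \<Longrightarrow> f + g \<in> L \<and> N (f + g) \<le> N f + N g"
proof (rule N_leI)
  assume f: "f \<in> L" and g: "g \<in> L"
  note [measurable] = Lp_measurable[OF f] Lp_measurable[OF g]
  show "f + g \<in> borel_measurable Q"
    unfolding plus_fun_def using Lp_measurable[OF f] Lp_measurable[OF g] by (rule borel_measurable_add)
  show "En (\<lambda>t. ennreal \<bar>(f + g) t\<bar>) \<le> ennreal (N f + N g)"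
    using En_abs_add[of f g] f g by (simp add: ennreal_plus N_nn ennreal_N)
qed (simp add: N_nn)

lemma Lp_scale: "f \<in> L \<Longrightarrow> c *\<^sub>R f \<in> L \<and> N (c *\<^sub>R f) = \<bar>c\<bar> * N f"
proof -
  assume f: "f \<in> L"
  note [measurable] = Lp_measurable[OF f]
  have e: "En (\<lambda>t. ennreal \<bar>(c *\<^sub>R f) t\<bar>) = ennreal (\<bar>c\<bar> * N f)"
    using En_abs_scale[of f c] f by (simp add: scaleR_fun_def ennreal_mult N_nn ennreal_N)
  have "c *\<^sub>R f \<in> L" unfolding Lp_iff e by (simp add: scaleR_fun_def)
  moreover have "N (c *\<^sub>R f) = \<bar>c\<bar> * N f"
    unfolding mixed_norm_def mixed_ennorm_eq e by (simp add: mixed_norm_def[symmetric] mixed_ennorm_eq[symmetric] N_nn)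
  ultimately show ?thesis by blast
qed

lemma subspace_L: "subspace L"
proof (rule subspaceI)
  have "En (\<lambda>t. 0) = 0" by (rule En_zero) auto
  then show "0 \<in> L" by (simp add: Lp_iff zero_fun_def)
qed (use Lp_add Lp_scale in auto)

lemma seminormed_L: "seminormed_subspace L N"
  by unfold_locales (use subspace_L Lp_add Lp_scale N_nn in auto)

interpretation Lp: seminormed_subspace L N by (rule seminormed_L)

lemma Lp_diff: "f \<in> L \<Longrightarrow> g \<in> L \<Longrightarrow> f - g \<in> L"
  by (rule subspace_diff[OF subspace_L])

lemma nn_integral_le_N: "f \<in> L \<Longrightarrow> (\<integral>\<^sup>+ t. ennreal \<bar>f t\<bar> \<partial>Q) \<le> ennreal (N f)"
  using nn_integral_le_En[of "\<lambda>t. ennreal \<bar>f t\<bar>"] Lp_measurable[of f] by (simp add: ennreal_N)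

lemma N_AE_0: "f \<in> borel_measurable Q \<Longrightarrow> AE t in Q. f t = 0 \<Longrightarrow> f \<in> L \<and> N f = 0"
  using En_zero[of "\<lambda>t. ennreal \<bar>f t\<bar>"] by (simp add: Lp_iff mixed_norm_def mixed_ennorm_eq)

text \<open>
  At points where the increments are not summable the limit has a default value, but there the
  right-hand side is infinite. Hence the estimate needs no exceptional set.
\<close>

lemma tail_bound:
  fixes v :: "nat \<Rightarrow> real"
  defines "g \<equiv> \<lambda>k. ennreal \<bar>v (Suc k) - v k\<bar>"
  shows "ennreal \<bar>lim (\<lambda>m. if (\<Sum>i. g i) < top then v m else 0) - v k\<bar> \<le> (\<Sum>i. g (i + k))"
proof (cases "(\<Sum>i. g i) < top")
  case False
  have "(\<Sum>i. g i) = (\<Sum>i. g (i + k)) + (\<Sum>i<k. g i)"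
    by (rule suminf_offset) simp
  moreover have "(\<Sum>i<k. g i) < top" by (simp add: g_def)
  ultimately have "(\<Sum>i. g (i + k)) = top" using False by (simp add: less_top[symmetric])
  then show ?thesis by simp
next
  case True
  have s: "summable (\<lambda>i. \<bar>v (Suc i) - v i\<bar>)"
    using True by (intro summable_suminf_not_top) (auto simp: g_def)
  then have "summable (\<lambda>i. v (Suc i) - v i)" by (rule summable_rabs_cancel)
  then have "convergent (\<lambda>n. v n - v 0)"
    by (simp add: summable_iff_convergent sum_lessThan_telescope)
  then have "convergent (\<lambda>n. (v n - v 0) + v 0)" by (intro convergent_add convergent_const)
  then have "convergent v" by simp
  then have l: "v \<longlonglongrightarrow> lim v" by (simp add: convergent_LIMSEQ_iff)
  define S where "S = (\<Sum>i. \<bar>v (Suc (i + k)) - v (i + k)\<bar>)"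
  have s': "summable (\<lambda>i. \<bar>v (Suc (i + k)) - v (i + k)\<bar>)"
    using summable_ignore_initial_segment[OF s, of k] by simp
  have "\<bar>v (m + k) - v k\<bar> \<le> S" for m
  proof -
    have "v (m + k) - v k = (\<Sum>i<m. v (Suc (i + k)) - v (i + k))"
      using sum_lessThan_telescope[of "\<lambda>i. v (i + k)" m] by simp
    also have "\<bar>\<dots>\<bar> \<le> (\<Sum>i<m. \<bar>v (Suc (i + k)) - v (i + k)\<bar>)" by (rule sum_abs)
    also have "\<dots> \<le> S" unfolding S_def by (intro sum_le_suminf s') auto
    finally show ?thesis .
  qed
  moreover have "(\<lambda>m. \<bar>v (m + k) - v k\<bar>) \<longlonglongrightarrow> \<bar>lim v - v k\<bar>"
    by (intro tendsto_intros LIMSEQ_ignore_initial_segment l)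
  ultimately have "\<bar>lim v - v k\<bar> \<le> S" by (intro LIMSEQ_le_const2) auto
  then have "ennreal \<bar>lim v - v k\<bar> \<le> ennreal S" by (rule ennreal_leI)
  also have "ennreal S = (\<Sum>i. g (i + k))"
    unfolding S_def g_def using s' by (intro suminf_ennreal2[symmetric]) auto
  finally show ?thesis using True by simp
qed

text \<open>
  As in the Riesz-Fischer theorem: along a rapidly converging subsequence the increments have finite
  total norm, so that the pointwise limit exists almost everywhere and the tails of the increments
  bound its distance.
\<close>

lemma complete_L:
  assumes u: "\<And>n. u n \<in> L" and cauchy: "\<forall>\<epsilon>>0. \<exists>M. \<forall>m\<ge>M. \<forall>n\<ge>M. N (u m - u n) < \<epsilon>"
  shows "\<exists>f\<in>L. (\<lambda>n. N (u n - f)) \<longlonglongrightarrow> 0"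
proof -
  have "\<forall>k. \<exists>M. \<forall>m\<ge>M. \<forall>n\<ge>M. N (u m - u n) < (1/2) ^ k" using cauchy by simp
  then obtain M where M: "\<And>k m n. M k \<le> m \<Longrightarrow> M k \<le> n \<Longrightarrow> N (u m - u n) < (1/2) ^ k" by metis
  define \<phi> where "\<phi> k = (\<Sum>i\<le>k. M i)" for k
  have \<phi>: "M k \<le> \<phi> k" "M k \<le> \<phi> (Suc k)" for k
    by (auto simp: \<phi>_def intro: member_le_sum trans_le_add1)
  define v where "v k = u (\<phi> k)" for k
  define g where "g k t = ennreal \<bar>v (Suc k) t - v k t\<bar>" for k t
  define f where "f t = lim (\<lambda>k. if (\<Sum>i. g i t) < top then v k t else 0)" for t
  have vL: "v k \<in> L" for k using u by (simp add: v_def)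
  note [measurable] = Lp_measurable[OF vL]
  have [measurable]: "g k \<in> borel_measurable Q" for k unfolding g_def by measurable
  have [measurable]: "f \<in> borel_measurable Q" unfolding f_def by measurable
  have gk: "En (g k) \<le> ennreal ((1/2) ^ k)" for k
  proof -
    have "En (g k) = ennreal (N (v (Suc k) - v k))"
      using ennreal_N[OF Lp_diff[OF vL vL], of "Suc k" k] by (simp add: g_def[abs_def])
    also have "\<dots> \<le> ennreal ((1/2) ^ k)" using M[OF \<phi>(2,1), of k] by (intro ennreal_leI) (simp add: v_def)
    finally show ?thesis .
  qed
  have fv: "f - v k \<in> L \<and> N (f - v k) \<le> 2 * (1/2) ^ k" for k
  proof (rule N_leI)
    show "f - v k \<in> borel_measurable Q"
      unfolding fun_diff_def by (rule borel_measurable_diff) measurable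
    have "En (\<lambda>t. ennreal \<bar>(f - v k) t\<bar>) \<le> En (\<lambda>t. \<Sum>i. g (i + k) t)"
      unfolding f_def g_def using tail_bound[of "\<lambda>k. v k _"] by (intro En_mono) simp
    also have "\<dots> \<le> (\<Sum>i. En (g (i + k)))" by (rule En_suminf) measurable
    also have "\<dots> \<le> (\<Sum>i. ennreal ((1/2) ^ (i + k)))" by (intro suminf_le gk) auto
    also have "\<dots> = ennreal (\<Sum>i. (1/2) ^ (i + k))"
      by (intro suminf_ennreal2) (auto simp: power_add intro!: summable_mult2 summable_geometric)
    also have "(\<Sum>i. (1/2::real) ^ (i + k)) = 2 * (1/2) ^ k"
      by (simp add: power_add suminf_mult2[symmetric] suminf_geometric summable_geometric)
    finally show "En (\<lambda>t. ennreal \<bar>(f - v k) t\<bar>) \<le> ennreal (2 * (1/2) ^ k)" .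
  qed simp
  have fL: "f \<in> L" using subspace_add[OF subspace_L, of "f - v 0" "v 0"] fv[of 0] vL by simp
  have "(\<lambda>n. N (u n - f)) \<longlonglongrightarrow> 0"
  proof (rule LIMSEQ_I)
    fix \<epsilon> :: real assume "0 < \<epsilon>"
    have "(\<lambda>k. 3 * (1/2) ^ k) \<longlonglongrightarrow> 3 * (0::real)" by (intro tendsto_intros LIMSEQ_power_zero) auto
    then have "eventually (\<lambda>k. 3 * (1/2::real) ^ k < \<epsilon>) sequentially"
      by (rule order_tendstoD(2)) (use \<open>0 < \<epsilon>\<close> in simp)
    then obtain k where k: "3 * (1/2::real) ^ k < \<epsilon>" by (auto simp: eventually_sequentially)
    have "norm (N (u n - f) - 0) < \<epsilon>" if "\<phi> k \<le> n" for n
    proof -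
      have "M k \<le> n" using \<phi>(1)[of k] that by simp
      then have "N (u n - v k) < (1/2) ^ k" unfolding v_def using M \<phi>(1) by blast
      moreover have "N (v k - f) \<le> 2 * (1/2) ^ k"
        using fv[of k] Lp.N_minus_commute[OF vL fL, of k] by simp
      moreover have "N (u n - f) \<le> N (u n - v k) + N (v k - f)" by (rule Lp.N_triangle[OF u vL fL])
      ultimately show ?thesis using k N_nn[of "u n - f"] by simp
    qed
    then show "\<exists>n0. \<forall>n\<ge>n0. norm (N (u n - f) - 0) < \<epsilon>" by blast
  qed
  with fL show ?thesis by blast
qed

text \<open>
  The marginal in the variable \<open>j\<close>, extended to all points as a function that does not depend on the
  \<open>j\<close>-th coordinate.
\<close>

definition Av :: "nat \<Rightarrow> ((nat \<Rightarrow> real) \<Rightarrow> real) \<Rightarrow> (nat \<Rightarrow> real) \<Rightarrow> real" where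
  "Av j f t = (\<integral>s. f (t(j := s)) \<partial>unit_interval)"

lemma X_iff: "f \<in> X \<longleftrightarrow> f \<in> L \<and> (\<forall>j\<in>Ix. AE t in cube (Ix - {j}). Av j f t = 0)"
  unfolding mixed_Lp0_def Av_def Ix_def by simp

lemma insert_del: "j \<in> Ix \<Longrightarrow> insert j (Ix - {j}) = Ix"
  by auto

lemma slice_measurable:
  assumes "j \<in> Ix" "f \<in> borel_measurable Q" "t \<in> space (cube (Ix - {j}))"
  shows "(\<lambda>s. f (t(j := s))) \<in> borel_measurable unit_interval"
  using measurable_compose[OF measurable_upd[OF assms(3), of j], of f borel] assms(1,2) insert_del by simp

lemma slice_pair_measurable:
  assumes "j \<in> Ix" "f \<in> borel_measurable Q"
  shows "(\<lambda>(t, s). f (t(j := s))) \<in> borel_measurable (cube (Ix - {j}) \<Otimes>\<^sub>M unit_interval)"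
  using measurable_compose[OF measurable_add_dim[of j "Ix - {j}" "\<lambda>_. unit_interval"], of f borel] assms insert_del
  by (simp add: split_beta')

lemma nn_integral_slice:
  assumes j: "j \<in> Ix" and g: "g \<in> borel_measurable Q"
  shows "(\<integral>\<^sup>+ t. g t \<partial>Q) = (\<integral>\<^sup>+ t. (\<integral>\<^sup>+ s. g (t(j := s)) \<partial>unit_interval) \<partial>cube (Ix - {j}))"
  using cubes.product_nn_integral_insert[of "Ix - {j}" j g] g insert_del[OF j] by simp

lemma slice_integrable:
  assumes j: "j \<in> Ix" and f: "f \<in> L"
  shows "AE t in cube (Ix - {j}). integrable unit_interval (\<lambda>s. f (t(j := s)))"
proof -
  note [measurable] = Lp_measurable[OF f]
  let ?C = "cube (Ix - {j})"
  have [measurable]: "(\<lambda>t. \<integral>\<^sup>+ s. ennreal \<bar>f (t(j := s))\<bar> \<partial>unit_interval) \<in> borel_measurable ?C"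
    using slice_pair_measurable[OF j, of "\<lambda>t. f t"] Lp_measurable[OF f]
    by (intro unit_interval.borel_measurable_nn_integral) (simp add: split_beta')
  have "(\<integral>\<^sup>+ t. (\<integral>\<^sup>+ s. ennreal \<bar>f (t(j := s))\<bar> \<partial>unit_interval) \<partial>?C) = (\<integral>\<^sup>+ t. ennreal \<bar>f t\<bar> \<partial>Q)"
    by (rule nn_integral_slice[OF j, symmetric]) measurable
  also have "\<dots> \<noteq> \<infinity>" using nn_integral_le_N[OF f] by (auto simp: top_unique)
  finally have "AE t in ?C. (\<integral>\<^sup>+ s. ennreal \<bar>f (t(j := s))\<bar> \<partial>unit_interval) \<noteq> \<infinity>"
    by (intro nn_integral_PInf_AE) auto
  moreover have "AE t in ?C. t \<in> space ?C" by (rule AE_I2)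
  ultimately show ?thesis
  proof eventually_elim
    case (elim t)
    then show ?case
      using slice_measurable[OF j Lp_measurable[OF f] elim(2)]
      by (intro integrableI_bounded) (auto simp: less_top)
  qed
qed

lemma Av_measurable:
  assumes "j \<in> Ix" "f \<in> borel_measurable Q"
  shows "Av j f \<in> borel_measurable (cube (Ix - {j}))"
  unfolding Av_def using slice_pair_measurable[OF assms]
  by (intro unit_interval.borel_measurable_lebesgue_integral)

text \<open>
  Subtracting a function with vanishing marginal does not change the marginal.
\<close>

lemma Av_diff_bound:
  assumes j: "j \<in> Ix" and f: "f \<in> L" and g: "g \<in> L" and 0: "AE t in cube (Ix - {j}). Av j g t = 0"
  shows "AE t in cube (Ix - {j}). ennreal \<bar>Av j f t\<bar> \<le> (\<integral>\<^sup>+ s. ennreal \<bar>(f - g) (t(j := s))\<bar> \<partial>unit_interval)"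
  using slice_integrable[OF j f] slice_integrable[OF j g] 0
proof eventually_elim
  case (elim t)
  have "Av j f t = (\<integral>s. f (t(j := s)) \<partial>unit_interval) - (\<integral>s. g (t(j := s)) \<partial>unit_interval)"
    using elim(3) by (simp add: Av_def)
  also have "\<dots> = (\<integral>s. (f - g) (t(j := s)) \<partial>unit_interval)"
    using elim(1,2) by simp
  finally have "ennreal \<bar>Av j f t\<bar> = ennreal (norm (\<integral>s. (f - g) (t(j := s)) \<partial>unit_interval))" by simp
  also have "\<dots> \<le> (\<integral>\<^sup>+ s. ennreal (norm ((f - g) (t(j := s)))) \<partial>unit_interval)"
    using elim(1,2) by (intro integral_norm_bound_ennreal) simp
  finally show ?case by simp
qed

text \<open>
  Marginals are bounded in the integral norm by the mixed norm of the difference to any function with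
  vanishing marginal.
\<close>

lemma X_closed:
  assumes f: "f \<in> L" and g: "\<And>n. g n \<in> X" and lim: "(\<lambda>n. N (g n - f)) \<longlonglongrightarrow> 0"
  shows "f \<in> X"
  unfolding X_iff
proof (intro conjI f ballI)
  fix j assume j: "j \<in> Ix"
  let ?C = "cube (Ix - {j})"
  have [measurable]: "Av j f \<in> borel_measurable ?C" by (rule Av_measurable[OF j Lp_measurable[OF f]])
  have "(\<integral>\<^sup>+ t. ennreal \<bar>Av j f t\<bar> \<partial>?C) \<le> ennreal (N (g n - f))" for n
  proof -
    have gL: "g n \<in> L" and 0: "AE t in ?C. Av j (g n) t = 0" using g[of n] j by (auto simp: X_iff)
    note [measurable] = Lp_measurable[OF Lp_diff[OF f gL]]
    have "(\<integral>\<^sup>+ t. ennreal \<bar>Av j f t\<bar> \<partial>?C) \<le> (\<integral>\<^sup>+ t. (\<integral>\<^sup>+ s. ennreal \<bar>(f - g n) (t(j := s))\<bar> \<partial>unit_interval) \<partial>?C)"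
      by (rule nn_integral_mono_AE[OF Av_diff_bound[OF j f gL 0]])
    also have "\<dots> = (\<integral>\<^sup>+ t. ennreal \<bar>(f - g n) t\<bar> \<partial>Q)"
      by (rule nn_integral_slice[OF j, symmetric]) measurable
    also have "\<dots> \<le> ennreal (N (f - g n))" by (rule nn_integral_le_N[OF Lp_diff[OF f gL]])
    finally show ?thesis using Lp.N_minus_commute[OF f gL] by simp
  qed
  moreover have "(\<lambda>n. ennreal (N (g n - f))) \<longlonglongrightarrow> ennreal 0" by (intro tendsto_ennrealI lim)
  ultimately have "(\<integral>\<^sup>+ t. ennreal \<bar>Av j f t\<bar> \<partial>?C) \<le> ennreal 0" by (intro LIMSEQ_le_const) auto
  then have "(\<integral>\<^sup>+ t. ennreal \<bar>Av j f t\<bar> \<partial>?C) = 0" by simp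
  then show "AE t in ?C. Av j f t = 0" by (subst (asm) nn_integral_0_iff_AE) auto
qed

lemma subspace_X: "subspace X"
proof (rule subspaceI)
  show "0 \<in> X" using subspace_0[OF subspace_L] by (simp add: X_iff Av_def)
next
  fix f g assume f: "f \<in> X" and g: "g \<in> X"
  have "AE t in cube (Ix - {j}). Av j (f + g) t = 0" if j: "j \<in> Ix" for j
  proof -
    have "AE t in cube (Ix - {j}). Av j f t = 0" "AE t in cube (Ix - {j}). Av j g t = 0"
      using f g j by (auto simp: X_iff)
    moreover have "f \<in> L" "g \<in> L" using f g by (auto simp: X_iff)
    note slice_integrable[OF j this(1)] slice_integrable[OF j this(2)]
    ultimately show ?thesis
    proof eventually_elim
      case (elim t)
      then show ?case by (simp add: Av_def)
    qed
  qed
  then show "f + g \<in> X" using f g subspace_add[OF subspace_L] by (simp add: X_iff)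
next
  fix c f assume f: "f \<in> X"
  then show "c *\<^sub>R f \<in> X"
    using subspace_scale[OF subspace_L, of f c] by (auto simp: X_iff Av_def scaleR_fun_def)
qed

lemma X_sub_L: "f \<in> X \<Longrightarrow> f \<in> L"
  by (simp add: X_iff)

lemma banach_on_X: "banach_on X N"
  unfolding banach_on_def
proof (intro conjI allI impI ballI subspace_X N_nn)
  fix u :: "nat \<Rightarrow> (nat \<Rightarrow> real) \<Rightarrow> real"
  assume u: "(\<forall>n. u n \<in> X) \<and> (\<forall>\<epsilon>>0. \<exists>M. \<forall>m\<ge>M. \<forall>n\<ge>M. N (u m - u n) < \<epsilon>)"
  then obtain f where "f \<in> L" "(\<lambda>n. N (u n - f)) \<longlonglongrightarrow> 0"
    using complete_L[of u] X_sub_L by blast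
  then show "\<exists>f\<in>X. (\<lambda>n. N (u n - f)) \<longlonglongrightarrow> 0" using X_closed u by blast
qed (use Lp_add Lp_scale X_sub_L in auto)

lemma seminormed_X: "seminormed_subspace X N"
  by unfold_locales (use subspace_X Lp_add Lp_scale N_nn X_sub_L in auto)

end

section \<open>Dyadic intervals and step functions\<close>

primrec num_rev :: "bool list \<Rightarrow> nat" where
  "num_rev [] = 0"
| "num_rev (b # I) = 2 * num_rev I + (if b then 0 else 1)"

text \<open>
  The position of a dyadic interval among those of its level, counted from the left. Refining an
  interval appends a bit at the end of the word, hence the recursion on the reversed word.
\<close>

definition num :: "bool list \<Rightarrow> nat" where "num I = num_rev (rev I)"

lemma num_simps [simp]: "num [] = 0" "num (I @ [b]) = 2 * num I + (if b then 0 else 1)"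
  by (simp_all add: num_def)

lemma num_less: "num I < 2 ^ length I"
  by (induction I rule: rev_induct) auto

lemma num_inj: "length I = length J \<Longrightarrow> num I = num J \<Longrightarrow> I = J"
proof (induction I arbitrary: J rule: rev_induct)
  case (snoc b I)
  from snoc.prems(1) obtain c K where J: "J = K @ [c]" by (cases J rule: rev_cases) auto
  have "b = c" using snoc.prems(2) unfolding J by (cases b; cases c; simp; presburger)
  moreover have "num I = num K" using snoc.prems(2) \<open>b = c\<close> unfolding J by simp
  ultimately show ?case using snoc.IH[of K] snoc.prems(1) J by simp
qed simp

lemma num_surj: "k < 2 ^ n \<Longrightarrow> \<exists>I. length I = n \<and> num I = k"
proof (induction n arbitrary: k)
  case (Suc n)
  have "k div 2 < 2 ^ n" using Suc.prems by (intro less_mult_imp_div_less) (simp add: mult.commute)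
  then obtain I where I: "length I = n" "num I = k div 2" using Suc.IH by blast
  have "num (I @ [even k]) = k" using I by auto
  then show ?case using I(1) by (intro exI[of _ "I @ [even k]"]) simp
qed simp

definition ivl :: "bool list \<Rightarrow> real set" where
  "ivl I = {real (num I) / 2 ^ length I ..< (real (num I) + 1) / 2 ^ length I}"

lemma ivl_Nil: "ivl [] = {0..<1}"
  by (simp add: ivl_def)

lemma mem_ivl_iff: "x \<in> ivl I \<longleftrightarrow> \<lfloor>2 ^ length I * x\<rfloor> = int (num I)"
  unfolding ivl_def floor_eq_iff by (auto simp: field_simps)

lemma ivl_snoc_True: "ivl (I @ [True]) = {real (num I) / 2 ^ length I ..< (real (num I) + 1 / 2) / 2 ^ length I}"
  by (simp add: ivl_def field_simps)

lemma ivl_snoc_False: "ivl (I @ [False]) = {(real (num I) + 1 / 2) / 2 ^ length I ..< (real (num I) + 1) / 2 ^ length I}"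
proof -
  have "(real (num I) + 1 / 2) / 2 ^ length I = real (num (I @ [False])) / 2 ^ length (I @ [False])"
    by (simp add: field_simps)
  moreover have "(real (num I) + 1) / 2 ^ length I = (real (num (I @ [False])) + 1) / 2 ^ length (I @ [False])"
    by (simp add: field_simps)
  ultimately show ?thesis unfolding ivl_def by (simp only:)
qed

text \<open>
  Left and right half.
\<close>

lemma ivl_split: "ivl I = ivl (I @ [True]) \<union> ivl (I @ [False])" "ivl (I @ [True]) \<inter> ivl (I @ [False]) = {}"
  unfolding ivl_snoc_True ivl_snoc_False unfolding ivl_def by (auto simp: field_simps)

lemma ivl_prefix: "ivl (I @ J) \<subseteq> ivl I"
proof (induction J rule: rev_induct)
  case (snoc b J)
  have "ivl ((I @ J) @ [b]) \<subseteq> ivl (I @ J)" using ivl_split(1)[of "I @ J"] by (cases b) auto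
  then show ?case using snoc by simp
qed simp

lemma ivl_sub_unit: "ivl I \<subseteq> {0..<1}"
  using ivl_prefix[of "[]" I] by (simp add: ivl_Nil)

lemma ivl_unique: "x \<in> ivl I \<Longrightarrow> x \<in> ivl J \<Longrightarrow> length I = length J \<Longrightarrow> I = J"
  by (rule num_inj) (auto simp: mem_ivl_iff)

lemma ivl_exists: "x \<in> {0..<1} \<Longrightarrow> \<exists>s\<in>pts n. x \<in> ivl s"
proof -
  assume x: "x \<in> {0..<1}"
  then have "0 \<le> \<lfloor>2 ^ n * x\<rfloor>" by simp
  then obtain k where k: "\<lfloor>2 ^ n * x\<rfloor> = int k" using nonneg_int_cases by blast
  have "2 ^ n * x < 2 ^ n" using x by simp
  then have "real k < 2 ^ n" using k by (metis floor_less_iff of_int_of_nat_eq of_int_floor_le order.strict_trans1)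
  then have "k < 2 ^ n" by (metis of_nat_less_iff of_nat_numeral of_nat_power)
  then obtain I where "length I = n" "num I = k" using num_surj by blast
  then show ?thesis using k by (intro bexI[of _ I]) (auto simp: mem_ivl_iff pts_def)
qed

lemma ivl_nested: "x \<in> ivl I \<Longrightarrow> x \<in> ivl J \<Longrightarrow> length I \<le> length J \<Longrightarrow> ivl J \<subseteq> ivl I"
proof -
  assume "x \<in> ivl I" "x \<in> ivl J" "length I \<le> length J"
  moreover have "ivl J \<subseteq> ivl (take (length I) J)"
    using ivl_prefix[of "take (length I) J" "drop (length I) J"] by simp
  ultimately have "I = take (length I) J" by (intro ivl_unique[of x]) auto
  then show ?thesis using \<open>ivl J \<subseteq> ivl (take (length I) J)\<close> by simp
qed

lemma Inf_ivl: "Inf (ivl I) = real (num I) / 2 ^ length I"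
  and Sup_ivl: "Sup (ivl I) = (real (num I) + 1) / 2 ^ length I"
  unfolding ivl_def by (auto intro!: cInf_atLeastLessThan cSup_atLeastLessThan simp: field_simps)

lemma haar_ivl: "haar (ivl I) x = indicator (ivl (I @ [True])) x - indicator (ivl (I @ [False])) x"
proof -
  have "(real (num I) / 2 ^ length I + (real (num I) + 1) / 2 ^ length I) / 2 = (real (num I) + 1 / 2) / 2 ^ length I"
    by (simp add: field_simps)
  then show ?thesis
    unfolding haar_def left_half_def right_half_def Inf_ivl Sup_ivl ivl_snoc_True ivl_snoc_False by (simp only:)
qed

lemma ivl_inj: "inj ivl"
proof (rule injI)
  fix I J assume e: "ivl I = ivl J"
  have "1 / 2 ^ length I = Sup (ivl I) - Inf (ivl I)" for I by (simp add: Inf_ivl Sup_ivl field_simps)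
  then have "1 / 2 ^ length I = (1::real) / 2 ^ length J" using e by metis
  then have "length I = length J" by simp
  moreover have "real (num I) / 2 ^ length I \<in> ivl I" by (simp add: ivl_def divide_strict_right_mono)
  ultimately show "I = J" using e by (intro ivl_unique) auto
qed

text \<open>
  Together with the injectivity of \<open>ivl\<close>, this makes words a bijective parametrisation of the dyadic
  intervals.
\<close>

lemma dyadic_intervals_eq: "dyadic_intervals = range ivl"
proof
  show "dyadic_intervals \<subseteq> range ivl"
  proof
    fix A assume "A \<in> dyadic_intervals"
    then obtain i j where ij: "1 \<le> i" "i \<le> 2 ^ j" "A = {(real i - 1) / 2 ^ j ..< real i / 2 ^ j}"
      unfolding dyadic_intervals_def by blast
    have "i - 1 < 2 ^ j" using ij by linarith
    then obtain I where "length I = j" "num I = i - 1" using num_surj by blast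
    then have "A = ivl I" using ij by (simp add: ivl_def of_nat_diff)
    then show "A \<in> range ivl" by simp
  qed
  show "range ivl \<subseteq> dyadic_intervals"
  proof
    fix A assume "A \<in> range ivl"
    then obtain I where "A = ivl I" by blast
    then have "A = {(real (num I + 1) - 1) / 2 ^ length I ..< real (num I + 1) / 2 ^ length I}"
      by (simp add: ivl_def add.commute)
    moreover have "1 \<le> num I + 1" "num I + 1 \<le> 2 ^ length I" using num_less[of I] by auto
    ultimately show "A \<in> dyadic_intervals" unfolding dyadic_intervals_def by blast
  qed
qed

lemma hr_eq: "hr I s = (if length I < length s \<and> take (length I) s = I then sg (s ! length I) else 0)"
  by (induction I s rule: hr.induct) auto

text \<open>
  The bridge between Haar functions on the interval and on words: on an atom of a finer grid the Haar
  function is constant.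
\<close>

lemma haar_eq_hr:
  assumes x: "x \<in> ivl s" and l: "length I < length s"
  shows "haar (ivl I) x = hr I s"
proof -
  have t: "x \<in> ivl (take k s)" for k
    using x ivl_prefix[of "take k s" "drop k s"] by auto
  show ?thesis
  proof (cases "take (length I) s = I")
    case True
    have "take (Suc (length I)) s = I @ [s ! length I]"
      using True l by (simp add: take_Suc_conv_app_nth)
    then have "x \<in> ivl (I @ [s ! length I])" using t[of "Suc (length I)"] by simp
    then show ?thesis
      using ivl_split(2)[of I] True l unfolding haar_ivl hr_eq
      by (cases "s ! length I") (auto simp: indicator_def sg_def)
  next
    case False
    have "x \<notin> ivl I" using ivl_unique[OF t[of "length I"], of I] False l by auto
    then show ?thesis using False ivl_split(1)[of I] unfolding haar_ivl hr_eq by (auto simp: indicator_def)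
  qed
qed

lemma ivl_borel [measurable]: "ivl I \<in> sets borel"
  by (simp add: ivl_def)

lemma emeasure_ivl: "emeasure unit_interval (ivl I) = ennreal (1 / 2 ^ length I)"
proof -
  have "emeasure unit_interval (ivl I) = emeasure lborel (ivl I)"
    using ivl_sub_unit[of I] by (intro emeasure_unit_interval) auto
  also have "\<dots> = ennreal ((real (num I) + 1) / 2 ^ length I - real (num I) / 2 ^ length I)"
    unfolding ivl_def by (rule emeasure_lborel_Ico) (simp add: divide_right_mono)
  also have "(real (num I) + 1) / 2 ^ length I - real (num I) / 2 ^ length I = 1 / 2 ^ length I"
    by (simp add: field_simps)
  finally show ?thesis .
qed

lemma ivl_in_unit [measurable]: "ivl I \<in> sets unit_interval"
  using ivl_sub_unit[of I] by (subst sets_restrict_space_iff) auto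

lemma AE_unit_interval_lt_1: "AE x in unit_interval. x \<in> {0..<1}"
proof -
  have "emeasure unit_interval {1} = 0" by (subst emeasure_unit_interval) auto
  moreover have "{1} \<in> sets unit_interval" by (subst sets_restrict_space_iff) auto
  ultimately have "{1} \<in> null_sets unit_interval" by (simp add: null_sets_def)
  then show ?thesis by (rule AE_I'[rotated 0, of "{1}"]) auto
qed

text \<open>
  The atoms cover the half-open interval; the end point \<open>1\<close> is a null set.
\<close>

lemma nn_integral_step:
  assumes "\<And>s x. s \<in> pts n \<Longrightarrow> x \<in> ivl s \<Longrightarrow> G x = ennreal (g s)" "\<And>s. s \<in> pts n \<Longrightarrow> 0 \<le> g s"
  shows "(\<integral>\<^sup>+ x. G x \<partial>unit_interval) = ennreal (avg n g)"
proof -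
  have "(\<integral>\<^sup>+ x. G x \<partial>unit_interval) = (\<integral>\<^sup>+ x. (\<Sum>s\<in>pts n. ennreal (g s) * indicator (ivl s) x) \<partial>unit_interval)"
  proof (rule nn_integral_cong_AE)
    show "AE x in unit_interval. G x = (\<Sum>s\<in>pts n. ennreal (g s) * indicator (ivl s) x)"
      using AE_unit_interval_lt_1
    proof eventually_elim
      case (elim x)
      then obtain r where r: "r \<in> pts n" "x \<in> ivl r" using ivl_exists by blast
      have "(\<Sum>s\<in>pts n. ennreal (g s) * indicator (ivl s) x) = (\<Sum>s\<in>pts n. if s = r then ennreal (g s) else 0)"
      proof (rule sum.cong)
        fix s assume "s \<in> pts n"
        then have "x \<in> ivl s \<longleftrightarrow> s = r" using r ivl_unique[of x s r] by (auto simp: pts_def)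
        then show "ennreal (g s) * indicator (ivl s) x = (if s = r then ennreal (g s) else 0)"
          by (simp add: indicator_def)
      qed simp
      then show ?case using r assms(1) by simp
    qed
  qed
  also have "\<dots> = (\<Sum>s\<in>pts n. ennreal (g s) * ennreal (1 / 2 ^ n))"
  proof (subst nn_integral_sum)
    show "(\<Sum>s\<in>pts n. \<integral>\<^sup>+ x. ennreal (g s) * indicator (ivl s) x \<partial>unit_interval) = (\<Sum>s\<in>pts n. ennreal (g s) * ennreal (1 / 2 ^ n))"
      by (intro sum.cong refl, subst nn_integral_cmult_indicator, rule ivl_in_unit, subst emeasure_ivl) (simp add: pts_def)
  qed measurable
  also have "\<dots> = ennreal (\<Sum>s\<in>pts n. g s * (1 / 2 ^ n))"
  proof -
    have "ennreal (g s) * ennreal (1 / 2 ^ n) = ennreal (g s * (1 / 2 ^ n))" if "s \<in> pts n" for s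
      using assms(2)[OF that] by (intro ennreal_mult[symmetric]) auto
    then have "(\<Sum>s\<in>pts n. ennreal (g s) * ennreal (1 / 2 ^ n)) = (\<Sum>s\<in>pts n. ennreal (g s * (1 / 2 ^ n)))"
      by (intro sum.cong) auto
    also have "\<dots> = ennreal (\<Sum>s\<in>pts n. g s * (1 / 2 ^ n))"
      using assms(2) by (intro sum_ennreal) auto
    finally show ?thesis .
  qed
  also have "(\<Sum>s\<in>pts n. g s * (1 / 2 ^ n)) = avg n g" by (simp add: avg_def sum_divide_distrib)
  finally show ?thesis .
qed

text \<open>
  For dyadic step functions the iterated norm is a finite computation. Therefore all estimates for
  finite Haar sums can be proved on the grid.
\<close>

lemma inorm_eq_sn:
  assumes "distinct js" "\<And>j. j \<in> set js \<Longrightarrow> 0 < p j"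
    "\<And>u t'. u \<in> grid n (length js) \<Longrightarrow> (\<And>i. i < length js \<Longrightarrow> t' (js ! i) \<in> ivl (u ! i)) \<Longrightarrow>
       (\<And>k. k \<notin> set js \<Longrightarrow> t' k = t k) \<Longrightarrow> g t' = ennreal \<bar>F u\<bar>"
  shows "inorm p js g t = ennreal (sn n (map p js) F)"
  using assms
proof (induction js arbitrary: t F)
  case Nil
  then show ?case by simp
next
  case (Cons j js)
  have pj: "0 < p j" using Cons.prems(2) by simp
  have IH: "inorm p js g (t(j := x)) = ennreal (sn n (map p js) (\<lambda>u. F (s # u)))" if s: "s \<in> pts n" "x \<in> ivl s" for s x
  proof (rule Cons.IH)
    show "g t' = ennreal \<bar>F (s # u)\<bar>" if u: "u \<in> grid n (length js)"
      "\<And>i. i < length js \<Longrightarrow> t' (js ! i) \<in> ivl (u ! i)" "\<And>k. k \<notin> set js \<Longrightarrow> t' k = (t(j := x)) k" for u t'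
    proof (rule Cons.prems(3))
      show "s # u \<in> grid n (length (j # js))" using s u by (simp add: Cons_grid)
      show "t' ((j # js) ! i) \<in> ivl ((s # u) ! i)" if "i < length (j # js)" for i
        using that u(2) u(3)[of j] Cons.prems(1) s by (cases i) auto
      show "t' k = t k" if "k \<notin> set (j # js)" for k using that u(3)[of k] by simp
    qed
  qed (use Cons.prems in auto)
  have "(\<integral>\<^sup>+ x. ennreal_powr (inorm p js g (t(j := x))) (p j) \<partial>unit_interval)
     = ennreal (avg n (\<lambda>s. sn n (map p js) (\<lambda>u. F (s # u)) powr p j))"
    by (rule nn_integral_step) (simp_all add: IH ennreal_powr_ennreal sn_nonneg)
  then show ?case by (simp add: ennreal_powr_ennreal avg_nonneg del: fun_upd_apply)
qed

lemma integral_haar: "(\<integral>x. haar (ivl I) x \<partial>unit_interval) = 0"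
proof -
  have m: "measure unit_interval (ivl J) = 1 / 2 ^ length J" for J
    using emeasure_ivl[of J] by (simp add: measure_def)
  have "integrable unit_interval (indicator (ivl J) :: real \<Rightarrow> real)" for J
    by (intro integrable_real_indicator) (auto simp: emeasure_ivl)
  moreover have "ivl J \<inter> {0..1} = ivl J" for J using ivl_sub_unit[of J] by auto
  ultimately show ?thesis
    unfolding haar_ivl by (simp add: m)
qed

section \<open>Dyadic step functions are dense\<close>

text \<open>
  A generator of the Borel sets of \<open>[0, 1]\<close> that is stable under intersections. The point \<open>1\<close>, which no
  half-open dyadic interval contains, has to be added.
\<close>

definition dyadic_gen :: "real set set" where
  "dyadic_gen = insert {} (insert {1} (range ivl))"

lemma dyadic_gen_Pow: "dyadic_gen \<subseteq> Pow {0..1}"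
  using ivl_sub_unit by (fastforce simp: dyadic_gen_def)

lemma dyadic_gen_Int: "A \<in> dyadic_gen \<Longrightarrow> B \<in> dyadic_gen \<Longrightarrow> A \<inter> B \<in> dyadic_gen"
proof -
  assume A: "A \<in> dyadic_gen" and B: "B \<in> dyadic_gen"
  have 1: "{1} \<inter> ivl I = {}" "ivl I \<inter> {1} = {}" for I using ivl_sub_unit[of I] by auto
  have "ivl I \<inter> ivl J \<in> dyadic_gen" for I J
  proof (cases "ivl I \<inter> ivl J = {}")
    case False
    then obtain x where x: "x \<in> ivl I" "x \<in> ivl J" by blast
    have "ivl I \<inter> ivl J = ivl I \<or> ivl I \<inter> ivl J = ivl J"
      using ivl_nested[OF x] ivl_nested[OF x(2,1)] by (cases "length I \<le> length J") auto
    then show ?thesis by (auto simp: dyadic_gen_def)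
  qed (simp add: dyadic_gen_def)
  then show ?thesis using A B 1 unfolding dyadic_gen_def by auto
qed

text \<open>
  Every half-line is, within the unit interval, the union of the countably many dyadic intervals that
  it contains, and possibly the end point.
\<close>

lemma sets_unit_interval_dyadic: "sets unit_interval = sets (sigma {0..1} dyadic_gen)"
proof
  let ?M = "sigma {0..1::real} dyadic_gen"
  have sp: "space ?M = {0..1}" by (rule space_measure_of[OF dyadic_gen_Pow])
  have gen: "A \<in> sets ?M" if "A \<in> dyadic_gen" for A
    using that dyadic_gen_Pow by (auto simp: sets_measure_of)
  have "{x \<in> {0..1}. x < a} \<in> sets ?M" for a :: real
  proof -
    let ?S = "{I. ivl I \<subseteq> {..<a}}"
    have "{x \<in> {0..1}. x < a} = (\<Union>I\<in>?S. ivl I) \<union> (if 1 < a then {1} else {})" (is "?L = ?R")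
    proof
      show "?R \<subseteq> ?L" using ivl_sub_unit by (fastforce split: if_splits)
      show "?L \<subseteq> ?R"
      proof
        fix x assume x: "x \<in> ?L"
        show "x \<in> ?R"
        proof (cases "x = 1")
          case False
          obtain n where n: "(1/2) ^ n < a - x"
            using real_arch_pow_inv[of "a - x" "1/2"] x by auto
          obtain I where I: "I \<in> pts n" "x \<in> ivl I" using ivl_exists[of x n] x False by auto
          have "ivl I \<subseteq> {..<a}"
          proof
            fix y assume "y \<in> ivl I"
            then have "y - x < 1 / 2 ^ n"
              using I unfolding ivl_def pts_def by (auto simp: add_divide_distrib)
            then show "y \<in> {..<a}" using n by (simp add: power_one_over)
          qed
          then show ?thesis using I(2) by auto
        qed (use x in auto)
      qed
    qed
    moreover have gI: "ivl I \<in> sets ?M" for I by (rule gen) (simp add: dyadic_gen_def)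
    then have "(\<Union>I\<in>?S. ivl I) \<in> sets ?M" by (intro sets.countable_UN'') auto
    moreover have "{1} \<in> sets ?M" by (rule gen) (simp add: dyadic_gen_def)
    then have "(if 1 < a then {1} else {}) \<in> sets ?M" by simp
    ultimately show ?thesis by auto
  qed
  then have id: "(\<lambda>x. x) \<in> borel_measurable ?M"
    unfolding borel_measurable_iff_less sp by simp
  show "sets unit_interval \<subseteq> sets ?M"
  proof
    fix A assume "A \<in> sets unit_interval"
    then obtain B where B: "B \<in> sets borel" "A = {0..1} \<inter> B" by (auto simp: sets_restrict_space)
    have "(\<lambda>x. x) -` B \<inter> space ?M \<in> sets ?M" by (rule measurable_sets[OF id B(1)])
    then show "A \<in> sets ?M" unfolding sp B(2) by (simp add: Int_commute)
  qed
  have "dyadic_gen \<subseteq> sets unit_interval"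
    using ivl_in_unit by (auto simp: dyadic_gen_def sets_restrict_space_iff)
  then show "sets ?M \<subseteq> sets unit_interval"
    using sets.sigma_sets_subset[of dyadic_gen unit_interval] dyadic_gen_Pow by (simp add: sets_measure_of)
qed

lemma inorm_const_1: "inorm p js (\<lambda>t. 1) t = 1"
  by (induction js arbitrary: t)
    (simp_all add: emeasure_unit_interval_space ennreal_powr_ennreal[of 1, simplified])

context mixed
begin

interpretation Lp: seminormed_subspace L N by (rule seminormed_L)

lemma box_subset: "A \<in> Ix \<rightarrow> dyadic_gen \<Longrightarrow> Pi\<^sub>E Ix A \<subseteq> Ix \<rightarrow>\<^sub>E {0..1}"
  by (rule PiE_mono) (use dyadic_gen_Pow in \<open>auto dest!: Pi_mem\<close>)

lemma sets_Q_dyadic: "sets Q = sigma_sets (space Q) {Pi\<^sub>E Ix A | A. A \<in> Ix \<rightarrow> dyadic_gen}"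
proof -
  let ?\<Omega> = "Ix \<rightarrow>\<^sub>E {0..1::real}"
  let ?P = "{{f \<in> ?\<Omega>. \<forall>i\<in>j. f i \<in> A i} | A j. j \<in> {Ix} \<and> A \<in> Pi j (\<lambda>_. dyadic_gen)}"
  have "sets Q = sets (Pi\<^sub>M Ix (\<lambda>_. sigma {0..1} dyadic_gen))"
    by (rule sets_PiM_cong[OF refl sets_unit_interval_dyadic])
  also have "\<dots> = sets (sigma ?\<Omega> ?P)"
  proof (rule sets_PiM_sigma)
    show "\<exists>S\<subseteq>dyadic_gen. countable S \<and> {0..1} = \<Union>S"
    proof (intro exI[of _ "{ivl [], {1}}"] conjI)
      show "{ivl [], {1}} \<subseteq> dyadic_gen" by (auto simp: dyadic_gen_def)
      show "{0..1} = \<Union>{ivl [], {1}}" by (auto simp: ivl_Nil)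
    qed simp
  qed (use dyadic_gen_Pow in auto)
  also have "?P = {Pi\<^sub>E Ix A | A. A \<in> Ix \<rightarrow> dyadic_gen}"
  proof -
    have "{f \<in> ?\<Omega>. \<forall>i\<in>Ix. f i \<in> A i} = Pi\<^sub>E Ix A" if "A \<in> Ix \<rightarrow> dyadic_gen" for A
      using box_subset[OF that] by (auto simp: PiE_iff subset_iff extensional_def)
    then have "(X = {f \<in> ?\<Omega>. \<forall>i\<in>Ix. f i \<in> A i} \<and> A \<in> Ix \<rightarrow> dyadic_gen) = (X = Pi\<^sub>E Ix A \<and> A \<in> Ix \<rightarrow> dyadic_gen)" for X A
      by (cases "A \<in> Ix \<rightarrow> dyadic_gen") simp_all
    then show ?thesis by simp
  qed
  also have "sets (sigma ?\<Omega> {Pi\<^sub>E Ix A | A. A \<in> Ix \<rightarrow> dyadic_gen}) = sigma_sets ?\<Omega> {Pi\<^sub>E Ix A | A. A \<in> Ix \<rightarrow> dyadic_gen}"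
  proof (rule sets_measure_of)
    show "{Pi\<^sub>E Ix A | A. A \<in> Ix \<rightarrow> dyadic_gen} \<subseteq> Pow ?\<Omega>"
      using box_subset by blast
  qed
  finally show ?thesis by (simp add: space_cube)
qed

definition tensor :: "(nat \<Rightarrow> real \<Rightarrow> real) \<Rightarrow> (nat \<Rightarrow> real) \<Rightarrow> real" where
  "tensor \<phi> t = (\<Prod>i\<in>Ix. \<phi> i (t i))"

lemma component_measurable:
  assumes "i \<in> Ix" "\<phi> \<in> borel_measurable borel"
  shows "(\<lambda>t. \<phi> (t i)) \<in> borel_measurable Q"
proof -
  have "\<phi> \<in> borel_measurable unit_interval"
    using assms(2) by (intro measurable_restrict_space1) simp
  then show ?thesis by (rule measurable_compose[OF measurable_component_singleton[OF assms(1)]])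
qed

lemma tensor_measurable: "(\<And>i. \<phi> i \<in> borel_measurable borel) \<Longrightarrow> tensor \<phi> \<in> borel_measurable Q"
  unfolding tensor_def[abs_def] by (intro borel_measurable_prod component_measurable)

lemma bounded_in_L:
  assumes "f \<in> borel_measurable Q" "\<And>t. t \<in> space Q \<Longrightarrow> \<bar>f t\<bar> \<le> c"
  shows "f \<in> L"
proof -
  have "En (\<lambda>t. ennreal \<bar>f t\<bar>) \<le> En (\<lambda>t. ennreal c * 1)"
    using assms(2) by (intro En_mono) (auto intro: ennreal_leI)
  also have "\<dots> = ennreal c * En (\<lambda>t. 1)" by (rule En_cmult) simp
  also have "\<dots> < top" by (simp add: En_def inorm_const_1)
  finally show ?thesis using assms(1) by (simp add: Lp_iff)
qed

lemma indicator_in_L: "A \<in> sets Q \<Longrightarrow> indicator A \<in> L"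
  by (rule bounded_in_L[of _ 1]) (auto simp: indicator_def)

definition norm_closure :: "((nat \<Rightarrow> real) \<Rightarrow> real) set \<Rightarrow> ((nat \<Rightarrow> real) \<Rightarrow> real) set" where
  "norm_closure S = {f \<in> L. \<forall>\<epsilon>>0. \<exists>g\<in>S. N (f - g) < \<epsilon>}"

lemma norm_closure_add:
  assumes S: "subspace S" "S \<subseteq> L" and f: "f \<in> norm_closure S" and g: "g \<in> norm_closure S"
  shows "f + g \<in> norm_closure S"
  unfolding norm_closure_def
proof (intro CollectI conjI allI impI)
  have fL: "f \<in> L" and gL: "g \<in> L" using f g by (auto simp: norm_closure_def)
  show "f + g \<in> L" by (rule subspace_add[OF subspace_L fL gL])
  fix \<epsilon> :: real assume "0 < \<epsilon>"
  then have e: "0 < \<epsilon> / 2" by simp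
  obtain f' where f': "f' \<in> S" "N (f - f') < \<epsilon> / 2" using f e unfolding norm_closure_def by blast
  obtain g' where g': "g' \<in> S" "N (g - g') < \<epsilon> / 2" using g e unfolding norm_closure_def by blast
  note * = f' g'
  have "N ((f - f') + (g - g')) \<le> N (f - f') + N (g - g')"
    using * S fL gL by (intro Lp.N_add Lp_diff) auto
  moreover have "(f - f') + (g - g') = (f + g) - (f' + g')" by simp
  ultimately have "N ((f + g) - (f' + g')) < \<epsilon>" using * by simp
  then show "\<exists>h\<in>S. N (f + g - h) < \<epsilon>" using * subspace_add[OF S(1)] by blast
qed

lemma norm_closure_scale:
  assumes S: "subspace S" "S \<subseteq> L" and f: "f \<in> norm_closure S"
  shows "c *\<^sub>R f \<in> norm_closure S"
  unfolding norm_closure_def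
proof (intro CollectI conjI allI impI)
  have fL: "f \<in> L" using f by (auto simp: norm_closure_def)
  show "c *\<^sub>R f \<in> L" by (rule subspace_scale[OF subspace_L fL])
  fix \<epsilon> :: real assume e: "0 < \<epsilon>"
  then have "0 < \<epsilon> / (\<bar>c\<bar> + 1)" by simp
  then obtain g where g: "g \<in> S" "N (f - g) < \<epsilon> / (\<bar>c\<bar> + 1)"
    using f unfolding norm_closure_def by blast
  have "N (c *\<^sub>R f - c *\<^sub>R g) = \<bar>c\<bar> * N (f - g)"
    using Lp.N_scale[OF Lp_diff[OF fL, of g], of c] g S by (auto simp: scaleR_diff_right)
  also have "\<dots> \<le> (\<bar>c\<bar> + 1) * N (f - g)" using N_nn by (intro mult_right_mono) auto
  also have "\<dots> < \<epsilon>" using g(2) by (simp add: field_simps)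
  finally show "\<exists>h\<in>S. N (c *\<^sub>R f - h) < \<epsilon>" using g subspace_scale[OF S(1)] by blast
qed

lemma norm_closure_limit:
  assumes S: "S \<subseteq> L" and f: "f \<in> L" and ap: "\<And>\<epsilon>. 0 < \<epsilon> \<Longrightarrow> \<exists>g\<in>norm_closure S. N (f - g) < \<epsilon>"
  shows "f \<in> norm_closure S"
  unfolding norm_closure_def
proof (intro CollectI conjI allI impI f)
  fix \<epsilon> :: real assume "0 < \<epsilon>"
  then obtain g where g: "g \<in> norm_closure S" "N (f - g) < \<epsilon> / 2" using ap[of "\<epsilon> / 2"] by auto
  have e: "0 < \<epsilon> / 2" using \<open>0 < \<epsilon>\<close> by simp
  obtain h where h: "h \<in> S" "N (g - h) < \<epsilon> / 2" using g(1) e unfolding norm_closure_def by blast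
  have "N (f - h) \<le> N (f - g) + N (g - h)"
    using f g h S by (intro Lp.N_triangle) (auto simp: norm_closure_def)
  then show "\<exists>h\<in>S. N (f - h) < \<epsilon>" using g h by force
qed

lemma norm_closure_base: "f \<in> S \<Longrightarrow> S \<subseteq> L \<Longrightarrow> f \<in> norm_closure S"
  unfolding norm_closure_def by (auto intro!: bexI[of _ f] simp: Lp.N_zero)

text \<open>
  Passing to a function that is equal almost everywhere stays in the closure, as the difference has
  norm zero.
\<close>

lemma norm_closure_AE:
  assumes S: "S \<subseteq> L" and g: "g \<in> norm_closure S" and f: "f \<in> borel_measurable Q" and eq: "AE t in Q. f t = g t"
  shows "f \<in> norm_closure S"
proof -
  have gL: "g \<in> L" using g by (simp add: norm_closure_def)
  have m: "f - g \<in> borel_measurable Q"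
    unfolding fun_diff_def using f Lp_measurable[OF gL] by (rule borel_measurable_diff)
  have "f - g \<in> L \<and> N (f - g) = 0"
    using eq by (intro N_AE_0[OF m]) (auto elim!: eventually_mono)
  note fg = this[THEN conjunct1] this[THEN conjunct2]
  have "f \<in> L" using subspace_add[OF subspace_L fg(1) gL] by simp
  then show ?thesis using g fg(2) by (intro norm_closure_limit[OF S]) force+
qed

definition bx :: "(nat \<Rightarrow> bool list) \<Rightarrow> (nat \<Rightarrow> real) \<Rightarrow> real" where
  "bx K = tensor (\<lambda>i. indicator (ivl (K i)))"

lemma bx_in_L: "bx K \<in> L"
proof (rule bounded_in_L[of _ 1])
  show "bx K \<in> borel_measurable Q" unfolding bx_def by (rule tensor_measurable) simp
  show "\<bar>bx K t\<bar> \<le> 1" for t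
    unfolding bx_def tensor_def by (simp add: abs_prod prod_le_1 indicator_def)
qed

lemma span_bx_L: "span (range bx) \<subseteq> L"
  by (rule span_minimal[OF _ subspace_L]) (use bx_in_L in auto)

lemma null_slice: "i \<in> Ix \<Longrightarrow> AE t in Q. t i \<in> {0..<1}"
proof -
  assume i: "i \<in> Ix"
  let ?A = "Pi\<^sub>E Ix (\<lambda>k. if k = i then {1} else {0..1})"
  have s1: "{1} \<in> sets unit_interval" by (subst sets_restrict_space_iff) auto
  have s2: "{0..1} \<in> sets unit_interval" by (subst sets_restrict_space_iff) auto
  have "emeasure Q ?A = (\<Prod>k\<in>Ix. emeasure unit_interval (if k = i then {1} else {0..1}))"
    using s1 s2 by (intro cubes.emeasure_PiM) auto
  also have "\<dots> = 0" using i by (intro prod_zero) (auto simp: emeasure_unit_interval)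
  finally have "?A \<in> null_sets Q"
    using s1 s2 by (auto simp: null_sets_def intro!: sets_PiM_I_finite)
  then show ?thesis
  proof (rule AE_I'[rotated 0])
    show "{t \<in> space Q. \<not> t i \<in> {0..<1}} \<subseteq> ?A"
      using i by (force simp: space_cube PiE_iff)
  qed
qed

text \<open>
  A generating box is empty, a null set, or a product of dyadic intervals.
\<close>

lemma indicator_box_cl:
  assumes A: "A \<in> Ix \<rightarrow> dyadic_gen"
  shows "indicator (Pi\<^sub>E Ix A) \<in> norm_closure (span (range bx))"
proof -
  have sets: "Pi\<^sub>E Ix A \<in> sets Q" unfolding sets_Q_dyadic using A by (intro sigma_sets.Basic) auto
  have m: "indicator (Pi\<^sub>E Ix A) \<in> borel_measurable Q" using sets by simp
  have zero: "(0 :: (nat \<Rightarrow> real) \<Rightarrow> real) \<in> norm_closure (span (range bx))"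
    by (rule norm_closure_base[OF _ span_bx_L]) (rule span_zero)
  consider i where "i \<in> Ix" "A i = {}" | i where "i \<in> Ix" "A i = {1}" | "\<forall>i\<in>Ix. \<exists>I. A i = ivl I"
    using A unfolding dyadic_gen_def by blast
  then show ?thesis
  proof cases
    case 1
    then have "Pi\<^sub>E Ix A = {}" by (auto simp: PiE_eq_empty_iff)
    then have "indicator (Pi\<^sub>E Ix A) = (0 :: (nat \<Rightarrow> real) \<Rightarrow> real)" by (simp add: fun_eq_iff)
    then show ?thesis using zero by (simp only:)
  next
    case 2
    have "AE t in Q. indicator (Pi\<^sub>E Ix A) t = (0::real)"
      using null_slice[OF 2(1)]
    proof eventually_elim
      case (elim t)
      have "t \<notin> Pi\<^sub>E Ix A"
      proof
        assume "t \<in> Pi\<^sub>E Ix A"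
        then have "t i \<in> A i" using 2(1) by (rule PiE_mem)
        then show False using 2(2) elim by simp
      qed
      then show ?case by simp
    qed
    then show ?thesis by (intro norm_closure_AE[OF span_bx_L zero m]) (simp add: zero_fun_def)
  next
    case 3
    then obtain K where K: "\<And>i. i \<in> Ix \<Longrightarrow> A i = ivl (K i)" by metis
    have "AE t in Q. indicator (Pi\<^sub>E Ix A) t = bx K t"
    proof (rule AE_I2)
      fix t assume "t \<in> space Q"
      then have e: "t \<in> extensional Ix" by (simp add: space_cube PiE_iff)
      show "indicator (Pi\<^sub>E Ix A) t = bx K t"
      proof (cases "\<forall>i\<in>Ix. t i \<in> ivl (K i)")
        case True
        then show ?thesis using e K by (simp add: bx_def tensor_def indicator_def PiE_iff)
      next
        case False
        then obtain i where i: "i \<in> Ix" "t i \<notin> ivl (K i)" by blast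
        then have "bx K t = 0" unfolding bx_def tensor_def by (intro prod_zero bexI[of _ i]) auto
        moreover have "t \<notin> Pi\<^sub>E Ix A" using i K by (auto simp: PiE_iff)
        ultimately show ?thesis by simp
      qed
    qed
    moreover have "bx K \<in> norm_closure (span (range bx))"
      by (rule norm_closure_base[OF _ span_bx_L]) (rule span_base, simp)
    ultimately show ?thesis by (intro norm_closure_AE[OF span_bx_L _ m])
  qed
qed

text \<open>
  Dynkin's \<open>\<pi>\<close>-\<open>\<lambda>\<close> argument: the sets whose indicator can be approximated are closed under complements
  and, by dominated convergence, under disjoint countable unions.
\<close>

lemma indicator_cl:
  assumes "A \<in> sets Q"
  shows "indicator A \<in> norm_closure (span (range bx))"
proof -
  let ?V = "span (range bx)"
  let ?G = "{Pi\<^sub>E Ix A | A. A \<in> Ix \<rightarrow> dyadic_gen}"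
  note V = subspace_span[of "range bx"] span_bx_L
  have Int: "Int_stable ?G"
  proof (rule Int_stableI)
    fix a b assume "a \<in> ?G" "b \<in> ?G"
    then obtain A B where AB: "a = Pi\<^sub>E Ix A" "A \<in> Ix \<rightarrow> dyadic_gen" "b = Pi\<^sub>E Ix B" "B \<in> Ix \<rightarrow> dyadic_gen" by blast
    have "a \<inter> b = Pi\<^sub>E Ix (\<lambda>i. A i \<inter> B i)" unfolding AB by (rule PiE_Int)
    moreover have "(\<lambda>i. A i \<inter> B i) \<in> Ix \<rightarrow> dyadic_gen" using AB dyadic_gen_Int by (auto simp: Pi_iff)
    ultimately show "a \<inter> b \<in> ?G" by blast
  qed
  have Pow: "?G \<subseteq> Pow (space Q)"
    unfolding space_cube using box_subset by blast
  have A: "A \<in> sigma_sets (space Q) ?G" using assms unfolding sets_Q_dyadic .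
  have diff: "f - g \<in> norm_closure ?V" if "f \<in> norm_closure ?V" "g \<in> norm_closure ?V" for f g
    using norm_closure_add[OF V that(1) norm_closure_scale[OF V that(2), of "-1"]] by simp
  show ?thesis using Int Pow A
  proof (induction rule: sigma_sets_induct_disjoint)
    case (basic A)
    then show ?case using indicator_box_cl by blast
  next
    case empty
    have "(0 :: (nat \<Rightarrow> real) \<Rightarrow> real) \<in> norm_closure ?V" by (rule norm_closure_base[OF _ span_bx_L]) (rule span_zero)
    then show ?case by (simp add: indicator_def zero_fun_def)
  next
    case (compl A)
    have one: "indicator (space Q) \<in> norm_closure ?V"
    proof (rule norm_closure_AE[OF span_bx_L])
      show "bx (\<lambda>_. []) \<in> norm_closure ?V" by (rule norm_closure_base[OF _ span_bx_L]) (rule span_base, simp)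
      have "AE t in Q. \<forall>i\<in>Ix. t i \<in> {0..<1}"
        using null_slice by (subst AE_finite_all) auto
      then show "AE t in Q. indicator (space Q) t = bx (\<lambda>_. []) t"
        using AE_space by eventually_elim (simp add: bx_def tensor_def ivl_Nil indicator_def)
    qed simp
    have "A \<subseteq> space Q" using compl(1) Pow by (rule sigma_sets_into_sp[rotated])
    then have "indicator (space Q - A) = (indicator (space Q) - indicator A :: (nat \<Rightarrow> real) \<Rightarrow> real)"
      by (auto simp: fun_eq_iff indicator_def)
    then show ?case using diff[OF one compl(2)] by (simp only:)
  next
    case (union A)
    have sets: "A n \<in> sets Q" for n using union(2) unfolding sets_Q_dyadic by blast
    define s where "s n = (\<Sum>k<n. indicator (A k) :: (nat \<Rightarrow> real) \<Rightarrow> real)" for n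
    have s_cl: "s n \<in> norm_closure ?V" for n
    proof (induction n)
      case 0
      show ?case unfolding s_def lessThan_0 sum.empty by (rule norm_closure_base[OF span_zero span_bx_L])
    next
      case (Suc n)
      show ?case using norm_closure_add[OF V Suc union(3)[of n]] unfolding s_def sum.lessThan_Suc by (simp only:)
    qed
    have s_apply: "s n t = indicator (\<Union>k<n. A k) t" for n t
    proof -
      have "s n t = (\<Sum>k<n. indicator (A k) t)" by (simp add: s_def sum_fun_apply)
      also have "\<dots> = indicator (\<Union>k<n. A k) t"
        using union(1) by (intro indicator_UN_disjoint[symmetric]) (auto simp: disjoint_family_on_def)
      finally show ?thesis .
    qed
    let ?u = "indicator (\<Union>i. A i) :: (nat \<Rightarrow> real) \<Rightarrow> real"
    have uL: "?u \<in> L" using sets by (intro indicator_in_L) auto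
    define g where "g n t = ennreal \<bar>(?u - s n) t\<bar>" for n t
    have sL: "s n \<in> L" for n using s_cl[of n] by (simp add: norm_closure_def)
    have "(\<lambda>n. En (g n)) \<longlonglongrightarrow> 0"
    proof (rule En_tendsto_0[where G = "\<lambda>t. 1"])
      show "g n \<in> borel_measurable Q" for n
        unfolding g_def using Lp_measurable[OF Lp_diff[OF uL sL[of n]]] by measurable
      show "g n t \<le> 1" for n t
        unfolding g_def by (auto simp: s_apply indicator_def)
      show "(\<lambda>n. g n t) \<longlonglongrightarrow> 0" for t
      proof (cases "t \<in> (\<Union>i. A i)")
        case True
        then obtain k where k: "t \<in> A k" by blast
        have "eventually (\<lambda>n. g n t = 0) sequentially"
          using eventually_gt_at_top[of k]
          by eventually_elim (use k in \<open>auto simp: g_def s_apply indicator_def\<close>)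
        then show ?thesis by (rule tendsto_eventually)
      next
        case False
        then have "g n t = 0" for n by (auto simp: g_def s_apply indicator_def)
        then show ?thesis by simp
      qed
      show "En (\<lambda>t. 1) < top" by (simp add: En_def inorm_const_1)
    qed simp
    then have lim: "(\<lambda>n. ennreal (N (?u - s n))) \<longlonglongrightarrow> 0"
      using ennreal_N[OF Lp_diff[OF uL sL]] by (simp add: g_def[abs_def])
    show ?case
    proof (rule norm_closure_limit[OF span_bx_L uL])
      fix \<epsilon> :: real assume "0 < \<epsilon>"
      then have "eventually (\<lambda>n. ennreal (N (?u - s n)) < ennreal \<epsilon>) sequentially"
        using lim by (intro order_tendstoD(2)) auto
      then obtain n where "ennreal (N (?u - s n)) < ennreal \<epsilon>" by (auto simp: eventually_sequentially)
      then have "N (?u - s n) < \<epsilon>" using N_nn by (simp add: ennreal_less_iff)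
      then show "\<exists>g\<in>norm_closure ?V. N (?u - g) < \<epsilon>" using s_cl by blast
    qed
  qed
qed

text \<open>
  From indicators to nonnegative functions by dominated convergence along monotone approximations, and
  to all functions by splitting into positive and negative part.
\<close>

lemma dyadic_steps_dense: "f \<in> L \<Longrightarrow> f \<in> norm_closure (span (range bx))"
proof -
  let ?V = "span (range bx)"
  note V = subspace_span[of "range bx"] span_bx_L
  have pos: "u \<in> L \<Longrightarrow> u \<in> norm_closure ?V" if "u \<in> borel_measurable Q" "\<And>t. 0 \<le> u t" for u
    using that
  proof (induction rule: borel_measurable_induct_real)
    case (set A)
    then show ?case using indicator_cl by simp
  next
    case (mult u c)
    have e: "(\<lambda>x. c * u x) = c *\<^sub>R u" by (simp add: scaleR_fun_def)
    show ?case
    proof (cases "c = 0")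
      case True
      then show ?thesis using norm_closure_base[OF span_zero span_bx_L] by (simp add: zero_fun_def)
    next
      case False
      have "(1 / c) *\<^sub>R (c *\<^sub>R u) \<in> L" using mult(5) unfolding e by (rule subspace_scale[OF subspace_L])
      then have "u \<in> L" using False by simp
      then show ?thesis unfolding e using mult by (intro norm_closure_scale[OF V]) auto
    qed
  next
    case (add u v)
    have "u \<in> L \<and> v \<in> L"
    proof -
      have "En (\<lambda>t. ennreal \<bar>u t\<bar>) \<le> En (\<lambda>t. ennreal \<bar>v t + u t\<bar>)"
        "En (\<lambda>t. ennreal \<bar>v t\<bar>) \<le> En (\<lambda>t. ennreal \<bar>v t + u t\<bar>)"
        using add(2,4) by (auto intro!: En_mono ennreal_leI)
      then show ?thesis using add(1,3,8) unfolding Lp_iff by (auto intro: le_less_trans)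
    qed
    then show ?case using norm_closure_add[OF V, of v u] add by (simp add: plus_fun_def)
  next
    case (seq U)
    have Ule: "U i t \<le> u t" if "t \<in> space Q" for i t
      using seq(4)[OF that] seq(3) by (intro incseq_le) (auto simp: incseq_def le_fun_def)
    have un: "0 \<le> u t" if "t \<in> space Q" for t using Ule[OF that, of 0] seq(2)[of 0 t] by linarith
    have UL: "U i \<in> L" for i
    proof -
      have "En (\<lambda>t. ennreal \<bar>U i t\<bar>) \<le> En (\<lambda>t. ennreal \<bar>u t\<bar>)"
      proof (intro En_mono ennreal_leI)
        fix t assume "t \<in> space Q"
        then show "\<bar>U i t\<bar> \<le> \<bar>u t\<bar>" using Ule[of t i] seq(2)[of i t] by simp
      qed
      then show ?thesis using seq(1,6) unfolding Lp_iff by (auto intro: le_less_trans)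
    qed
    define g where "g n t = ennreal \<bar>(u - U n) t\<bar>" for n t
    have "(\<lambda>n. En (g n)) \<longlonglongrightarrow> 0"
    proof (rule En_tendsto_0[where G = "\<lambda>t. ennreal \<bar>u t\<bar>"])
      show "g n \<in> borel_measurable Q" for n
        unfolding g_def using Lp_measurable[OF Lp_diff[OF seq(6) UL[of n]]] by measurable
      show "(\<lambda>t. ennreal \<bar>u t\<bar>) \<in> borel_measurable Q" using Lp_measurable[OF seq(6)] by measurable
      show "g n t \<le> ennreal \<bar>u t\<bar>" if "t \<in> space Q" for n t
        unfolding g_def using Ule[OF that, of n] seq(2)[of n t] by (intro ennreal_leI) simp
      show "(\<lambda>n. g n t) \<longlonglongrightarrow> 0" if "t \<in> space Q" for t
      proof -
        have "(\<lambda>n. ennreal \<bar>u t - U n t\<bar>) \<longlonglongrightarrow> ennreal \<bar>u t - u t\<bar>"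
          by (intro tendsto_intros seq(4) that)
        then show ?thesis by (simp add: g_def)
      qed
      show "En (\<lambda>t. ennreal \<bar>u t\<bar>) < top" using seq(6) by (simp add: Lp_iff)
    qed
    then have lim: "(\<lambda>n. ennreal (N (u - U n))) \<longlonglongrightarrow> 0"
      using ennreal_N[OF Lp_diff[OF seq(6) UL]] by (simp add: g_def[abs_def])
    show ?case
    proof (rule norm_closure_limit[OF span_bx_L seq(6)])
      fix \<epsilon> :: real assume "0 < \<epsilon>"
      then have "eventually (\<lambda>n. ennreal (N (u - U n)) < ennreal \<epsilon>) sequentially"
        using lim by (intro order_tendstoD(2)) auto
      then obtain n where "ennreal (N (u - U n)) < ennreal \<epsilon>" by (auto simp: eventually_sequentially)
      then have "N (u - U n) < \<epsilon>" using N_nn by (simp add: ennreal_less_iff)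
      then show "\<exists>g\<in>norm_closure ?V. N (u - g) < \<epsilon>" using seq(5) UL by blast
    qed
  qed
  assume f: "f \<in> L"
  note [measurable] = Lp_measurable[OF f]
  define f1 f2 where "f1 = (\<lambda>t. max 0 (f t))" and "f2 = (\<lambda>t. max 0 (- f t))"
  have [measurable]: "f1 \<in> borel_measurable Q" "f2 \<in> borel_measurable Q" unfolding f1_def f2_def by measurable
  have "En (\<lambda>t. ennreal \<bar>f1 t\<bar>) \<le> En (\<lambda>t. ennreal \<bar>f t\<bar>)" "En (\<lambda>t. ennreal \<bar>f2 t\<bar>) \<le> En (\<lambda>t. ennreal \<bar>f t\<bar>)"
    by (auto intro!: En_mono ennreal_leI simp: f1_def f2_def)
  then have "f1 \<in> L" "f2 \<in> L" using f unfolding Lp_iff by (auto intro: le_less_trans)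
  then have "f1 \<in> norm_closure ?V" "f2 \<in> norm_closure ?V" using pos[of f1] pos[of f2] by (auto simp: f1_def f2_def)
  from norm_closure_add[OF V this(1) norm_closure_scale[OF V this(2), of "-1"]]
  have "f1 + (-1) *\<^sub>R f2 \<in> norm_closure ?V" .
  moreover have "f1 + (-1) *\<^sub>R f2 = f" by (auto simp: fun_eq_iff f1_def f2_def scaleR_fun_def max_def)
  ultimately show "f \<in> norm_closure ?V" by simp
qed

end

section \<open>Totality of the Haar system\<close>

context mixed
begin

interpretation Lp: seminormed_subspace L N by (rule seminormed_L)

lemma tensor_upd:
  assumes "j \<in> Ix"
  shows "tensor \<phi> (t(j := s)) = \<phi> j s * (\<Prod>i\<in>Ix - {j}. \<phi> i (t i))"
    and "tensor (\<phi>(j := \<psi>)) t = \<psi> (t j) * (\<Prod>i\<in>Ix - {j}. \<phi> i (t i))"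
  unfolding tensor_def using assms by (simp_all add: prod.remove[of Ix j])

lemma tensor_split: "j \<in> Ix \<Longrightarrow> tensor \<phi> t = \<phi> j (t j) * (\<Prod>i\<in>Ix - {j}. \<phi> i (t i))"
  unfolding tensor_def by (rule prod.remove) simp_all

lemma Av_tens: "j \<in> Ix \<Longrightarrow> Av j (tensor \<phi>) t = (\<integral>s. \<phi> j s \<partial>unit_interval) * (\<Prod>i\<in>Ix - {j}. \<phi> i (t i))"
  unfolding Av_def by (simp add: tensor_upd del: fun_upd_apply)

lemma tensor_in_L:
  assumes "\<And>i. \<phi> i \<in> borel_measurable borel" "\<And>i s. \<bar>\<phi> i s\<bar> \<le> 1"
  shows "tensor \<phi> \<in> L"
proof (rule bounded_in_L[of _ 1])
  show "\<bar>tensor \<phi> t\<bar> \<le> 1" for t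
    unfolding tensor_def abs_prod using assms(2) by (intro prod_le_1) simp
qed (rule tensor_measurable[OF assms(1)])

text \<open>
  The indicator of a dyadic interval minus its mean; the constant is cut off at the end point \<open>1\<close>, as
  are all Haar functions.
\<close>

definition h1 :: "bool list \<Rightarrow> real \<Rightarrow> real" where
  "h1 I s = indicator (ivl I) s - 1 / 2 ^ length I * indicator (ivl []) s"

lemma h1_bounded: "\<bar>h1 I s\<bar> \<le> 1"
  using ivl_sub_unit[of I] by (auto simp: h1_def indicator_def ivl_Nil field_simps)

lemma h1_measurable: "h1 I \<in> borel_measurable borel"
  unfolding h1_def by measurable

text \<open>
  These families lead from dyadic boxes, for empty \<open>S\<close>, to tensor products that have mean zero in every
  variable, when \<open>S\<close> contains all of them.
\<close>

definition gens :: "nat set \<Rightarrow> ((nat \<Rightarrow> real) \<Rightarrow> real) set" where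
  "gens S = (\<lambda>K. tensor (\<lambda>i. if i \<in> S then h1 (K i) else indicator (ivl (K i)))) ` UNIV"

lemma gens_L: "gens S \<subseteq> L"
proof -
  have "tensor (\<lambda>i. if i \<in> S then h1 (K i) else indicator (ivl (K i))) \<in> L" for K
    by (rule tensor_in_L) (auto simp: h1_measurable h1_bounded indicator_def)
  then show ?thesis by (auto simp: gens_def)
qed

lemma span_gens_L: "span (gens S) \<subseteq> L"
  by (rule span_minimal[OF gens_L subspace_L])

lemma integral_ivl: "(\<integral>s. indicator (ivl I) s \<partial>unit_interval) = (1 / 2 ^ length I :: real)"
proof -
  have "measure unit_interval (ivl I) = 1 / 2 ^ length I"
    using emeasure_ivl[of I] by (simp add: measure_def)
  moreover have "ivl I \<inter> {0..1} = ivl I" using ivl_sub_unit[of I] by auto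
  ultimately show ?thesis by simp
qed

lemma integrable_bounded_unit:
  "\<phi> \<in> borel_measurable borel \<Longrightarrow> (\<And>s. \<bar>\<phi> s\<bar> \<le> 1) \<Longrightarrow> integrable unit_interval \<phi>" for \<phi> :: "real \<Rightarrow> real"
  by (rule unit_interval.integrable_const_bound[of _ 1]) (auto intro: measurable_restrict_space1)

text \<open>
  Subtracting the mean in the factor \<open>j\<close> of a combination \<open>g\<close> of boxes changes \<open>g\<close> by its own marginal.
  Integrability of the slices is carried along because marginals are additive only for integrable
  functions.
\<close>

lemma replace_factor:
  assumes j: "j \<in> Ix" "j \<notin> S" and g: "g \<in> span (gens S)"
  shows "(\<forall>t. integrable unit_interval (\<lambda>s. g (t(j := s)))) \<and>
    (\<exists>g'\<in>span (gens (insert j S)). \<forall>t. g t - g' t = indicator (ivl []) (t j) * Av j g t)"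
  using g
proof (induction rule: span_induct)
  case base
  show ?case
  proof (rule subspaceI)
    show "0 \<in> Collect (\<lambda>g. (\<forall>t. integrable unit_interval (\<lambda>s. g (t(j := s)))) \<and>
      (\<exists>g'\<in>span (gens (insert j S)). \<forall>t. g t - g' t = indicator (ivl []) (t j) * Av j g t))"
      using span_zero[of "gens (insert j S)"] by (auto simp: Av_def intro!: bexI[of _ 0])
  next
    fix x y
    assume "x \<in> Collect (\<lambda>g. (\<forall>t. integrable unit_interval (\<lambda>s. g (t(j := s)))) \<and>
      (\<exists>g'\<in>span (gens (insert j S)). \<forall>t. g t - g' t = indicator (ivl []) (t j) * Av j g t))"
      and "y \<in> Collect (\<lambda>g. (\<forall>t. integrable unit_interval (\<lambda>s. g (t(j := s)))) \<and>
      (\<exists>g'\<in>span (gens (insert j S)). \<forall>t. g t - g' t = indicator (ivl []) (t j) * Av j g t))"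
    then obtain x' y' where x: "\<forall>t. integrable unit_interval (\<lambda>s. x (t(j := s)))" "x' \<in> span (gens (insert j S))"
        "\<And>t. x t - x' t = indicator (ivl []) (t j) * Av j x t"
      and y: "\<forall>t. integrable unit_interval (\<lambda>s. y (t(j := s)))" "y' \<in> span (gens (insert j S))"
        "\<And>t. y t - y' t = indicator (ivl []) (t j) * Av j y t" by blast
    have "Av j (x + y) t = Av j x t + Av j y t" for t
      using x(1) y(1) by (simp add: Av_def del: fun_upd_apply)
    then have "(x + y) t - (x' + y') t = indicator (ivl []) (t j) * Av j (x + y) t" for t
      using x(3)[of t] y(3)[of t] by (simp add: algebra_simps)
    moreover have "x' + y' \<in> span (gens (insert j S))" by (rule span_add[OF x(2) y(2)])
    moreover have "\<forall>t. integrable unit_interval (\<lambda>s. (x + y) (t(j := s)))"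
      using x(1) y(1) by (simp del: fun_upd_apply)
    ultimately show "x + y \<in> Collect (\<lambda>g. (\<forall>t. integrable unit_interval (\<lambda>s. g (t(j := s)))) \<and>
      (\<exists>g'\<in>span (gens (insert j S)). \<forall>t. g t - g' t = indicator (ivl []) (t j) * Av j g t))" by blast
  next
    fix c x
    assume "x \<in> Collect (\<lambda>g. (\<forall>t. integrable unit_interval (\<lambda>s. g (t(j := s)))) \<and>
      (\<exists>g'\<in>span (gens (insert j S)). \<forall>t. g t - g' t = indicator (ivl []) (t j) * Av j g t))"
    then obtain x' where x: "\<forall>t. integrable unit_interval (\<lambda>s. x (t(j := s)))" "x' \<in> span (gens (insert j S))"
        "\<And>t. x t - x' t = indicator (ivl []) (t j) * Av j x t" by blast
    have "Av j (c *\<^sub>R x) t = c * Av j x t" for t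
      by (simp add: Av_def scaleR_fun_def del: fun_upd_apply)
    then have "(c *\<^sub>R x) t - (c *\<^sub>R x') t = indicator (ivl []) (t j) * Av j (c *\<^sub>R x) t" for t
      using arg_cong[OF x(3)[of t], of "\<lambda>z. c * z"] by (simp add: scaleR_fun_def algebra_simps)
    moreover have "c *\<^sub>R x' \<in> span (gens (insert j S))" by (rule span_scale[OF x(2)])
    moreover have "\<forall>t. integrable unit_interval (\<lambda>s. (c *\<^sub>R x) (t(j := s)))"
      using x(1) by (simp add: scaleR_fun_def del: fun_upd_apply)
    ultimately show "c *\<^sub>R x \<in> Collect (\<lambda>g. (\<forall>t. integrable unit_interval (\<lambda>s. g (t(j := s)))) \<and>
      (\<exists>g'\<in>span (gens (insert j S)). \<forall>t. g t - g' t = indicator (ivl []) (t j) * Av j g t))" by blast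
  qed
next
  case (step x)
  then obtain K where K: "x = tensor (\<lambda>i. if i \<in> S then h1 (K i) else indicator (ivl (K i)))"
    by (auto simp: gens_def)
  define \<phi> where "\<phi> i = (if i \<in> S then h1 (K i) else indicator (ivl (K i)))" for i
  have x: "x = tensor \<phi>" by (simp add: K \<phi>_def[abs_def])
  have \<phi>j: "\<phi> j = indicator (ivl (K j))" using j by (simp add: \<phi>_def)
  define x' where "x' = tensor (\<lambda>i. if i \<in> insert j S then h1 (K i) else indicator (ivl (K i)))"
  have "(\<lambda>i. if i \<in> insert j S then h1 (K i) else indicator (ivl (K i))) = \<phi>(j := h1 (K j))"
    by (auto simp: \<phi>_def)
  then have x': "x' = tensor (\<phi>(j := h1 (K j)))" by (simp add: x'_def)
  have "integrable unit_interval (\<lambda>s. x (t(j := s)))" for t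
    unfolding x tensor_upd(1)[OF j(1)] \<phi>j
    by (intro integrable_mult_left integrable_bounded_unit) (auto simp: indicator_def)
  moreover have "x t - x' t = indicator (ivl []) (t j) * Av j x t" for t
    unfolding x x' Av_tens[OF j(1)] tensor_upd(2)[OF j(1)] tensor_split[OF j(1), of \<phi>] \<phi>j integral_ivl
    by (simp add: h1_def algebra_simps)
  moreover have "x' \<in> span (gens (insert j S))"
    unfolding x'_def gens_def by (intro span_base imageI UNIV_I)
  ultimately show ?case by blast
qed

lemma slice_Q_measurable:
  assumes j: "j \<in> Ix" and g: "g \<in> borel_measurable Q"
  shows "(\<lambda>(t, s). g (t(j := s))) \<in> borel_measurable (Q \<Otimes>\<^sub>M unit_interval)"
proof -
  have "insert j Ix = Ix" using j by auto
  then show ?thesis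
    using measurable_compose[OF measurable_add_dim[of j Ix "\<lambda>_. unit_interval"], of g borel] g
    by (simp add: split_beta')
qed

lemma En_AE_mono:
  assumes [measurable]: "h \<in> borel_measurable Q" "k \<in> borel_measurable Q" and le: "AE t in Q. h t \<le> k t"
  shows "En h \<le> En k"
proof -
  define m where "m t = (if h t \<le> k t then 0 else h t)" for t
  have [measurable]: "m \<in> borel_measurable Q" unfolding m_def by measurable
  have "AE t in Q. m t = 0" using le by eventually_elim (simp add: m_def)
  then have "En m = 0" by (intro En_zero) auto
  have "En h \<le> En (\<lambda>t. k t + m t)" by (intro En_mono) (simp add: m_def)
  also have "\<dots> \<le> En k + En m" by (rule En_add) auto
  finally show ?thesis using \<open>En m = 0\<close> by simp
qed

text \<open>
  The marginal of \<open>g\<close> is that of \<open>g - f\<close>, and averaging does not increase the norm.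
\<close>

lemma En_Av_le:
  assumes j: "j \<in> Ix" and f: "f \<in> X" and g: "g \<in> L"
  shows "En (\<lambda>t. ennreal \<bar>Av j g t\<bar>) \<le> ennreal (N (g - f))"
proof -
  have fL: "f \<in> L" and f0: "AE t in cube (Ix - {j}). Av j f t = 0" using f j by (auto simp: X_iff)
  let ?C = "cube (Ix - {j})"
  have gfL: "g - f \<in> L" by (rule Lp_diff[OF g fL])
  define h where "h t = ennreal \<bar>Av j g t\<bar>" for t
  define k where "k t = (\<integral>\<^sup>+ s. ennreal \<bar>(g - f) (t(j := s))\<bar> \<partial>unit_interval)" for t
  have [measurable]: "Av j g \<in> borel_measurable Q"
    unfolding Av_def using slice_Q_measurable[OF j Lp_measurable[OF g]]
    by (intro unit_interval.borel_measurable_lebesgue_integral)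
  have [measurable]: "h \<in> borel_measurable Q" unfolding h_def by measurable
  have abs_m: "(\<lambda>t. ennreal \<bar>(g - f) t\<bar>) \<in> borel_measurable Q"
    using Lp_measurable[OF gfL] by measurable
  have [measurable]: "k \<in> borel_measurable Q"
    unfolding k_def using slice_Q_measurable[OF j abs_m]
    by (intro unit_interval.borel_measurable_nn_integral)
  \<comment> \<open>The pointwise estimate holds off a null set of the lower dimensional cube. To lift it to the
    cube, the function \<open>m\<close> collects the exceptional values; it does not depend on the \<open>j\<close>-th
    coordinate.\<close>
  define m where "m t = (if h t \<le> k t then 0 else h t)" for t
  have [measurable]: "m \<in> borel_measurable Q" unfolding m_def by measurable
  have inv: "m (t(j := s)) = m t" for t s by (simp add: m_def h_def k_def Av_def del: fun_upd_apply)
  have "AE t in ?C. m t = 0"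
    using Av_diff_bound[OF j g fL f0] by eventually_elim (simp add: m_def h_def k_def)
  then have "(\<integral>\<^sup>+ t. (\<integral>\<^sup>+ s. m (t(j := s)) \<partial>unit_interval) \<partial>?C) = (\<integral>\<^sup>+ t. 0 \<partial>?C)"
    unfolding inv by (intro nn_integral_cong_AE) (auto elim!: eventually_mono)
  then have "(\<integral>\<^sup>+ t. m t \<partial>Q) = 0" by (subst nn_integral_slice[OF j]) auto
  then have "AE t in Q. m t = 0" by (subst (asm) nn_integral_0_iff_AE) auto
  then have "AE t in Q. h t \<le> k t" by eventually_elim (simp add: m_def split: if_splits)
  then have "En h \<le> En k" by (intro En_AE_mono) auto
  also have "En k \<le> En (\<lambda>t. ennreal \<bar>(g - f) t\<bar>)"
    unfolding k_def by (rule En_average[OF j abs_m])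
  also have "\<dots> = ennreal (N (g - f))" by (rule ennreal_N[OF gfL, symmetric])
  finally show ?thesis by (simp add: h_def[abs_def])
qed

text \<open>
  One coordinate at a time: if \<open>g\<close> is close to \<open>f\<close>, and \<open>f\<close> has vanishing marginal in the variable \<open>j\<close>,
  then the marginal of \<open>g\<close> is small and can be removed from \<open>g\<close>.
\<close>

lemma approx_gens:
  assumes f: "f \<in> X" and S: "S \<subseteq> Ix" and "0 < \<epsilon>"
  shows "\<exists>g\<in>span (gens S). N (f - g) < \<epsilon>"
proof -
  have fL: "f \<in> L" using f by (rule X_sub_L)
  have "finite S" by (rule finite_subset[OF S finite_Ix])
  from this S \<open>0 < \<epsilon>\<close> show ?thesis
  proof (induction S arbitrary: \<epsilon> rule: finite_induct)
    case empty
    have "range bx = gens {}" by (simp add: gens_def bx_def[abs_def])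
    then show ?case using dyadic_steps_dense[OF fL] empty(2) unfolding norm_closure_def by (simp only: mem_Collect_eq)
  next
    case (insert j S)
    then have j: "j \<in> Ix" "j \<notin> S" by auto
    have "S \<subseteq> Ix" "0 < \<epsilon> / 2" using insert.prems by auto
    from insert.IH[OF this] obtain g where g: "g \<in> span (gens S)" "N (f - g) < \<epsilon> / 2" by blast
    have gL: "g \<in> L" using g span_gens_L by blast
    obtain g' where g': "g' \<in> span (gens (insert j S))" "\<And>t. g t - g' t = indicator (ivl []) (t j) * Av j g t"
      using replace_factor[OF j g(1)] by blast
    have g'L: "g' \<in> L" using g' span_gens_L by blast
    have "En (\<lambda>t. ennreal \<bar>(g - g') t\<bar>) \<le> En (\<lambda>t. ennreal \<bar>Av j g t\<bar>)"
      using g'(2) by (intro En_mono ennreal_leI) (simp add: abs_mult indicator_def)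
    also have "\<dots> \<le> ennreal (N (g - f))" by (rule En_Av_le[OF j(1) f gL])
    finally have "N (g - g') \<le> N (g - f)" by (intro N_le N_nn)
    moreover have "N (f - g') \<le> N (f - g) + N (g - g')" by (rule Lp.N_triangle[OF fL gL g'L])
    moreover have "N (g - f) = N (f - g)" by (rule Lp.N_minus_commute[OF gL fL])
    ultimately have "N (f - g') < \<epsilon>" using g(2) by linarith
    then show ?case by (rule bexI[OF _ g'(1)])
  qed
qed

definition hsys :: "(nat \<Rightarrow> bool list) \<Rightarrow> (nat \<Rightarrow> real) \<Rightarrow> real" where
  "hsys K = tensor (\<lambda>i. haar (ivl (K i)))"

lemma haar_measurable: "haar (ivl I) \<in> borel_measurable borel"
  unfolding haar_ivl[abs_def] by measurable

lemma haar_bounded: "\<bar>haar (ivl I) s\<bar> \<le> 1"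
  unfolding haar_ivl by (auto simp: indicator_def)

lemma hsys_in_X: "hsys K \<in> X"
  unfolding X_iff
proof (intro conjI ballI)
  show "hsys K \<in> L" unfolding hsys_def
    by (rule tensor_in_L) (auto simp: haar_measurable haar_bounded)
  show "AE t in cube (Ix - {j}). Av j (hsys K) t = 0" if "j \<in> Ix" for j
    unfolding hsys_def Av_tens[OF that] integral_haar by simp
qed

text \<open>
  Halving an interval averages the centred indicator with plus or minus the Haar function.
\<close>

lemma h1_span: "h1 I \<in> span (range (\<lambda>I. haar (ivl I)))"
proof (induction I rule: rev_induct)
  case Nil
  have "h1 [] = 0" by (simp add: h1_def fun_eq_iff)
  then show ?case by (simp only: span_zero)
next
  case (snoc b I)
  have "h1 (I @ [b]) = (1/2) *\<^sub>R h1 I + (sg b / 2) *\<^sub>R haar (ivl I)"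
  proof
    fix s
    have "indicator (ivl I) s = (indicator (ivl (I @ [True])) s + indicator (ivl (I @ [False])) s :: real)"
      using ivl_split[of I] by (auto simp: indicator_def)
    then show "h1 (I @ [b]) s = ((1/2) *\<^sub>R h1 I + (sg b / 2) *\<^sub>R haar (ivl I)) s"
      by (cases b) (simp_all add: h1_def haar_ivl scaleR_fun_def field_simps)
  qed
  moreover have "haar (ivl I) \<in> span (range (\<lambda>I. haar (ivl I)))" by (rule span_base) simp
  ultimately show ?case using snoc by (simp only: span_add span_scale)
qed

text \<open>
  Multilinearity of the tensor product, one factor at a time.
\<close>

lemma tensor_span:
  assumes "S \<subseteq> Ix" "\<And>i. i \<in> S \<Longrightarrow> \<phi> i \<in> span (range (\<lambda>I. haar (ivl I)))"
    "\<And>i. i \<notin> S \<Longrightarrow> \<phi> i \<in> range (\<lambda>I. haar (ivl I))"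
  shows "tensor \<phi> \<in> span (range hsys)"
proof -
  have "finite S" by (rule finite_subset[OF assms(1) finite_Ix])
  from this assms show ?thesis
  proof (induction S arbitrary: \<phi> rule: finite_induct)
    case empty
    then have "\<forall>i. \<exists>I. \<phi> i = haar (ivl I)" by blast
    then obtain K where "\<And>i. \<phi> i = haar (ivl (K i))" by metis
    then have "tensor \<phi> = hsys K" by (simp add: hsys_def tensor_def[abs_def])
    then show ?case by (simp add: span_base)
  next
    case (insert j S)
    have j: "j \<in> Ix" using insert by auto
    have "tensor (\<phi>(j := \<psi>)) \<in> span (range hsys)" if "\<psi> \<in> span (range (\<lambda>I. haar (ivl I)))" for \<psi>
      using that
    proof (induction rule: span_induct)
      case base
      show ?case
      proof (rule subspaceI)
        have "tensor (\<phi>(j := 0)) = 0" by (simp add: fun_eq_iff tensor_upd(2)[OF j])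
        then show "0 \<in> Collect (\<lambda>\<psi>. tensor (\<phi>(j := \<psi>)) \<in> span (range hsys))" by (simp only: mem_Collect_eq span_zero)
      next
        fix x y
        assume xy: "x \<in> Collect (\<lambda>\<psi>. tensor (\<phi>(j := \<psi>)) \<in> span (range hsys))" "y \<in> Collect (\<lambda>\<psi>. tensor (\<phi>(j := \<psi>)) \<in> span (range hsys))"
        have "tensor (\<phi>(j := x + y)) = tensor (\<phi>(j := x)) + tensor (\<phi>(j := y))"
          by (simp add: fun_eq_iff tensor_upd(2)[OF j] distrib_right)
        then show "x + y \<in> Collect (\<lambda>\<psi>. tensor (\<phi>(j := \<psi>)) \<in> span (range hsys))"
          using xy by (simp only: mem_Collect_eq span_add)
      next
        fix c x
        assume x: "x \<in> Collect (\<lambda>\<psi>. tensor (\<phi>(j := \<psi>)) \<in> span (range hsys))"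
        have "tensor (\<phi>(j := c *\<^sub>R x)) = c *\<^sub>R tensor (\<phi>(j := x))"
          by (simp add: fun_eq_iff tensor_upd(2)[OF j] scaleR_fun_def mult.assoc)
        then show "c *\<^sub>R x \<in> Collect (\<lambda>\<psi>. tensor (\<phi>(j := \<psi>)) \<in> span (range hsys))"
          using x by (simp only: mem_Collect_eq span_scale)
      qed
    next
      case (step \<psi>)
      have "(\<phi>(j := \<psi>)) i \<in> span (range (\<lambda>I. haar (ivl I)))" if "i \<in> S" for i
        using insert.prems(2)[of i] that insert.hyps(2) by auto
      moreover have "(\<phi>(j := \<psi>)) i \<in> range (\<lambda>I. haar (ivl I))" if "i \<notin> S" for i
        using insert.prems(3)[of i] that step by (cases "i = j") auto
      ultimately show ?case using insert.IH[of "\<phi>(j := \<psi>)"] insert.prems(1) by blast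
    qed
    from this[of "\<phi> j"] insert.prems(2)[of j] show ?case by simp
  qed
qed

lemma gens_Ix_span: "gens Ix \<subseteq> span (range hsys)"
proof
  fix g assume "g \<in> gens Ix"
  then obtain K where "g = tensor (\<lambda>i. if i \<in> Ix then h1 (K i) else indicator (ivl (K i)))" by (auto simp: gens_def)
  then have "g = tensor (\<lambda>i. if i \<in> Ix then h1 (K i) else haar (ivl []))"
    by (simp add: tensor_def[abs_def])
  also have "\<dots> \<in> span (range hsys)"
    by (rule tensor_span[of Ix]) (auto simp: h1_span)
  finally show "g \<in> span (range hsys)" .
qed

text \<open>
  The combination of the two steps: \<open>f\<close> is approximated by tensor products of centred indicators, and
  these are finite combinations of Haar functions.
\<close>

lemma haar_total:
  assumes "f \<in> X" "0 < \<epsilon>"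
  shows "\<exists>g\<in>span (range hsys). N (f - g) < \<epsilon>"
proof -
  obtain g where "g \<in> span (gens Ix)" "N (f - g) < \<epsilon>" using approx_gens[OF assms(1) order_refl assms(2)] by blast
  moreover have "span (gens Ix) \<subseteq> span (range hsys)"
    by (rule span_minimal[OF gens_Ix_span subspace_span])
  ultimately show ?thesis by blast
qed

lemma N_hsys_pos: "0 < N (hsys K)"
proof -
  have L: "hsys K \<in> L" by (rule X_sub_L[OF hsys_in_X])
  have "(\<integral>\<^sup>+ t. ennreal \<bar>hsys K t\<bar> \<partial>Q) = (\<integral>\<^sup>+ t. (\<Prod>i\<in>Ix. ennreal \<bar>haar (ivl (K i)) (t i)\<bar>) \<partial>Q)"
    by (simp add: hsys_def tensor_def abs_prod prod_ennreal)
  also have "\<dots> = (\<Prod>i\<in>Ix. \<integral>\<^sup>+ s. ennreal \<bar>haar (ivl (K i)) s\<bar> \<partial>unit_interval)"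
  proof (rule cubes.product_nn_integral_prod)
    fix i
    note [measurable] = haar_measurable[of "K i"]
    show "(\<lambda>s. ennreal \<bar>haar (ivl (K i)) s\<bar>) \<in> borel_measurable unit_interval"
      by (rule measurable_restrict_space1) measurable
  qed simp
  also have "\<dots> \<noteq> 0"
  proof -
    have "(\<integral>\<^sup>+ s. ennreal \<bar>haar (ivl I) s\<bar> \<partial>unit_interval) \<noteq> 0" for I
    proof -
      have "ennreal \<bar>haar (ivl I) s\<bar> = indicator (ivl I) s" for s
        using ivl_split[of I] unfolding haar_ivl by (auto simp: indicator_def)
      then show ?thesis by (simp add: emeasure_ivl del: Int_iff)
    qed
    then show ?thesis by simp
  qed
  finally have "N (hsys K) \<noteq> 0" using nn_integral_le_N[OF L] by (auto simp: le_zero_eq)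
  then show ?thesis using N_nn[of "hsys K"] by simp
qed

end

section \<open>Haar sums on the grid\<close>

lemma th_prod: "length u = length J \<Longrightarrow> th J u = (\<Prod>i<length J. hr (J ! i) (u ! i))"
proof (induction J arbitrary: u)
  case (Cons I J)
  then obtain s v where u: "u = s # v" "length v = length J" by (cases u) auto
  show ?case using Cons.IH[OF u(2)] by (simp add: u prod.lessThan_Suc_shift del: prod.lessThan_Suc)
qed simp

lemma th_snoc: "length J = length v \<Longrightarrow> th (J @ [I]) (v @ [s]) = th J v * hr I s"
  by (induction J v rule: list_induct2) simp_all

lemma avg_take: "avg (m + n) (\<lambda>s. f (take m s)) = avg m f"
proof (induction m arbitrary: f)
  case (Suc m)
  show ?case using Suc[of "\<lambda>s. f (True # s)"] Suc[of "\<lambda>s. f (False # s)"] by (simp add: avg_Suc)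
qed simp

lemma hr_square: "length I < length s \<Longrightarrow> (hr I s)\<^sup>2 = (if take (length I) s = I then 1 else 0)"
  by (auto simp: hr_eq sg_def)

text \<open>
  The squares of the Haar functions of all subintervals of a fixed level are the indicators of a
  partition of \<open>I\<close>; exactly one summand survives at each atom.
\<close>

lemma sum_hr_extensions:
  assumes "length s = n" "length I + k < n"
  shows "(\<Sum>r\<in>pts k. (hr (I @ r) s)\<^sup>2 * f r) = (hr I s)\<^sup>2 * f (take k (drop (length I) s))"
proof -
  have "(\<Sum>r\<in>pts k. (hr (I @ r) s)\<^sup>2 * f r)
     = (\<Sum>r\<in>pts k. if r = take k (drop (length I) s) then (hr I s)\<^sup>2 * f r else 0)"
  proof (rule sum.cong[OF refl])
    fix r assume r: "r \<in> pts k"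
    then have "take (length (I @ r)) s = I @ r \<longleftrightarrow> take (length I) s = I \<and> r = take k (drop (length I) s)"
      using assms by (auto simp: pts_def take_add)
    then show "(hr (I @ r) s)\<^sup>2 * f r = (if r = take k (drop (length I) s) then (hr I s)\<^sup>2 * f r else 0)"
      using assms r by (simp add: hr_square pts_def)
  qed
  also have "\<dots> = (hr I s)\<^sup>2 * f (take k (drop (length I) s))"
  proof -
    have "take k (drop (length I) s) \<in> pts k" using assms by (simp add: pts_def)
    then show ?thesis by simp
  qed
  finally show ?thesis .
qed

context mixed
begin

abbreviation "ps \<equiv> map p js"

lemma length_js: "length js = d" "length ps = d"
  by (simp_all add: js_def)

lemma ps_gt_1: "r \<in> set ps \<Longrightarrow> 1 < r"
  using js_facts(3) by auto

lemma ps_pos: "r \<in> set ps \<Longrightarrow> 0 < r"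
  using ps_gt_1 by fastforce

text \<open>
  Coordinates are numbered from \<open>1\<close>, list positions from \<open>0\<close>.
\<close>

definition hrect :: "bool list list \<Rightarrow> (nat \<Rightarrow> real) \<Rightarrow> real" where
  "hrect J = hsys (\<lambda>i. J ! (i - 1))"

text \<open>
  The norm of a finite Haar sum is a norm on the grid.
\<close>

lemma N_haar_sum:
  fixes \<rho> :: "'k \<Rightarrow> bool list list"
  assumes \<rho>: "\<And>k. k \<in> K \<Longrightarrow> \<rho> k \<in> rects n d"
  shows "N (\<Sum>k\<in>K. a k *\<^sub>R hrect (\<rho> k)) = sn n ps (\<lambda>u. \<Sum>k\<in>K. th (\<rho> k) u * a k)"
proof -
  let ?f = "\<Sum>k\<in>K. a k *\<^sub>R hrect (\<rho> k)"
  have "En (\<lambda>t. ennreal \<bar>?f t\<bar>) = ennreal (sn n ps (\<lambda>u. \<Sum>k\<in>K. th (\<rho> k) u * a k))"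
    unfolding En_def
  proof (rule inorm_eq_sn)
    fix u t'
    assume u: "u \<in> grid n (length js)" and t': "\<And>i. i < length js \<Longrightarrow> t' (js ! i) \<in> ivl (u ! i)"
    have "hrect (\<rho> k) t' = th (\<rho> k) u" if k: "k \<in> K" for k
    proof -
      have len: "length (\<rho> k) = d" "length u = d" using \<rho>[OF k] u by (simp_all add: rects_def grid_def length_js)
      have "hrect (\<rho> k) t' = (\<Prod>i\<in>Ix. haar (ivl (\<rho> k ! (i - 1))) (t' i))"
        by (simp add: hrect_def hsys_def tensor_def)
      also have "\<dots> = (\<Prod>i<d. haar (ivl (\<rho> k ! i)) (t' (Suc i)))"
        unfolding Ix_def by (rule prod.reindex_bij_witness[of _ Suc "\<lambda>i. i - 1"]) auto
      also have "\<dots> = (\<Prod>i<d. hr (\<rho> k ! i) (u ! i))"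
      proof (rule prod.cong[OF refl])
        fix i assume "i \<in> {..<d}"
        then have i: "i < d" by simp
        have "\<rho> k ! i \<in> set (\<rho> k)" "u ! i \<in> set u" using i len by auto
        then have "length (\<rho> k ! i) < n" "length (u ! i) = n"
          using \<rho>[OF k] u by (auto simp: rects_def grid_def nodes_def pts_def)
        moreover have "t' (Suc i) \<in> ivl (u ! i)" using t'[of i] i by (simp add: length_js js_def nth_upt del: upt_Suc)
        ultimately show "haar (ivl (\<rho> k ! i)) (t' (Suc i)) = hr (\<rho> k ! i) (u ! i)"
          by (intro haar_eq_hr) auto
      qed
      also have "\<dots> = th (\<rho> k) u" using len by (simp add: th_prod)
      finally show ?thesis .
    qed
    then have "?f t' = (\<Sum>k\<in>K. th (\<rho> k) u * a k)"
      by (simp add: sum_fun_apply scaleR_fun_def mult.commute)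
    then show "ennreal \<bar>?f t'\<bar> = ennreal \<bar>\<Sum>k\<in>K. th (\<rho> k) u * a k\<bar>" by simp
  qed (use js_facts in auto)
  then show ?thesis by (simp add: mixed_norm_def mixed_ennorm_eq sn_nonneg)
qed

text \<open>
  A variant of the square function estimates for indexed families, which are extended by zero
  coefficients to all rectangles of the grid.
\<close>

lemma square_function_indexed:
  obtains C where "1 \<le> C"
    "\<And>n (K :: 'k set) \<rho> a. finite K \<Longrightarrow> inj_on \<rho> K \<Longrightarrow> \<rho> ` K \<subseteq> rects n d \<Longrightarrow>
       sn n ps (\<lambda>u. \<Sum>k\<in>K. th (\<rho> k) u * a k) \<le> C * sn n ps (\<lambda>u. L2_set (\<lambda>k. th (\<rho> k) u * a k) K)"
    "\<And>n (K :: 'k set) \<rho> a. finite K \<Longrightarrow> inj_on \<rho> K \<Longrightarrow> \<rho> ` K \<subseteq> rects n d \<Longrightarrow>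
       sn n ps (\<lambda>u. L2_set (\<lambda>k. th (\<rho> k) u * a k) K) \<le> C * sn n ps (\<lambda>u. \<Sum>k\<in>K. th (\<rho> k) u * a k)"
proof -
  obtain C where C: "0 < C" and
    1: "\<And>n a. sn n ps (\<lambda>u. \<Sum>J\<in>rects n d. th J u * a J) \<le> C * sn n ps (\<lambda>u. L2_set (\<lambda>J. th J u * a J) (rects n d))" and
    2: "\<And>n a. sn n ps (\<lambda>u. L2_set (\<lambda>J. th J u * a J) (rects n d)) \<le> C * sn n ps (\<lambda>u. \<Sum>J\<in>rects n d. th J u * a J)"
    using square_function[of ps, OF ps_gt_1] unfolding length_js by blast
  have key: "(\<Sum>k\<in>K. th (\<rho> k) u * a k) = (\<Sum>J\<in>rects n d. th J u * (if J \<in> \<rho> ` K then a (inv_into K \<rho> J) else 0))"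
    "L2_set (\<lambda>k. th (\<rho> k) u * a k) K = L2_set (\<lambda>J. th J u * (if J \<in> \<rho> ` K then a (inv_into K \<rho> J) else 0)) (rects n d)"
    if K: "finite K" "inj_on \<rho> K" "\<rho> ` K \<subseteq> rects n d" for n and K :: "'k set" and \<rho> a u
  proof -
    have gen: "(\<Sum>J\<in>rects n d. if J \<in> \<rho> ` K then h J (a (inv_into K \<rho> J)) else 0) = (\<Sum>k\<in>K. h (\<rho> k) (a k))" for h :: "_ \<Rightarrow> _ \<Rightarrow> real"
    proof -
      have "(\<Sum>J\<in>rects n d. if J \<in> \<rho> ` K then h J (a (inv_into K \<rho> J)) else 0) = (\<Sum>J\<in>\<rho> ` K. h J (a (inv_into K \<rho> J)))"
        using K(3) by (simp add: sum.If_cases Int_absorb1 del: image_iff)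
      also have "\<dots> = (\<Sum>k\<in>K. h (\<rho> k) (a k))" using K by (simp add: sum.reindex)
      finally show ?thesis .
    qed
    show "(\<Sum>k\<in>K. th (\<rho> k) u * a k) = (\<Sum>J\<in>rects n d. th J u * (if J \<in> \<rho> ` K then a (inv_into K \<rho> J) else 0))"
      unfolding gen[of "\<lambda>J z. th J u * z", symmetric] by (intro sum.cong) auto
    show "L2_set (\<lambda>k. th (\<rho> k) u * a k) K = L2_set (\<lambda>J. th J u * (if J \<in> \<rho> ` K then a (inv_into K \<rho> J) else 0)) (rects n d)"
      by (rule L2_set_sum_eq, unfold gen[of "\<lambda>J z. (th J u * z)\<^sup>2", symmetric]) (intro sum.cong, auto)
  qed
  show thesis
  proof (rule that[of "max 1 C"])
    fix n :: nat and K :: "'k set" and \<rho> a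
    assume K: "finite K" "inj_on \<rho> K" "\<rho> ` K \<subseteq> rects n d"
    have m: "C * sn n ps f \<le> max 1 C * sn n ps f" for f
      by (intro mult_right_mono sn_nonneg) simp
    show "sn n ps (\<lambda>u. \<Sum>k\<in>K. th (\<rho> k) u * a k) \<le> max 1 C * sn n ps (\<lambda>u. L2_set (\<lambda>k. th (\<rho> k) u * a k) K)"
      unfolding key[OF K] by (rule order_trans[OF 1 m])
    show "sn n ps (\<lambda>u. L2_set (\<lambda>k. th (\<rho> k) u * a k) K) \<le> max 1 C * sn n ps (\<lambda>u. \<Sum>k\<in>K. th (\<rho> k) u * a k)"
      unfolding key[OF K] by (rule order_trans[OF 2 m])
  qed simp
qed

text \<open>
  The last variable is the innermost one, so that Stein's inequality for it holds for each value of
  the other variables, which play the role of parameters.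
\<close>

lemma Stein_last_variable:
  obtains C where "1 \<le> C"
    "\<And>n (K::'k set) l g. \<forall>k\<in>K. l k \<le> n \<Longrightarrow>
       sn n ps (\<lambda>u. L2_set (\<lambda>k. cexp n (l k) (g k (butlast u)) (last u)) K) \<le> C * sn n ps (\<lambda>u. L2_set (\<lambda>k. g k (butlast u) (last u)) K)"
proof -
  have dIx: "d \<in> {1..d}" using d by simp
  obtain C where C: "0 < C" and
    st: "\<And>n (K::'k set) l g. (\<And>k. k \<in> K \<Longrightarrow> l k \<le> n) \<Longrightarrow>
       sn n [p d] (\<lambda>u. L2_set (\<lambda>k. cexp n (l k) (g k) (hd u)) K) \<le> C * sn n [p d] (\<lambda>u. L2_set (\<lambda>k. g k (hd u)) K)"
    using stein_inequality[OF p[OF dIx]] by blast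
  have e: "ps = map p [1..<d] @ [p d]" using d by (simp add: js_def)
  have main: "sn n ps (\<lambda>u. L2_set (\<lambda>k. cexp n (l k) (g k (butlast u)) (last u)) K) \<le> C * sn n ps (\<lambda>u. L2_set (\<lambda>k. g k (butlast u) (last u)) K)"
    if l: "\<And>k. k \<in> K \<Longrightarrow> l k \<le> n" for n and K :: "'k set" and l g
    unfolding e
  proof (rule sn_append_le)
    show "0 < q" if "q \<in> set (map p [1..<d])" for q using that ps_pos unfolding e by simp
    fix v
    have c: "sn n [p d] (\<lambda>w. F (v @ w)) = sn n [p d] (\<lambda>w. F (v @ [hd w]))" for F
      by (rule sn_cong) (auto simp: grid_def length_Suc_conv)
    show "sn n [p d] (\<lambda>w. L2_set (\<lambda>k. cexp n (l k) (g k (butlast (v @ w))) (last (v @ w))) K)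
        \<le> C * sn n [p d] (\<lambda>w. L2_set (\<lambda>k. g k (butlast (v @ w)) (last (v @ w))) K)"
      using st[OF l, where g = "\<lambda>k. g k v"]
      unfolding c[of "\<lambda>u. L2_set (\<lambda>k. cexp n (l k) (g k (butlast u)) (last u)) K"] c[of "\<lambda>u. L2_set (\<lambda>k. g k (butlast u) (last u)) K"]
      by (simp del: sn.simps)
  qed (use C in simp)
  show thesis
  proof (rule that[of "max 1 C"])
    fix n :: nat and K :: "'k set" and l g
    assume l: "\<forall>k\<in>K. l k \<le> n"
    show "sn n ps (\<lambda>u. L2_set (\<lambda>k. cexp n (l k) (g k (butlast u)) (last u)) K) \<le> max 1 C * sn n ps (\<lambda>u. L2_set (\<lambda>k. g k (butlast u) (last u)) K)"
      by (rule order_trans[OF main mult_right_mono[OF _ sn_nonneg]]) (use l in auto)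
  qed simp
qed

lemma dyadic_rectangles_bij:
  "bij_betw (\<lambda>J. \<lambda>i\<in>{1..d}. ivl (J ! (i - 1))) {J. length J = d} (dyadic_rectangles d)"
proof (rule bij_betwI')
  fix J K :: "bool list list" assume JK: "J \<in> {J. length J = d}" "K \<in> {J. length J = d}"
  show "(\<lambda>i\<in>{1..d}. ivl (J ! (i - 1))) = (\<lambda>i\<in>{1..d}. ivl (K ! (i - 1))) \<longleftrightarrow> J = K"
  proof
    assume e: "(\<lambda>i\<in>{1..d}. ivl (J ! (i - 1))) = (\<lambda>i\<in>{1..d}. ivl (K ! (i - 1)))"
    show "J = K"
    proof (rule nth_equalityI)
      fix i assume "i < length J"
      then have "ivl (J ! i) = ivl (K ! i)" using fun_cong[OF e, of "Suc i"] JK by simp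
      then show "J ! i = K ! i" using ivl_inj by (simp add: inj_eq)
    qed (use JK in simp)
  qed simp
next
  fix J :: "bool list list"
  show "(\<lambda>i\<in>{1..d}. ivl (J ! (i - 1))) \<in> dyadic_rectangles d"
    by (auto simp: dyadic_rectangles_def dyadic_intervals_eq)
next
  fix R assume R: "R \<in> dyadic_rectangles d"
  then have "\<forall>i\<in>{1..d}. \<exists>I. R i = ivl I" by (auto simp: dyadic_rectangles_def dyadic_intervals_eq)
  then obtain f where f: "\<And>i. i \<in> {1..d} \<Longrightarrow> R i = ivl (f i)" by metis
  have "R = (\<lambda>i\<in>{1..d}. ivl (map f [1..<Suc d] ! (i - 1)))"
  proof
    fix i
    show "R i = (\<lambda>i\<in>{1..d}. ivl (map f [1..<Suc d] ! (i - 1))) i"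
    proof (cases "i \<in> {1..d}")
      case True
      then have "i - 1 < length [1..<Suc d]" "[1..<Suc d] ! (i - 1) = i" by (auto simp: nth_upt simp del: upt_Suc)
      then have "map f [1..<Suc d] ! (i - 1) = f i" by (simp only: nth_map)
      then show ?thesis using f[OF True] True by simp
    next
      case False
      then show ?thesis using R by (auto simp: dyadic_rectangles_def PiE_iff extensional_def)
    qed
  qed
  then show "\<exists>J\<in>{J. length J = d}. R = (\<lambda>i\<in>{1..d}. ivl (J ! (i - 1)))"
    by (intro bexI[of _ "map f [1..<Suc d]"]) auto
qed

lemma tensor_haar_eq_hrect: "tensor_haar d (\<lambda>i\<in>{1..d}. ivl (J ! (i - 1))) = hrect J"
  by (rule ext) (simp add: tensor_haar_def hrect_def hsys_def tensor_def Ix_def)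

lemma rects_exhaust:
  assumes "finite F" "\<And>J. J \<in> F \<Longrightarrow> length J = d"
  shows "\<exists>n\<ge>m. F \<subseteq> rects n d"
proof -
  define n where "n = m + (\<Sum>J\<in>F. \<Sum>I\<leftarrow>J. Suc (length I))"
  have "J \<in> rects n d" if J: "J \<in> F" for J
  proof -
    have "length I < n" if I: "I \<in> set J" for I
    proof -
      have "Suc (length I) \<le> (\<Sum>I\<leftarrow>J. Suc (length I))" using I by (intro member_le_sum_list) auto
      also have "\<dots> \<le> (\<Sum>J\<in>F. \<Sum>I\<leftarrow>J. Suc (length I))" using J assms(1) by (intro member_le_sum) auto
      finally show ?thesis by (simp add: n_def)
    qed
    then show ?thesis using assms(2)[OF J] by (auto simp: rects_def nodes_def)
  qed
  then show ?thesis by (intro exI[of _ n]) (auto simp: n_def)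
qed

end

section \<open>The Haar system as an unconditional basis\<close>

text \<open>
  An enumeration of the dyadic rectangles, each of them given by the list of its sides. The proof works
  for every enumeration.
\<close>

locale enumerated = mixed +
  fixes \<sigma> :: "nat \<Rightarrow> bool list list"
  assumes \<sigma>: "bij_betw \<sigma> UNIV {J. length J = d}"
begin

definition e :: "nat \<Rightarrow> (nat \<Rightarrow> real) \<Rightarrow> real" where
  "e n = hrect (\<sigma> n)"

lemma \<sigma>_length: "length (\<sigma> n) = d"
  using bij_betwE[OF \<sigma>] by blast

lemma \<sigma>_inj: "inj \<sigma>"
  using \<sigma> by (rule bij_betw_imp_inj_on)

lemma \<sigma>_inv: "length J = d \<Longrightarrow> \<sigma> (inv \<sigma> J) = J"
  using bij_betw_inv_into_right[OF \<sigma>, of J] by simp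

lemma N_square_function:
  obtains C where "1 \<le> C"
    "\<And>n (K :: 'k set) \<rho> a. finite K \<Longrightarrow> inj_on \<rho> K \<Longrightarrow> \<rho> ` K \<subseteq> rects n d \<Longrightarrow>
       N (\<Sum>k\<in>K. a k *\<^sub>R hrect (\<rho> k)) \<le> C * sn n ps (\<lambda>u. L2_set (\<lambda>k. th (\<rho> k) u * a k) K)"
    "\<And>n (K :: 'k set) \<rho> a. finite K \<Longrightarrow> inj_on \<rho> K \<Longrightarrow> \<rho> ` K \<subseteq> rects n d \<Longrightarrow>
       sn n ps (\<lambda>u. L2_set (\<lambda>k. th (\<rho> k) u * a k) K) \<le> C * N (\<Sum>k\<in>K. a k *\<^sub>R hrect (\<rho> k))"
proof (rule square_function_indexed)
  fix C assume C: "1 \<le> C" and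
    1: "\<And>n (K :: 'k set) \<rho> a. finite K \<Longrightarrow> inj_on \<rho> K \<Longrightarrow> \<rho> ` K \<subseteq> rects n d \<Longrightarrow>
       sn n ps (\<lambda>u. \<Sum>k\<in>K. th (\<rho> k) u * a k) \<le> C * sn n ps (\<lambda>u. L2_set (\<lambda>k. th (\<rho> k) u * a k) K)" and
    2: "\<And>n (K :: 'k set) \<rho> a. finite K \<Longrightarrow> inj_on \<rho> K \<Longrightarrow> \<rho> ` K \<subseteq> rects n d \<Longrightarrow>
       sn n ps (\<lambda>u. L2_set (\<lambda>k. th (\<rho> k) u * a k) K) \<le> C * sn n ps (\<lambda>u. \<Sum>k\<in>K. th (\<rho> k) u * a k)"
  show thesis
  proof (rule that[OF C])
    fix n :: nat and K :: "'k set" and \<rho> a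
    assume K: "finite K" "inj_on \<rho> K" "\<rho> ` K \<subseteq> rects n d"
    have e: "N (\<Sum>k\<in>K. a k *\<^sub>R hrect (\<rho> k)) = sn n ps (\<lambda>u. \<Sum>k\<in>K. th (\<rho> k) u * a k)"
      by (rule N_haar_sum) (use K(3) in auto)
    show "N (\<Sum>k\<in>K. a k *\<^sub>R hrect (\<rho> k)) \<le> C * sn n ps (\<lambda>u. L2_set (\<lambda>k. th (\<rho> k) u * a k) K)"
      unfolding e by (rule 1[OF K])
    show "sn n ps (\<lambda>u. L2_set (\<lambda>k. th (\<rho> k) u * a k) K) \<le> C * N (\<Sum>k\<in>K. a k *\<^sub>R hrect (\<rho> k))"
      unfolding e by (rule 2[OF K])
  qed
qed

lemma rects_of_indices:
  assumes "finite F"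
  shows "\<exists>n\<ge>m. \<sigma> ` F \<subseteq> rects n d"
  by (rule rects_exhaust) (use assms \<sigma>_length in auto)

lemma span_e: "range hsys \<subseteq> range e"
proof
  fix g assume "g \<in> range hsys"
  then obtain K where K: "g = hsys K" by blast
  define J where "J = map (\<lambda>i. K (Suc i)) [0..<d]"
  have "hrect J = hsys K"
    unfolding hrect_def hsys_def tensor_def Ix_def by (rule ext, rule prod.cong) (auto simp: J_def)
  moreover have "e (inv \<sigma> J) = hrect J" by (simp add: e_def \<sigma>_inv J_def)
  ultimately show "g \<in> range e" using K by (metis rangeI)
qed

lemma span_e_sum:
  assumes "g \<in> span (range e)"
  shows "\<exists>F a. finite F \<and> g = (\<Sum>n\<in>F. a n *\<^sub>R e n)"
proof -
  obtain t r where t: "finite t" "t \<subseteq> range e" "g = (\<Sum>x\<in>t. r x *\<^sub>R x)"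
    using assms unfolding span_explicit by blast
  have "\<forall>x\<in>t. \<exists>n. x = e n" using t(2) by blast
  then obtain \<iota> where \<iota>: "\<And>x. x \<in> t \<Longrightarrow> x = e (\<iota> x)" by metis
  have inj: "inj_on \<iota> t" using \<iota> by (metis inj_onI)
  have "(\<Sum>n\<in>\<iota> ` t. r (e n) *\<^sub>R e n) = (\<Sum>x\<in>t. r (e (\<iota> x)) *\<^sub>R e (\<iota> x))"
    by (simp add: sum.reindex[OF inj])
  also have "\<dots> = g" unfolding t(3) using \<iota> by (intro sum.cong) auto
  finally show ?thesis using t(1) by (metis finite_imageI)
qed

text \<open>
  Deleting terms decreases the square function pointwise.
\<close>

lemma haar_unconditional_system:
  obtains C where "unconditional_system X N e C"
proof -
  obtain C where C: "1 \<le> C" and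
    1: "\<And>n (K :: nat set) \<rho> a. finite K \<Longrightarrow> inj_on \<rho> K \<Longrightarrow> \<rho> ` K \<subseteq> rects n d \<Longrightarrow>
       N (\<Sum>k\<in>K. a k *\<^sub>R hrect (\<rho> k)) \<le> C * sn n ps (\<lambda>u. L2_set (\<lambda>k. th (\<rho> k) u * a k) K)" and
    2: "\<And>n (K :: nat set) \<rho> a. finite K \<Longrightarrow> inj_on \<rho> K \<Longrightarrow> \<rho> ` K \<subseteq> rects n d \<Longrightarrow>
       sn n ps (\<lambda>u. L2_set (\<lambda>k. th (\<rho> k) u * a k) K) \<le> C * N (\<Sum>k\<in>K. a k *\<^sub>R hrect (\<rho> k))"
    by (rule N_square_function) (rule that)
  interpret seminormed_subspace X N by (rule seminormed_X)
  have "unconditional_system X N e (C * C)"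
  proof unfold_locales
    show "e n \<in> X" "0 < N (e n)" for n
      by (simp_all add: e_def hrect_def hsys_in_X N_hsys_pos)
    show "N (\<Sum>n\<in>F. a n *\<^sub>R e n) \<le> C * C * N (\<Sum>n\<in>G. a n *\<^sub>R e n)" if G: "finite G" "F \<subseteq> G" for F G a
    proof -
      have F: "finite F" using G finite_subset by blast
      obtain n where n: "\<sigma> ` G \<subseteq> rects n d" using rects_of_indices[OF G(1), of 0] by blast
      have inj: "inj_on \<sigma> F" "inj_on \<sigma> G" using \<sigma>_inj by (auto intro: inj_on_subset)
      have "N (\<Sum>n\<in>F. a n *\<^sub>R e n) \<le> C * sn n ps (\<lambda>u. L2_set (\<lambda>k. th (\<sigma> k) u * a k) F)"
        unfolding e_def using n G(2) by (intro 1 F inj) auto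
      also have "sn n ps (\<lambda>u. L2_set (\<lambda>k. th (\<sigma> k) u * a k) F) \<le> sn n ps (\<lambda>u. L2_set (\<lambda>k. th (\<sigma> k) u * a k) G)"
        using G ps_pos by (intro sn_mono) (auto simp: L2_set_def sum_nonneg intro!: sum_mono2)
      also have "\<dots> \<le> C * N (\<Sum>n\<in>G. a n *\<^sub>R e n)"
        unfolding e_def by (rule 2[OF G(1) inj(2) n])
      finally show ?thesis using C by (simp add: mult.assoc)
    qed
    show "\<exists>F a. finite F \<and> N (x - (\<Sum>n\<in>F. a n *\<^sub>R e n)) < \<epsilon>" if x: "x \<in> X" "0 < \<epsilon>" for x \<epsilon>
    proof -
      obtain g where g: "g \<in> span (range hsys)" "N (x - g) < \<epsilon>" using haar_total[OF x] by blast
      have "g \<in> span (range e)" using g(1) span_mono[OF span_e] by blast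
      then obtain F a where "finite F" "g = (\<Sum>n\<in>F. a n *\<^sub>R e n)" using span_e_sum by blast
      with g(2) show ?thesis by blast
    qed
  qed
  then show thesis by (rule that)
qed

lemma block_estimate:
  obtains K r where "0 \<le> K" "1 < r"
    "\<And>m F a B. disjoint_family_on F {..<m} \<Longrightarrow> \<forall>k<m. finite (F k) \<Longrightarrow>
       \<forall>k<m. N (\<Sum>n\<in>F k. a n *\<^sub>R e n) \<le> B \<Longrightarrow>
       N (\<Sum>k<m. \<Sum>n\<in>F k. a n *\<^sub>R e n) \<le> K * B * real m powr (1 / r)"
proof (rule upper_estimate[of ps])
  show "1 < q" if "q \<in> set ps" for q using that by (rule ps_gt_1)
  fix C r assume C: "0 < C" "1 < r" and
    up: "\<And>n m F a B. disjoint_family_on F {..<m} \<Longrightarrow> (\<And>k. k < m \<Longrightarrow> F k \<subseteq> rects n (length ps)) \<Longrightarrow>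
       (\<And>k. k < m \<Longrightarrow> sn n ps (\<lambda>u. \<Sum>J\<in>F k. th J u * a J) \<le> B) \<Longrightarrow>
       sn n ps (\<lambda>u. \<Sum>k<m. \<Sum>J\<in>F k. th J u * a J) \<le> C * B * real m powr (1 / r)"
  show thesis
  proof (rule that[of C r])
    fix m :: nat and F :: "nat \<Rightarrow> nat set" and a :: "nat \<Rightarrow> real" and B :: real
    assume dis: "disjoint_family_on F {..<m}" and fin: "\<forall>k<m. finite (F k)"
      and B: "\<forall>k<m. N (\<Sum>n\<in>F k. a n *\<^sub>R e n) \<le> B"
    define U where "U = (\<Union>k<m. F k)"
    have U: "finite U" using fin by (simp add: U_def)
    obtain n where n: "\<sigma> ` U \<subseteq> rects n d" using rects_of_indices[OF U, of 0] by blast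
    have re: "(\<Sum>J\<in>\<sigma> ` F k. th J u * a (inv \<sigma> J)) = (\<Sum>i\<in>F k. th (\<sigma> i) u * a i)" for k u
      using \<sigma>_inj by (subst sum.reindex) (auto intro: inj_on_subset)
    have Fr: "\<sigma> i \<in> rects n d" if "k < m" "i \<in> F k" for k i using n that by (auto simp: U_def)
    have "N (\<Sum>k<m. \<Sum>n\<in>F k. a n *\<^sub>R e n) = sn n ps (\<lambda>u. \<Sum>k<m. \<Sum>J\<in>\<sigma> ` F k. th J u * a (inv \<sigma> J))"
    proof -
      have 1: "(\<Sum>k<m. \<Sum>n\<in>F k. a n *\<^sub>R e n) = (\<Sum>z\<in>Sigma {..<m} F. a (snd z) *\<^sub>R hrect (\<sigma> (snd z)))"
        unfolding e_def using fin by (subst sum.Sigma) (auto simp: split_def)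
      have 2: "(\<Sum>k<m. \<Sum>i\<in>F k. th (\<sigma> i) u * a i) = (\<Sum>z\<in>Sigma {..<m} F. th (\<sigma> (snd z)) u * a (snd z))" for u
        using fin by (subst sum.Sigma) (auto simp: split_def)
      show ?thesis
        unfolding re 1 2 by (rule N_haar_sum) (use Fr in auto)
    qed
    also have "\<dots> \<le> C * B * real m powr (1 / r)"
    proof (rule up)
      show "disjoint_family_on (\<lambda>k. \<sigma> ` F k) {..<m}"
        using dis \<sigma>_inj unfolding disjoint_family_on_def by (metis image_Int image_empty)
      show "\<sigma> ` F k \<subseteq> rects n (length ps)" if "k < m" for k using Fr[OF that] by (auto simp: length_js)
      show "sn n ps (\<lambda>u. \<Sum>J\<in>\<sigma> ` F k. th J u * a (inv \<sigma> J)) \<le> B" if k: "k < m" for k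
        using B[rule_format, OF k] N_haar_sum[of "F k" \<sigma> n a] Fr[OF k] unfolding re e_def by simp
    qed
    finally show "N (\<Sum>k<m. \<Sum>n\<in>F k. a n *\<^sub>R e n) \<le> C * B * real m powr (1 / r)" .
  qed (use C in auto)
qed

section \<open>The winning strategy\<close>

text \<open>
  The level of the last side of the rectangle with number \<open>k\<close>.
\<close>

definition lvl :: "nat \<Rightarrow> nat" where "lvl k = length (last (\<sigma> k))"

text \<open>
  Any bound that exceeds the levels of all rectangles with numbers up to \<open>n\<close> would do: a rectangle
  whose last side is that fine has a number greater than \<open>n\<close>.
\<close>

definition lvl_bound :: "nat \<Rightarrow> nat" where "lvl_bound n = (\<Sum>i\<le>n. Suc (lvl i))"

lemma lvl_less_lvl_bound: "i \<le> n \<Longrightarrow> lvl i < lvl_bound n"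
proof -
  assume "i \<le> n"
  then have "Suc (lvl i) \<le> lvl_bound n" unfolding lvl_bound_def by (intro member_le_sum) auto
  then show ?thesis by simp
qed

text \<open>
  In answer to the history \<open>ns\<close>, the last side of the current rectangle is subdivided down to this
  level. It is large enough to respect the opponent's last move, not smaller than the level of the
  current rectangle, and strictly increasing during the game, which makes blocks of different moves
  disjoint.
\<close>

definition target_lvl :: "nat list \<Rightarrow> nat" where
  "target_lvl ns = length ns + lvl_bound (length ns - 1) + sum_list (map lvl_bound ns)"

text \<open>
  The number of halvings that lead from the last side of the current rectangle to the target level.
\<close>

definition depth :: "nat list \<Rightarrow> nat" where
  "depth ns = target_lvl ns - lvl (length ns - 1)"

text \<open>
  The number of the rectangle obtained from rectangle \<open>k\<close> by passing to the descendant \<open>r\<close> of its last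
  side.
\<close>

definition child :: "nat \<Rightarrow> bool list \<Rightarrow> nat" where
  "child k r = inv \<sigma> (butlast (\<sigma> k) @ [last (\<sigma> k) @ r])"

text \<open>
  The current rectangle has number \<open>length ns - 1\<close>, since the history includes the opponent's present move.
\<close>

definition Bset :: "nat list \<Rightarrow> nat set" where
  "Bset ns = child (length ns - 1) ` pts (depth ns)"

lemma grid_last:
  assumes "u \<in> grid m d"
  shows "u \<noteq> []" "length (butlast u) = d - 1" "length (last u) = m"
proof -
  show u: "u \<noteq> []" "length (butlast u) = d - 1" using assms d by (auto simp: grid_def)
  have "last u \<in> pts m" using last_in_set[OF u(1)] assms by (auto simp: grid_def)
  then show "length (last u) = m" by (simp add: pts_def)
qed

lemma \<sigma>_nonempty: "\<sigma> k \<noteq> []"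
  using \<sigma>_length[of k] d by auto

lemma \<sigma>_child: "\<sigma> (child k r) = butlast (\<sigma> k) @ [last (\<sigma> k) @ r]"
  unfolding child_def using \<sigma>_length[of k] d by (intro \<sigma>_inv) simp

lemma lvl_child: "lvl (child k r) = lvl k + length r"
  by (simp add: lvl_def \<sigma>_child)

lemma child_inj: "inj (child k)"
proof (rule injI)
  fix r r' assume "child k r = child k r'"
  then have "\<sigma> (child k r) = \<sigma> (child k r')" by simp
  then show "r = r'" by (simp add: \<sigma>_child)
qed

context
  fixes n :: "nat \<Rightarrow> nat"
begin

definition D :: "nat \<Rightarrow> nat" where "D k = depth (map n [0..<Suc k])"

lemma target_lvl_eq: "target_lvl (map n [0..<Suc k]) = Suc k + lvl_bound k + (\<Sum>i\<le>k. lvl_bound (n i))"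
proof -
  have "sum_list (map lvl_bound (map n [0..<Suc k])) = (\<Sum>i\<le>k. lvl_bound (n i))"
    using interv_sum_list_conv_sum_set_nat[of "\<lambda>i. lvl_bound (n i)" 0 "Suc k"]
    by (simp add: comp_def atLeast0_lessThan_Suc atLeast0LessThan lessThan_Suc_atMost[symmetric] del: upt_Suc)
  then show ?thesis unfolding target_lvl_def by (simp del: upt_Suc)
qed

lemma lvl_D: "lvl k + D k = target_lvl (map n [0..<Suc k])"
proof -
  have "lvl k \<le> target_lvl (map n [0..<Suc k])" unfolding target_lvl_eq using lvl_less_lvl_bound[of k k] by simp
  then show ?thesis by (simp add: D_def depth_def del: upt_Suc)
qed

lemma Bset_eq: "Bset (map n [0..<Suc k]) = child k ` pts (D k)"
  by (simp add: Bset_def D_def del: upt_Suc)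

lemma target_lvl_mono: "k < l \<Longrightarrow> target_lvl (map n [0..<Suc k]) < target_lvl (map n [0..<Suc l])"
proof -
  assume "k < l"
  then have "lvl_bound k \<le> lvl_bound l" "(\<Sum>i\<le>k. lvl_bound (n i)) \<le> (\<Sum>i\<le>l. lvl_bound (n i))"
    unfolding lvl_bound_def by (auto intro!: sum_mono2)
  then show ?thesis unfolding target_lvl_eq using \<open>k < l\<close> by simp
qed

lemma child_lvl: "r \<in> pts (D k) \<Longrightarrow> lvl (child k r) = target_lvl (map n [0..<Suc k])"
  by (simp add: lvl_child pts_def lvl_D[symmetric] del: upt_Suc)

text \<open>
  The last sides of all rectangles in the block are finer than those of the rectangles with numbers
  up to \<open>n k\<close>.
\<close>

lemma Bset_late: "Bset (map n [0..<Suc k]) \<subseteq> {n k..}"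
proof
  fix j assume "j \<in> Bset (map n [0..<Suc k])"
  then have "lvl j = target_lvl (map n [0..<Suc k])" unfolding Bset_eq using child_lvl by blast
  moreover have "lvl_bound (n k) \<le> (\<Sum>i\<le>k. lvl_bound (n i))" by (rule member_le_sum) auto
  ultimately have "lvl_bound (n k) \<le> lvl j" unfolding target_lvl_eq by simp
  then have "\<not> j \<le> n k" using lvl_less_lvl_bound[of j "n k"] by auto
  then show "j \<in> {n k..}" by simp
qed

lemma Bset_disjoint: "k \<noteq> l \<Longrightarrow> Bset (map n [0..<Suc k]) \<inter> Bset (map n [0..<Suc l]) = {}"
proof -
  assume kl: "k \<noteq> l"
  have "lvl j = target_lvl (map n [0..<Suc k])" if "j \<in> Bset (map n [0..<Suc k])" for j k
    using that unfolding Bset_eq using child_lvl by blast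
  moreover have "target_lvl (map n [0..<Suc k]) \<noteq> target_lvl (map n [0..<Suc l])"
    using target_lvl_mono[of k l] target_lvl_mono[of l k] kl by (cases k l rule: linorder_cases) auto
  ultimately show ?thesis by (auto simp del: upt_Suc) metis
qed

lemma sum_Bset: "(\<Sum>j\<in>Bset (map n [0..<Suc k]). f j) = (\<Sum>r\<in>pts (D k). f (child k r))"
  unfolding Bset_eq by (subst sum.reindex) (auto intro: inj_on_subset[OF child_inj])

text \<open>
  The rectangles of the blocks, indexed by the pairs of a move and a descendant.
\<close>

definition \<rho> :: "nat \<times> bool list \<Rightarrow> bool list list" where
  "\<rho> kr = \<sigma> (child (fst kr) (snd kr))"

definition pairs :: "nat set \<Rightarrow> (nat \<times> bool list) set" where
  "pairs F = Sigma F (\<lambda>k. pts (D k))"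

lemma finite_pairs: "finite F \<Longrightarrow> finite (pairs F)"
  by (simp add: pairs_def)

lemma \<rho>_inj: "inj_on \<rho> (pairs F)"
proof (rule inj_onI)
  fix x y assume x: "x \<in> pairs F" and y: "y \<in> pairs F" and "\<rho> x = \<rho> y"
  then have c: "child (fst x) (snd x) = child (fst y) (snd y)"
    using \<sigma>_inj by (simp add: \<rho>_def inj_eq)
  have "lvl (child (fst x) (snd x)) = target_lvl (map n [0..<Suc (fst x)])" "lvl (child (fst y) (snd y)) = target_lvl (map n [0..<Suc (fst y)])"
    using x y child_lvl by (auto simp: pairs_def)
  then have "target_lvl (map n [0..<Suc (fst x)]) = target_lvl (map n [0..<Suc (fst y)])" using c by simp
  then have "fst x = fst y"
    using target_lvl_mono[of "fst x" "fst y"] target_lvl_mono[of "fst y" "fst x"] by (cases "fst x" "fst y" rule: linorder_cases) auto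
  moreover from this have "snd x = snd y" using c child_inj by (simp add: inj_eq)
  ultimately show "x = y" by (simp add: prod_eq_iff)
qed

lemma sum_pairs:
  fixes f :: "nat \<Rightarrow> nat \<Rightarrow> 'b::comm_monoid_add"
  assumes "finite F"
  shows "(\<Sum>k\<in>F. \<Sum>j\<in>Bset (map n [0..<Suc k]). f k j) = (\<Sum>z\<in>pairs F. f (fst z) (child (fst z) (snd z)))"
  unfolding sum_Bset pairs_def using assms by (subst sum.Sigma) (auto simp: split_def)

text \<open>
  The point of the construction: on a sufficiently fine grid the supports of the Haar functions
  in the block of \<open>k\<close> partition the support of the \<open>k\<close>-th Haar function.
\<close>

lemma square_pairs:
  assumes F: "finite F" and u: "u \<in> grid m d" and m: "\<And>k. k \<in> F \<Longrightarrow> lvl k + D k < m"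
  shows "(\<Sum>z\<in>pairs F. (th (\<rho> z) u * a (fst z) (child (fst z) (snd z)))\<^sup>2)
    = (\<Sum>k\<in>F. (th (\<sigma> k) u * a k (child k (take (D k) (drop (lvl k) (last u)))))\<^sup>2)"
proof -
  have u': "u \<noteq> []" "length (butlast u) = d - 1" "length (last u) = m"
    using grid_last[OF u] by auto
  have b: "length (butlast (\<sigma> k)) = length (butlast u)" for k using \<sigma>_length[of k] u' by simp
  have th\<sigma>: "th (\<sigma> k) u = th (butlast (\<sigma> k)) (butlast u) * hr (last (\<sigma> k)) (last u)" for k
    using th_snoc[OF b, of k "last (\<sigma> k)" "last u"] u' \<sigma>_nonempty[of k] by simp
  have th\<rho>: "th (\<rho> (k, r)) u = th (butlast (\<sigma> k)) (butlast u) * hr (last (\<sigma> k) @ r) (last u)" for k r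
    using th_snoc[OF b, of k "last (\<sigma> k) @ r" "last u"] u' by (simp add: \<rho>_def \<sigma>_child)
  have "(\<Sum>z\<in>pairs F. (th (\<rho> z) u * a (fst z) (child (fst z) (snd z)))\<^sup>2)
     = (\<Sum>k\<in>F. \<Sum>r\<in>pts (D k). (th (\<rho> (k, r)) u * a k (child k r))\<^sup>2)"
    unfolding pairs_def using F by (subst sum.Sigma) (auto simp: split_def)
  also have "\<dots> = (\<Sum>k\<in>F. (th (\<sigma> k) u * a k (child k (take (D k) (drop (lvl k) (last u)))))\<^sup>2)"
  proof (rule sum.cong[OF refl])
    fix k assume k: "k \<in> F"
    have "(\<Sum>r\<in>pts (D k). (th (\<rho> (k, r)) u * a k (child k r))\<^sup>2)
       = (th (butlast (\<sigma> k)) (butlast u))\<^sup>2 * (\<Sum>r\<in>pts (D k). (hr (last (\<sigma> k) @ r) (last u))\<^sup>2 * (a k (child k r))\<^sup>2)"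
      unfolding th\<rho> by (simp add: sum_distrib_left power_mult_distrib mult.assoc)
    also have "(\<Sum>r\<in>pts (D k). (hr (last (\<sigma> k) @ r) (last u))\<^sup>2 * (a k (child k r))\<^sup>2)
       = (hr (last (\<sigma> k)) (last u))\<^sup>2 * (a k (child k (take (D k) (drop (length (last (\<sigma> k))) (last u)))))\<^sup>2"
      using m[OF k] by (intro sum_hr_extensions[OF u'(3)]) (simp add: lvl_def)
    finally show "(\<Sum>r\<in>pts (D k). (th (\<rho> (k, r)) u * a k (child k r))\<^sup>2)
       = (th (\<sigma> k) u * a k (child k (take (D k) (drop (lvl k) (last u)))))\<^sup>2"
      unfolding th\<sigma> by (simp add: power_mult_distrib lvl_def mult.assoc)
  qed
  finally show ?thesis .
qed

lemma fine_grid: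
  assumes F: "finite F"
  shows "\<exists>m. \<sigma> ` F \<subseteq> rects m d \<and> \<rho> ` pairs F \<subseteq> rects m d \<and> (\<forall>k\<in>F. lvl k + D k < m)"
proof -
  define G where "G = F \<union> (\<lambda>z. child (fst z) (snd z)) ` pairs F"
  have "finite G" using F finite_pairs by (simp add: G_def)
  then obtain m where m: "Suc (\<Sum>k\<in>F. lvl k + D k) \<le> m" "\<sigma> ` G \<subseteq> rects m d"
    using rects_of_indices by blast
  have "lvl k + D k < m" if "k \<in> F" for k
    using member_le_sum[OF that _ F, of "\<lambda>k. lvl k + D k"] m(1) by simp
  moreover have "\<rho> ` pairs F \<subseteq> \<sigma> ` G" by (auto simp: \<rho>_def G_def)
  moreover have "\<sigma> ` F \<subseteq> \<sigma> ` G" by (auto simp: G_def)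
  ultimately show ?thesis using m(2) by blast
qed

end

text \<open>
  The first two estimates compare square functions, which are equal. For the third, the coefficient of
  \<open>e k\<close> is the mean of the coefficients in its block. On the grid this mean is a conditional
  expectation in the last variable at the level of the rectangle \<open>k\<close>, applied to the function that
  carries the coefficients of the block. Stein's inequality removes the conditional expectations, and
  what remains is the square function of the sum over the blocks.
\<close>

lemma strategy_bounds:
  obtains C where "1 \<le> C"
    "\<And>n F a. finite F \<Longrightarrow> N (\<Sum>k\<in>F. a k *\<^sub>R (\<Sum>j\<in>Bset (map n [0..<Suc k]). e j)) \<le> C * N (\<Sum>k\<in>F. a k *\<^sub>R e k)"
    "\<And>n F a. finite F \<Longrightarrow> N (\<Sum>k\<in>F. a k *\<^sub>R e k) \<le> C * N (\<Sum>k\<in>F. a k *\<^sub>R (\<Sum>j\<in>Bset (map n [0..<Suc k]). e j))"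
    "\<And>n F x. finite F \<Longrightarrow> N (\<Sum>k\<in>F. (\<Sum>j\<in>Bset (map n [0..<Suc k]). 1 / 2 ^ depth (map n [0..<Suc k]) * x j) *\<^sub>R e k)
       \<le> C * N (\<Sum>j\<in>(\<Union>k\<in>F. Bset (map n [0..<Suc k])). x j *\<^sub>R e j)"
proof -
  obtain C1 where C1: "1 \<le> C1" and
    a1: "\<And>n (K :: nat set) \<rho> a. finite K \<Longrightarrow> inj_on \<rho> K \<Longrightarrow> \<rho> ` K \<subseteq> rects n d \<Longrightarrow>
       N (\<Sum>k\<in>K. a k *\<^sub>R hrect (\<rho> k)) \<le> C1 * sn n ps (\<lambda>u. L2_set (\<lambda>k. th (\<rho> k) u * a k) K)" and
    a2: "\<And>n (K :: nat set) \<rho> a. finite K \<Longrightarrow> inj_on \<rho> K \<Longrightarrow> \<rho> ` K \<subseteq> rects n d \<Longrightarrow>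
       sn n ps (\<lambda>u. L2_set (\<lambda>k. th (\<rho> k) u * a k) K) \<le> C1 * N (\<Sum>k\<in>K. a k *\<^sub>R hrect (\<rho> k))"
    by (rule N_square_function) (rule that)
  obtain C2 where C2: "1 \<le> C2" and
    b1: "\<And>n (K :: (nat \<times> bool list) set) \<rho> a. finite K \<Longrightarrow> inj_on \<rho> K \<Longrightarrow> \<rho> ` K \<subseteq> rects n d \<Longrightarrow>
       N (\<Sum>k\<in>K. a k *\<^sub>R hrect (\<rho> k)) \<le> C2 * sn n ps (\<lambda>u. L2_set (\<lambda>k. th (\<rho> k) u * a k) K)" and
    b2: "\<And>n (K :: (nat \<times> bool list) set) \<rho> a. finite K \<Longrightarrow> inj_on \<rho> K \<Longrightarrow> \<rho> ` K \<subseteq> rects n d \<Longrightarrow>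
       sn n ps (\<lambda>u. L2_set (\<lambda>k. th (\<rho> k) u * a k) K) \<le> C2 * N (\<Sum>k\<in>K. a k *\<^sub>R hrect (\<rho> k))"
    by (rule N_square_function) (rule that)
  obtain CS where CS: "1 \<le> CS" and
    st: "\<And>n (K::nat set) l g. \<forall>k\<in>K. l k \<le> n \<Longrightarrow>
       sn n ps (\<lambda>u. L2_set (\<lambda>k. cexp n (l k) (g k (butlast u)) (last u)) K) \<le> CS * sn n ps (\<lambda>u. L2_set (\<lambda>k. g k (butlast u) (last u)) K)"
    by (rule Stein_last_variable) (rule that)
  have inj: "inj_on \<sigma> F" for F using \<sigma>_inj by (rule inj_on_subset) simp
  have sumB: "(\<Sum>k\<in>F. a k *\<^sub>R (\<Sum>j\<in>Bset (map n [0..<Suc k]). e j)) = (\<Sum>z\<in>pairs n F. a (fst z) *\<^sub>R hrect (\<rho> z))"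
    if "finite F" for n F a
    using sum_pairs[OF that, of "\<lambda>k j. a k *\<^sub>R e j" n] by (simp add: scaleR_sum_right e_def \<rho>_def del: upt_Suc)
  have sq: "sn m ps (\<lambda>u. L2_set (\<lambda>z. th (\<rho> z) u * a (fst z)) (pairs n F)) = sn m ps (\<lambda>u. L2_set (\<lambda>k. th (\<sigma> k) u * a k) F)"
    if F: "finite F" and m: "\<And>k. k \<in> F \<Longrightarrow> lvl k + D n k < m" for m n F a
  proof (rule sn_cong)
    fix u assume "u \<in> grid m (length ps)"
    then have "u \<in> grid m d" by (simp add: length_js)
    from square_pairs[OF F this m, of "\<lambda>k j. a k"]
    show "L2_set (\<lambda>z. th (\<rho> z) u * a (fst z)) (pairs n F) = L2_set (\<lambda>k. th (\<sigma> k) u * a k) F"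
      by (rule L2_set_sum_eq)
  qed
  define C where "C = C1 * C2 * CS"
  have C12: "1 \<le> C1 * C2" using C1 C2 mult_mono[of 1 C1 1 C2] by simp
  have C: "1 \<le> C" "C1 * C2 \<le> C"
    using C12 CS mult_mono[of 1 "C1 * C2" 1 CS] mult_left_mono[of 1 CS "C1 * C2"] by (simp_all add: C_def)
  show thesis
  proof (rule that[OF C(1)])
    fix n :: "nat \<Rightarrow> nat" and F :: "nat set" and a :: "nat \<Rightarrow> real"
    assume F: "finite F"
    obtain m where m: "\<sigma> ` F \<subseteq> rects m d" "\<rho> ` pairs n F \<subseteq> rects m d" "\<And>k. k \<in> F \<Longrightarrow> lvl k + D n k < m"
      using fine_grid[OF F, of n] by blast
    let ?b = "\<Sum>k\<in>F. a k *\<^sub>R (\<Sum>j\<in>Bset (map n [0..<Suc k]). e j)" and ?e = "\<Sum>k\<in>F. a k *\<^sub>R e k"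
    let ?S = "sn m ps (\<lambda>u. L2_set (\<lambda>k. th (\<sigma> k) u * a k) F)"
    have sqF: "?S = sn m ps (\<lambda>u. L2_set (\<lambda>z. th (\<rho> z) u * a (fst z)) (pairs n F))"
      by (rule sq[OF F, symmetric]) (rule m(3))
    have "N ?b \<le> C2 * ?S"
      unfolding sumB[OF F] sqF by (rule b1[OF finite_pairs[OF F] \<rho>_inj m(2)])
    also have "\<dots> \<le> C2 * (C1 * N ?e)"
      unfolding e_def using C2 by (intro mult_left_mono a2 F inj m) auto
    also have "\<dots> \<le> C * N ?e" using C(2) N_nn[of ?e] mult_right_mono[of "C1 * C2" C "N ?e"] by (simp add: mult_ac)
    finally show "N ?b \<le> C * N ?e" .
    have "N ?e \<le> C1 * ?S" unfolding e_def by (rule a1[OF F inj m(1)])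
    also have "\<dots> \<le> C1 * (C2 * N ?b)"
      unfolding sumB[OF F] sqF
      using C1 by (intro mult_left_mono b2 finite_pairs F \<rho>_inj m) auto
    also have "\<dots> \<le> C * N ?b" using C(2) N_nn[of ?b] mult_right_mono[of "C1 * C2" C "N ?b"] by (simp add: mult_ac)
    finally show "N ?e \<le> C * N ?b" .
  next
    fix n :: "nat \<Rightarrow> nat" and F :: "nat set" and x :: "nat \<Rightarrow> real"
    assume F: "finite F"
    obtain m where m: "\<sigma> ` F \<subseteq> rects m d" "\<rho> ` pairs n F \<subseteq> rects m d" "\<And>k. k \<in> F \<Longrightarrow> lvl k + D n k < m"
      using fine_grid[OF F, of n] by blast
    define y where "y k = (\<Sum>j\<in>Bset (map n [0..<Suc k]). 1 / 2 ^ depth (map n [0..<Suc k]) * x j)" for k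
    have y: "y k = avg (D n k) (\<lambda>r. x (child k r))" for k
      unfolding y_def sum_Bset by (simp add: avg_def D_def sum_divide_distrib del: upt_Suc)
    \<comment> \<open>The Haar function in the last variable enters squared, that is, as an indicator, since otherwise
      its conditional expectation would vanish.\<close>
    define g where "g k v s = th (butlast (\<sigma> k)) v * ((hr (last (\<sigma> k)) s)\<^sup>2 * x (child k (take (D n k) (drop (lvl k) s))))" for k v s
    let ?r = "\<Sum>j\<in>(\<Union>k\<in>F. Bset (map n [0..<Suc k])). x j *\<^sub>R e j"
    have split: "th (\<sigma> k) u = th (butlast (\<sigma> k)) (butlast u) * hr (last (\<sigma> k)) (last u)"
      and lens: "length (last u) = m" if "u \<in> grid m d" for u k
    proof -
      have u': "u \<noteq> []" "length (butlast u) = d - 1" "length (last u) = m"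
        using grid_last[OF that] by auto
      then show "length (last u) = m" by simp
      have b: "length (butlast (\<sigma> k)) = length (butlast u)" using \<sigma>_length[of k] u' by simp
      show "th (\<sigma> k) u = th (butlast (\<sigma> k)) (butlast u) * hr (last (\<sigma> k)) (last u)"
        using th_snoc[OF b, of "last (\<sigma> k)" "last u"] u' \<sigma>_nonempty[of k] by simp
    qed
    have hr4: "(hr I s) ^ 4 = (hr I s)\<^sup>2" for I s by (simp add: hr_eq sg_def)
    have E: "cexp m (lvl k) (g k v) s = th (butlast (\<sigma> k)) v * ((hr (last (\<sigma> k)) s)\<^sup>2 * y k)"
      if k: "k \<in> F" and s: "length s = m" for k v s
    proof -
      have lk: "lvl k + D n k < m" by (rule m(3)[OF k])
      have "cexp m (lvl k) (g k v) s = avg (m - lvl k) (\<lambda>r. (th (butlast (\<sigma> k)) v * (hr (last (\<sigma> k)) s)\<^sup>2) * x (child k (take (D n k) r)))"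
        unfolding cexp_def
      proof (rule avg_cong)
        fix r assume r: "r \<in> pts (m - lvl k)"
        have "(hr (last (\<sigma> k)) (take (lvl k) s @ r))\<^sup>2 = (hr (last (\<sigma> k)) s)\<^sup>2"
          using s r lk by (simp add: hr_square lvl_def pts_def)
        then show "g k v (take (lvl k) s @ r) = (th (butlast (\<sigma> k)) v * (hr (last (\<sigma> k)) s)\<^sup>2) * x (child k (take (D n k) r))"
          using s lk by (simp add: g_def min_def)
      qed
      also have "\<dots> = (th (butlast (\<sigma> k)) v * (hr (last (\<sigma> k)) s)\<^sup>2) * avg (m - lvl k) (\<lambda>r. x (child k (take (D n k) r)))"
        by (rule avg_cmult)
      also have "avg (m - lvl k) (\<lambda>r. x (child k (take (D n k) r))) = y k"
        using avg_take[of "D n k" "m - lvl k - D n k" "\<lambda>r. x (child k r)"] lk by (simp add: y)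
      finally show ?thesis by simp
    qed
    have "N (\<Sum>k\<in>F. y k *\<^sub>R e k) \<le> C1 * sn m ps (\<lambda>u. L2_set (\<lambda>k. th (\<sigma> k) u * y k) F)"
      unfolding e_def by (rule a1[OF F inj m(1)])
    also have "sn m ps (\<lambda>u. L2_set (\<lambda>k. th (\<sigma> k) u * y k) F)
       = sn m ps (\<lambda>u. L2_set (\<lambda>k. cexp m (lvl k) (g k (butlast u)) (last u)) F)"
    proof (rule sn_cong, rule L2_set_sum_eq, rule sum.cong[OF refl])
      fix u k assume "u \<in> grid m (length ps)" and k: "k \<in> F"
      then have u: "u \<in> grid m d" by (simp add: length_js)
      show "(th (\<sigma> k) u * y k)\<^sup>2 = (cexp m (lvl k) (g k (butlast u)) (last u))\<^sup>2"
        unfolding E[OF k lens[OF u]] split[OF u] by (simp add: power_mult_distrib hr4)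
    qed
    also have "\<dots> \<le> CS * sn m ps (\<lambda>u. L2_set (\<lambda>k. g k (butlast u) (last u)) F)"
      by (rule st) (use m(3) in fastforce)
    also have "sn m ps (\<lambda>u. L2_set (\<lambda>k. g k (butlast u) (last u)) F)
       = sn m ps (\<lambda>u. L2_set (\<lambda>z. th (\<rho> z) u * x (child (fst z) (snd z))) (pairs n F))"
    proof (rule sn_cong, rule L2_set_sum_eq)
      fix u assume "u \<in> grid m (length ps)"
      then have u: "u \<in> grid m d" by (simp add: length_js)
      show "(\<Sum>k\<in>F. (g k (butlast u) (last u))\<^sup>2) = (\<Sum>z\<in>pairs n F. (th (\<rho> z) u * x (child (fst z) (snd z)))\<^sup>2)"
        unfolding square_pairs[OF F u m(3), of "\<lambda>k. x", simplified]
        by (rule sum.cong[OF refl]) (simp add: g_def split[OF u] power_mult_distrib hr4)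
    qed
    also have "\<dots> \<le> C2 * N (\<Sum>z\<in>pairs n F. x (child (fst z) (snd z)) *\<^sub>R hrect (\<rho> z))"
      by (rule b2[OF finite_pairs[OF F] \<rho>_inj m(2)])
    also have "(\<Sum>z\<in>pairs n F. x (child (fst z) (snd z)) *\<^sub>R hrect (\<rho> z)) = ?r"
    proof -
      have "?r = (\<Sum>k\<in>F. \<Sum>j\<in>Bset (map n [0..<Suc k]). x j *\<^sub>R e j)"
      proof (rule sum.UNION_disjoint[OF F])
        show "\<forall>k\<in>F. finite (Bset (map n [0..<Suc k]))" by (simp add: Bset_def)
        show "\<forall>k\<in>F. \<forall>l\<in>F. k \<noteq> l \<longrightarrow> Bset (map n [0..<Suc k]) \<inter> Bset (map n [0..<Suc l]) = {}"
          using Bset_disjoint by blast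
      qed
      then show ?thesis using sum_pairs[OF F, of "\<lambda>k j. x j *\<^sub>R e j" n] by (simp add: e_def \<rho>_def del: upt_Suc)
    qed
    finally show "N (\<Sum>k\<in>F. (\<Sum>j\<in>Bset (map n [0..<Suc k]). 1 / 2 ^ depth (map n [0..<Suc k]) * x j) *\<^sub>R e k) \<le> C * N ?r"
      using C1 CS unfolding y_def[symmetric] C_def by (simp add: mult_ac mult_left_mono)
  qed
qed

text \<open>
  The weights are the relative lengths of the subintervals, so they sum to one over each block.
\<close>

theorem strategically_reproducible_e: "strategically_reproducible X N e"
proof -
  obtain C where "unconditional_system X N e C" by (rule haar_unconditional_system)
  then interpret unconditional_system X N e C .
  obtain D where D: "1 \<le> D" and
    up: "\<And>n F a. finite F \<Longrightarrow> N (\<Sum>k\<in>F. a k *\<^sub>R (\<Sum>j\<in>Bset (map n [0..<Suc k]). e j)) \<le> D * N (\<Sum>k\<in>F. a k *\<^sub>R e k)" and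
    lo: "\<And>n F a. finite F \<Longrightarrow> N (\<Sum>k\<in>F. a k *\<^sub>R e k) \<le> D * N (\<Sum>k\<in>F. a k *\<^sub>R (\<Sum>j\<in>Bset (map n [0..<Suc k]). e j))" and
    pr: "\<And>n F x. finite F \<Longrightarrow> N (\<Sum>k\<in>F. (\<Sum>j\<in>Bset (map n [0..<Suc k]). 1 / 2 ^ depth (map n [0..<Suc k]) * x j) *\<^sub>R e k)
       \<le> D * N (\<Sum>j\<in>(\<Union>k\<in>F. Bset (map n [0..<Suc k])). x j *\<^sub>R e j)"
    by (rule strategy_bounds) (rule that)
  have win: "winning_strategy X N e ((C * D)\<^sup>2)
      (\<lambda>ns. (\<Sum>j\<in>Bset ns. e j, \<Sum>j\<in>Bset ns. (1 / 2 ^ depth ns) *\<^sub>R coord X N e j))"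
  proof (rule block_strategy_wins[OF D])
    show "finite (Bset (map n [0..<Suc k]))" for n k by (simp add: Bset_def)
    show "Bset (map n [0..<Suc k]) \<subseteq> {n k..}" for n k by (rule Bset_late)
    show "Bset (map n [0..<Suc k]) \<inter> Bset (map n [0..<Suc l]) = {}" if "k \<noteq> l" for n k l
      by (rule Bset_disjoint[OF that])
    show "(\<Sum>j\<in>Bset (map n [0..<Suc k]). (1::real) / 2 ^ depth (map n [0..<Suc k])) = 1" for n k
      unfolding sum_Bset by (simp add: D_def card_pts del: upt_Suc)
  qed (rule up lo pr; assumption)+
  obtain K r where K: "0 \<le> K" and r: "1 < r" and
    bl: "\<And>m F a B. disjoint_family_on F {..<m} \<Longrightarrow> \<forall>k<m. finite (F k) \<Longrightarrow>
       \<forall>k<m. N (\<Sum>n\<in>F k. a n *\<^sub>R e n) \<le> B \<Longrightarrow>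
       N (\<Sum>k<m. \<Sum>n\<in>F k. a n *\<^sub>R e n) \<le> K * B * real m powr (1 / r)"
    by (rule block_estimate) (rule that)
  have "shrinking_basis X N e"
    by (rule shrinking_of_upper_estimate[OF r K]) (rule bl; blast)
  moreover have "1 \<le> (C * D)\<^sup>2"
    using C_ge_1 D mult_mono[of 1 C 1 D] by (simp add: one_le_power)
  ultimately show ?thesis
    unfolding strategically_reproducible_def using banach_on_X unconditional win by blast
qed

end

theorem theorem5p1:
  fixes d :: nat and p :: "nat \<Rightarrow> real"
  assumes "1 \<le> d"
    and "\<And>i. i \<in> {1..d} \<Longrightarrow> 1 < p i"
  shows "\<exists>\<sigma>::nat \<Rightarrow> nat \<Rightarrow> real set.
    bij_betw \<sigma> UNIV (dyadic_rectangles d) \<and>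
    strategically_reproducible (mixed_Lp0 d p) (mixed_norm d p) (\<lambda>n. tensor_haar d (\<sigma> n))"
proof -
  interpret mixed d p by unfold_locales (use assms in auto)
  let ?R = "{J :: bool list list. length J = d}"
  have "infinite ?R"
  proof -
    have "inj (\<lambda>I :: bool list. replicate d I)" using assms(1) by (auto simp: inj_def replicate_eq_replicate)
    then have "infinite (range (\<lambda>I :: bool list. replicate d I))"
      using infinite_UNIV_listI by (auto dest: finite_imageD)
    moreover have "range (\<lambda>I :: bool list. replicate d I) \<subseteq> ?R" by auto
    ultimately show ?thesis using finite_subset by blast
  qed
  then have \<tau>: "bij_betw (from_nat_into ?R) UNIV ?R" by (intro bij_betw_from_nat_into) auto
  interpret enumerated d p "from_nat_into ?R" by unfold_locales (rule \<tau>)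
  define \<sigma> where "\<sigma> n = (\<lambda>i\<in>{1..d}. ivl (from_nat_into ?R n ! (i - 1)))" for n
  have "bij_betw \<sigma> UNIV (dyadic_rectangles d)"
    using bij_betw_trans[OF \<tau> dyadic_rectangles_bij] by (simp add: comp_def \<sigma>_def[abs_def])
  moreover have "(\<lambda>n. tensor_haar d (\<sigma> n)) = e"
    by (rule ext) (simp only: \<sigma>_def tensor_haar_eq_hrect e_def)
  ultimately show ?thesis using strategically_reproducible_e by auto
qed

end
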